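(* Let $(M,g,J)$ be a compact Kähler manifold of complex dimension $m\ge 2$ with constant positive scalar curvature. Let $E$ be its traceless Ricci tensor, $B$ its Bochner tensor and $\Lambda(M,g)$ its Yamabe constant. Set $P(2)=3/2$ and $P(m)=\frac{2(2m-1)}{m^2-1}$ for $m\ge 3$. If $$\sqrt{2}\,\|E\|_{L^m(M)}+\|B\|_{L^m(M)}<\Lambda(M,g)\,P(m)\sqrt{\frac{2(m+1)(m+2)}{2m^2+4m+3}},$$ then $(M,g,J)$ is Kähler-Einstein.
   Context: Manifolds are connected. For a Kähler manifold $(M,g,J)$ of complex dimension $m$ (real dimension $n=2m$), $S_g$ denotes the Riemannian scalar curvature, and the Yamabe constant is $$\Lambda(M,g)=\inf_{0\neq u\in C_0^\infty(M)}\frac{\int_M\left(|\nabla u|^2+\frac{n-2}{4(n-1)}S_g u^2\right)dV_g}{\left(\int_M|u|^{\frac{2n}{n-2}}dV_g\right)^{\frac{n-2}{n}}},\qquad n=2m.$$ In local complex coordinates $(z_\alpha)$, $g_{\alpha\bar\beta}$, $R_{\alpha\bar\beta}$, $R_{\alpha\bar\beta\gamma\bar\delta}$ are the components of the metric, the Ricci tensor (usual sign, positive on complex projective space) and the curvature tensor, the curvature sign convention being such that $R_{\alpha\bar\beta}=-g^{\gamma\bar\delta}R_{\alpha\bar\beta\gamma\bar\delta}$ (summation convention). Set $R=g^{\alpha\bar\beta}R_{\alpha\bar\beta}$ (the complex scalar curvature), so $S_g=2R$. The traceless Ricci tensor is $E=E_{\alpha\bar\beta}\,dz^\alpha\otimes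 dz^{\bar\beta}+E_{\bar\alpha\beta}\,dz^{\bar\alpha}\otimes dz^\beta$ with $E_{\alpha\bar\beta}=R_{\alpha\bar\beta}-\frac{R}{m}g_{\alpha\bar\beta}$ and $E_{\bar\alpha\beta}=\overline{E_{\alpha\bar\beta}}$; Kähler-Einstein means $E=0$. The Bochner tensor $B$ has components $$B_{\alpha\bar\beta\gamma\bar\delta}=R_{\alpha\bar\beta\gamma\bar\delta}+\tfrac{1}{m+2}\left(R_{\alpha\bar\beta}g_{\gamma\bar\delta}+R_{\gamma\bar\beta}g_{\alpha\bar\delta}+g_{\alpha\bar\beta}R_{\gamma\bar\delta}+g_{\gamma\bar\beta}R_{\alpha\bar\delta}\right)-\tfrac{R}{(m+1)(m+2)}\left(g_{\alpha\bar\beta}g_{\gamma\bar\delta}+g_{\gamma\bar\beta}g_{\alpha\bar\delta}\right).$$ Norms: at a point, in a frame with $g_{\alpha\bar\beta}=\delta_{\alpha\beta}$, $|E|^2=2\sum_{\alpha,\beta}|E_{\alpha\bar\beta}|^2$ and $|B|^2=4\sum_{\alpha,\beta,\gamma,\delta}|B_{\alpha\bar\beta\gamma\bar\delta}|^2$ (the norms of $E$, $B$ as real tensors). For a tensor $T$, $\|T\|_{L^m(M)}=\left(\int_M|T|^m dV_g\right)^{1/m}$. *)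

theory Defs
  imports "HOL-Analysis.Analysis"
begin

section \<open>Smooth maps on open subsets of Euclidean space\<close>

text \<open>For open \<open>S\<close>, \<open>Ck_on k S f\<close> says that \<open>f\<close> is \<open>k\<close> times continuously differentiable on \<open>S\<close>.\<close>

primrec Ck_on :: "nat \<Rightarrow> 'v::euclidean_space set \<Rightarrow> ('v \<Rightarrow> real) \<Rightarrow> bool" where
  "Ck_on 0 S f \<longleftrightarrow> continuous_on S f"
| "Ck_on (Suc k) S f \<longleftrightarrow> (\<forall>z\<in>S. f differentiable (at z)) \<and>
     (\<forall>v. Ck_on k S (\<lambda>z. frechet_derivative f (at z) v))"

definition smooth_fun_on :: "'v::euclidean_space set \<Rightarrow> ('v \<Rightarrow> real) \<Rightarrow> bool" where
  "smooth_fun_on S f \<longleftrightarrow> (\<forall>k. Ck_on k S f)"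


section \<open>Riemannian geometry of a metric on an open set\<close>

text \<open>A metric \<open>h\<close> on an open subset of a Euclidean space assigns to each point \<open>z\<close> the inner product
  \<open>h z\<close>; it is used only at points of that open set. Vectors stand for constant vector fields, so
  brackets vanish.\<close>

type_synonym 'v metric = "'v \<Rightarrow> 'v \<Rightarrow> 'v \<Rightarrow> real"

definition sharp :: "'v::euclidean_space metric \<Rightarrow> 'v \<Rightarrow> ('v \<Rightarrow> real) \<Rightarrow> 'v" where
  "sharp h z l = (THE u. \<forall>x. h z u x = l x)"

text \<open>\<open>levi_civita h z v w\<close> is the covariant derivative of \<open>w\<close> along \<open>v\<close>, given by the Koszul formula.\<close>

definition levi_civita :: "'v::euclidean_space metric \<Rightarrow> 'v \<Rightarrow> 'v \<Rightarrow> 'v \<Rightarrow> 'v" where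
  "levi_civita h z v w = sharp h z (\<lambda>x.
     (frechet_derivative (\<lambda>y. h y w x) (at z) v
      + frechet_derivative (\<lambda>y. h y v x) (at z) w
      - frechet_derivative (\<lambda>y. h y v w) (at z) x) / 2)"

text \<open>The endomorphism \<open>R(u,v)w = \<nabla>\<^sub>u \<nabla>\<^sub>v w - \<nabla>\<^sub>v \<nabla>\<^sub>u w\<close>.\<close>

definition curvature :: "'v::euclidean_space metric \<Rightarrow> 'v \<Rightarrow> 'v \<Rightarrow> 'v \<Rightarrow> 'v \<Rightarrow> 'v" where
  "curvature h z u v w =
     frechet_derivative (\<lambda>y. levi_civita h y v w) (at z) u
     - frechet_derivative (\<lambda>y. levi_civita h y u w) (at z) v
     + levi_civita h z u (levi_civita h z v w)
     - levi_civita h z v (levi_civita h z u w)"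

text \<open>The (4,0)-curvature tensor in the convention \<open>Rm(x,y,u,w) = g(R(x,y)w, u)\<close>. The Ricci tensor is
  the trace of \<open>u \<mapsto> R(u,v)w\<close>, hence positive on spheres; for a Kaehler metric, in complex
  coordinates, it is minus the trace of \<open>Rm\<close> over its last two indices.\<close>

definition riemann_tensor :: "'v::euclidean_space metric \<Rightarrow> 'v \<Rightarrow> 'v \<Rightarrow> 'v \<Rightarrow> 'v \<Rightarrow> 'v \<Rightarrow> real" where
  "riemann_tensor h z x y u w = h z (curvature h z x y w) u"

definition ricci_tensor :: "'v::euclidean_space metric \<Rightarrow> 'v \<Rightarrow> 'v \<Rightarrow> 'v \<Rightarrow> real" where
  "ricci_tensor h z v w = (\<Sum>b\<in>Basis. curvature h z b v w \<bullet> b)"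

text \<open>The trace of the Ricci endomorphism.\<close>

definition scalar_curvature :: "'v::euclidean_space metric \<Rightarrow> 'v \<Rightarrow> real" where
  "scalar_curvature h z = (\<Sum>b\<in>Basis. sharp h z (ricci_tensor h z b) \<bullet> b)"

definition grad_norm_sq :: "'v::euclidean_space metric \<Rightarrow> ('v \<Rightarrow> real) \<Rightarrow> 'v \<Rightarrow> real" where
  "grad_norm_sq h f z =
     (let G = sharp h z (frechet_derivative f (at z)) in h z G G)"

text \<open>The density of the Riemannian volume with respect to Lebesgue measure, from the Gram matrix of
  the real coordinate vectors \<open>\<partial>/\<partial>x\<^sub>\<alpha>\<close>, \<open>\<partial>/\<partial>y\<^sub>\<alpha>\<close>.\<close>

primrec real_frame :: "'m::finite + 'm \<Rightarrow> complex ^ 'm" where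
  "real_frame (Inl a) = axis a 1"
| "real_frame (Inr a) = axis a \<i>"

definition volume_density :: "(complex ^ 'm::finite) metric \<Rightarrow> complex ^ 'm \<Rightarrow> real" where
  "volume_density h z =
     sqrt (det (\<chi> i j. h z (real_frame i) (real_frame j) :: real ^ ('m + 'm) ^ ('m + 'm)))"


section \<open>Complex components\<close>

text \<open>A pair \<open>(x, y)\<close> stands for the complexified tangent vector \<open>x + i y\<close>. Here the complex structure
  \<open>J\<close> on \<open>complex ^ 'm\<close> is multiplication by \<open>\<i>\<close>; \<open>hol v\<close> is the (1,0)-part \<open>(v - i J v) / 2\<close>
  of \<open>v\<close>, so that \<open>hol (axis \<alpha> 1) = \<partial>/\<partial>z\<^sub>\<alpha>\<close>, and \<open>antihol v\<close> is its conjugate.\<close>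

definition hol :: "complex ^ 'm \<Rightarrow> (complex ^ 'm) \<times> (complex ^ 'm::finite)" where
  "hol v = ((1/2) *\<^sub>R v, - ((1/2) *\<^sub>R (\<i> *s v)))"

definition antihol :: "complex ^ 'm \<Rightarrow> (complex ^ 'm) \<times> (complex ^ 'm::finite)" where
  "antihol v = ((1/2) *\<^sub>R v, (1/2) *\<^sub>R (\<i> *s v))"

text \<open>The complex-linear extension of a real-linear map to complexified vectors.\<close>

definition cext :: "('v \<Rightarrow> complex) \<Rightarrow> 'v \<times> 'v \<Rightarrow> complex" where
  "cext l p = l (fst p) + \<i> * l (snd p)"

text \<open>The components \<open>T\<^bsub>\<alpha>\<beta>-bar\<^esub>\<close> and \<open>T\<^bsub>\<alpha>\<beta>-bar\<gamma>\<delta>-bar\<^esub>\<close> of real tensors, where the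
  vectors \<open>a, b, c, d\<close> of a frame take the place of the indices.\<close>

definition comp2 ::
  "(complex ^ 'm \<Rightarrow> complex ^ 'm \<Rightarrow> real) \<Rightarrow> complex ^ 'm \<Rightarrow> complex ^ 'm::finite \<Rightarrow> complex" where
  "comp2 T a b = cext (\<lambda>x. cext (\<lambda>y. complex_of_real (T x y)) (antihol b)) (hol a)"

definition comp4 ::
  "(complex ^ 'm \<Rightarrow> complex ^ 'm \<Rightarrow> complex ^ 'm \<Rightarrow> complex ^ 'm \<Rightarrow> real) \<Rightarrow>
    complex ^ 'm \<Rightarrow> complex ^ 'm \<Rightarrow> complex ^ 'm \<Rightarrow> complex ^ 'm::finite \<Rightarrow> complex" where
  "comp4 T a b c d =
     cext (\<lambda>x. cext (\<lambda>y. cext (\<lambda>u. cext (\<lambda>w. complex_of_real (T x y u w))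
       (antihol d)) (hol c)) (antihol b)) (hol a)"

text \<open>In the following, \<open>e\<close> is a complex frame \<open>e\<^sub>\<alpha>\<close> of the tangent space at \<open>z\<close>, i.e. the components
  are those with respect to \<open>hol (e\<^sub>\<alpha>)\<close>.\<close>

type_synonym 'm frame = "'m \<Rightarrow> complex ^ 'm"

definition coord_frame :: "'m::finite frame" where
  "coord_frame a = axis a 1"

definition g_comp ::
  "(complex ^ 'm) metric \<Rightarrow> complex ^ 'm \<Rightarrow> 'm::finite frame \<Rightarrow> 'm \<Rightarrow> 'm \<Rightarrow> complex" where
  "g_comp h z e a b = comp2 (h z) (e a) (e b)"

definition ricci_comp ::
  "(complex ^ 'm) metric \<Rightarrow> complex ^ 'm \<Rightarrow> 'm::finite frame \<Rightarrow> 'm \<Rightarrow> 'm \<Rightarrow> complex" where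
  "ricci_comp h z e a b = comp2 (ricci_tensor h z) (e a) (e b)"

definition riemann_comp ::
  "(complex ^ 'm) metric \<Rightarrow> complex ^ 'm \<Rightarrow> 'm::finite frame \<Rightarrow> 'm \<Rightarrow> 'm \<Rightarrow> 'm \<Rightarrow> 'm \<Rightarrow> complex" where
  "riemann_comp h z e a b c d = comp4 (riemann_tensor h z) (e a) (e b) (e c) (e d)"

text \<open>\<open>g_inv\<close> is \<open>g\<^bsup>\<alpha>\<beta>-bar\<^esup>\<close>, normalised by \<open>(\<Sum>\<beta>. g\<^bsup>\<alpha>\<beta>-bar\<^esup> g\<^bsub>\<gamma>\<beta>-bar\<^esub>) = \<delta>\<^bsub>\<alpha>\<gamma>\<^esub>\<close>; this is
  why the indices are swapped.\<close>

definition g_inv ::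
  "(complex ^ 'm) metric \<Rightarrow> complex ^ 'm \<Rightarrow> 'm::finite frame \<Rightarrow> 'm \<Rightarrow> 'm \<Rightarrow> complex" where
  "g_inv h z e a b = matrix_inv (\<chi> i j. g_comp h z e i j) $ b $ a"

definition complex_scalar :: "(complex ^ 'm) metric \<Rightarrow> complex ^ 'm \<Rightarrow> 'm::finite frame \<Rightarrow> complex" where
  "complex_scalar h z e = (\<Sum>a\<in>UNIV. \<Sum>b\<in>UNIV. g_inv h z e a b * ricci_comp h z e a b)"

definition E_comp ::
  "(complex ^ 'm) metric \<Rightarrow> complex ^ 'm \<Rightarrow> 'm::finite frame \<Rightarrow> 'm \<Rightarrow> 'm \<Rightarrow> complex" where
  "E_comp h z e a b =
     ricci_comp h z e a b - complex_scalar h z e / of_nat CARD('m) * g_comp h z e a b"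

definition bochner_comp ::
  "(complex ^ 'm) metric \<Rightarrow> complex ^ 'm \<Rightarrow> 'm::finite frame \<Rightarrow> 'm \<Rightarrow> 'm \<Rightarrow> 'm \<Rightarrow> 'm \<Rightarrow> complex" where
  "bochner_comp h z e a b c d =
     (let m = of_nat CARD('m); G = g_comp h z e; Rc = ricci_comp h z e in
       riemann_comp h z e a b c d
       + 1 / (m + 2) * (Rc a b * G c d + Rc c b * G a d + G a b * Rc c d + G c b * Rc a d)
       - complex_scalar h z e / ((m + 1) * (m + 2)) * (G a b * G c d + G c b * G a d))"

text \<open>Any two unitary frames give the same norms.\<close>

definition unitary_frame :: "(complex ^ 'm) metric \<Rightarrow> complex ^ 'm \<Rightarrow> 'm::finite frame \<Rightarrow> bool" where
  "unitary_frame h z e \<longleftrightarrow> (\<forall>a b. g_comp h z e a b = (if a = b then 1 else 0))"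

definition E_norm :: "(complex ^ 'm::finite) metric \<Rightarrow> complex ^ 'm \<Rightarrow> real" where
  "E_norm h z = (let e = (SOME e. unitary_frame h z e) in
     sqrt (2 * (\<Sum>a\<in>UNIV. \<Sum>b\<in>UNIV. (cmod (E_comp h z e a b))\<^sup>2)))"

definition bochner_norm :: "(complex ^ 'm::finite) metric \<Rightarrow> complex ^ 'm \<Rightarrow> real" where
  "bochner_norm h z = (let e = (SOME e. unitary_frame h z e) in
     sqrt (4 * (\<Sum>a\<in>UNIV. \<Sum>b\<in>UNIV. \<Sum>c\<in>UNIV. \<Sum>d\<in>UNIV.
       (cmod (bochner_comp h z e a b c d))\<^sup>2)))"


section \<open>Kaehler manifolds\<close>

text \<open>A manifold is a topological space \<open>X\<close> with a holomorphic atlas \<open>A\<close>; a chart is a pair of its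
  domain and its coordinate map. The complex dimension is \<open>CARD('m)\<close>.\<close>

type_synonym ('a, 'm) chart = "'a set \<times> ('a \<Rightarrow> complex ^ 'm)"

definition chart_image :: "('a, 'm) chart \<Rightarrow> (complex ^ 'm) set" where
  "chart_image c = snd c ` fst c"

definition chart_inv :: "('a, 'm) chart \<Rightarrow> complex ^ 'm \<Rightarrow> 'a" where
  "chart_inv c = inv_into (fst c) (snd c)"

definition is_chart :: "'a topology \<Rightarrow> ('a, 'm::finite) chart \<Rightarrow> bool" where
  "is_chart X c \<longleftrightarrow> openin X (fst c) \<and> open (chart_image c) \<and>
     homeomorphic_map (subtopology X (fst c)) (top_of_set (chart_image c)) (snd c)"

definition holomorphic_map_on ::
  "(complex ^ 'm::finite) set \<Rightarrow> (complex ^ 'm \<Rightarrow> complex ^ 'm) \<Rightarrow> bool" where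
  "holomorphic_map_on S f \<longleftrightarrow>
     (\<forall>z\<in>S. \<exists>D. (f has_derivative D) (at z) \<and> (\<forall>a v. D (a *s v) = a *s D v))"

definition complex_manifold :: "'a topology \<Rightarrow> ('a, 'm::finite) chart set \<Rightarrow> bool" where
  "complex_manifold X A \<longleftrightarrow>
     Hausdorff_space X \<and>
     (\<exists>\<B>. countable \<B> \<and> (\<forall>V\<in>\<B>. openin X V) \<and>
        (\<forall>U x. openin X U \<and> x \<in> U \<longrightarrow> (\<exists>V\<in>\<B>. x \<in> V \<and> V \<subseteq> U))) \<and>
     connected_space X \<and> topspace X \<noteq> {} \<and>
     (\<forall>c\<in>A. is_chart X c) \<and> (\<Union>c\<in>A. fst c) = topspace X \<and>
     (\<forall>c\<in>A. \<forall>d\<in>A. holomorphic_map_on (snd c ` (fst c \<inter> fst d)) (snd d \<circ> chart_inv c))"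

text \<open>\<open>g c z\<close> is the metric at the point with coordinates \<open>z\<close> in the chart \<open>c\<close>.\<close>

type_synonym ('a, 'm) mfd_metric = "('a, 'm) chart \<Rightarrow> (complex ^ 'm) metric"

definition riemannian_metric ::
  "('a, 'm::finite) chart set \<Rightarrow> ('a, 'm) mfd_metric \<Rightarrow> bool" where
  "riemannian_metric A g \<longleftrightarrow>
     (\<forall>c\<in>A.
        (\<forall>z\<in>chart_image c. bilinear (g c z) \<and> (\<forall>v w. g c z v w = g c z w v) \<and>
           (\<forall>v. v \<noteq> 0 \<longrightarrow> g c z v v > 0)) \<and>
        (\<forall>v w. smooth_fun_on (chart_image c) (\<lambda>z. g c z v w))) \<and>
     (\<forall>c\<in>A. \<forall>d\<in>A. \<forall>p\<in>fst c \<inter> fst d. \<forall>v w.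
        (let D = frechet_derivative (snd d \<circ> chart_inv c) (at (snd c p)) in
           g c (snd c p) v w = g d (snd d p) (D v) (D w)))"

text \<open>The fundamental form is \<open>\<omega>(v,w) = g(J v, w)\<close>; the last condition is \<open>d\<omega> = 0\<close>.\<close>

definition kaehler_manifold ::
  "'a topology \<Rightarrow> ('a, 'm::finite) chart set \<Rightarrow> ('a, 'm) mfd_metric \<Rightarrow> bool" where
  "kaehler_manifold X A g \<longleftrightarrow>
     complex_manifold X A \<and> riemannian_metric A g \<and>
     (\<forall>c\<in>A. \<forall>z\<in>chart_image c.
        (\<forall>v w. g c z (\<i> *s v) (\<i> *s w) = g c z v w) \<and>
        (let \<omega> = (\<lambda>y v w. g c y (\<i> *s v) w) in
          \<forall>u v w. frechet_derivative (\<lambda>y. \<omega> y v w) (at z) u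
                + frechet_derivative (\<lambda>y. \<omega> y w u) (at z) v
                + frechet_derivative (\<lambda>y. \<omega> y u v) (at z) w = 0))"

definition kaehler_einstein ::
  "('a, 'm::finite) chart set \<Rightarrow> ('a, 'm) mfd_metric \<Rightarrow> bool" where
  "kaehler_einstein A g \<longleftrightarrow>
     (\<forall>c\<in>A. \<forall>z\<in>chart_image c. \<forall>a b. E_comp (g c) z coord_frame a b = 0)"


section \<open>Integration and the Yamabe constant\<close>

text \<open>The unique Borel measure that in each chart has the density \<open>volume_density\<close>.\<close>

definition volume ::
  "'a topology \<Rightarrow> ('a, 'm::finite) chart set \<Rightarrow> ('a, 'm) mfd_metric \<Rightarrow> 'a measure" where
  "volume X A g = (THE \<mu>. space \<mu> = topspace X \<and>
     sets \<mu> = sigma_sets (topspace X) {S. openin X S} \<and>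
     (\<forall>c\<in>A. \<forall>S\<in>sets \<mu>. S \<subseteq> fst c \<longrightarrow>
        emeasure \<mu> S =
          (\<integral>\<^sup>+ z. ennreal (volume_density (g c) z) * indicator (snd c ` S) z \<partial>lborel)))"

text \<open>The value at \<open>p\<close> of a function given in charts by \<open>F c z\<close>; it is applied to quantities that do
  not depend on the chart.\<close>

definition at_point ::
  "('a, 'm) chart set \<Rightarrow> (('a, 'm) chart \<Rightarrow> complex ^ 'm \<Rightarrow> real) \<Rightarrow> 'a \<Rightarrow> real" where
  "at_point A F p = (let c = (SOME c. c \<in> A \<and> p \<in> fst c) in F c (snd c p))"

definition lp_norm ::
  "'a topology \<Rightarrow> ('a, 'm::finite) chart set \<Rightarrow> ('a, 'm) mfd_metric \<Rightarrow> real \<Rightarrow>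
    (('a, 'm) chart \<Rightarrow> complex ^ 'm \<Rightarrow> real) \<Rightarrow> real" where
  "lp_norm X A g q F = (LINT p|volume X A g. \<bar>at_point A F p\<bar> powr q) powr (1 / q)"

definition test_function :: "'a topology \<Rightarrow> ('a, 'm::finite) chart set \<Rightarrow> ('a \<Rightarrow> real) \<Rightarrow> bool" where
  "test_function X A u \<longleftrightarrow>
     (\<forall>c\<in>A. smooth_fun_on (chart_image c) (u \<circ> chart_inv c)) \<and>
     compactin X (X closure_of {p \<in> topspace X. u p \<noteq> 0})"

definition yamabe_quotient ::
  "'a topology \<Rightarrow> ('a, 'm::finite) chart set \<Rightarrow> ('a, 'm) mfd_metric \<Rightarrow> ('a \<Rightarrow> real) \<Rightarrow> real" where
  "yamabe_quotient X A g u =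
     (let n = 2 * real CARD('m) in
       (LINT p|volume X A g.
          at_point A (\<lambda>c. grad_norm_sq (g c) (u \<circ> chart_inv c)) p
          + (n - 2) / (4 * (n - 1)) * at_point A (\<lambda>c. scalar_curvature (g c)) p * (u p)\<^sup>2)
       / (LINT p|volume X A g. \<bar>u p\<bar> powr (2 * n / (n - 2))) powr ((n - 2) / n))"

definition yamabe_constant ::
  "'a topology \<Rightarrow> ('a, 'm::finite) chart set \<Rightarrow> ('a, 'm) mfd_metric \<Rightarrow> real" where
  "yamabe_constant X A g =
     (INF u \<in> {u. test_function X A u \<and> (\<exists>p\<in>topspace X. u p \<noteq> 0)}. yamabe_quotient X A g u)"

definition P :: "nat \<Rightarrow> real" where
  "P m = (if m = 2 then 3 / 2 else 2 * (2 * real m - 1) / ((real m)\<^sup>2 - 1))"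

end

(*
  For constant scalar curvature the Weitzenboeck formula bounds the Laplacian of |E|^2 from below by
  the gradient of |E| (with the refined Kato constant (m+1)/m), a positive multiple of the scalar
  curvature times |E|^2, and a cubic curvature term; splitting the curvature into its Bochner, traceless
  Ricci and scalar parts, the cubic term is at most kappa (sqrt 2 |E| + |B|) |E|^2, where
  kappa^2 = (2m^2+4m+3) / (2(m+1)(m+2)). Integrate over M. Hoelder's inequality and the Yamabe inequality
  for u = sqrt (|E|^2 + eps) bound the cubic term by a multiple of the Yamabe energy of u that is smaller
  than P(m), so that for eps -> 0 it is absorbed by the other two terms. Hence the integral of |E|^2
  vanishes.

  The volume measure is glued from the chart densities, whose compatibility is the change of variables
  formula, and the integral of a Laplacian vanishes by a partition of unity and the divergence theorem in
  charts.
*)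

theory Submission
  imports Defs "HOL-Complex_Analysis.Cauchy_Integral_Formula"
begin

text \<open>The definitions speak of a real metric and of norms in a frame picked by choice, whereas
  the calculus below needs smooth complex components. Both sides meet in the Hermitian matrix
  \<open>H\<close> of the metric: curvature, gradient and Laplacian become expressions in
  \<open>H\<close>, its inverse and their Wirtinger derivatives, and |E|^2 is twice
  \<open>ricci_sq\<close> up to a constant, hence smooth independently of frames. Holomorphic
  coordinates in which \<open>H\<close> is the identity to first order exist because of the Kaehler
  condition; in them the Weitzenboeck formula reduces to commuting partial derivatives. The
  constants have separate origins. \<open>\<kappa>\<close> bounds the projection of E \<otimes> E to
  the tensors with the algebraic symmetries of B. P(m) is the smaller of two ratios up to which the
  two parts of the Yamabe energy can be absorbed: the gradient part is limited by the Kato constant,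
  the scalar part by the coefficient s/(m+1) of |E|^2 in the Weitzenboeck inequality. The first
  limit is the decisive one for m = 2 only.\<close>

abbreviation sum_all :: "('i \<Rightarrow> 'b::comm_monoid_add) \<Rightarrow> 'b" (binder "\<Sum>*" 10) where
  "sum_all f \<equiv> sum f UNIV"

section \<open>Continuously differentiable maps\<close>

text \<open>The recursion of \<open>Ck_on\<close> with values in an arbitrary normed space, so that
  complex components and coordinate changes are covered. Only derivatives in constant directions
  occur, which keeps operator-valued maps out of the induction.\<close>

primrec Ck :: "nat \<Rightarrow> 'v::euclidean_space set \<Rightarrow> ('v \<Rightarrow> 'b::real_normed_vector) \<Rightarrow> bool" where
  "Ck 0 S f \<longleftrightarrow> continuous_on S f"
| "Ck (Suc k) S f \<longleftrightarrow> (\<forall>z\<in>S. f differentiable (at z)) \<and>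
     (\<forall>v. Ck k S (\<lambda>z. frechet_derivative f (at z) v))"

lemma Ck_on_eq_Ck: "Ck_on k S f = Ck k S f"
  by (induction k arbitrary: f) auto

lemma frechet_derivative_eq:
  "(f has_derivative D) (at z) \<Longrightarrow> frechet_derivative f (at z) = D"
  by (rule frechet_derivative_at[symmetric])

lemma differentiable_imp_has_derivative:
  "f differentiable (at z) \<Longrightarrow> (f has_derivative frechet_derivative f (at z)) (at z)"
  by (simp add: frechet_derivative_works)

lemma differentiable_cong_open:
  assumes "open S" "z \<in> S" "\<And>y. y \<in> S \<Longrightarrow> f y = g y" "f differentiable (at z)"
  shows "g differentiable (at z)"
  using assms has_derivative_transform_within_open[of f _ z UNIV S g]
  unfolding differentiable_def by blast

lemma frechet_derivative_cong_open:
  assumes "open S" "z \<in> S" "\<And>y. y \<in> S \<Longrightarrow> f y = g y"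
  shows "frechet_derivative f (at z) = frechet_derivative g (at z)"
proof -
  have "(f has_derivative D) (at z) \<longleftrightarrow> (g has_derivative D) (at z)" for D
    using has_derivative_transform_within_open[of f D z UNIV S g]
      has_derivative_transform_within_open[of g D z UNIV S f] assms by auto
  then show ?thesis unfolding frechet_derivative_def by simp
qed

text \<open>Derivatives at a point see a neighbourhood, hence the openness of S.\<close>

lemma Ck_cong:
  assumes "open S" "\<And>y. y \<in> S \<Longrightarrow> f y = g y"
  shows "Ck k S f \<longleftrightarrow> Ck k S g"
  using assms(2)
proof (induction k arbitrary: f g)
  case 0
  then show ?case by (simp cong: continuous_on_cong)
next
  case (Suc k)
  have "(\<forall>z\<in>S. f differentiable (at z)) \<longleftrightarrow> (\<forall>z\<in>S. g differentiable (at z))"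
    using differentiable_cong_open[OF assms(1)] Suc.prems by metis
  moreover have "Ck k S (\<lambda>z. frechet_derivative f (at z) v) \<longleftrightarrow> Ck k S (\<lambda>z. frechet_derivative g (at z) v)" for v
    by (rule Suc.IH) (metis frechet_derivative_cong_open[OF assms(1)] Suc.prems)
  ultimately show ?case by simp
qed

lemma Ck_SucD: "Ck (Suc k) S f \<Longrightarrow> Ck k S f"
proof (induction k arbitrary: f)
  case 0
  then show ?case
    by (auto simp: continuous_on_eq_continuous_within differentiable_imp_continuous_within
        intro: continuous_at_imp_continuous_at_within)
next
  case (Suc k)
  then show ?case by (metis Ck.simps(2))
qed

lemma Ck_le: "j \<le> k \<Longrightarrow> Ck k S f \<Longrightarrow> Ck j S f"
  by (induction k) (auto simp: le_Suc_eq dest: Ck_SucD simp del: Ck.simps)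

lemma Ck_subset: "T \<subseteq> S \<Longrightarrow> Ck k S f \<Longrightarrow> Ck k T f"
  by (induction k arbitrary: f) (auto intro: continuous_on_subset)

lemma Ck_differentiable: "Ck (Suc k) S f \<Longrightarrow> z \<in> S \<Longrightarrow> f differentiable (at z)"
  by simp

lemma Ck_has_derivative:
  "Ck (Suc k) S f \<Longrightarrow> z \<in> S \<Longrightarrow> (f has_derivative frechet_derivative f (at z)) (at z)"
  by (simp add: differentiable_imp_has_derivative)

lemma Ck_SucI:
  assumes "open S" "\<And>z. z \<in> S \<Longrightarrow> (f has_derivative D z) (at z)" "\<And>v. Ck k S (\<lambda>z. D z v)"
  shows "Ck (Suc k) S f"
proof -
  have "Ck k S (\<lambda>z. frechet_derivative f (at z) v)" for v
    using assms(3)[of v] Ck_cong[OF assms(1), of "\<lambda>z. frechet_derivative f (at z) v" "\<lambda>z. D z v"]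
    by (simp add: frechet_derivative_eq[OF assms(2)])
  then show ?thesis using assms(2) by (auto simp: differentiable_def)
qed

lemma Ck_const: "Ck k S (\<lambda>z. c)"
  by (induction k arbitrary: c) (auto simp: frechet_derivative_const)

lemma Ck_bounded_linear:
  assumes L: "bounded_linear L" and "open S" "Ck k S f"
  shows "Ck k S (\<lambda>z. L (f z))"
  using assms(3)
proof (induction k arbitrary: f)
  case 0
  then show ?case by (simp add: bounded_linear.continuous_on[OF L])
next
  case (Suc k)
  have d: "((\<lambda>z. L (f z)) has_derivative (\<lambda>v. L (frechet_derivative f (at z) v))) (at z)" if "z \<in> S" for z
    by (rule bounded_linear.has_derivative[OF L]) (rule Ck_has_derivative[OF Suc.prems that])
  show ?case
    by (rule Ck_SucI[OF assms(2) d]) (use Suc in auto)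
qed

lemma Ck_add:
  assumes "open S" "Ck k S f" "Ck k S g"
  shows "Ck k S (\<lambda>z. f z + g z)"
  using assms(2,3)
proof (induction k arbitrary: f g)
  case 0
  then show ?case by (auto intro: continuous_on_add)
next
  case (Suc k)
  have d: "((\<lambda>z. f z + g z) has_derivative (\<lambda>v. frechet_derivative f (at z) v + frechet_derivative g (at z) v)) (at z)"
    if "z \<in> S" for z
    by (rule has_derivative_add) (use Suc.prems that in \<open>auto intro: Ck_has_derivative\<close>)
  show ?case by (rule Ck_SucI[OF assms(1) d]) (use Suc in auto)
qed

text \<open>The product rule once for all products in use: multiplication, scaling, inner product.
  The factor that is not differentiated is available with one order less by
  \<open>Ck_SucD\<close>.\<close>

lemma Ck_bilinear:
  assumes B: "bounded_bilinear B" and "open S" "Ck k S f" "Ck k S g"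
  shows "Ck k S (\<lambda>z. B (f z) (g z))"
  using assms(3,4)
proof (induction k arbitrary: f g)
  case 0
  then show ?case by (simp add: bounded_bilinear.continuous_on[OF B])
next
  case (Suc k)
  have d: "((\<lambda>z. B (f z) (g z)) has_derivative (\<lambda>v. B (f z) (frechet_derivative g (at z) v)
     + B (frechet_derivative f (at z) v) (g z))) (at z)" if "z \<in> S" for z
    by (rule bounded_bilinear.FDERIV[OF B]) (use Suc.prems that in \<open>auto intro: Ck_has_derivative\<close>)
  show ?case
  proof (rule Ck_SucI[OF assms(2) d])
    fix v
    show "Ck k S (\<lambda>z. B (f z) (frechet_derivative g (at z) v) + B (frechet_derivative f (at z) v) (g z))"
      using Ck_SucD[OF Suc.prems(1)] Ck_SucD[OF Suc.prems(2)] Suc.prems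
      by (intro Ck_add[OF assms(2)] Suc.IH) auto
  qed
qed

lemmas Ck_mult = Ck_bilinear[OF bounded_bilinear_mult]
lemmas Ck_scaleR = Ck_bilinear[OF bounded_bilinear_scaleR]

lemma Ck_minus: "open S \<Longrightarrow> Ck k S f \<Longrightarrow> Ck k S (\<lambda>z. - f z)"
  by (rule Ck_bounded_linear[OF bounded_linear_minus[OF bounded_linear_ident]])

lemma Ck_diff: "open S \<Longrightarrow> Ck k S f \<Longrightarrow> Ck k S g \<Longrightarrow> Ck k S (\<lambda>z. f z - g z)"
  using Ck_add[of S k f "\<lambda>z. - g z"] Ck_minus[of S k g] by simp

lemma Ck_sum: "open S \<Longrightarrow> (\<And>i. i \<in> I \<Longrightarrow> Ck k S (f i)) \<Longrightarrow> Ck k S (\<lambda>z. \<Sum>i\<in>I. f i z)"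
  by (induction I rule: infinite_finite_induct) (auto simp: Ck_const intro: Ck_add)

lemma Ck_inverse:
  fixes f :: "'v::euclidean_space \<Rightarrow> 'b::real_normed_field"
  assumes "open S" "Ck k S f" "\<And>z. z \<in> S \<Longrightarrow> f z \<noteq> 0"
  shows "Ck k S (\<lambda>z. inverse (f z))"
  using assms(2)
proof (induction k)
  case 0
  then show ?case using assms(3) by (auto intro: continuous_on_inverse)
next
  case (Suc k)
  have d: "((\<lambda>z. inverse (f z)) has_derivative (\<lambda>v. - (inverse (f z) * frechet_derivative f (at z) v * inverse (f z)))) (at z)"
    if "z \<in> S" for z
    by (rule Deriv.has_derivative_inverse) (use assms(3) that Suc.prems in \<open>auto intro: Ck_has_derivative\<close>)
  have IH: "Ck k S (\<lambda>z. inverse (f z))" using Suc Ck_SucD by blast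
  show ?case
    by (rule Ck_SucI[OF assms(1) d]) (use Suc.prems in \<open>auto intro!: Ck_minus Ck_mult IH assms(1)\<close>)
qed

lemma Ck_sqrt:
  fixes f :: "'v::euclidean_space \<Rightarrow> real"
  assumes "open S" "Ck k S f" "\<And>z. z \<in> S \<Longrightarrow> f z > 0"
  shows "Ck k S (\<lambda>z. sqrt (f z))"
  using assms(2)
proof (induction k)
  case 0
  then show ?case by (auto intro: continuous_on_real_sqrt)
next
  case (Suc k)
  have d: "((\<lambda>z. sqrt (f z)) has_derivative (\<lambda>v. inverse (sqrt (f z)) * (1/2) * frechet_derivative f (at z) v)) (at z)"
    if "z \<in> S" for z
    using has_derivative_real_sqrt[OF assms(3)[OF that] Ck_has_derivative[OF Suc.prems that]]
    by (simp add: field_simps)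
  have IH: "Ck k S (\<lambda>z. inverse (sqrt (f z)))"
    using Suc.IH[OF Ck_SucD[OF Suc.prems]] assms(3) by (intro Ck_inverse assms(1)) fastforce+
  show ?case
    by (rule Ck_SucI[OF assms(1) d], assumption) (intro Ck_mult Ck_const IH assms(1), use Suc.prems in simp)
qed

lemma Ck_of_real: "open S \<Longrightarrow> Ck k S f \<Longrightarrow> Ck k S (\<lambda>z. complex_of_real (f z))"
  by (rule Ck_bounded_linear[OF bounded_linear_of_real])
lemma Ck_Re: "open S \<Longrightarrow> Ck k S f \<Longrightarrow> Ck k S (\<lambda>z. Re (f z))"
  by (rule Ck_bounded_linear[OF bounded_linear_Re])
lemma Ck_Im: "open S \<Longrightarrow> Ck k S f \<Longrightarrow> Ck k S (\<lambda>z. Im (f z))"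
  by (rule Ck_bounded_linear[OF bounded_linear_Im])
lemma Ck_cnj: "open S \<Longrightarrow> Ck k S f \<Longrightarrow> Ck k S (\<lambda>z. cnj (f z))"
  by (rule Ck_bounded_linear[OF bounded_linear_cnj])

lemma Ck_compose:
  fixes f :: "'w::euclidean_space \<Rightarrow> 'b::real_normed_vector" and \<tau> :: "'v::euclidean_space \<Rightarrow> 'w"
  assumes S: "open S" and T: "open T" "\<tau> ` S \<subseteq> T" and \<tau>: "Ck k S \<tau>" and f: "Ck k T f"
  shows "Ck k S (\<lambda>z. f (\<tau> z))"
  using \<tau> f
proof (induction k arbitrary: f)
  case 0
  then show ?case using T by (auto intro: continuous_on_compose2)
next
  case (Suc k)
  \<comment> \<open>\<open>Ck\<close> knows only derivatives in fixed directions, but the direction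
    in which f is differentiated varies with z. Expanding it in the basis leaves products to which
    the induction hypothesis applies.\<close>
  let ?D = "\<lambda>z v. \<Sum>b\<in>Basis. (frechet_derivative \<tau> (at z) v \<bullet> b) *\<^sub>R frechet_derivative f (at (\<tau> z)) b"
  have d: "((\<lambda>z. f (\<tau> z)) has_derivative ?D z) (at z)" if z: "z \<in> S" for z
  proof -
    have tz: "\<tau> z \<in> T" using T z by auto
    have fd: "(f has_derivative frechet_derivative f (at (\<tau> z))) (at (\<tau> z))"
      using Ck_has_derivative Suc.prems(2) tz by blast
    interpret L: bounded_linear "frechet_derivative f (at (\<tau> z))" using fd by (rule has_derivative_bounded_linear)
    have "((\<lambda>z. f (\<tau> z)) has_derivative (\<lambda>v. frechet_derivative f (at (\<tau> z)) (frechet_derivative \<tau> (at z) v))) (at z)"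
      using diff_chain_at[OF Ck_has_derivative[OF Suc.prems(1) z] fd] by (simp add: o_def)
    moreover have "frechet_derivative f (at (\<tau> z)) w = (\<Sum>b\<in>Basis. (w \<bullet> b) *\<^sub>R frechet_derivative f (at (\<tau> z)) b)" for w
    proof -
      have "frechet_derivative f (at (\<tau> z)) (\<Sum>b\<in>Basis. (w \<bullet> b) *\<^sub>R b)
          = (\<Sum>b\<in>Basis. (w \<bullet> b) *\<^sub>R frechet_derivative f (at (\<tau> z)) b)"
        by (simp only: L.sum L.scaleR)
      then show ?thesis by (simp only: euclidean_representation)
    qed
    then have "(\<lambda>v. frechet_derivative f (at (\<tau> z)) (frechet_derivative \<tau> (at z) v)) = ?D z" by (intro ext)
    ultimately show ?thesis by (simp only:)
  qed
  show ?case
  proof (rule Ck_SucI[OF S d])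
    fix v
    show "Ck k S (\<lambda>z. ?D z v)"
    proof (intro Ck_sum Ck_scaleR S)
      fix b :: 'w
      show "Ck k S (\<lambda>z. frechet_derivative \<tau> (at z) v \<bullet> b)"
        by (rule Ck_bounded_linear[OF bounded_linear_inner_left S]) (use Suc.prems in simp)
      show "Ck k S (\<lambda>z. frechet_derivative f (at (\<tau> z)) b)"
        by (rule Suc.IH) (use Suc.prems Ck_SucD in auto)
    qed
  qed
qed

text \<open>Two applications of the one-dimensional mean value theorem, first along u to the
  difference in direction v, then along v to the derivative in direction u.\<close>

lemma second_difference_mvt:
  fixes f :: "'v::euclidean_space \<Rightarrow> real"
  assumes S: "ball z r \<subseteq> S" and f: "Ck 2 S f" and s: "s > 0" "s * (norm u + norm v) < r"
  obtains y where "dist z y \<le> s * (norm u + norm v)"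
    "f (z + s *\<^sub>R u + s *\<^sub>R v) - f (z + s *\<^sub>R u) - f (z + s *\<^sub>R v) + f z
      = s\<^sup>2 * frechet_derivative (\<lambda>x. frechet_derivative f (at x) u) (at y) v"
proof -
  have in_ball: "z + a *\<^sub>R u + b *\<^sub>R v \<in> S \<and> dist z (z + a *\<^sub>R u + b *\<^sub>R v) \<le> s * (norm u + norm v)"
    if "0 \<le> a" "a \<le> s" "0 \<le> b" "b \<le> s" for a b
  proof -
    have "norm (a *\<^sub>R u + b *\<^sub>R v) \<le> norm (a *\<^sub>R u) + norm (b *\<^sub>R v)" by (rule norm_triangle_ineq)
    also have "\<dots> = a * norm u + b * norm v" using that by simp
    also have "\<dots> \<le> s * norm u + s * norm v" using that by (intro add_mono mult_right_mono) auto
    finally have "norm (a *\<^sub>R u + b *\<^sub>R v) \<le> s * (norm u + norm v)" by (simp add: distrib_left)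
    moreover have "z - (z + a *\<^sub>R u + b *\<^sub>R v) = - (a *\<^sub>R u + b *\<^sub>R v)" by simp
    ultimately have "dist z (z + a *\<^sub>R u + b *\<^sub>R v) \<le> s * (norm u + norm v)"
      by (simp only: dist_norm norm_minus_cancel)
    then show ?thesis using S s(2) by (auto simp: subset_eq)
  qed
  have f2: "Ck (Suc (Suc 0)) S f" using f by (simp add: numeral_2_eq_2)
  let ?Du = "\<lambda>x. frechet_derivative f (at x) u"
  have f1: "(f has_derivative frechet_derivative f (at x)) (at x)" if "x \<in> S" for x
    using Ck_has_derivative f2 that by blast
  have fu: "(?Du has_derivative frechet_derivative ?Du (at x)) (at x)" if "x \<in> S" for x
    using f2 that by (intro Ck_has_derivative[of 0 S]) auto
  have lin: "frechet_derivative f (at x) (a *\<^sub>R w) = a * frechet_derivative f (at x) w" if "x \<in> S" for x a w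
    using has_derivative_linear[OF f1[OF that]] by (simp add: linear_cmul)
  have lin2: "frechet_derivative ?Du (at x) (a *\<^sub>R w) = a * frechet_derivative ?Du (at x) w" if "x \<in> S" for x a w
    using has_derivative_linear[OF fu[OF that]] by (simp add: linear_cmul)
  \<comment> \<open>F carries the v-difference; its increment from 0 to s is the second
    difference.\<close>
  define F where "F t = f (z + t *\<^sub>R u + s *\<^sub>R v) - f (z + t *\<^sub>R u + 0 *\<^sub>R v)" for t
  have "\<exists>\<xi>. 0 < \<xi> \<and> \<xi> < s \<and> F s - F 0 = (s - 0) * (?Du (z + \<xi> *\<^sub>R u + s *\<^sub>R v) - ?Du (z + \<xi> *\<^sub>R u + 0 *\<^sub>R v))"
  proof (rule MVT2[OF s(1)])
    fix t assume t: "0 \<le> t" "t \<le> s"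
    have "((\<lambda>t. f (z + t *\<^sub>R u + b *\<^sub>R v)) has_derivative (\<lambda>h. frechet_derivative f (at (z + t *\<^sub>R u + b *\<^sub>R v)) (h *\<^sub>R u))) (at t)"
      if "0 \<le> b" "b \<le> s" for b
    proof (rule has_derivative_compose[where f="\<lambda>t. z + t *\<^sub>R u + b *\<^sub>R v" and g=f])
      show "((\<lambda>t. z + t *\<^sub>R u + b *\<^sub>R v) has_derivative (\<lambda>h. h *\<^sub>R u)) (at t)"
        by (auto intro!: derivative_eq_intros)
    qed (use f1 in_ball t that in auto)
    note D = this
    have F': "(F has_derivative (\<lambda>h. frechet_derivative f (at (z + t *\<^sub>R u + s *\<^sub>R v)) (h *\<^sub>R u)
         - frechet_derivative f (at (z + t *\<^sub>R u + 0 *\<^sub>R v)) (h *\<^sub>R u))) (at t)"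
      unfolding F_def by (rule has_derivative_diff[OF D D]) (use s(1) in auto)
    have mem: "z + t *\<^sub>R u + s *\<^sub>R v \<in> S" "z + t *\<^sub>R u + 0 *\<^sub>R v \<in> S"
      using in_ball[of t s] in_ball[of t 0] t s(1) by auto
    have "(F has_derivative (\<lambda>h. h * (?Du (z + t *\<^sub>R u + s *\<^sub>R v) - ?Du (z + t *\<^sub>R u + 0 *\<^sub>R v)))) (at t)"
      using F' unfolding lin[OF mem(1)] lin[OF mem(2)] right_diff_distrib[symmetric] .
    then show "(F has_real_derivative (?Du (z + t *\<^sub>R u + s *\<^sub>R v) - ?Du (z + t *\<^sub>R u + 0 *\<^sub>R v))) (at t)"
      by (simp add: has_field_derivative_def mult.commute[of _ "_ - _"])
  qed
  then obtain \<xi> where \<xi>: "0 < \<xi>" "\<xi> < s" "F s - F 0 = s * (?Du (z + \<xi> *\<^sub>R u + s *\<^sub>R v) - ?Du (z + \<xi> *\<^sub>R u + 0 *\<^sub>R v))"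
    by auto
  have "\<exists>\<eta>. 0 < \<eta> \<and> \<eta> < s \<and> ?Du (z + \<xi> *\<^sub>R u + s *\<^sub>R v) - ?Du (z + \<xi> *\<^sub>R u + 0 *\<^sub>R v)
      = (s - 0) * frechet_derivative ?Du (at (z + \<xi> *\<^sub>R u + \<eta> *\<^sub>R v)) v"
  proof (rule MVT2[OF s(1)])
    fix t assume t: "0 \<le> t" "t \<le> s"
    have "((\<lambda>t. ?Du (z + \<xi> *\<^sub>R u + t *\<^sub>R v)) has_derivative (\<lambda>h. frechet_derivative ?Du (at (z + \<xi> *\<^sub>R u + t *\<^sub>R v)) (h *\<^sub>R v))) (at t)"
    proof (rule has_derivative_compose[where f="\<lambda>t. z + \<xi> *\<^sub>R u + t *\<^sub>R v" and g="?Du"])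
      show "((\<lambda>t. z + \<xi> *\<^sub>R u + t *\<^sub>R v) has_derivative (\<lambda>h. h *\<^sub>R v)) (at t)"
        by (auto intro!: derivative_eq_intros)
    qed (use fu in_ball t \<xi> in auto)
    then show "((\<lambda>t. ?Du (z + \<xi> *\<^sub>R u + t *\<^sub>R v)) has_real_derivative frechet_derivative ?Du (at (z + \<xi> *\<^sub>R u + t *\<^sub>R v)) v) (at t)"
      using in_ball[of \<xi> t] t \<xi> by (simp add: has_field_derivative_def lin2 mult.commute[of _ "frechet_derivative _ _ _"])
  qed
  then obtain \<eta> where \<eta>: "0 < \<eta>" "\<eta> < s" "?Du (z + \<xi> *\<^sub>R u + s *\<^sub>R v) - ?Du (z + \<xi> *\<^sub>R u + 0 *\<^sub>R v)
      = s * frechet_derivative ?Du (at (z + \<xi> *\<^sub>R u + \<eta> *\<^sub>R v)) v" by auto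
  show thesis
  proof (rule that)
    show "dist z (z + \<xi> *\<^sub>R u + \<eta> *\<^sub>R v) \<le> s * (norm u + norm v)" using in_ball \<xi> \<eta> by auto
    show "f (z + s *\<^sub>R u + s *\<^sub>R v) - f (z + s *\<^sub>R u) - f (z + s *\<^sub>R v) + f z
      = s\<^sup>2 * frechet_derivative ?Du (at (z + \<xi> *\<^sub>R u + \<eta> *\<^sub>R v)) v"
      using \<xi>(3) \<eta>(3) by (simp add: F_def power2_eq_square)
  qed
qed

text \<open>The second difference is symmetric in u and v, and by the mean value lemma it is s^2
  times either mixed derivative at a point near z. By continuity the two values at z cannot
  differ.\<close>

lemma symmetric_second_derivative_real:
  fixes f :: "'v::euclidean_space \<Rightarrow> real"
  assumes "open S" "z \<in> S" and f: "Ck 2 S f"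
  shows "frechet_derivative (\<lambda>x. frechet_derivative f (at x) u) (at z) v
       = frechet_derivative (\<lambda>x. frechet_derivative f (at x) v) (at z) u"
proof (rule ccontr)
  let ?A = "\<lambda>y. frechet_derivative (\<lambda>x. frechet_derivative f (at x) u) (at y) v"
  let ?B = "\<lambda>y. frechet_derivative (\<lambda>x. frechet_derivative f (at x) v) (at y) u"
  assume ne: "?A z \<noteq> ?B z"
  define e where "e = \<bar>?A z - ?B z\<bar> / 2"
  have e: "e > 0" using ne by (simp add: e_def)
  have "continuous_on S ?A" "continuous_on S ?B" using f by (simp_all add: numeral_2_eq_2)
  then have "continuous (at z) ?A" "continuous (at z) ?B"
    using assms by (auto simp: continuous_on_eq_continuous_at)
  then have cA: "\<exists>d>0. \<forall>y. dist y z < d \<longrightarrow> dist (?A y) (?A z) < e" and cB: "\<exists>d>0. \<forall>y. dist y z < d \<longrightarrow> dist (?B y) (?B z) < e"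
    using e by (simp_all only: continuous_at_eps_delta)
  from cA obtain d1 where d1: "d1 > 0" "\<And>y. dist y z < d1 \<Longrightarrow> \<bar>?A y - ?A z\<bar> < e"
    by (auto simp only: dist_real_def)
  from cB obtain d2 where d2: "d2 > 0" "\<And>y. dist y z < d2 \<Longrightarrow> \<bar>?B y - ?B z\<bar> < e"
    by (auto simp only: dist_real_def)
  note d = d1(1) d2(1) d1(2) d2(2)
  obtain r where r: "r > 0" "ball z r \<subseteq> S" using assms openE by blast
  define \<rho> where "\<rho> = Min {r, d1, d2}"
  have \<rho>: "\<rho> > 0" "\<rho> \<le> r" "\<rho> \<le> d1" "\<rho> \<le> d2" using r d by (auto simp: \<rho>_def)
  \<comment> \<open>The summand 1 keeps N positive when u = v = 0.\<close>
  define N where "N = norm u + norm v + 1"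
  have N: "N > 0" by (simp add: add_nonneg_pos N_def)
  define s where "s = \<rho> / (2 * N)"
  have s: "s > 0" using \<rho>(1) N by (simp add: s_def)
  have "s * (norm u + norm v) \<le> s * N" using s by (simp add: N_def)
  also have "\<dots> = \<rho> / 2" using N by (simp add: s_def)
  also have "\<dots> < \<rho>" using \<rho>(1) by simp
  finally have s: "s > 0" "s * (norm u + norm v) < \<rho>" using s by auto
  have "s * (norm u + norm v) < r" "s * (norm v + norm u) < r" using s \<rho> by (auto simp: add.commute)
  obtain y1 where
    y1: "dist z y1 \<le> s * (norm u + norm v)" "f (z + s *\<^sub>R u + s *\<^sub>R v) - f (z + s *\<^sub>R u) - f (z + s *\<^sub>R v) + f z = s\<^sup>2 * ?A y1"
    by (rule second_difference_mvt[OF r(2) f s(1) \<open>s * (norm u + norm v) < r\<close>])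
  obtain y2 where
    y2: "dist z y2 \<le> s * (norm v + norm u)" "f (z + s *\<^sub>R v + s *\<^sub>R u) - f (z + s *\<^sub>R v) - f (z + s *\<^sub>R u) + f z = s\<^sup>2 * ?B y2"
    by (rule second_difference_mvt[OF r(2) f s(1) \<open>s * (norm v + norm u) < r\<close>])
  have close: False if "p = q" "\<bar>p - a\<bar> < \<bar>a - b\<bar> / 2" "\<bar>q - b\<bar> < \<bar>a - b\<bar> / 2" for p q a b :: real
    using that by (auto simp: abs_if split: if_splits)
  have "s\<^sup>2 * ?A y1 = s\<^sup>2 * ?B y2" 
    unfolding y1(2)[symmetric] y2(2)[symmetric] by (simp add: add.assoc add.commute[of "s *\<^sub>R v"])
  then have "?A y1 = ?B y2" using s(1) by simp
  moreover have "\<bar>?A y1 - ?A z\<bar> < e" using d(3)[of y1] y1(1) s(2) \<rho>(3) by (simp add: dist_commute)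
  moreover have "\<bar>?B y2 - ?B z\<bar> < e" using d(4)[of y2] y2(1) s(2) \<rho>(4) by (simp add: dist_commute add.commute)
  ultimately show False unfolding e_def by (rule close)
qed

text \<open>Real and imaginary part are bounded linear and therefore commute with both
  derivatives.\<close>

lemma symmetric_second_derivative:
  fixes f :: "'v::euclidean_space \<Rightarrow> complex"
  assumes S: "open S" "z \<in> S" and f: "Ck 2 S f"
  shows "frechet_derivative (\<lambda>x. frechet_derivative f (at x) u) (at z) v
       = frechet_derivative (\<lambda>x. frechet_derivative f (at x) v) (at z) u"
proof -
  have f2: "Ck (Suc (Suc 0)) S f" using f by (simp add: numeral_2_eq_2)
  have *: "L (frechet_derivative (\<lambda>x. frechet_derivative f (at x) u) (at z) v)
      = frechet_derivative (\<lambda>x. frechet_derivative (\<lambda>x. L (f x)) (at x) u) (at z) v"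
    if L: "bounded_linear L" for L :: "complex \<Rightarrow> real" and u v
  proof -
    have 1: "frechet_derivative (\<lambda>x. L (f x)) (at x) = (\<lambda>v. L (frechet_derivative f (at x) v))" if "x \<in> S" for x
      by (rule frechet_derivative_eq, rule bounded_linear.has_derivative[OF L]) (use f2 that Ck_has_derivative in blast)
    have "frechet_derivative (\<lambda>x. frechet_derivative (\<lambda>x. L (f x)) (at x) u) (at z)
        = frechet_derivative (\<lambda>x. L (frechet_derivative f (at x) u)) (at z)"
      by (rule frechet_derivative_cong_open[OF S]) (simp add: 1)
    also have "\<dots> = (\<lambda>v. L (frechet_derivative (\<lambda>x. frechet_derivative f (at x) u) (at z) v))"
      by (rule frechet_derivative_eq, rule bounded_linear.has_derivative[OF L], rule Ck_has_derivative[of 0 S])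
        (use f2 S in auto)
    finally show ?thesis by simp
  qed
  show ?thesis
    by (rule complex_eqI)
      (simp_all add: *[OF bounded_linear_Re] *[OF bounded_linear_Im]
        symmetric_second_derivative_real[OF S Ck_Re[OF S(1) f]] symmetric_second_derivative_real[OF S Ck_Im[OF S(1) f]])
qed

section \<open>Wirtinger derivatives\<close>

definition dz :: "'m::finite \<Rightarrow> (complex ^ 'm \<Rightarrow> complex) \<Rightarrow> complex ^ 'm \<Rightarrow> complex" where
  "dz a F z = (frechet_derivative F (at z) (axis a 1) - \<i> * frechet_derivative F (at z) (axis a \<i>)) / 2"

definition dzb :: "'m::finite \<Rightarrow> (complex ^ 'm \<Rightarrow> complex) \<Rightarrow> complex ^ 'm \<Rightarrow> complex" where
  "dzb a F z = (frechet_derivative F (at z) (axis a 1) + \<i> * frechet_derivative F (at z) (axis a \<i>)) / 2"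

lemma dz_eq: "(F has_derivative D) (at z) \<Longrightarrow> dz a F z = (D (axis a 1) - \<i> * D (axis a \<i>)) / 2"
  by (simp add: dz_def frechet_derivative_eq)

lemma dzb_eq: "(F has_derivative D) (at z) \<Longrightarrow> dzb a F z = (D (axis a 1) + \<i> * D (axis a \<i>)) / 2"
  by (simp add: dzb_def frechet_derivative_eq)

lemma complex_vec_expansion:
  fixes w :: "complex ^ 'm::finite"
  shows "w = (\<Sum>*b. Re (w $ b) *\<^sub>R axis b 1 + Im (w $ b) *\<^sub>R axis b \<i>)"
proof (rule vec_eq_iff[THEN iffD2], rule allI)
  fix i
  have "(\<Sum>*b. Re (w $ b) *\<^sub>R axis b 1 + Im (w $ b) *\<^sub>R axis b \<i>) $ i
     = (\<Sum>*b. if b = i then Re (w $ b) *\<^sub>R 1 + Im (w $ b) *\<^sub>R \<i> else 0)"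
    unfolding sum_component by (rule sum.cong) (auto simp: axis_def)
  then show "w $ i = (\<Sum>*b. Re (w $ b) *\<^sub>R axis b 1 + Im (w $ b) *\<^sub>R axis b \<i>) $ i"
    by (simp add: complex_eq_iff)
qed

lemma linear_expansion:
  fixes L :: "complex ^ 'm::finite \<Rightarrow> 'b::real_vector"
  assumes "linear L"
  shows "L w = (\<Sum>*b. Re (w $ b) *\<^sub>R L (axis b 1) + Im (w $ b) *\<^sub>R L (axis b \<i>))"
proof -
  have "L w = L (\<Sum>*b. Re (w $ b) *\<^sub>R axis b 1 + Im (w $ b) *\<^sub>R axis b \<i>)"
    by (simp flip: complex_vec_expansion)
  then show ?thesis by (simp add: linear_sum[OF assms] linear_add[OF assms] linear_cmul[OF assms])
qed

text \<open>Splits the real differential into its complex linear and antilinear parts. The chain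
  rules, the Koszul formula and the gradient are reduced to Wirtinger derivatives through
  it.\<close>

lemma frechet_derivative_expansion:
  assumes "F differentiable (at z)"
  shows "frechet_derivative F (at z) w = (\<Sum>*b. w $ b * dz b F z + cnj (w $ b) * dzb b F z)"
proof -
  have "linear (frechet_derivative F (at z))"
    by (rule has_derivative_linear, rule differentiable_imp_has_derivative, rule assms)
  note linear_expansion[OF this, of w]
  also have "(\<Sum>*b. Re (w $ b) *\<^sub>R frechet_derivative F (at z) (axis b 1) + Im (w $ b) *\<^sub>R frechet_derivative F (at z) (axis b \<i>))
     = (\<Sum>*b. w $ b * dz b F z + cnj (w $ b) * dzb b F z)"
    by (rule sum.cong) (auto simp: dz_def dzb_def complex_eq_iff field_simps)
  finally show ?thesis .
qed

lemma dz_const [simp]: "dz a (\<lambda>z. c) z = 0" and dzb_const [simp]: "dzb a (\<lambda>z. c) z = 0"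
  by (simp_all add: dz_def dzb_def frechet_derivative_const)

lemma
  assumes F: "F differentiable (at z)" and G: "G differentiable (at z)"
  shows dz_add: "dz a (\<lambda>z. F z + G z) z = dz a F z + dz a G z"
    and dzb_add: "dzb a (\<lambda>z. F z + G z) z = dzb a F z + dzb a G z"
    and dz_diff: "dz a (\<lambda>z. F z - G z) z = dz a F z - dz a G z"
    and dzb_diff: "dzb a (\<lambda>z. F z - G z) z = dzb a F z - dzb a G z"
    and dz_mult: "dz a (\<lambda>z. F z * G z) z = dz a F z * G z + F z * dz a G z"
    and dzb_mult: "dzb a (\<lambda>z. F z * G z) z = dzb a F z * G z + F z * dzb a G z"
proof -
  note d = differentiable_imp_has_derivative[OF F] differentiable_imp_has_derivative[OF G]
  show "dz a (\<lambda>z. F z + G z) z = dz a F z + dz a G z" "dzb a (\<lambda>z. F z + G z) z = dzb a F z + dzb a G z"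
    unfolding dz_eq[OF has_derivative_add[OF d]] dzb_eq[OF has_derivative_add[OF d]] dz_def[of a F] dz_def[of a G]
      dzb_def[of a F] dzb_def[of a G] by (simp_all add: field_simps)
  show "dz a (\<lambda>z. F z - G z) z = dz a F z - dz a G z" "dzb a (\<lambda>z. F z - G z) z = dzb a F z - dzb a G z"
    unfolding dz_eq[OF has_derivative_diff[OF d]] dzb_eq[OF has_derivative_diff[OF d]] dz_def[of a F] dz_def[of a G]
      dzb_def[of a F] dzb_def[of a G] by (simp_all add: field_simps)
  show "dz a (\<lambda>z. F z * G z) z = dz a F z * G z + F z * dz a G z" "dzb a (\<lambda>z. F z * G z) z = dzb a F z * G z + F z * dzb a G z"
    unfolding dz_eq[OF has_derivative_mult[OF d]] dzb_eq[OF has_derivative_mult[OF d]] dz_def[of a F] dz_def[of a G]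
      dzb_def[of a F] dzb_def[of a G] by (simp_all add: field_simps)
qed

lemma
  assumes F: "F differentiable (at z)"
  shows dz_cnj: "dz a (\<lambda>z. cnj (F z)) z = cnj (dzb a F z)"
    and dzb_cnj: "dzb a (\<lambda>z. cnj (F z)) z = cnj (dz a F z)"
    and dz_uminus: "dz a (\<lambda>z. - F z) z = - dz a F z"
    and dzb_uminus: "dzb a (\<lambda>z. - F z) z = - dzb a F z"
    and dz_cmult: "dz a (\<lambda>z. c * F z) z = c * dz a F z"
    and dzb_cmult: "dzb a (\<lambda>z. c * F z) z = c * dzb a F z"
proof -
  note d = differentiable_imp_has_derivative[OF F]
  show "dz a (\<lambda>z. cnj (F z)) z = cnj (dzb a F z)" "dzb a (\<lambda>z. cnj (F z)) z = cnj (dz a F z)"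
    unfolding dz_eq[OF has_derivative_cnj[OF d]] dzb_eq[OF has_derivative_cnj[OF d]] dz_def[of a F] dzb_def[of a F]
    by (simp_all add: field_simps)
  show "dz a (\<lambda>z. - F z) z = - dz a F z" "dzb a (\<lambda>z. - F z) z = - dzb a F z"
    unfolding dz_eq[OF has_derivative_minus[OF d]] dzb_eq[OF has_derivative_minus[OF d]] dz_def[of a F] dzb_def[of a F]
    by (simp_all add: field_simps)
  show "dz a (\<lambda>z. c * F z) z = c * dz a F z" "dzb a (\<lambda>z. c * F z) z = c * dzb a F z"
    using dz_mult[of "\<lambda>_. c" z F a] dzb_mult[of "\<lambda>_. c" z F a] F by simp_all
qed

lemma
  assumes "\<And>i. i \<in> I \<Longrightarrow> F i differentiable (at z)"
  shows dz_sum: "dz a (\<lambda>z. \<Sum>i\<in>I. F i z) z = (\<Sum>i\<in>I. dz a (F i) z)"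
    and dzb_sum: "dzb a (\<lambda>z. \<Sum>i\<in>I. F i z) z = (\<Sum>i\<in>I. dzb a (F i) z)"
proof -
  have d: "((\<lambda>z. \<Sum>i\<in>I. F i z) has_derivative (\<lambda>v. \<Sum>i\<in>I. frechet_derivative (F i) (at z) v)) (at z)"
    by (rule has_derivative_sum) (simp add: assms differentiable_imp_has_derivative)
  show "dz a (\<lambda>z. \<Sum>i\<in>I. F i z) z = (\<Sum>i\<in>I. dz a (F i) z)"
    "dzb a (\<lambda>z. \<Sum>i\<in>I. F i z) z = (\<Sum>i\<in>I. dzb a (F i) z)"
    unfolding dz_eq[OF d] dzb_eq[OF d] by (simp_all add: dz_def dzb_def sum_distrib_left sum_divide_distrib
        flip: sum_subtractf sum.distrib)
qed

lemma
  assumes "open S" "z \<in> S" "\<And>y. y \<in> S \<Longrightarrow> F y = G y"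
  shows dz_cong_open: "dz a F z = dz a G z" and dzb_cong_open: "dzb a F z = dzb a G z"
  using frechet_derivative_cong_open[OF assms] by (simp_all add: dz_def dzb_def)

lemma
  assumes "open S" "Ck (Suc k) S F"
  shows Ck_dz: "Ck k S (dz a F)" and Ck_dzb: "Ck k S (dzb a F)"
proof -
  have c: "Ck k S (\<lambda>z. frechet_derivative F (at z) v)" for v using assms by simp
  have "Ck k S (\<lambda>z. frechet_derivative F (at z) (axis a 1) * (1/2) - (\<i>/2) * frechet_derivative F (at z) (axis a \<i>))"
    by (intro Ck_diff Ck_mult Ck_const assms(1) c)
  moreover have "Ck k S (\<lambda>z. frechet_derivative F (at z) (axis a 1) * (1/2) + (\<i>/2) * frechet_derivative F (at z) (axis a \<i>))"
    by (intro Ck_add Ck_mult Ck_const assms(1) c)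
  ultimately show "Ck k S (dz a F)" "Ck k S (dzb a F)"
    unfolding dz_def[abs_def] dzb_def[abs_def] by (simp_all add: diff_divide_distrib add_divide_distrib)
qed

lemma
  assumes S: "open S" "z \<in> S" and F: "Ck 2 S F"
  shows dz_dzb_commute: "dz a (dzb b F) z = dzb b (dz a F) z"
    and dz_dz_commute: "dz a (dz b F) z = dz b (dz a F) z"
proof -
  have F2: "Ck (Suc (Suc 0)) S F" using F by (simp add: numeral_2_eq_2)
  define D where "D u v = frechet_derivative (\<lambda>x. frechet_derivative F (at x) u) (at z) v" for u v
  have D: "((\<lambda>x. frechet_derivative F (at x) u) has_derivative D u) (at z)" for u
    unfolding D_def by (rule Ck_has_derivative[of 0 S]) (use F2 S in auto)
  have sym: "D u v = D v u" for u v
    unfolding D_def by (rule symmetric_second_derivative[OF S F])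
  have 1: "(dz b F has_derivative (\<lambda>v. (D (axis b 1) v - \<i> * D (axis b \<i>) v) / 2)) (at z)" for b
    unfolding dz_def[abs_def] by (auto intro!: derivative_eq_intros D)
  have 2: "(dzb b F has_derivative (\<lambda>v. (D (axis b 1) v + \<i> * D (axis b \<i>) v) / 2)) (at z)" for b
    unfolding dzb_def[abs_def] by (auto intro!: derivative_eq_intros D)
  show "dz a (dzb b F) z = dzb b (dz a F) z" "dz a (dz b F) z = dz b (dz a F) z"
    unfolding dz_eq[OF 1] dz_eq[OF 2] dzb_eq[OF 1] dzb_eq[OF 2]
      sym[of "axis a 1" "axis b 1"] sym[of "axis a \<i>" "axis b 1"] sym[of "axis a 1" "axis b \<i>"] sym[of "axis a \<i>" "axis b \<i>"]
    by (simp_all add: field_simps)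
qed

section \<open>Holomorphic maps\<close>

text \<open>Complex differentiability at every point, as in \<open>holomorphic_map_on\<close>;
  continuity of the derivative, let alone smoothness, has to come from Cauchy's formula.\<close>

definition holo :: "(complex ^ 'm::finite) set \<Rightarrow> (complex ^ 'm \<Rightarrow> complex) \<Rightarrow> bool" where
  "holo S f \<longleftrightarrow> (\<forall>z\<in>S. f differentiable (at z) \<and>
     (\<forall>a v. frechet_derivative f (at z) (a *s v) = a * frechet_derivative f (at z) v))"

lemma holo_component:
  fixes f :: "complex ^ 'm::finite \<Rightarrow> complex ^ 'm"
  assumes "holomorphic_map_on S f"
  shows "holo S (\<lambda>z. f z $ i)"
  unfolding holo_def
proof (intro ballI)
  fix z assume "z \<in> S"
  then obtain D where D: "(f has_derivative D) (at z)" "\<And>a v. D (a *s v) = a *s D v"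
    using assms unfolding holomorphic_map_on_def by blast
  have d: "((\<lambda>z. f z $ i) has_derivative (\<lambda>v. D v $ i)) (at z)"
    by (rule bounded_linear.has_derivative[OF bounded_linear_vec_nth D(1)])
  show "(\<lambda>z. f z $ i) differentiable at z \<and>
         (\<forall>a v. frechet_derivative (\<lambda>z. f z $ i) (at z) (a *s v) = a * frechet_derivative (\<lambda>z. f z $ i) (at z) v)"
    unfolding frechet_derivative_eq[OF d] using d D(2) by (auto simp: differentiable_def)
qed

lemma norm_smult: "norm (c *s (v :: complex ^ 'm::finite)) = cmod c * norm v"
  by (simp add: norm_vec_def L2_set_def norm_mult power_mult_distrib real_sqrt_mult flip: sum_distrib_left)

lemma bounded_bilinear_smult: "bounded_bilinear (\<lambda>c (v :: complex ^ 'm::finite). c *s v)"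
  unfolding bilinear_conv_bounded_bilinear[symmetric] bilinear_def
  by (auto intro!: linearI simp: vec_eq_iff algebra_simps)

lemma has_derivative_line:
  "((\<lambda>\<zeta>. z + \<zeta> *s (v :: complex ^ 'm::finite)) has_derivative (\<lambda>h. h *s v)) (at x within T)"
proof -
  have "bounded_linear (\<lambda>h. h *s v)"
    by (rule bounded_bilinear.bounded_linear_left[OF bounded_bilinear_smult])
  then show ?thesis by (auto intro!: derivative_eq_intros bounded_linear_imp_has_derivative)
qed

text \<open>Cauchy's formula for the derivative along the complex line z + \<zeta> v, on a circle of
  fixed radius around the moving point z. Curve and kernel do not depend on z, so z is a mere
  parameter of an integral over [0,1].\<close>

lemma holo_cauchy:
  fixes f :: "complex ^ 'm::finite \<Rightarrow> complex" and v :: "complex ^ 'm"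
  assumes "open S" "holo S f" and z0: "z0 \<in> S"
  obtains \<rho> \<gamma> k where "\<rho> > 0" "continuous_on UNIV \<gamma>" "continuous_on UNIV k"
    "\<And>z t. z \<in> ball z0 \<rho> \<Longrightarrow> z + \<gamma> (t::real) *s v \<in> S"
    "\<And>z. z \<in> ball z0 \<rho> \<Longrightarrow> frechet_derivative f (at z) v = integral (cbox 0 1) (\<lambda>t. f (z + \<gamma> t *s v) * k t)"
proof -
  obtain R where R: "R > 0" "ball z0 R \<subseteq> S" using assms openE by blast
  \<comment> \<open>z stays within \<rho> of \<open>z0\<close> and the circle adds at most \<rho>,
    which remains inside the ball of radius R. The summand 1 in the next denominator admits v =
    0.\<close>
  define \<rho> where "\<rho> = R / 3"
  define r where "r = \<rho> / (norm v + 1)"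
  have nv: "norm v + 1 > 0" by (simp add: add_nonneg_pos)
  have \<rho>: "\<rho> > 0" using R by (simp add: \<rho>_def)
  have r: "r > 0" using \<rho> nv by (simp add: r_def)
  have rv: "r * norm v \<le> \<rho>"
  proof -
    have "r * norm v \<le> r * (norm v + 1)" using r by simp
    also have "\<dots> = \<rho>" using nv by (simp add: r_def)
    finally show ?thesis .
  qed
  define \<gamma> where "\<gamma> = (\<lambda>t::real. of_real r * exp (2 * of_real pi * \<i> * of_real t))"
  define k where "k = (\<lambda>t. inverse (\<gamma> t))"
  have \<gamma>0: "\<gamma> t \<noteq> 0" for t using r by (simp add: \<gamma>_def)
  have cmod_\<gamma>: "cmod (\<gamma> t) = r" for t using r by (simp add: \<gamma>_def norm_mult)
  have inS: "z + \<zeta> *s v \<in> S" if "z \<in> ball z0 \<rho>" "cmod \<zeta> \<le> r" for z \<zeta>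
  proof -
    have "norm (\<zeta> *s v) \<le> \<rho>" using that(2) rv mult_right_mono[of "cmod \<zeta>" r "norm v"] by (simp add: norm_smult)
    moreover have "dist z0 (z + \<zeta> *s v) \<le> dist z0 z + norm (\<zeta> *s v)"
      using norm_triangle_ineq4[of "z0 - z" "\<zeta> *s v"] by (simp add: dist_norm algebra_simps)
    ultimately have "dist z0 (z + \<zeta> *s v) < R" using that(1) \<rho> by (simp add: \<rho>_def)
    then show ?thesis using R by auto
  qed
  show thesis
  proof (rule that[OF \<rho>, of \<gamma> k])
    show "continuous_on UNIV \<gamma>" unfolding \<gamma>_def by (intro continuous_intros)
    then show "continuous_on UNIV k" unfolding k_def using \<gamma>0 by (intro continuous_on_inverse) auto
    show "z + \<gamma> t *s v \<in> S" if "z \<in> ball z0 \<rho>" for z t using inS[OF that] cmod_\<gamma> by simp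
  next
    fix z assume z: "z \<in> ball z0 \<rho>"
    define g where "g = (\<lambda>\<zeta>. f (z + \<zeta> *s v))"
    have fd: "(f has_derivative frechet_derivative f (at x)) (at x)" "frechet_derivative f (at x) (a *s w) = a * frechet_derivative f (at x) w"
      if "x \<in> S" for x a w using that assms(2) unfolding holo_def by (auto intro: differentiable_imp_has_derivative)
    have gd: "(g has_field_derivative frechet_derivative f (at (z + \<zeta> *s v)) v) (at \<zeta>)" if "cmod \<zeta> \<le> r" for \<zeta>
    proof -
      have "(g has_derivative (\<lambda>h. frechet_derivative f (at (z + \<zeta> *s v)) (h *s v))) (at \<zeta>)"
        unfolding g_def by (rule has_derivative_compose[OF has_derivative_line fd(1)]) (rule inS[OF z that])
      then show ?thesis unfolding has_field_derivative_def fd(2)[OF inS[OF z that]] by (simp add: mult_commute_abs)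
    qed
    have hol: "g holomorphic_on cball 0 r"
      unfolding holomorphic_on_def field_differentiable_def using gd has_field_derivative_at_within
      by (metis mem_cball_0)
    have "(g has_field_derivative (1 / (2 * of_real pi * \<i>) * contour_integral (circlepath 0 r) (\<lambda>u. g u / (u - 0)\<^sup>2))) (at 0)"
      by (rule Cauchy_derivative_integral_circlepath(2))
        (use hol r in \<open>auto intro: holomorphic_on_imp_continuous_on holomorphic_on_subset\<close>)
    moreover have "(g has_field_derivative frechet_derivative f (at z) v) (at 0)" using gd[of 0] r by simp
    ultimately have "frechet_derivative f (at z) v = 1 / (2 * of_real pi * \<i>) * contour_integral (circlepath 0 r) (\<lambda>u. g u / (u - 0)\<^sup>2)"
      using DERIV_unique by blast
    also have "\<dots> = integral {0..1} (\<lambda>t. 1 / (2 * of_real pi * \<i>) * (g (circlepath 0 r t) / (circlepath 0 r t - 0)\<^sup>2 * vector_derivative (circlepath 0 r) (at t)))"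
      unfolding contour_integral_integral by (subst integral_mult_right) simp
    also have "\<dots> = integral (cbox 0 1) (\<lambda>t. f (z + \<gamma> t *s v) * k t)"
      unfolding cbox_interval
    proof (rule integral_cong)
      fix t :: real
      have cp: "circlepath 0 r t = \<gamma> t" by (simp add: circlepath \<gamma>_def)
      have vd: "vector_derivative (circlepath 0 r) (at t) = 2 * of_real pi * \<i> * \<gamma> t"
        by (simp add: vector_derivative_circlepath \<gamma>_def)
      have "1 / (2 * of_real pi * \<i>) * (F / (e - 0)\<^sup>2 * (2 * of_real pi * \<i> * e)) = F * inverse e" if "e \<noteq> 0" for F e :: complex
        using that by (simp add: field_simps power2_eq_square)
      from this[OF \<gamma>0[of t]]
      show "1 / (2 * complex_of_real pi * \<i>) * (g (circlepath 0 r t) / (circlepath 0 r t - 0)\<^sup>2 *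
          vector_derivative (circlepath 0 r) (at t)) = f (z + \<gamma> t *s v) * k t"
        unfolding cp vd g_def k_def .
    qed
    finally show "frechet_derivative f (at z) v = integral (cbox 0 1) (\<lambda>t. f (z + \<gamma> t *s v) * k t)" .
  qed
qed

text \<open>The derivative is an integral of values of f, so it is first continuous and then, by
  differentiation under the integral sign, complex differentiable itself.\<close>

lemma holo_frechet_derivative:
  fixes f :: "complex ^ 'm::finite \<Rightarrow> complex" and v :: "complex ^ 'm"
  assumes S: "open S" and f: "holo S f"
  shows "holo S (\<lambda>z. frechet_derivative f (at z) v)"
proof -
  have fd: "(f has_derivative frechet_derivative f (at x)) (at x)" "frechet_derivative f (at x) (a *s w) = a * frechet_derivative f (at x) w"
    if "x \<in> S" for x a w using that f unfolding holo_def by (auto intro: differentiable_imp_has_derivative)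
  have contf: "continuous_on S f"
    using fd(1) by (auto simp: continuous_on_eq_continuous_at[OF S] intro: has_derivative_continuous)
  have line_cont: "continuous_on (ball z0 \<rho> \<times> cbox 0 1) (\<lambda>(z, t). z + \<gamma> t *s v)"
    if "continuous_on UNIV \<gamma>" for z0 v :: "complex ^ 'm" and \<rho> and \<gamma> :: "real \<Rightarrow> complex"
    unfolding split_beta
    by (intro continuous_on_add bounded_bilinear.continuous_on[OF bounded_bilinear_smult] continuous_intros
        continuous_on_compose2[OF that]) auto
  have contD: "continuous_on S (\<lambda>z. frechet_derivative f (at z) v)" for v
    unfolding continuous_on_eq_continuous_at[OF S]
  proof
    fix z0 assume z0: "z0 \<in> S"
    obtain \<rho> \<gamma> k where \<rho>: "\<rho> > 0" and \<gamma>: "continuous_on UNIV \<gamma>" and k: "continuous_on UNIV k"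
      and inS: "\<And>z t. z \<in> ball z0 \<rho> \<Longrightarrow> z + \<gamma> (t::real) *s v \<in> S"
      and int: "\<And>z. z \<in> ball z0 \<rho> \<Longrightarrow> frechet_derivative f (at z) v = integral (cbox 0 1) (\<lambda>t. f (z + \<gamma> t *s v) * k t)"
      using holo_cauchy[OF S f z0, of v] by blast
    have "continuous_on (ball z0 \<rho>) (\<lambda>z. integral (cbox 0 1) (\<lambda>t. f (z + \<gamma> t *s v) * k t))"
      apply (rule integral_continuous_on_param)
      using inS line_cont[OF \<gamma>, of z0 \<rho> v] unfolding split_beta
      by (auto intro!: continuous_intros continuous_on_compose2[OF contf] continuous_on_compose2[OF k])
    then have "continuous_on (ball z0 \<rho>) (\<lambda>z. frechet_derivative f (at z) v)"
      by (subst continuous_on_cong[OF refl int]) auto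
    then show "isCont (\<lambda>z. frechet_derivative f (at z) v) z0"
      using \<rho> by (simp add: continuous_on_eq_continuous_at)
  qed
  show ?thesis
    unfolding holo_def
  proof
    fix z0 assume z0: "z0 \<in> S"
    obtain \<rho> \<gamma> k where \<rho>: "\<rho> > 0" and \<gamma>: "continuous_on UNIV \<gamma>" and k: "continuous_on UNIV k"
      and inS: "\<And>z t. z \<in> ball z0 \<rho> \<Longrightarrow> z + \<gamma> (t::real) *s v \<in> S"
      and int: "\<And>z. z \<in> ball z0 \<rho> \<Longrightarrow> frechet_derivative f (at z) v = integral (cbox 0 1) (\<lambda>t. f (z + \<gamma> t *s v) * k t)"
      using holo_cauchy[OF S f z0, of v] by blast
    \<comment> \<open>The Leibniz rule wants the derivative as a bounded linear function, jointly
      continuous in z and t. Joint continuity rests on \<open>contD\<close>, obtained beforehand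
      from the same integral.\<close>
    define fx where "fx z t = Blinfun (\<lambda>w. frechet_derivative f (at (z + \<gamma> t *s v)) w * k t)" for z t
    have bl: "bounded_linear (\<lambda>w. frechet_derivative f (at (z + \<gamma> t *s v)) w * k t)" if "z \<in> ball z0 \<rho>" for z t
      by (rule bounded_linear_mult_const) (rule has_derivative_bounded_linear[OF fd(1)[OF inS[OF that]]])
    have fx: "blinfun_apply (fx z t) w = frechet_derivative f (at (z + \<gamma> t *s v)) w * k t" if "z \<in> ball z0 \<rho>" for z t w
      unfolding fx_def by (simp add: bounded_linear_Blinfun_apply[OF bl[OF that]])
    have cfx: "continuous_on (ball z0 \<rho> \<times> cbox 0 1) (\<lambda>(z, t). fx z t)"
    proof (rule continuous_on_blinfun_componentwise)
      fix w :: "complex ^ 'm"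
      have "continuous_on (ball z0 \<rho> \<times> cbox 0 1) (\<lambda>p. frechet_derivative f (at (fst p + \<gamma> (snd p) *s v)) w * k (snd p))"
        using inS line_cont[OF \<gamma>, of z0 \<rho> v] unfolding split_beta
        by (auto intro!: continuous_intros continuous_on_compose2[OF contD] continuous_on_compose2[OF k])
      then show "continuous_on (ball z0 \<rho> \<times> cbox 0 1) (\<lambda>p. blinfun_apply (case p of (z, t) \<Rightarrow> fx z t) w)"
        by (rule continuous_on_eq) (auto simp: fx)
    qed
    have cfz: "continuous_on (cbox 0 1) (fx z)" if "z \<in> ball z0 \<rho>" for z
    proof -
      have "continuous_on (cbox 0 1) (\<lambda>t. (\<lambda>(z, t). fx z t) (z, t))"
        by (rule continuous_on_compose2[OF cfx]) (use that in \<open>auto intro!: continuous_intros\<close>)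
      then show ?thesis by simp
    qed
    have "((\<lambda>z. integral (cbox 0 1) (\<lambda>t. f (z + \<gamma> t *s v) * k t)) has_derivative integral (cbox 0 1) (fx z0)) (at z0 within ball z0 \<rho>)"
    proof (rule leibniz_rule[OF _ _ cfx])
      fix z t assume z: "z \<in> ball z0 \<rho>"
      have "((\<lambda>z. f (z + \<gamma> t *s v) * k t) has_derivative (\<lambda>w. frechet_derivative f (at (z + \<gamma> t *s v)) w * k t)) (at z within ball z0 \<rho>)"
        by (rule has_derivative_mult_left, rule has_derivative_compose[where f="\<lambda>z. z + \<gamma> t *s v" and g=f])
          (auto intro!: derivative_eq_intros fd(1) inS[OF z])
      then show "((\<lambda>z. f (z + \<gamma> t *s v) * k t) has_derivative blinfun_apply (fx z t)) (at z within ball z0 \<rho>)"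
        using ext[of "blinfun_apply (fx z t)", OF fx[OF z]] by simp
    next
      fix z assume z: "z \<in> ball z0 \<rho>"
      show "(\<lambda>t. f (z + \<gamma> t *s v) * k t) integrable_on cbox 0 1"
      proof (rule integrable_continuous)
        have "continuous_on (cbox 0 1) (\<lambda>t. z + \<gamma> t *s v)"
          by (intro continuous_on_add bounded_bilinear.continuous_on[OF bounded_bilinear_smult] continuous_intros
              continuous_on_compose2[OF \<gamma>]) auto
        then show "continuous_on (cbox 0 1) (\<lambda>t. f (z + \<gamma> t *s v) * k t)"
          using inS[OF z] by (auto intro!: continuous_intros continuous_on_compose2[OF contf] continuous_on_compose2[OF k])
      qed
    qed (use \<rho> in auto)
    then have "((\<lambda>z. integral (cbox 0 1) (\<lambda>t. f (z + \<gamma> t *s v) * k t)) has_derivative integral (cbox 0 1) (fx z0)) (at z0)"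
      using at_within_open[of z0 "ball z0 \<rho>"] \<rho> by simp
    then have D: "((\<lambda>z. frechet_derivative f (at z) v) has_derivative integral (cbox 0 1) (fx z0)) (at z0)"
      by (rule has_derivative_transform_within_open[of _ _ _ _ "ball z0 \<rho>"]) (use \<rho> int in auto)
    \<comment> \<open>Complex linearity passes under the integral, so the derivative is holomorphic
      again and the argument can be iterated.\<close>
    have "blinfun_apply (integral (cbox 0 1) (fx z0)) (a *s w) = a * blinfun_apply (integral (cbox 0 1) (fx z0)) w" for a w
    proof -
      have "fx z0 integrable_on cbox 0 1" using cfz \<rho> by (intro integrable_continuous) auto
      then have "blinfun_apply (integral (cbox 0 1) (fx z0)) w = integral (cbox 0 1) (\<lambda>t. frechet_derivative f (at (z0 + \<gamma> t *s v)) w * k t)" for w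
        using \<rho> fx[of z0] by (simp add: blinfun_apply_integral)
      then show ?thesis using fd(2)[OF inS[of z0]] \<rho> by (simp add: mult.assoc)
    qed
    then show "(\<lambda>z. frechet_derivative f (at z) v) differentiable at z0 \<and>
         (\<forall>a w. frechet_derivative (\<lambda>z. frechet_derivative f (at z) v) (at z0) (a *s w)
            = a * frechet_derivative (\<lambda>z. frechet_derivative f (at z) v) (at z0) w)"
      unfolding frechet_derivative_eq[OF D] using D by (auto simp: differentiable_def)
  qed
qed

lemma holo_Ck: "open S \<Longrightarrow> holo S f \<Longrightarrow> Ck k S f"
proof (induction k arbitrary: f)
  case 0
  have "isCont f z" if "z \<in> S" for z
    using 0 that unfolding holo_def by (blast intro: differentiable_imp_continuous_within)
  then show ?case using 0(1) by (simp add: continuous_on_eq_continuous_at)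
next
  case (Suc k)
  have "\<forall>z\<in>S. f differentiable at z" using Suc.prems(2) by (simp add: holo_def)
  moreover have "Ck k S (\<lambda>z. frechet_derivative f (at z) v)" for v
    by (rule Suc.IH[OF Suc.prems(1) holo_frechet_derivative[OF Suc.prems]])
  ultimately show ?case by simp
qed

lemma Ck_vec:
  fixes f :: "'v::euclidean_space \<Rightarrow> complex ^ 'm::finite"
  assumes "open S" "\<And>i. Ck k S (\<lambda>z. f z $ i)"
  shows "Ck k S f"
proof -
  have bl: "bounded_linear (\<lambda>c::complex. axis i c :: complex ^ 'm)" for i
    by (intro linear_conv_bounded_linear[THEN iffD1] linearI) (auto simp: vec_eq_iff axis_def)
  have "f z = (\<Sum>*i. axis i (f z $ i))" for z
    by (auto simp: vec_eq_iff axis_def sum_component if_distrib cong: if_cong)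
  moreover have "Ck k S (\<lambda>z. \<Sum>*i. axis i (f z $ i))"
    by (intro Ck_sum Ck_bounded_linear[OF bl] assms)
  ultimately show ?thesis by simp
qed

lemma holomorphic_map_Ck: "open S \<Longrightarrow> holomorphic_map_on S f \<Longrightarrow> Ck k S f"
  by (intro Ck_vec holo_Ck holo_component)

lemma holo_dzb: assumes "holo S f" "z \<in> S" shows "dzb a f z = 0"
proof -
  have "axis a \<i> = \<i> *s axis a (1::complex)" by (auto simp: vec_eq_iff axis_def)
  then have "frechet_derivative f (at z) (axis a \<i>) = \<i> * frechet_derivative f (at z) (axis a 1)"
    using assms unfolding holo_def by metis
  then show ?thesis by (simp add: dzb_def)
qed

lemma holo_dz: assumes "open S" "holo S f" shows "holo S (dz a f)"
proof -
  have eq: "dz a f z = frechet_derivative f (at z) (axis a 1)" if "z \<in> S" for z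
  proof -
    have "axis a \<i> = \<i> *s axis a (1::complex)" by (auto simp: vec_eq_iff axis_def)
    then have "frechet_derivative f (at z) (axis a \<i>) = \<i> * frechet_derivative f (at z) (axis a 1)"
      using assms that unfolding holo_def by metis
    then show ?thesis by (simp add: dz_def)
  qed
  have h: "holo S (\<lambda>z. frechet_derivative f (at z) (axis a 1))" by (rule holo_frechet_derivative[OF assms])
  show ?thesis unfolding holo_def
  proof
    fix z assume z: "z \<in> S"
    have "frechet_derivative (dz a f) (at z) = frechet_derivative (\<lambda>z. frechet_derivative f (at z) (axis a 1)) (at z)"
      by (rule frechet_derivative_cong_open[OF assms(1) z eq])
    moreover have "dz a f differentiable (at z)"
      using h z by (intro differentiable_cong_open[OF assms(1) z eq[symmetric]]) (auto simp: holo_def)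
    ultimately show "dz a f differentiable at z \<and>
      (\<forall>c v. frechet_derivative (dz a f) (at z) (c *s v) = c * frechet_derivative (dz a f) (at z) v)"
      using h z unfolding holo_def by simp
  qed
qed

text \<open>The derivative of \<tau> is complex linear, so types are not mixed: unbarred derivatives
  meet the Jacobian, barred ones its conjugate.\<close>

lemma
  fixes \<tau> :: "complex ^ 'm::finite \<Rightarrow> complex ^ 'm"
  assumes \<tau>: "holomorphic_map_on S \<tau>" and z: "z \<in> S" and F: "F differentiable (at (\<tau> z))"
  shows dz_compose: "dz a (\<lambda>z. F (\<tau> z)) z = (\<Sum>*b. dz a (\<lambda>z. \<tau> z $ b) z * dz b F (\<tau> z))"
    and dzb_compose: "dzb a (\<lambda>z. F (\<tau> z)) z = (\<Sum>*b. cnj (dz a (\<lambda>z. \<tau> z $ b) z) * dzb b F (\<tau> z))"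
proof -
  obtain D where D: "(\<tau> has_derivative D) (at z)" "\<And>a v. D (a *s v) = a *s D v"
    using \<tau> z unfolding holomorphic_map_on_def by blast
  have d: "((\<lambda>z. \<tau> z $ i) has_derivative (\<lambda>v. D v $ i)) (at z)" for i
    by (rule bounded_linear.has_derivative[OF bounded_linear_vec_nth D(1)])
  have "axis a \<i> = \<i> *s axis a (1::complex)" by (auto simp: vec_eq_iff axis_def)
  then have Di: "D (axis a \<i>) = \<i> *s D (axis a 1)" using D(2) by metis
  have comp: "((\<lambda>z. F (\<tau> z)) has_derivative (\<lambda>v. frechet_derivative F (at (\<tau> z)) (D v))) (at z)"
    using diff_chain_at[OF D(1) differentiable_imp_has_derivative[OF F]] by (simp add: o_def)
  have t: "dz a (\<lambda>z. \<tau> z $ b) z = D (axis a 1) $ b" for b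
    unfolding dz_eq[OF d] by (simp add: Di)
  show "dz a (\<lambda>z. F (\<tau> z)) z = (\<Sum>*b. dz a (\<lambda>z. \<tau> z $ b) z * dz b F (\<tau> z))"
    unfolding dz_eq[OF comp] frechet_derivative_expansion[OF F] t Di
    by (simp only: sum_distrib_left sum_divide_distrib sum_subtractf[symmetric], rule sum.cong)
      (simp_all add: field_simps)
  show "dzb a (\<lambda>z. F (\<tau> z)) z = (\<Sum>*b. cnj (dz a (\<lambda>z. \<tau> z $ b) z) * dzb b F (\<tau> z))"
    unfolding dzb_eq[OF comp] frechet_derivative_expansion[OF F] t Di
    by (simp only: sum_distrib_left sum_divide_distrib sum.distrib[symmetric], rule sum.cong)
      (simp_all add: field_simps)
qed

section \<open>Matrix calculus\<close>

type_synonym 'm cmat = "complex ^ 'm ^ 'm"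

definition hadj :: "complex ^ 'n ^ 'm \<Rightarrow> complex ^ 'm ^ 'n" where
  "hadj A = (\<chi> i j. cnj (A $ j $ i))"

definition smat :: "complex \<Rightarrow> complex ^ 'n ^ 'm \<Rightarrow> complex ^ 'n ^ 'm" where
  "smat c A = (\<chi> i j. c * A $ i $ j)"

lemma hadj_nth [simp]: "hadj A $ i $ j = cnj (A $ j $ i)"
  by (simp add: hadj_def)

lemma smat_nth [simp]: "smat c A $ i $ j = c * A $ i $ j"
  by (simp add: smat_def)

lemma matrix_mult_nth: "(A ** B) $ i $ j = (\<Sum>*k. A $ i $ k * B $ k $ j)"
  by (simp add: matrix_matrix_mult_def)

lemma mat_1_nth: "mat 1 $ i $ j = (if i = j then 1 else 0)"
  by (simp add: mat_def)

lemma matrix_eqI: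
  fixes A B :: "'a ^ 'n ^ 'm"
  shows "(\<And>i j. A $ i $ j = B $ i $ j) \<Longrightarrow> A = B"
  by (simp add: vec_eq_iff)

lemma hadj_mult: "hadj (A ** B) = hadj B ** hadj A"
  by (rule matrix_eqI) (simp add: matrix_mult_nth mult.commute)

lemma hadj_hadj [simp]: "hadj (hadj A) = A"
  by (rule matrix_eqI) simp

lemma hadj_mat_1 [simp]: "hadj (mat 1) = mat 1"
  by (rule matrix_eqI) (simp add: mat_1_nth)

lemma bounded_bilinear_matrix_mult:
  "bounded_bilinear ((**) :: 'm::finite cmat \<Rightarrow> 'm cmat \<Rightarrow> 'm cmat)"
  unfolding bilinear_conv_bounded_bilinear[symmetric] bilinear_def
  by (auto intro!: linearI matrix_eqI simp: matrix_mult_nth distrib_left distrib_right sum.distrib scaleR_sum_right)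

interpretation mm: bounded_bilinear "(**) :: 'm::finite cmat \<Rightarrow> 'm cmat \<Rightarrow> 'm cmat"
  by (rule bounded_bilinear_matrix_mult)

lemma smat_mult_left: "smat c A ** B = smat c (A ** B)"
  and smat_mult_right: "A ** smat c B = smat c (A ** B)"
  by (auto intro!: matrix_eqI simp: matrix_mult_nth sum_distrib_left ac_simps)

lemma trace_smat: "trace (smat c A) = c * trace A"
  by (simp add: trace_def sum_distrib_left)

lemma trace_sum: "trace (\<Sum>i\<in>I. A i) = (\<Sum>i\<in>I. trace (A i :: 'a::comm_semiring_1 ^ 'n ^ 'n))"
  unfolding trace_def by (simp add: sum_component) (rule sum.swap)

lemma trace_minus: "trace (- A) = - trace (A :: 'a::comm_ring_1 ^ 'n ^ 'n)"
  by (simp add: trace_def sum_negf)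

lemma matrix_inv_mult:
  fixes A :: "'m::finite cmat"
  assumes "invertible A"
  shows "A ** matrix_inv A = mat 1" "matrix_inv A ** A = mat 1"
  using someI_ex[OF assms[unfolded invertible_def]] unfolding matrix_inv_def by blast+

lemma matrix_inv_eqI:
  fixes A :: "'m::finite cmat"
  assumes "A ** B = mat 1"
  shows "matrix_inv A = B" "invertible A"
proof -
  show inv: "invertible A" using assms matrix_left_right_inverse unfolding invertible_def by blast
  have "matrix_inv A = matrix_inv A ** (A ** B)" using assms by simp
  also have "\<dots> = B" using matrix_inv_mult[OF inv] by (simp add: matrix_mul_assoc)
  finally show "matrix_inv A = B" .
qed

section \<open>Entrywise Wirtinger calculus for matrix-valued functions\<close>

definition mCk :: "nat \<Rightarrow> (complex ^ 'm::finite) set \<Rightarrow> (complex ^ 'm \<Rightarrow> 'm cmat) \<Rightarrow> bool" where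
  "mCk k S F \<longleftrightarrow> (\<forall>i j. Ck k S (\<lambda>z. F z $ i $ j))"

definition mdiff :: "(complex ^ 'm::finite \<Rightarrow> 'm cmat) \<Rightarrow> complex ^ 'm \<Rightarrow> bool" where
  "mdiff F z \<longleftrightarrow> (\<forall>i j. (\<lambda>z. F z $ i $ j) differentiable (at z))"

definition mdz :: "'m::finite \<Rightarrow> (complex ^ 'm \<Rightarrow> 'm cmat) \<Rightarrow> complex ^ 'm \<Rightarrow> 'm cmat" where
  "mdz a F z = (\<chi> i j. dz a (\<lambda>z. F z $ i $ j) z)"

definition mdzb :: "'m::finite \<Rightarrow> (complex ^ 'm \<Rightarrow> 'm cmat) \<Rightarrow> complex ^ 'm \<Rightarrow> 'm cmat" where
  "mdzb a F z = (\<chi> i j. dzb a (\<lambda>z. F z $ i $ j) z)"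

lemma mdz_nth [simp]: "mdz a F z $ i $ j = dz a (\<lambda>z. F z $ i $ j) z"
  and mdzb_nth [simp]: "mdzb a F z $ i $ j = dzb a (\<lambda>z. F z $ i $ j) z"
  by (simp_all add: mdz_def mdzb_def)

lemma mCk_mdiff: "mCk (Suc k) S F \<Longrightarrow> z \<in> S \<Longrightarrow> mdiff F z"
  unfolding mCk_def mdiff_def by (blast intro: Ck_differentiable)

lemma mCk_mdz: "open S \<Longrightarrow> mCk (Suc k) S F \<Longrightarrow> mCk k S (mdz a F)"
  and mCk_mdzb: "open S \<Longrightarrow> mCk (Suc k) S F \<Longrightarrow> mCk k S (mdzb a F)"
  unfolding mCk_def by (simp_all add: Ck_dz Ck_dzb del: Ck.simps)

lemma mCk_mult: "open S \<Longrightarrow> mCk k S F \<Longrightarrow> mCk k S G \<Longrightarrow> mCk k S (\<lambda>z. F z ** G z)"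
  unfolding mCk_def by (simp add: matrix_mult_nth Ck_sum Ck_mult)

lemma mCk_uminus: "open S \<Longrightarrow> mCk k S F \<Longrightarrow> mCk k S (\<lambda>z. - F z)"
  unfolding mCk_def by (simp add: Ck_minus)

lemma mCk_add: "open S \<Longrightarrow> mCk k S F \<Longrightarrow> mCk k S G \<Longrightarrow> mCk k S (\<lambda>z. F z + G z)"
  unfolding mCk_def by (simp add: Ck_add)

lemma mCk_hadj: "open S \<Longrightarrow> mCk k S F \<Longrightarrow> mCk k S (\<lambda>z. hadj (F z))"
  unfolding mCk_def by (simp add: Ck_cnj)

lemma Ck_trace: "open S \<Longrightarrow> mCk k S F \<Longrightarrow> Ck k S (\<lambda>z. trace (F z))"
  unfolding mCk_def trace_def by (simp add: Ck_sum)

lemma Ck_prod: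
  fixes f :: "'i \<Rightarrow> 'v::euclidean_space \<Rightarrow> 'b::{real_normed_algebra,comm_monoid_mult}"
  shows "open S \<Longrightarrow> (\<And>i. i \<in> I \<Longrightarrow> Ck k S (f i)) \<Longrightarrow> Ck k S (\<lambda>z. \<Prod>i\<in>I. f i z)"
  by (induction I rule: infinite_finite_induct) (auto simp: Ck_const intro: Ck_mult)

lemma Ck_det:
  fixes F :: "'v::euclidean_space \<Rightarrow> 'b::{real_normed_algebra,comm_ring_1} ^ 'n ^ 'n"
  assumes "open S" "\<And>i j. Ck k S (\<lambda>z. F z $ i $ j)"
  shows "Ck k S (\<lambda>z. det (F z))"
  unfolding det_def by (intro Ck_sum Ck_mult Ck_prod Ck_const assms)

text \<open>Cramer's rule for the columns of the inverse. The entries of the inverse become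
  quotients of polynomials in the entries, whence the smoothness of the inverse metric.\<close>

lemma matrix_inv_nth:
  fixes A :: "'m::finite cmat"
  assumes "invertible A"
  shows "matrix_inv A $ i $ k = det (\<chi> p j. if j = i then axis k 1 $ p else A $ p $ j) / det A"
proof -
  have d: "det A \<noteq> 0" using assms by (simp add: invertible_det_nz)
  have "A *v column k (matrix_inv A) = axis k 1"
    using matrix_inv_mult(1)[OF assms]
    by (auto simp: vec_eq_iff matrix_vector_mult_def column_def axis_def matrix_matrix_mult_def mat_def)
  then have "column k (matrix_inv A) = (\<chi> i. det (\<chi> p j. if j = i then axis k 1 $ p else A $ p $ j) / det A)"
    using cramer[OF d, of "column k (matrix_inv A)"] by simp
  then show ?thesis by (simp add: vec_eq_iff column_def)
qed

lemma mCk_matrix_inv: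
  assumes "open S" "mCk k S F" "\<And>z. z \<in> S \<Longrightarrow> invertible (F z)"
  shows "mCk k S (\<lambda>z. matrix_inv (F z))"
  unfolding mCk_def
proof (intro allI)
  fix i j
  have c: "Ck k S (\<lambda>z. F z $ p $ q)" for p q using assms(2) by (simp add: mCk_def)
  have "Ck k S (\<lambda>z. det (\<chi> p q. if q = i then axis j 1 $ p else F z $ p $ q) * inverse (det (F z)))"
  proof (intro Ck_mult Ck_inverse Ck_det assms(1) c)
    fix p q show "Ck k S (\<lambda>z. (\<chi> p q. if q = i then axis j 1 $ p else F z $ p $ q) $ p $ q)"
      using c[of p q] by (cases "q = i") (simp_all add: Ck_const)
  next
    fix z assume "z \<in> S" then show "det (F z) \<noteq> 0" using assms(3) by (simp add: invertible_det_nz)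
  qed
  then show "Ck k S (\<lambda>z. matrix_inv (F z) $ i $ j)"
    by (rule iffD1[OF Ck_cong[OF assms(1)], rotated]) (simp add: matrix_inv_nth assms(3) divide_inverse)
qed

lemma mdiff_mult: "mdiff F z \<Longrightarrow> mdiff G z \<Longrightarrow> mdiff (\<lambda>z. F z ** G z) z"
  unfolding mdiff_def by (auto simp: matrix_mult_nth intro!: differentiable_sum differentiable_mult)

lemma mdiff_hadj:
  assumes "mdiff F z"
  shows "mdiff (\<lambda>z. hadj (F z)) z"
  unfolding mdiff_def hadj_nth
proof (intro allI)
  fix i j
  have "(\<lambda>z. F z $ j $ i) differentiable (at z)" using assms by (simp add: mdiff_def)
  from has_derivative_cnj[OF differentiable_imp_has_derivative[OF this]]
  show "(\<lambda>z. cnj (F z $ j $ i)) differentiable (at z)" by (auto simp: differentiable_def)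
qed

lemma
  assumes F: "mdiff F z" and G: "mdiff G z"
  shows mdz_mult: "mdz a (\<lambda>z. F z ** G z) z = mdz a F z ** G z + F z ** mdz a G z"
    and mdzb_mult: "mdzb a (\<lambda>z. F z ** G z) z = mdzb a F z ** G z + F z ** mdzb a G z"
    and mdz_add: "mdz a (\<lambda>z. F z + G z) z = mdz a F z + mdz a G z"
proof -
  have f: "(\<lambda>z. F z $ i $ j) differentiable (at z)" "(\<lambda>z. G z $ i $ j) differentiable (at z)" for i j
    using F G by (auto simp: mdiff_def)
  have fg: "(\<lambda>z. F z $ i $ k * G z $ k $ j) differentiable (at z)" for i j k
    by (intro differentiable_mult f)
  show "mdz a (\<lambda>z. F z ** G z) z = mdz a F z ** G z + F z ** mdz a G z"
    by (rule matrix_eqI) (simp add: matrix_mult_nth dz_sum fg dz_mult f sum.distrib)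
  show "mdzb a (\<lambda>z. F z ** G z) z = mdzb a F z ** G z + F z ** mdzb a G z"
    by (rule matrix_eqI) (simp add: matrix_mult_nth dzb_sum fg dzb_mult f sum.distrib)
  show "mdz a (\<lambda>z. F z + G z) z = mdz a F z + mdz a G z"
    by (auto intro!: matrix_eqI simp: dz_add f)
qed

lemma
  assumes F: "mdiff F z"
  shows mdz_hadj: "mdz a (\<lambda>z. hadj (F z)) z = hadj (mdzb a F z)"
    and mdzb_hadj: "mdzb a (\<lambda>z. hadj (F z)) z = hadj (mdz a F z)"
    and mdz_uminus: "mdz a (\<lambda>z. - F z) z = - mdz a F z"
    and dz_trace: "dz a (\<lambda>z. trace (F z)) z = trace (mdz a F z)"
    and dzb_trace: "dzb a (\<lambda>z. trace (F z)) z = trace (mdzb a F z)"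
proof -
  have f: "(\<lambda>z. F z $ i $ j) differentiable (at z)" for i j
    using F by (auto simp: mdiff_def)
  show "mdz a (\<lambda>z. hadj (F z)) z = hadj (mdzb a F z)" "mdzb a (\<lambda>z. hadj (F z)) z = hadj (mdz a F z)"
    "mdz a (\<lambda>z. - F z) z = - mdz a F z"
    by (auto intro!: matrix_eqI simp: dz_cnj dzb_cnj dz_uminus f)
  show "dz a (\<lambda>z. trace (F z)) z = trace (mdz a F z)" "dzb a (\<lambda>z. trace (F z)) z = trace (mdzb a F z)"
    by (auto simp: trace_def dz_sum dzb_sum f)
qed

lemma
  assumes "open S" "z \<in> S" "\<And>y. y \<in> S \<Longrightarrow> F y = G y"
  shows mdz_cong_open: "mdz a F z = mdz a G z" and mdzb_cong_open: "mdzb a F z = mdzb a G z"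
  by (auto intro!: matrix_eqI dz_cong_open[OF assms(1,2)] dzb_cong_open[OF assms(1,2)] simp: assms(3))

lemma mdz_const [simp]: "mdz a (\<lambda>z. C) z = 0" and mdzb_const [simp]: "mdzb a (\<lambda>z. C) z = 0"
  by (auto intro!: matrix_eqI)

lemma
  assumes "open S" "z \<in> S" "mCk 2 S F"
  shows mdz_mdzb_commute: "mdz a (mdzb b F) z = mdzb b (mdz a F) z"
    and mdz_mdz_commute: "mdz a (mdz b F) z = mdz b (mdz a F) z"
proof -
  have c: "Ck 2 S (\<lambda>z. F z $ i $ j)" for i j using assms by (simp add: mCk_def)
  show "mdz a (mdzb b F) z = mdzb b (mdz a F) z"
    by (rule matrix_eqI) (simp add: dz_dzb_commute[OF assms(1,2) c])
  show "mdz a (mdz b F) z = mdz b (mdz a F) z"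
    by (rule matrix_eqI) (simp add: dz_dz_commute[OF assms(1,2) c, of a b])
qed

lemma
  assumes "open S" "z \<in> S" "mCk (Suc k) S F" "\<And>z. z \<in> S \<Longrightarrow> invertible (F z)"
  shows mdz_matrix_inv: "mdz a (\<lambda>z. matrix_inv (F z)) z = - (matrix_inv (F z) ** mdz a F z ** matrix_inv (F z))"
    and mdzb_matrix_inv: "mdzb a (\<lambda>z. matrix_inv (F z)) z = - (matrix_inv (F z) ** mdzb a F z ** matrix_inv (F z))"
proof -
  have d: "mdiff F z" "mdiff (\<lambda>z. matrix_inv (F z)) z"
    using assms mCk_matrix_inv[OF assms(1,3,4)] mCk_mdiff by blast+
  \<comment> \<open>Differentiating F F^-1 = 1 gives this equation, with X the derivative of F and Y
    that of the inverse.\<close>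
  have solve: "Y = - (matrix_inv (F z) ** X ** matrix_inv (F z))" if "X ** matrix_inv (F z) + F z ** Y = 0" for X Y
  proof -
    have "matrix_inv (F z) ** (X ** matrix_inv (F z) + F z ** Y) = 0" using that by (simp add: mm.zero_right)
    then have "matrix_inv (F z) ** X ** matrix_inv (F z) + Y = 0"
      using matrix_inv_mult[OF assms(4)[OF assms(2)]] by (simp add: mm.add_right matrix_mul_assoc)
    then show ?thesis by (metis add.commute add_eq_0_iff)
  qed
  have one: "F y ** matrix_inv (F y) = mat 1" if "y \<in> S" for y
    using matrix_inv_mult assms(4) that by blast
  show "mdz a (\<lambda>z. matrix_inv (F z)) z = - (matrix_inv (F z) ** mdz a F z ** matrix_inv (F z))"
    using mdz_cong_open[where F="\<lambda>y. F y ** matrix_inv (F y)" and G="\<lambda>_. mat 1" and a=a, OF assms(1,2) one]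
    by (intro solve) (simp add: mdz_mult[OF d])
  show "mdzb a (\<lambda>z. matrix_inv (F z)) z = - (matrix_inv (F z) ** mdzb a F z ** matrix_inv (F z))"
    using mdzb_cong_open[where F="\<lambda>y. F y ** matrix_inv (F y)" and G="\<lambda>_. mat 1" and a=a, OF assms(1,2) one]
    by (intro solve) (simp add: mdzb_mult[OF d])
qed

section \<open>Kaehler metrics in coordinates\<close>

text \<open>\<open>H z $ a $ b\<close> is the component \<open>g\<^bsub>ab-bar\<^esub>\<close>, and \<open>KM H a b z $ c $ d\<close> is minus the component
  \<open>R\<^bsub>ab-bar cd-bar\<^esub>\<close> of the curvature tensor.\<close>

definition Win :: "(complex ^ 'm::finite \<Rightarrow> 'm cmat) \<Rightarrow> complex ^ 'm \<Rightarrow> 'm cmat" where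
  "Win H z = matrix_inv (H z)"

definition KM :: "(complex ^ 'm::finite \<Rightarrow> 'm cmat) \<Rightarrow> 'm \<Rightarrow> 'm \<Rightarrow> complex ^ 'm \<Rightarrow> 'm cmat" where
  "KM H a b z = mdz a H z ** Win H z ** mdzb b H z - mdz a (mdzb b H) z"

text \<open>The contraction over the last index pair; the sign built into \<open>KM\<close> makes it
  the Ricci tensor in the convention that is positive on projective space.\<close>

definition RicM :: "(complex ^ 'm::finite \<Rightarrow> 'm cmat) \<Rightarrow> complex ^ 'm \<Rightarrow> 'm cmat" where
  "RicM H z = (\<chi> a b. trace (KM H a b z ** Win H z))"

definition ScM :: "(complex ^ 'm::finite \<Rightarrow> 'm cmat) \<Rightarrow> complex ^ 'm \<Rightarrow> complex" where
  "ScM H z = trace (RicM H z ** Win H z)"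

text \<open>Half of the squared norm of Ric as a real tensor. For constant scalar curvature it
  differs from |E|^2 / 2 by a constant, and it is smooth by construction; it is the function to
  which the Laplacian is applied.\<close>

definition ricci_sq :: "(complex ^ 'm::finite \<Rightarrow> 'm cmat) \<Rightarrow> complex ^ 'm \<Rightarrow> complex" where
  "ricci_sq H z = trace (RicM H z ** Win H z ** (RicM H z ** Win H z))"

text \<open>For a Kaehler metric this is half of the Riemannian Laplacian, without first-order
  terms. Likewise, for real F, twice \<open>grad2\<close> is the squared length of the
  gradient.\<close>

definition Lap :: "(complex ^ 'm::finite \<Rightarrow> 'm cmat) \<Rightarrow> (complex ^ 'm \<Rightarrow> complex) \<Rightarrow> complex ^ 'm \<Rightarrow> complex" where
  "Lap H F z = (\<Sum>*a b. Win H z $ b $ a * dz a (dzb b F) z)"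

definition grad2 :: "(complex ^ 'm::finite \<Rightarrow> 'm cmat) \<Rightarrow> (complex ^ 'm \<Rightarrow> complex) \<Rightarrow> complex ^ 'm \<Rightarrow> complex" where
  "grad2 H F z = (\<Sum>*a b. Win H z $ b $ a * dz a F z * dzb b F z)"

text \<open>The Hermitian side of a Kaehler metric; the last assumption is closedness of the
  fundamental form. Detached from the real metric, the notion is stable under holomorphic pullback
  (\<open>kaehler_pullb\<close>) by matrix calculus alone.\<close>

locale kaehler_chart =
  fixes S :: "(complex ^ 'm::finite) set" and H :: "complex ^ 'm \<Rightarrow> 'm cmat"
  assumes open_S: "open S"
    and smooth: "\<And>k. mCk k S H"
    and herm: "\<And>z. z \<in> S \<Longrightarrow> hadj (H z) = H z"
    and pos: "\<And>z v. z \<in> S \<Longrightarrow> v \<noteq> 0 \<Longrightarrow> Re (\<Sum>*a b. v $ a * cnj (v $ b) * H z $ a $ b) > 0"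
    and kaehler: "\<And>z a b c. z \<in> S \<Longrightarrow> mdz c H z $ a $ b = mdz a H z $ c $ b"
begin

text \<open>On the conjugate of a kernel vector the Hermitian form would vanish, against
  positivity.\<close>

lemma invertible_H: assumes "z \<in> S" shows "invertible (H z)"
  unfolding invertible_left_inverse matrix_left_invertible_ker
proof (intro allI impI)
  fix x assume x: "H z *v x = 0"
  show "x = 0"
  proof (rule ccontr)
    define v where "v = (\<chi> i. cnj (x $ i))"
    assume "x \<noteq> 0"
    then have "v \<noteq> 0" by (simp add: v_def vec_eq_iff)
    then have "Re (\<Sum>*a b. v $ a * cnj (v $ b) * H z $ a $ b) > 0" by (rule pos[OF assms])
    also have "(\<Sum>*a b. v $ a * cnj (v $ b) * H z $ a $ b) = (\<Sum>*a. v $ a * (H z *v x) $ a)"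
      by (simp add: v_def matrix_vector_mult_def sum_distrib_left mult.commute mult.left_commute)
    finally show False by (simp add: x)
  qed
qed

lemma Win_mult: "z \<in> S \<Longrightarrow> H z ** Win H z = mat 1" "z \<in> S \<Longrightarrow> Win H z ** H z = mat 1"
  unfolding Win_def using matrix_inv_mult invertible_H by auto

lemma hadj_Win: assumes "z \<in> S" shows "hadj (Win H z) = Win H z"
proof -
  have "hadj (Win H z ** H z) = mat 1" using Win_mult[OF assms] by simp
  then have "H z ** hadj (Win H z) = mat 1" by (simp add: hadj_mult herm[OF assms])
  then show ?thesis unfolding Win_def using matrix_inv_eqI by metis
qed

lemma smooth_Win: "mCk k S (Win H)"
  unfolding Win_def[abs_def] by (rule mCk_matrix_inv[OF open_S smooth invertible_H])

lemma mdiff_H: "z \<in> S \<Longrightarrow> mdiff H z"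
  using mCk_mdiff[OF smooth] .

lemma mdiff_Win: "z \<in> S \<Longrightarrow> mdiff (Win H) z"
  using mCk_mdiff[OF smooth_Win] .

lemma smooth_mdz: "mCk k S (mdz a H)" and smooth_mdzb: "mCk k S (mdzb a H)"
  using mCk_mdz[OF open_S smooth] mCk_mdzb[OF open_S smooth] by auto

lemma smooth_mdz_mdzb: "mCk k S (mdz a (mdzb b H))"
  by (rule mCk_mdz[OF open_S smooth_mdzb])

lemma smooth_KM: "mCk k S (KM H a b)"
proof -
  have "mCk k S (\<lambda>z. mdz a H z ** Win H z ** mdzb b H z + - mdz a (mdzb b H) z)"
    by (intro mCk_add mCk_mult mCk_uminus open_S smooth_mdz smooth_mdzb smooth_Win smooth_mdz_mdzb)
  then show ?thesis unfolding KM_def[abs_def] by simp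
qed

lemma smooth_RicM: "mCk k S (RicM H)"
  unfolding RicM_def[abs_def] mCk_def
  using Ck_trace[OF open_S mCk_mult[OF open_S smooth_KM smooth_Win]] by simp

lemma smooth_ricci_sq: "Ck k S (ricci_sq H)"
  unfolding ricci_sq_def[abs_def] by (intro Ck_trace mCk_mult open_S smooth_RicM smooth_Win)

lemma mdz_Win: "z \<in> S \<Longrightarrow> mdz a (Win H) z = - (Win H z ** mdz a H z ** Win H z)"
  and mdzb_Win: "z \<in> S \<Longrightarrow> mdzb a (Win H) z = - (Win H z ** mdzb a H z ** Win H z)"
  unfolding Win_def[abs_def]
  using mdz_matrix_inv[OF open_S _ smooth invertible_H] mdzb_matrix_inv[OF open_S _ smooth invertible_H] by auto

lemma mdzb_H: "z \<in> S \<Longrightarrow> mdzb a H z = hadj (mdz a H z)"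
  using mdzb_hadj[OF mdiff_H, of z a] mdzb_cong_open[OF open_S _ herm, where z=z and a=a] by simp

lemma kaehler_b: "z \<in> S \<Longrightarrow> mdzb d H z $ a $ b = mdzb b H z $ a $ d"
  using kaehler[of z d b a] by (simp add: mdzb_H del: mdz_nth mdzb_nth)

lemma hadj_KM: assumes z: "z \<in> S" shows "hadj (KM H a b z) = KM H b a z"
proof -
  have "hadj (mdz a (mdzb b H) z) = mdzb a (mdz b H) z"
  proof -
    have "hadj (mdz a (mdzb b H) z) = mdzb a (\<lambda>z. hadj (mdzb b H z)) z"
      by (rule mdzb_hadj[symmetric]) (rule mCk_mdiff[OF smooth_mdzb z])
    also have "\<dots> = mdzb a (mdz b H) z"
      by (rule mdzb_cong_open[OF open_S z]) (simp add: mdzb_H)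
    finally show ?thesis .
  qed
  also have "\<dots> = mdz b (mdzb a H) z"
    by (rule mdz_mdzb_commute[OF open_S z smooth, symmetric])
  finally have 1: "hadj (mdz a (mdzb b H) z) = mdz b (mdzb a H) z" .
  have 2: "hadj (X - Y) = hadj X - hadj Y" for X Y :: "'m cmat" by (rule matrix_eqI) simp
  show ?thesis
    unfolding KM_def 2 1 hadj_mult hadj_Win[OF z] mdzb_H[OF z] by (simp add: matrix_mul_assoc)
qed

lemma hadj_RicM: assumes z: "z \<in> S" shows "hadj (RicM H z) = RicM H z"
proof (rule matrix_eqI)
  fix a b
  have tr: "cnj (trace X) = trace (hadj X)" for X :: "'m cmat" by (simp add: trace_def)
  show "hadj (RicM H z) $ a $ b = RicM H z $ a $ b"
    unfolding hadj_nth RicM_def vec_lambda_beta tr hadj_mult hadj_KM[OF z] hadj_Win[OF z]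
    by (rule trace_mul_sym)
qed

text \<open>The Ricci form is the curvature of the canonical bundle.\<close>

lemma RicM_eq: assumes z: "z \<in> S"
  shows "RicM H z $ a $ b = - dzb b (\<lambda>z. trace (mdz a H z ** Win H z)) z"
proof -
  have d: "mdiff (mdz a H) z" "mdiff (Win H) z"
    using mCk_mdiff[OF smooth_mdz z] mdiff_Win[OF z] by auto
  have "mdzb b (mdz a H) z = mdz a (mdzb b H) z"
    by (rule mdz_mdzb_commute[OF open_S z smooth, symmetric])
  then show ?thesis
    unfolding dzb_trace[OF mdiff_mult[OF d]] mdzb_mult[OF d] mdzb_Win[OF z] RicM_def vec_lambda_beta KM_def
    by (simp add: mm.diff_left mm.minus_right trace_add trace_sub trace_minus matrix_mul_assoc)
qed

text \<open>The trace is the derivative of log det H in the direction a, so this is the symmetry of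
  second derivatives of log det H, checked on the traces themselves.\<close>

lemma trace_mdz_closed: assumes z: "z \<in> S"
  shows "dz c (\<lambda>z. trace (mdz a H z ** Win H z)) z = dz a (\<lambda>z. trace (mdz c H z ** Win H z)) z"
proof -
  have d: "mdiff (mdz a H) z" "mdiff (Win H) z" for a
    using mCk_mdiff[OF smooth_mdz z] mdiff_Win[OF z] by auto
  have e: "dz c (\<lambda>z. trace (mdz a H z ** Win H z)) z
      = trace (mdz c (mdz a H) z ** Win H z) - trace (mdz a H z ** Win H z ** (mdz c H z ** Win H z))" for a c
    unfolding dz_trace[OF mdiff_mult[OF d]] mdz_mult[OF d] mdz_Win[OF z]
    by (simp add: mm.minus_right trace_add trace_minus trace_sub matrix_mul_assoc)
  show ?thesis
    unfolding e mdz_mdz_commute[OF open_S z smooth, of a c]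
      trace_mul_sym[of "mdz a H z ** Win H z" "mdz c H z ** Win H z"] ..
qed

text \<open>By \<open>RicM_eq\<close> the Ricci form is the barred derivative of a form closed under
  unbarred derivatives; commuting the two kinds of derivative gives the claim, a contracted second
  Bianchi identity.\<close>

lemma RicM_closed: assumes z: "z \<in> S"
  shows "dz c (\<lambda>z. RicM H z $ a $ b) z = dz a (\<lambda>z. RicM H z $ c $ b) z"
proof -
  let ?t = "\<lambda>a z. trace (mdz a H z ** Win H z)"
  have st: "Ck k S (?t a)" for k a by (intro Ck_trace mCk_mult open_S smooth_mdz smooth_Win)
  have e: "dz c (\<lambda>z. RicM H z $ a $ b) z = - dzb b (dz c (?t a)) z" for a c
  proof -
    have "dz c (\<lambda>z. RicM H z $ a $ b) z = dz c (\<lambda>z. - dzb b (?t a) z) z"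
      by (rule dz_cong_open[OF open_S z]) (rule RicM_eq)
    also have "\<dots> = - dz c (dzb b (?t a)) z"
      by (rule dz_uminus) (rule Ck_differentiable[OF Ck_dzb[OF open_S st] z])
    also have "\<dots> = - dzb b (dz c (?t a)) z"
      by (simp add: dz_dzb_commute[OF open_S z st])
    finally show ?thesis .
  qed
  have "dzb b (dz c (?t a)) z = dzb b (dz a (?t c)) z"
    by (rule dzb_cong_open[OF open_S z]) (rule trace_mdz_closed)
  then show ?thesis by (simp add: e)
qed

lemma RicM_closed_b: assumes z: "z \<in> S"
  shows "dzb c (\<lambda>z. RicM H z $ a $ b) z = dzb b (\<lambda>z. RicM H z $ a $ c) z"
proof -
  have d: "(\<lambda>z. RicM H z $ b $ a) differentiable (at z)" for a b
    using mCk_mdiff[OF smooth_RicM z] by (simp add: mdiff_def)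
  have e: "dzb c (\<lambda>z. RicM H z $ a $ b) z = cnj (dz c (\<lambda>z. RicM H z $ b $ a) z)" for a b c
  proof -
    have "dzb c (\<lambda>z. RicM H z $ a $ b) z = dzb c (\<lambda>z. cnj (RicM H z $ b $ a)) z"
      using hadj_RicM by (intro dzb_cong_open[OF open_S z]) (metis hadj_nth)
    also have "\<dots> = cnj (dz c (\<lambda>z. RicM H z $ b $ a) z)" by (rule dzb_cnj[OF d])
    finally show ?thesis .
  qed
  show ?thesis unfolding e RicM_closed[OF z, of c b a] ..
qed

end

section \<open>Naturality under holomorphic maps\<close>

text \<open>The row index is the variable of differentiation, the transpose of the usual convention,
  so that a Hermitian form pulls back to \<open>M ** H ** hadj M\<close>.\<close>

definition jac :: "(complex ^ 'm::finite \<Rightarrow> complex ^ 'm) \<Rightarrow> complex ^ 'm \<Rightarrow> 'm cmat" where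
  "jac \<tau> z = (\<chi> a p. dz a (\<lambda>z. \<tau> z $ p) z)"

definition pullb :: "(complex ^ 'm::finite \<Rightarrow> 'm cmat) \<Rightarrow> (complex ^ 'm \<Rightarrow> complex ^ 'm) \<Rightarrow> complex ^ 'm \<Rightarrow> 'm cmat" where
  "pullb H \<tau> z = jac \<tau> z ** H (\<tau> z) ** hadj (jac \<tau> z)"

lemma Lap_eq_trace: "Lap H F z = trace ((\<chi> a b. dz a (dzb b F) z) ** Win H z)"
  by (simp add: Lap_def trace_def matrix_mult_nth mult.commute)

lemma grad2_eq_trace: "grad2 H F z = trace ((\<chi> a b. dz a F z * dzb b F z) ** Win H z)"
  by (simp add: grad2_def trace_def matrix_mult_nth mult.commute mult.left_commute)

lemma matrix_triple_nth: "(A ** B ** C) $ i $ j = (\<Sum>*p q. A $ i $ p * C $ q $ j * B $ p $ q)"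
  for A :: "'a::comm_semiring_1 ^ 'n ^ 'm"
proof -
  have "(A ** B ** C) $ i $ j = (\<Sum>*q p. A $ i $ p * C $ q $ j * B $ p $ q)"
    by (simp add: matrix_mult_nth sum_distrib_right sum_distrib_left ac_simps)
  also have "\<dots> = (\<Sum>*p q. A $ i $ p * C $ q $ j * B $ p $ q)"
    by (rule sum.swap)
  finally show ?thesis .
qed

lemma sum_swap4:
  "(\<Sum>p\<in>A. \<Sum>q\<in>B. \<Sum>a\<in>C. \<Sum>b\<in>D. f p q a b) = (\<Sum>a\<in>C. \<Sum>b\<in>D. \<Sum>p\<in>A. \<Sum>q\<in>B. f p q a b)"
proof -
  have "(\<Sum>p\<in>A. \<Sum>q\<in>B. \<Sum>a\<in>C. \<Sum>b\<in>D. f p q a b) = (\<Sum>p\<in>A. \<Sum>a\<in>C. \<Sum>q\<in>B. \<Sum>b\<in>D. f p q a b)"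
    by (rule sum.cong[OF refl], rule sum.swap)
  also have "\<dots> = (\<Sum>p\<in>A. \<Sum>a\<in>C. \<Sum>b\<in>D. \<Sum>q\<in>B. f p q a b)"
    by (rule sum.cong[OF refl], rule sum.cong[OF refl], rule sum.swap)
  also have "\<dots> = (\<Sum>a\<in>C. \<Sum>p\<in>A. \<Sum>b\<in>D. \<Sum>q\<in>B. f p q a b)"
    by (rule sum.swap)
  also have "\<dots> = (\<Sum>a\<in>C. \<Sum>b\<in>D. \<Sum>p\<in>A. \<Sum>q\<in>B. f p q a b)"
    by (rule sum.cong[OF refl], rule sum.swap)
  finally show ?thesis .
qed

lemma sum_smat_mult:
  fixes A B :: "'i \<Rightarrow> 'm::finite cmat"
  shows "(\<Sum>p\<in>I. smat (x p) (A p)) ** w ** (\<Sum>q\<in>J. smat (y q) (B q)) = (\<Sum>p\<in>I. \<Sum>q\<in>J. smat (x p * y q) (A p ** w ** B q))"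
  apply (simp only: mm.sum_left smat_mult_left)
  apply (simp only: mm.sum_right smat_mult_right)
  apply (rule sum.cong[OF refl], rule matrix_eqI)
  apply (simp add: sum_component sum_distrib_left mult.assoc)
  done

text \<open>Serves two purposes: normal coordinates around a point and the transition between two
  charts. \<tau> is locally biholomorphic, the natural condition for local tensor
  identities.\<close>

locale holo_pullback = kaehler_chart S H for S :: "(complex ^ 'm::finite) set" and H +
  fixes S' and \<tau> :: "complex ^ 'm \<Rightarrow> complex ^ 'm"
  assumes open_S': "open S'"
    and holo_\<tau>: "holomorphic_map_on S' \<tau>"
    and image_\<tau>: "\<tau> ` S' \<subseteq> S"
    and invertible_jac: "\<And>z. z \<in> S' \<Longrightarrow> invertible (jac \<tau> z)"
begin

abbreviation "M \<equiv> jac \<tau>"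
abbreviation "H' \<equiv> pullb H \<tau>"

lemma tau_in: "z \<in> S' \<Longrightarrow> \<tau> z \<in> S"
  using image_\<tau> by auto

lemma jac_nth: "M z $ a $ p = dz a (\<lambda>z. \<tau> z $ p) z"
  by (simp add: jac_def)

lemma holo_jac: "holo S' (\<lambda>z. M z $ a $ p)"
  unfolding jac_nth by (rule holo_dz[OF open_S' holo_component[OF holo_\<tau>]])

lemma smooth_jac: "mCk k S' M"
  unfolding mCk_def using holo_Ck[OF open_S' holo_jac] by blast

lemma mdzb_jac: "z \<in> S' \<Longrightarrow> mdzb a M z = 0"
  by (rule matrix_eqI) (simp add: holo_dzb[OF holo_jac])

lemma mdzb_mdz_jac: "z \<in> S' \<Longrightarrow> mdzb a (mdz b M) z = 0"
  by (rule matrix_eqI) (simp add: holo_dzb[OF holo_dz[OF open_S' holo_jac]])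

lemma smooth_mdz_jac: "mCk k S' (mdz a M)"
  by (rule mCk_mdz[OF open_S' smooth_jac])

lemma Ck_tau: "Ck k S F \<Longrightarrow> Ck k S' (\<lambda>z. F (\<tau> z))"
  by (rule Ck_compose[OF open_S' open_S image_\<tau> holomorphic_map_Ck[OF open_S' holo_\<tau>]])

lemma mCk_tau: "mCk k S F \<Longrightarrow> mCk k S' (\<lambda>z. F (\<tau> z))"
  unfolding mCk_def using Ck_tau by blast

lemma dz_tau: "F differentiable (at (\<tau> z)) \<Longrightarrow> z \<in> S' \<Longrightarrow> dz a (\<lambda>z. F (\<tau> z)) z = (\<Sum>*b. M z $ a $ b * dz b F (\<tau> z))"
  and dzb_tau: "F differentiable (at (\<tau> z)) \<Longrightarrow> z \<in> S' \<Longrightarrow> dzb a (\<lambda>z. F (\<tau> z)) z = (\<Sum>*b. cnj (M z $ a $ b) * dzb b F (\<tau> z))"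
  unfolding jac_nth using dz_compose[OF holo_\<tau>] dzb_compose[OF holo_\<tau>] by auto

lemma mdz_tau: assumes "mdiff F (\<tau> z)" "z \<in> S'"
  shows "mdz a (\<lambda>z. F (\<tau> z)) z = (\<Sum>*p. smat (M z $ a $ p) (mdz p F (\<tau> z)))"
    and "mdzb a (\<lambda>z. F (\<tau> z)) z = (\<Sum>*p. smat (cnj (M z $ a $ p)) (mdzb p F (\<tau> z)))"
proof -
  have d: "(\<lambda>z. F z $ i $ j) differentiable (at (\<tau> z))" for i j using assms(1) by (simp add: mdiff_def)
  show "mdz a (\<lambda>z. F (\<tau> z)) z = (\<Sum>*p. smat (M z $ a $ p) (mdz p F (\<tau> z)))"
    "mdzb a (\<lambda>z. F (\<tau> z)) z = (\<Sum>*p. smat (cnj (M z $ a $ p)) (mdzb p F (\<tau> z)))"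
    using dz_tau[OF d assms(2)] dzb_tau[OF d assms(2)] by (auto intro!: matrix_eqI simp: sum_component)
qed

text \<open>No first derivatives of F survive: the conjugated Jacobian is antiholomorphic, so the
  unbarred derivative annihilates it.\<close>

lemma second_tau:
  assumes F: "Ck 2 S F" and z: "z \<in> S'"
  shows "dz a (dzb b (\<lambda>z. F (\<tau> z))) z = (M z ** (\<chi> p q. dz p (dzb q F) (\<tau> z)) ** hadj (M z)) $ a $ b"
proof -
  have F2: "Ck (Suc (Suc 0)) S F" using F by (simp add: numeral_2_eq_2)
  have 1: "dzb b (\<lambda>z. F (\<tau> z)) y = (\<Sum>*q. cnj (M y $ b $ q) * dzb q F (\<tau> y))" if "y \<in> S'" for y
    by (rule dzb_tau[OF Ck_differentiable[OF F2 tau_in[OF that]] that])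
  have dM: "(\<lambda>z. cnj (M z $ b $ q)) differentiable (at z)" for b q
    using mdiff_hadj[OF mCk_mdiff[OF smooth_jac z]] by (simp add: mdiff_def)
  have dF: "(dzb q F) differentiable (at (\<tau> z))" for q
    using Ck_differentiable[OF Ck_dzb[OF open_S F2] tau_in[OF z]] .
  have dF': "(\<lambda>z. dzb q F (\<tau> z)) differentiable (at z)" for q
    using Ck_differentiable[OF Ck_tau[OF Ck_dzb[OF open_S F2]] z] .
  have z0: "dz a (\<lambda>z. cnj (M z $ b $ q)) z = 0" for q
    using holo_dzb[OF holo_jac z, of a b q] dz_cnj[of "\<lambda>z. M z $ b $ q" z a] holo_jac[of b q] z by (simp add: holo_def)
  have "dz a (dzb b (\<lambda>z. F (\<tau> z))) z = dz a (\<lambda>y. \<Sum>*q. cnj (M y $ b $ q) * dzb q F (\<tau> y)) z"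
    by (rule dz_cong_open[OF open_S' z 1])
  also have "\<dots> = (\<Sum>*q. cnj (M z $ b $ q) * (\<Sum>*p. M z $ a $ p * dz p (dzb q F) (\<tau> z)))"
    by (subst dz_sum) (auto simp: dz_mult dM dF' z0 dz_tau[OF dF z] intro!: differentiable_mult)
  also have "\<dots> = (\<Sum>*p q. M z $ a $ p * cnj (M z $ b $ q) * dz p (dzb q F) (\<tau> z))"
    by (subst sum.swap) (simp add: sum_distrib_left mult.assoc mult.left_commute)
  finally show ?thesis by (simp add: matrix_triple_nth)
qed

definition "N z = matrix_inv (M z)"

lemma N_mult: "z \<in> S' \<Longrightarrow> M z ** N z = mat 1" "z \<in> S' \<Longrightarrow> N z ** M z = mat 1"
  unfolding N_def using matrix_inv_mult invertible_jac by auto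

lemma
  assumes z: "z \<in> S'"
  shows cancel_MN: "X ** M z ** N z = X" and cancel_NM: "X ** N z ** M z = X"
    and cancel_MN': "X ** hadj (M z) ** hadj (N z) = X" and cancel_NM': "X ** hadj (N z) ** hadj (M z) = X"
    and cancel_HW: "X ** H (\<tau> z) ** Win H (\<tau> z) = X" and cancel_WH: "X ** Win H (\<tau> z) ** H (\<tau> z) = X"
proof -
  have h: "hadj (M z) ** hadj (N z) = mat 1" "hadj (N z) ** hadj (M z) = mat 1"
    using N_mult[OF z] by (simp_all add: hadj_mult[symmetric])
  show "X ** M z ** N z = X" "X ** N z ** M z = X" "X ** hadj (M z) ** hadj (N z) = X"
    "X ** hadj (N z) ** hadj (M z) = X" "X ** H (\<tau> z) ** Win H (\<tau> z) = X" "X ** Win H (\<tau> z) ** H (\<tau> z) = X"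
    using N_mult[OF z] h Win_mult[OF tau_in[OF z]] by (simp_all add: matrix_mul_assoc[symmetric])
qed

lemmas cancels = cancel_MN cancel_NM cancel_MN' cancel_NM' cancel_HW cancel_WH

lemma Win_pullb: assumes z: "z \<in> S'"
  shows "Win H' z = hadj (N z) ** Win H (\<tau> z) ** N z"
  unfolding Win_def[of H']
proof (rule matrix_inv_eqI(1))
  show "H' z ** (hadj (N z) ** Win H (\<tau> z) ** N z) = mat 1"
    unfolding pullb_def matrix_mul_assoc by (simp add: cancels[OF z] N_mult[OF z])
qed

lemma mdiffs:
  assumes z: "z \<in> S'"
  shows "mdiff M z" "mdiff (\<lambda>z. hadj (M z)) z" "mdiff (\<lambda>z. H (\<tau> z)) z" "mdiff (mdz a M) z" "mdiff (\<lambda>z. hadj (mdz a M z)) z"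
    "mdiff (mdz a (\<lambda>z. H (\<tau> z))) z" "mdiff (mdzb a (\<lambda>z. H (\<tau> z))) z"
  using mCk_mdiff[OF smooth_jac z] mCk_mdiff[OF mCk_tau[OF smooth] z] mCk_mdiff[OF smooth_mdz_jac z]
    mCk_mdiff[OF mCk_mdz[OF open_S' mCk_tau[OF smooth]] z] mCk_mdiff[OF mCk_mdzb[OF open_S' mCk_tau[OF smooth]] z]
  by (auto intro: mdiff_hadj)

lemma mdz_hadj_jac: "z \<in> S' \<Longrightarrow> mdz a (\<lambda>z. hadj (M z)) z = 0"
  and mdz_hadj_mdz_jac: "z \<in> S' \<Longrightarrow> mdz a (\<lambda>z. hadj (mdz b M z)) z = 0"
  and mdzb_hadj_jac: "z \<in> S' \<Longrightarrow> mdzb a (\<lambda>z. hadj (M z)) z = hadj (mdz a M z)"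
proof -
  have h0: "hadj 0 = (0 :: 'm cmat)" by (rule matrix_eqI) simp
  show "mdz a (\<lambda>z. hadj (M z)) z = 0" "mdz a (\<lambda>z. hadj (mdz b M z)) z = 0" if "z \<in> S'"
    using mdz_hadj[OF mdiffs(1)[OF that]] mdz_hadj[OF mdiffs(4)[OF that]] mdzb_jac[OF that] mdzb_mdz_jac[OF that]
    by (simp_all add: h0)
  show "mdzb a (\<lambda>z. hadj (M z)) z = hadj (mdz a M z)" if "z \<in> S'"
    by (rule mdzb_hadj[OF mdiffs(1)[OF that]])
qed

lemma mdz_pullb: assumes z: "z \<in> S'"
  shows "mdz a H' z = mdz a M z ** H (\<tau> z) ** hadj (M z) + M z ** mdz a (\<lambda>z. H (\<tau> z)) z ** hadj (M z)"
  unfolding pullb_def[abs_def] using mdiffs[OF z]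
  by (simp add: mdz_mult mdiff_mult mdz_hadj_jac[OF z] mm.add_left mm.zero_right)

lemma mdzb_pullb: assumes z: "z \<in> S'"
  shows "mdzb b H' z = M z ** mdzb b (\<lambda>z. H (\<tau> z)) z ** hadj (M z) + M z ** H (\<tau> z) ** hadj (mdz b M z)"
  unfolding pullb_def[abs_def] using mdiffs[OF z]
  by (simp add: mdzb_mult mdiff_mult mdzb_hadj_jac[OF z] mdzb_jac[OF z] mm.add_left mm.zero_left)

lemma mdz_mdzb_pullb: assumes z: "z \<in> S'"
  shows "mdz a (mdzb b H') z =
     mdz a M z ** mdzb b (\<lambda>z. H (\<tau> z)) z ** hadj (M z) + M z ** mdz a (mdzb b (\<lambda>z. H (\<tau> z))) z ** hadj (M z)
     + mdz a M z ** H (\<tau> z) ** hadj (mdz b M z) + M z ** mdz a (\<lambda>z. H (\<tau> z)) z ** hadj (mdz b M z)"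
proof -
  have "mdz a (mdzb b H') z = mdz a (\<lambda>z. M z ** mdzb b (\<lambda>z. H (\<tau> z)) z ** hadj (M z) + M z ** H (\<tau> z) ** hadj (mdz b M z)) z"
    by (rule mdz_cong_open[OF open_S' z mdzb_pullb])
  also have "\<dots> = mdz a M z ** mdzb b (\<lambda>z. H (\<tau> z)) z ** hadj (M z) + M z ** mdz a (mdzb b (\<lambda>z. H (\<tau> z))) z ** hadj (M z)
     + mdz a M z ** H (\<tau> z) ** hadj (mdz b M z) + M z ** mdz a (\<lambda>z. H (\<tau> z)) z ** hadj (mdz b M z)"
    using mdiffs[OF z] by (simp add: mdz_add mdz_mult mdiff_mult mdz_hadj_jac[OF z] mdz_hadj_mdz_jac[OF z] mm.add_left mm.zero_right)
  finally show ?thesis .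
qed

text \<open>Derivatives of the Jacobian occur both in the quadratic term and in the second
  derivatives of the metric, and they cancel. This is why the combination \<open>KM\<close> is a
  tensor.\<close>

lemma KM_pullb: assumes z: "z \<in> S'"
  shows "KM H' a b z = M z ** (\<Sum>*p q. smat (M z $ a $ p * cnj (M z $ b $ q)) (KM H p q (\<tau> z))) ** hadj (M z)"
proof -
  let ?h = "\<lambda>z. H (\<tau> z)"
  have 1: "KM H' a b z = M z ** (mdz a ?h z ** Win H (\<tau> z) ** mdzb b ?h z - mdz a (mdzb b ?h) z) ** hadj (M z)"
    unfolding KM_def mdz_pullb[OF z] mdzb_pullb[OF z] mdz_mdzb_pullb[OF z] Win_pullb[OF z]
    by (simp add: mm.add_left mm.add_right mm.diff_left mm.diff_right matrix_mul_assoc cancels[OF z])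
  have 2: "mdz a (mdzb b ?h) z = (\<Sum>*p q. smat (M z $ a $ p * cnj (M z $ b $ q)) (mdz p (mdzb q H) (\<tau> z)))"
  proof (rule matrix_eqI)
    fix i j
    have "Ck 2 S (\<lambda>z. H z $ i $ j)" using smooth by (simp add: mCk_def)
    from second_tau[OF this z]
    show "mdz a (mdzb b ?h) z $ i $ j = (\<Sum>*p q. smat (M z $ a $ p * cnj (M z $ b $ q)) (mdz p (mdzb q H) (\<tau> z))) $ i $ j"
      by (simp add: sum_component matrix_triple_nth)
  qed
  have 3: "mdz a ?h z ** Win H (\<tau> z) ** mdzb b ?h z
     = (\<Sum>*p q. smat (M z $ a $ p * cnj (M z $ b $ q)) (mdz p H (\<tau> z) ** Win H (\<tau> z) ** mdzb q H (\<tau> z)))"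
    unfolding mdz_tau[OF mdiff_H[OF tau_in[OF z]] z] by (rule sum_smat_mult)
  have 4: "smat c X - smat c Y = smat c (X - Y)" for c and X Y :: "'m cmat"
    by (rule matrix_eqI) (simp add: right_diff_distrib)
  show ?thesis
    unfolding 1 2 3 by (simp add: KM_def 4 sum_subtractf[symmetric])
qed

lemma KM_pullb_nth: assumes z: "z \<in> S'"
  shows "KM H' a b z $ c $ d = (\<Sum>*p q r s. 
      M z $ a $ p * cnj (M z $ b $ q) * M z $ c $ r * cnj (M z $ d $ s) * KM H p q (\<tau> z) $ r $ s)"
  unfolding KM_pullb[OF z] mm.sum_left mm.sum_right smat_mult_left smat_mult_right
  by (simp add: sum_component matrix_triple_nth sum_distrib_left mult.assoc)

text \<open>Contraction with the metric is invariant, since the Jacobians cancel cyclically under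
  the trace. The invariance of all scalars below is an instance.\<close>

lemma trace_pullb: assumes z: "z \<in> S'"
  shows "trace (M z ** D ** hadj (M z) ** Win H' z) = trace (D ** Win H (\<tau> z))"
proof -
  have "trace (M z ** D ** hadj (M z) ** Win H' z) = trace (M z ** (D ** Win H (\<tau> z) ** N z))"
    unfolding Win_pullb[OF z] by (simp add: matrix_mul_assoc cancels[OF z])
  also have "\<dots> = trace (D ** Win H (\<tau> z))"
    unfolding trace_mul_sym[of "M z"] by (simp add: cancels[OF z])
  finally show ?thesis .
qed

lemma RicM_pullb: assumes z: "z \<in> S'"
  shows "RicM H' z = M z ** RicM H (\<tau> z) ** hadj (M z)"
  by (rule matrix_eqI)
    (simp add: matrix_triple_nth RicM_def KM_pullb[OF z] trace_pullb[OF z] mm.sum_left smat_mult_left trace_sum trace_smat)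

lemma ScM_pullb: "z \<in> S' \<Longrightarrow> ScM H' z = ScM H (\<tau> z)"
  by (simp add: ScM_def RicM_pullb trace_pullb)

lemma ricci_sq_pullb: assumes z: "z \<in> S'" shows "ricci_sq H' z = ricci_sq H (\<tau> z)"
proof -
  have eq: "RicM H' z ** Win H' z ** (RicM H' z ** Win H' z)
     = M z ** (RicM H (\<tau> z) ** Win H (\<tau> z) ** RicM H (\<tau> z)) ** hadj (M z) ** Win H' z"
    unfolding RicM_pullb[OF z] Win_pullb[OF z] by (simp add: matrix_mul_assoc cancels[OF z])
  show ?thesis unfolding ricci_sq_def eq trace_pullb[OF z] by (simp add: matrix_mul_assoc)
qed

lemma Lap_pullb: assumes "Ck 2 S F" "z \<in> S'"
  shows "Lap H' (\<lambda>z. F (\<tau> z)) z = Lap H F (\<tau> z)"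
proof -
  have "(\<chi> a b. dz a (dzb b (\<lambda>z. F (\<tau> z))) z) = M z ** (\<chi> p q. dz p (dzb q F) (\<tau> z)) ** hadj (M z)"
    by (rule matrix_eqI) (simp add: second_tau[OF assms])
  then show ?thesis unfolding Lap_eq_trace by (simp add: trace_pullb[OF assms(2)])
qed

lemma grad2_pullb: assumes F: "F differentiable (at (\<tau> z))" and z: "z \<in> S'"
  shows "grad2 H' (\<lambda>z. F (\<tau> z)) z = grad2 H F (\<tau> z)"
proof -
  have "(\<chi> a b. dz a (\<lambda>z. F (\<tau> z)) z * dzb b (\<lambda>z. F (\<tau> z)) z) = M z ** (\<chi> p q. dz p F (\<tau> z) * dzb q F (\<tau> z)) ** hadj (M z)"
    by (rule matrix_eqI) (simp add: matrix_triple_nth dz_tau[OF F z] dzb_tau[OF F z] sum_product mult.assoc mult.left_commute)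
  then show ?thesis unfolding grad2_eq_trace by (simp add: trace_pullb[OF z])
qed

lemma kaehler_pullb: "kaehler_chart S' H'"
proof
  show "open S'" by (rule open_S')
  show "mCk k S' H'" for k
    unfolding pullb_def[abs_def] by (intro mCk_mult mCk_hadj mCk_tau smooth smooth_jac open_S')
  show "hadj (H' z) = H' z" if "z \<in> S'" for z
    unfolding pullb_def hadj_mult herm[OF tau_in[OF that]] by (simp add: matrix_mul_assoc)
next
  fix z v assume z: "z \<in> S'" and v: "(v :: complex ^ 'm) \<noteq> 0"
  \<comment> \<open>The push-forward of v: the pulled back form at v is the original form at w, and
    the invertible Jacobian keeps w nonzero.\<close>
  define w where "w = v v* M z"
  have w: "w $ p = (\<Sum>*a. M z $ a $ p * v $ a)" for p
    by (simp add: w_def vector_matrix_mult_def mult.commute)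
  have "w \<noteq> 0"
  proof
    assume "w = 0"
    then have "w v* N z = 0" by (simp add: vector_matrix_mult_def vec_eq_iff)
    then show False using v by (simp add: w_def vector_matrix_mul_assoc N_mult[OF z])
  qed
  then have "Re (\<Sum>*p q. w $ p * cnj (w $ q) * H (\<tau> z) $ p $ q) > 0" by (rule pos[OF tau_in[OF z]])
  also have "(\<Sum>*p q. w $ p * cnj (w $ q) * H (\<tau> z) $ p $ q)
     = (\<Sum>*p q a b. v $ a * cnj (v $ b) * (M z $ a $ p * cnj (M z $ b $ q) * H (\<tau> z) $ p $ q))"
    unfolding w cnj_sum sum_product sum_distrib_right
    by (intro sum.cong refl) (simp add: ac_simps sum_distrib_left)
  also have "\<dots> = (\<Sum>*a b p q. v $ a * cnj (v $ b) * (M z $ a $ p * cnj (M z $ b $ q) * H (\<tau> z) $ p $ q))"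
    by (rule sum_swap4)
  also have "\<dots> = (\<Sum>*a b. v $ a * cnj (v $ b) * H' z $ a $ b)"
    by (simp add: pullb_def matrix_triple_nth sum_distrib_left)
  finally show "0 < Re (\<Sum>*a b. v $ a * cnj (v $ b) * H' z $ a $ b)" .
next
  fix z a b c assume z: "z \<in> S'"
  \<comment> \<open>The two sources of the symmetry: here the second derivatives of \<tau>, in
    \<open>sym2\<close> the Kaehler condition of the target.\<close>
  have sym1: "mdz c M z $ a $ p = mdz a M z $ c $ p" for p
    using dz_dz_commute[OF open_S' z holo_Ck[OF open_S' holo_component[OF holo_\<tau>]], of c a p] by (simp add: jac_nth)
  have sym2: "(M z ** mdz c (\<lambda>z. H (\<tau> z)) z) $ a $ s = (M z ** mdz a (\<lambda>z. H (\<tau> z)) z) $ c $ s" for s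
  proof -
    have "(M z ** mdz c (\<lambda>z. H (\<tau> z)) z) $ a $ s = (\<Sum>*r p. M z $ a $ r * M z $ c $ p * mdz p H (\<tau> z) $ r $ s)" for a c
      unfolding mdz_tau[OF mdiff_H[OF tau_in[OF z]] z] by (simp add: matrix_mult_nth sum_component sum_distrib_left mult.assoc)
    note e = this
    have "(\<Sum>*r p. M z $ a $ r * M z $ c $ p * mdz p H (\<tau> z) $ r $ s)
      = (\<Sum>*r p. M z $ a $ r * M z $ c $ p * mdz r H (\<tau> z) $ p $ s)"
      by (intro sum.cong refl arg_cong2[where f="(*)"] kaehler tau_in z)
    also have "\<dots> = (\<Sum>*p r. M z $ c $ p * M z $ a $ r * mdz r H (\<tau> z) $ p $ s)"
      by (subst sum.swap) (simp add: mult.commute mult.left_commute)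
    finally show ?thesis by (simp only: e)
  qed
  show "mdz c H' z $ a $ b = mdz a H' z $ c $ b"
    unfolding mdz_pullb[OF z] vector_add_component matrix_mult_nth[of _ "hadj (M z)"] sym2
    unfolding matrix_mult_nth[of "mdz _ M z"] sym1 ..
qed

end

section \<open>Normal coordinates\<close>

context kaehler_chart
begin

text \<open>A quadratic holomorphic change of coordinates removes the first derivatives of the
  metric. It exists because the coefficients to be removed are symmetric, which is the Kaehler
  condition at \<open>z0\<close>. The rows of E become the coordinate frame at 0.\<close>

lemma normal_coordinates:
  assumes z0: "z0 \<in> S" and E: "E ** H z0 ** hadj E = mat 1"
  obtains S' \<tau> where "holo_pullback S H S' \<tau>" "0 \<in> S'" "\<tau> 0 = z0" "jac \<tau> 0 = E"
    "pullb H \<tau> 0 = mat 1" "\<And>b. mdz b (pullb H \<tau>) 0 = 0"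
proof -
  \<comment> \<open>First derivatives of the metric in the linear coordinates given by E, with all
    indices referred to that frame.\<close>
  define Y where "Y b = E ** (\<Sum>*p. smat (E $ b $ p) (mdz p H z0)) ** hadj E" for b
  have Y: "Y b $ c $ a = (\<Sum>*r s p. E $ c $ r * cnj (E $ a $ s) * E $ b $ p * mdz p H z0 $ r $ s)" for a b c
    by (simp add: Y_def matrix_triple_nth sum_component sum_distrib_left mult.assoc del: mdz_nth)
  have Ysym: "Y b $ c $ a = Y c $ b $ a" for a b c
  proof -
    have "Y b $ c $ a = (\<Sum>*s r p. E $ c $ r * cnj (E $ a $ s) * E $ b $ p * mdz r H z0 $ p $ s)"
      unfolding Y by (subst sum.swap) (simp only: kaehler[OF z0])
    also have "\<dots> = (\<Sum>*s p r. E $ b $ p * cnj (E $ a $ s) * E $ c $ r * mdz r H z0 $ p $ s)"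
      by (rule sum.cong[OF refl], subst sum.swap) (simp add: ac_simps)
    also have "\<dots> = Y c $ b $ a" unfolding Y by (rule sum.swap)
    finally show ?thesis .
  qed
  \<comment> \<open>Differentiating the symmetric quadratic term undoes the factor 1/2, so the
    Jacobian acquires exactly the linear part -Y.\<close>
  define \<tau> where "\<tau> w = z0 + (\<Sum>*a. (w $ a - (\<Sum>*b c. w $ b * w $ c * Y b $ c $ a) / 2) *s (E $ a))" for w :: "complex ^ 'm"
  define D where "D w h = (\<Sum>*a. (h $ a - (\<Sum>*b c. w $ b * h $ c * Y b $ c $ a)) *s (E $ a))" for w h :: "complex ^ 'm"
  have nth_deriv: "((\<lambda>w::complex ^ 'm. w $ a) has_derivative (\<lambda>h. h $ a)) (at w)" for a w
    by (rule bounded_linear_imp_has_derivative[OF bounded_linear_vec_nth])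
  have Dtau: "(\<tau> has_derivative D w) (at w)" for w
  proof -
    have q: "((\<lambda>w. (w $ a - (\<Sum>*b c. w $ b * w $ c * Y b $ c $ a) / 2)) has_derivative
        (\<lambda>h. h $ a - (\<Sum>*b c. w $ b * h $ c * Y b $ c $ a))) (at w)" for a
    proof -
      have "((\<lambda>w. (w $ a - (\<Sum>*b c. w $ b * w $ c * Y b $ c $ a) / 2)) has_derivative
        (\<lambda>h. h $ a - (\<Sum>*b c. (w $ b * h $ c + h $ b * w $ c) * Y b $ c $ a) / 2)) (at w)"
        by (auto intro!: derivative_eq_intros nth_deriv)
      moreover have "(\<Sum>*b c. (w $ b * h $ c + h $ b * w $ c) * Y b $ c $ a) / 2
          = (\<Sum>*b c. w $ b * h $ c * Y b $ c $ a)" for h :: "complex ^ 'm"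
      proof -
        have "(\<Sum>*b c. h $ b * w $ c * Y b $ c $ a) = (\<Sum>*c b. h $ b * w $ c * Y c $ b $ a)"
          by (subst sum.swap) (simp only: Ysym)
        then have "(\<Sum>*b c. h $ b * w $ c * Y b $ c $ a) = (\<Sum>*b c. w $ b * h $ c * Y b $ c $ a)"
          by (simp add: mult.commute)
        then show ?thesis by (simp add: distrib_right sum.distrib)
      qed
      ultimately show ?thesis by simp
    qed
    have smul: "((\<lambda>w. f w *s v) has_derivative (\<lambda>h. f' h *s v)) (at w)" if "(f has_derivative f') (at w)"
      for f :: "complex ^ 'm \<Rightarrow> complex" and f' and v :: "complex ^ 'm"
      by (rule bounded_linear.has_derivative[OF bounded_bilinear.bounded_linear_left[OF bounded_bilinear_smult] that])
    have "(\<tau> has_derivative (\<lambda>h. 0 + D w h)) (at w)"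
      unfolding \<tau>_def[abs_def] D_def by (intro has_derivative_add has_derivative_const has_derivative_sum smul q)
    then show ?thesis by simp
  qed
  have Dlin: "D w (c *s v) = c *s D w v" for w c v
  proof -
    have eq: "(c *s v) $ a - (\<Sum>*b. \<Sum>ca\<in>UNIV. w $ b * (c *s v) $ ca * Y b $ ca $ a)
      = c * (v $ a - (\<Sum>*b. \<Sum>ca\<in>UNIV. w $ b * v $ ca * Y b $ ca $ a))" for a
      by (simp add: right_diff_distrib sum_distrib_left ac_simps)
    have "(\<Sum>*a. (c * x a) *s (E $ a)) = c *s (\<Sum>*a. x a *s (E $ a))" for x
      by (simp add: vec_eq_iff sum_component sum_distrib_left mult.assoc)
    then show ?thesis unfolding D_def eq .
  qed
  have hol: "holomorphic_map_on T \<tau>" for T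
    unfolding holomorphic_map_on_def using Dtau Dlin by blast
  have jac: "jac \<tau> w $ c $ p = E $ c $ p - (\<Sum>*b a. w $ b * Y b $ c $ a * E $ a $ p)" for w c p
  proof -
    have ai: "axis c \<i> = \<i> *s axis c (1::complex)" by (auto simp: vec_eq_iff axis_def)
    have "((\<lambda>w. \<tau> w $ p) has_derivative (\<lambda>h. D w h $ p)) (at w)"
      by (rule bounded_linear.has_derivative[OF bounded_linear_vec_nth Dtau])
    then have "jac \<tau> w $ c $ p = D w (axis c 1) $ p"
      by (simp add: jac_def dz_eq ai Dlin)
    also have "\<dots> = (\<Sum>*a. (axis c 1 $ a) * E $ a $ p) - (\<Sum>*a. (\<Sum>*b. w $ b * Y b $ c $ a) * E $ a $ p)"
    proof -
      have "(\<Sum>*b c'. w $ b * axis c 1 $ c' * Y b $ c' $ a) = (\<Sum>*b. w $ b * Y b $ c $ a)" for a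
        by (simp add: axis_def if_distrib if_distribR cong: if_cong)
      then show ?thesis
        by (simp only: D_def sum_component vector_smult_component left_diff_distrib sum_subtractf)
    qed
    also have "(\<Sum>*a. (axis c 1 $ a) * E $ a $ p) = E $ c $ p"
      by (simp add: axis_def if_distrib if_distribR cong: if_cong)
    also have "(\<Sum>*a. (\<Sum>*b. w $ b * Y b $ c $ a) * E $ a $ p) = (\<Sum>*b a. w $ b * Y b $ c $ a * E $ a $ p)"
      unfolding sum_distrib_right by (rule sum.swap)
    finally show ?thesis .
  qed
  have jac0: "jac \<tau> 0 = E" by (rule matrix_eqI) (simp add: jac)
  have tau0: "\<tau> 0 = z0" by (simp add: \<tau>_def)
  have tau_cont: "continuous_on UNIV \<tau>"
    using Dtau by (auto simp: continuous_on_eq_continuous_at intro: has_derivative_continuous)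
  \<comment> \<open>Where \<tau> lands in S and is locally biholomorphic; 0 belongs to it because E
    is invertible.\<close>
  define S' where "S' = (\<tau> -` S) \<inter> {w. det (jac \<tau> w) \<noteq> 0}"
  have "continuous_on UNIV (\<lambda>w. det (jac \<tau> w))"
  proof -
    have "Ck 0 UNIV (\<lambda>w. det (jac \<tau> w))"
    proof (rule Ck_det[OF open_UNIV])
      have "holo UNIV (\<lambda>w. jac \<tau> w $ i $ j)" for i j
        using holo_dz[OF open_UNIV holo_component[OF hol]] by (simp add: jac_def)
      then show "Ck 0 UNIV (\<lambda>w. jac \<tau> w $ i $ j)" for i j by (rule holo_Ck[OF open_UNIV])
    qed
    then show ?thesis by simp
  qed
  then have "open {w. det (jac \<tau> w) \<noteq> 0}"
    using open_Collect_neq[of "\<lambda>w. det (jac \<tau> w)" "\<lambda>_. 0"] by simp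
  moreover have "open (\<tau> -` S)" using open_S tau_cont by (simp add: continuous_on_open_vimage)
  ultimately have opS': "open S'" by (simp add: S'_def open_Int)
  have "invertible E"
    using matrix_inv_eqI(2)[of E "H z0 ** hadj E"] E by (simp add: matrix_mul_assoc)
  then have S0: "0 \<in> S'" using z0 by (simp add: S'_def tau0 jac0 invertible_det_nz)
  interpret P: holo_pullback S H S' \<tau>
    by unfold_locales (auto simp: S'_def invertible_det_nz opS' hol opS'[unfolded S'_def])
  have pull0: "pullb H \<tau> 0 = mat 1" by (simp add: pullb_def jac0 tau0 E)
  have dM: "mdz b (jac \<tau>) 0 = - (Y b ** E)" for b
  proof (rule matrix_eqI)
    fix c p
    have "((\<lambda>w. jac \<tau> w $ c $ p) has_derivative (\<lambda>h. - (\<Sum>*b a. h $ b * Y b $ c $ a * E $ a $ p))) (at 0)"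
      unfolding jac by (auto intro!: derivative_eq_intros nth_deriv)
    note dz_eq[OF this, of b]
    also have "(- (\<Sum>ba\<in>UNIV. \<Sum>*a. axis b 1 $ ba * Y ba $ c $ a * E $ a $ p) -
        \<i> * - (\<Sum>ba\<in>UNIV. \<Sum>*a. axis b \<i> $ ba * Y ba $ c $ a * E $ a $ p)) / 2 = - (\<Sum>*a. Y b $ c $ a * E $ a $ p)"
    proof -
      have "(\<Sum>ba\<in>UNIV. \<Sum>*a. axis b t $ ba * Y ba $ c $ a * E $ a $ p) = t * (\<Sum>*a. Y b $ c $ a * E $ a $ p)" for t
      proof -
        have "(\<Sum>ba\<in>UNIV. \<Sum>*a. axis b t $ ba * Y ba $ c $ a * E $ a $ p)
          = (\<Sum>ba\<in>UNIV. if ba = b then t * (\<Sum>*a. Y b $ c $ a * E $ a $ p) else 0)"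
          by (rule sum.cong[OF refl]) (auto simp: axis_def sum_distrib_left mult.assoc)
        then show ?thesis by simp
      qed
      then show ?thesis by simp
    qed
    finally show "mdz b (jac \<tau>) 0 $ c $ p = (- (Y b ** E)) $ c $ p" by (simp add: matrix_mult_nth)
  qed
  \<comment> \<open>The Jacobian contributes -Y and the metric +Y; the conjugated Jacobian has no
    unbarred derivative.\<close>
  have "mdz b (pullb H \<tau>) 0 = 0" for b
  proof -
    have "mdz b (pullb H \<tau>) 0 = - (Y b ** E) ** H z0 ** hadj E + E ** mdz b (\<lambda>z. H (\<tau> z)) 0 ** hadj E"
      using P.mdz_pullb[OF S0, of b] by (simp add: jac0 tau0 dM)
    also have "E ** mdz b (\<lambda>z. H (\<tau> z)) 0 ** hadj E = Y b"
      using P.mdz_tau(1)[OF mdiff_H[OF P.tau_in[OF S0]] S0, of b] by (simp add: tau0 jac0 Y_def)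
    also have "- (Y b ** E) ** H z0 ** hadj E = - (Y b ** (E ** H z0 ** hadj E))"
      by (simp add: mm.minus_left matrix_mul_assoc)
    finally show ?thesis by (simp add: E)
  qed
  with P.holo_pullback_axioms S0 tau0 jac0 pull0 show thesis by (rule that)
qed

end

section \<open>Pointwise tensor inequalities\<close>

lemma cauchy_schwarz_cnj:
  fixes f g :: "'i \<Rightarrow> complex"
  shows "(Re (\<Sum>i\<in>I. f i * cnj (g i)))\<^sup>2 \<le> (\<Sum>i\<in>I. (cmod (f i))\<^sup>2) * (\<Sum>i\<in>I. (cmod (g i))\<^sup>2)"
proof -
  have "\<bar>Re (\<Sum>i\<in>I. f i * cnj (g i))\<bar> \<le> cmod (\<Sum>i\<in>I. f i * cnj (g i))" by (rule abs_Re_le_cmod)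
  also have "\<dots> \<le> (\<Sum>i\<in>I. cmod (f i) * cmod (g i))"
    by (rule order.trans[OF norm_sum]) (simp add: norm_mult)
  finally have "(Re (\<Sum>i\<in>I. f i * cnj (g i)))\<^sup>2 \<le> (\<Sum>i\<in>I. cmod (f i) * cmod (g i))\<^sup>2"
    by (metis abs_ge_zero power2_abs power_mono)
  also have "\<dots> \<le> (\<Sum>i\<in>I. (cmod (f i))\<^sup>2) * (\<Sum>i\<in>I. (cmod (g i))\<^sup>2)"
    by (rule Cauchy_Schwarz_ineq_sum)
  finally show ?thesis .
qed

lemma cauchy_schwarz_cnj2:
  fixes f g :: "'i::finite \<Rightarrow> 'j::finite \<Rightarrow> complex"
  shows "(Re (\<Sum>*i j. f i j * cnj (g i j)))\<^sup>2
    \<le> (\<Sum>*i j. (cmod (f i j))\<^sup>2) * (\<Sum>*i j. (cmod (g i j))\<^sup>2)"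
  using cauchy_schwarz_cnj[of "\<lambda>(i, j). f i j" "\<lambda>(i, j). g i j" "UNIV \<times> UNIV"]
  by (simp add: sum.cartesian_product split_beta del: UNIV_Times_UNIV)

lemma cauchy_schwarz_cnj3:
  fixes f g :: "'i::finite \<Rightarrow> 'j::finite \<Rightarrow> 'k::finite \<Rightarrow> complex"
  shows "(Re (\<Sum>*i j k. f i j k * cnj (g i j k)))\<^sup>2
    \<le> (\<Sum>*i j k. (cmod (f i j k))\<^sup>2) * (\<Sum>*i j k. (cmod (g i j k))\<^sup>2)"
  using cauchy_schwarz_cnj[of "\<lambda>(i, j, k). f i j k" "\<lambda>(i, j, k). g i j k" "UNIV \<times> UNIV \<times> UNIV"]
  by (simp add: sum.cartesian_product split_beta del: UNIV_Times_UNIV)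

lemma cauchy_schwarz_cnj4:
  fixes f g :: "'i::finite \<Rightarrow> 'j::finite \<Rightarrow> 'k::finite \<Rightarrow> 'l::finite \<Rightarrow> complex"
  shows "(Re (\<Sum>*i j k l. f i j k l * cnj (g i j k l)))\<^sup>2
    \<le> (\<Sum>*i j k l. (cmod (f i j k l))\<^sup>2) * (\<Sum>*i j k l. (cmod (g i j k l))\<^sup>2)"
  using cauchy_schwarz_cnj[of "\<lambda>(i, j, k, l). f i j k l" "\<lambda>(i, j, k, l). g i j k l" "UNIV \<times> UNIV \<times> UNIV \<times> UNIV"]
  by (simp add: sum.cartesian_product split_beta del: UNIV_Times_UNIV)

lemma mult_cnj_cmod: "z * cnj z = complex_of_real ((cmod z)\<^sup>2)" "cnj z * z = complex_of_real ((cmod z)\<^sup>2)"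
  using complex_norm_square[of z] by (simp_all add: mult.commute)

text \<open>E models the traceless Ricci tensor in a unitary frame; in terms of the
  \<open>t2\<close> defined next, |E|^2 = 2 t2.\<close>

locale traceless_hermitian =
  fixes E :: "'m::finite \<Rightarrow> 'm \<Rightarrow> complex" and m :: real
  assumes m: "m = real CARD('m)"
    and herm: "\<And>i j. cnj (E i j) = E j i"
    and traceless: "(\<Sum>*i. E i i) = 0"
    and card_ge_2: "CARD('m) \<ge> 2"
begin

definition "t2 = (\<Sum>*i j. (cmod (E i j))\<^sup>2)"

lemma t2_nonneg: "t2 \<ge> 0" unfolding t2_def by (intro sum_nonneg) simp

lemma m_ge_2: "m \<ge> 2" using card_ge_2 by (simp add: m)

definition app :: "('m \<Rightarrow> complex) \<Rightarrow> 'm \<Rightarrow> complex" where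
  "app x i = (\<Sum>*j. E i j * x j)"

definition nsq :: "('m \<Rightarrow> complex) \<Rightarrow> real" where
  "nsq x = (\<Sum>*i. (cmod (x i))\<^sup>2)"

lemma nsq_nonneg: "nsq x \<ge> 0" unfolding nsq_def by (intro sum_nonneg) simp

lemma nsq_cnj: "(\<Sum>*i. x i * cnj (x i)) = of_real (nsq x)" "(\<Sum>*i. cnj (x i) * x i) = of_real (nsq x)"
  by (simp_all add: nsq_def mult_cnj_cmod)

lemma t2_E: "(\<Sum>*i j. E i j * E j i) = of_real t2"
proof -
  have "(\<Sum>*i j. E i j * E j i) = (\<Sum>*i j. E i j * cnj (E i j))" by (simp only: herm)
  then show ?thesis by (simp add: t2_def mult_cnj_cmod)
qed

lemma cnj_app: "cnj (app x i) = (\<Sum>*j. cnj (x j) * E j i)"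
  by (simp add: app_def herm mult.commute)

text \<open>The eigenvalue bound \<lambda>^2 <= (m-1)/m tr E^2 for traceless Hermitian matrices, by
  duality: |Ex|^2 is the product of E with a traceless Hermitian matrix Y built from x and Ex, and
  Cauchy-Schwarz leaves the norm of Y.\<close>

lemma app_bound: "m * nsq (app x) \<le> (m - 1) * nsq x * t2"
proof -
  define y where "y = app x"
  define \<alpha> where "\<alpha> = (\<Sum>*i. y i * cnj (x i))"
  define c where "c = \<alpha> / of_real m"
  \<comment> \<open>The Hermitian part of y x^* with its trace removed; c is the trace divided by
    m.\<close>
  define Y where "Y i j = (y i * cnj (x j) + x i * cnj (y j)) / 2 - (if i = j then c else 0)" for i j
  have \<alpha>_alt: "\<alpha> = (\<Sum>*i j. cnj (x i) * E i j * x j)"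
    by (simp add: \<alpha>_def y_def app_def sum_distrib_left ac_simps)
  have "cnj \<alpha> = (\<Sum>*i j. cnj (x j) * E j i * x i)"
    by (simp add: \<alpha>_alt herm ac_simps)
  also have "\<dots> = \<alpha>" unfolding \<alpha>_alt by (rule sum.swap)
  finally have cnj_\<alpha>: "cnj \<alpha> = \<alpha>" .
  then obtain r where \<alpha>r: "\<alpha> = complex_of_real r" by (metis Reals_cases Reals_cnj_iff)
  have cnj_c: "cnj c = c" by (simp add: c_def cnj_\<alpha>)
  have xy: "(\<Sum>*i. x i * cnj (y i)) = \<alpha>" using cnj_\<alpha> by (simp add: \<alpha>_def mult.commute)
  have EY: "(\<Sum>*i j. E i j * cnj (Y i j)) = of_real (nsq y)"
  proof -
    have 1: "(\<Sum>*i j. E i j * (cnj (y i) * x j)) = of_real (nsq y)"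
    proof -
      have "(\<Sum>*j. E i j * (k * x j)) = k * y i" for i k
        by (simp add: y_def app_def sum_distrib_left ac_simps)
      then show ?thesis by (simp only: nsq_cnj)
    qed
    have "(\<Sum>*i j. E i j * (cnj (x i) * y j)) = (\<Sum>*j i. E i j * (cnj (x i) * y j))"
      by (rule sum.swap)
    also have "\<dots> = (\<Sum>*j. cnj (y j) * y j)"
    proof -
      have "(\<Sum>*i. E i j * (cnj (x i) * k)) = cnj (y j) * k" for j k
        by (simp add: y_def cnj_app sum_distrib_left ac_simps)
      then show ?thesis by (simp only:)
    qed
    finally have 2: "(\<Sum>*i j. E i j * (cnj (x i) * y j)) = of_real (nsq y)" by (simp add: nsq_cnj)
    have 3: "(\<Sum>*i j. E i j * (if i = j then c else 0)) = 0"
    proof -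
      have "(\<Sum>*i j. E i j * (if i = j then c else 0)) = (\<Sum>*i. E i i) * c"
        by (simp add: if_distrib sum_distrib_right cong: if_cong)
      then show ?thesis by (simp add: traceless)
    qed
    have "E i j * cnj (Y i j) = (1/2) * (E i j * (cnj (y i) * x j)) + (1/2) * (E i j * (cnj (x i) * y j)) - E i j * (if i = j then c else 0)" for i j
      by (simp add: Y_def cnj_c field_simps)
    then have "(\<Sum>*i j. E i j * cnj (Y i j)) = (1/2) * of_real (nsq y) + (1/2) * of_real (nsq y)"
      by (simp only: sum.distrib sum_subtractf sum_distrib_left[symmetric] 1 2 3) simp
    then show ?thesis by simp
  qed
  have YY: "(\<Sum>*i j. (cmod (Y i j))\<^sup>2) = (nsq y * nsq x + (Re \<alpha>)\<^sup>2) / 2 - (Re \<alpha>)\<^sup>2 / m"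
  proof -
    have e: "Y i j * cnj (Y i j) = (1/4) * ((y i * cnj (y i)) * (cnj (x j) * x j)) + (1/4) * ((y i * cnj (x i)) * (y j * cnj (x j)))
        + (1/4) * ((x i * cnj (y i)) * (x j * cnj (y j))) + (1/4) * ((x i * cnj (x i)) * (cnj (y j) * y j))
        - (if i = j then c * (y i * cnj (x i)) + c * (x i * cnj (y i)) - c * c else 0)" for i j
      by (cases "i = j") (simp_all add: Y_def cnj_c field_simps)
    have d: "(\<Sum>*i j. if i = j then c * (y i * cnj (x i)) + c * (x i * cnj (y i)) - c * c else 0)
       = 2 * c * \<alpha> - of_real m * (c * c)"
      by (simp add: sum.distrib sum_subtractf sum_distrib_left[symmetric] xy \<alpha>_def[symmetric] m)
    have "(\<Sum>*i j. Y i j * cnj (Y i j))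
      = (1/4) * (of_real (nsq y) * of_real (nsq x)) + (1/4) * (\<alpha> * \<alpha>) + (1/4) * (\<alpha> * \<alpha>) + (1/4) * (of_real (nsq x) * of_real (nsq y))
        - (2 * c * \<alpha> - of_real m * (c * c))"
      unfolding e sum.distrib sum_subtractf d sum_distrib_left[symmetric] sum_distrib_right[symmetric]
        nsq_cnj xy \<alpha>_def[symmetric] ..
    also have "\<dots> = of_real ((nsq y * nsq x + (Re \<alpha>)\<^sup>2) / 2 - (Re \<alpha>)\<^sup>2 / m)"
      using m_ge_2 unfolding c_def \<alpha>r by (simp add: field_simps power2_eq_square)
    finally have "complex_of_real (\<Sum>*i j. (cmod (Y i j))\<^sup>2) = of_real ((nsq y * nsq x + (Re \<alpha>)\<^sup>2) / 2 - (Re \<alpha>)\<^sup>2 / m)"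
      by (simp add: mult_cnj_cmod)
    then show ?thesis by (simp only: of_real_eq_iff)
  qed
  have "(Re \<alpha>)\<^sup>2 \<le> nsq y * nsq x"
    using cauchy_schwarz_cnj[of y x UNIV] by (simp add: \<alpha>_def nsq_def)
  \<comment> \<open>The place where m >= 2 enters: the coefficient of \<alpha>^2 in the norm of Y
    must not be negative.\<close>
  then have "((1/2) - 1 / m) * (Re \<alpha>)\<^sup>2 \<le> ((1/2) - 1 / m) * (nsq y * nsq x)"
    using m_ge_2 by (intro mult_left_mono) (auto simp: field_simps)
  then have "(\<Sum>*i j. (cmod (Y i j))\<^sup>2) \<le> (1 - 1 / m) * (nsq y * nsq x)"
    unfolding YY by (simp add: left_diff_distrib add_divide_distrib)
  then have "t2 * (\<Sum>*i j. (cmod (Y i j))\<^sup>2) \<le> t2 * ((1 - 1 / m) * (nsq y * nsq x))"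
    by (rule mult_left_mono) (rule t2_nonneg)
  moreover have "(nsq y)\<^sup>2 \<le> t2 * (\<Sum>*i j. (cmod (Y i j))\<^sup>2)"
    using cauchy_schwarz_cnj2[of E Y] unfolding EY by (simp add: t2_def)
  ultimately have le: "nsq y * nsq y \<le> nsq y * (t2 * (1 - 1 / m) * nsq x)"
    by (simp add: power2_eq_square ac_simps)
  show ?thesis
  proof (cases "nsq y = 0")
    case True
    then show ?thesis using nsq_nonneg[of x] t2_nonneg m_ge_2 by (simp add: y_def[symmetric])
  next
    case False
    then have "nsq y \<le> t2 * (1 - 1 / m) * nsq x"
      using le nsq_nonneg[of y] by (metis less_eq_real_def mult_le_cancel_left_pos)
    then show ?thesis using m_ge_2 by (simp add: y_def[symmetric] field_simps)
  qed
qed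

text \<open>The refined Kato inequality: project \<open>x \<otimes> E\<close> to the tensors with the symmetries of the covariant
  derivative \<open>T\<close> of \<open>E\<close>.\<close>

lemma kato:
  fixes T :: "'m \<Rightarrow> 'm \<Rightarrow> 'm \<Rightarrow> complex"
  assumes sym: "\<And>g a b. T g a b = T a g b" and tr: "\<And>g. (\<Sum>*a. T g a a) = 0"
  defines "x \<equiv> \<lambda>g. \<Sum>*a b. E b a * T g a b"
  shows "(m + 1) * nsq x \<le> m * t2 * (\<Sum>*g a b. (cmod (T g a b))\<^sup>2)"
proof -
  define y where "y = app x"
  \<comment> \<open>The value that makes Z trace free: the corrections have the traces m y and y,
    against y / 2 from the main part.\<close>
  define c where "c = 1 / (2 * (complex_of_real m + 1))"
  have mc: "complex_of_real m + 1 \<noteq> 0" using m_ge_2 by (simp add: complex_eq_iff)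
  have cnj_c: "cnj c = c" by (simp add: c_def)
  define d where "d a b = (if a = b then 1 else 0 :: complex)" for a b :: 'm
  have cnj_d: "cnj (d a b) = d a b" for a b by (simp add: d_def)
  define Z where "Z g a b = (x g * E a b + x a * E g b) / 2 - c * (y g * d a b + y a * d g b)" for g a b
  have Z1: "(\<Sum>*a. Z g a a) = 0" for g
  proof -
    have "(\<Sum>*a. Z g a a) = (1/2) * (x g * (\<Sum>*a. E a a) + (\<Sum>*a. E g a * x a))
        - c * (y g * (\<Sum>*a. d a a) + (\<Sum>*a. y a * d g a))"
      by (simp add: Z_def sum_subtractf sum.distrib add_divide_distrib sum_divide_distrib sum_distrib_left distrib_left ac_simps)
    also have "(\<Sum>*a. y a * d g a) = y g" by (simp add: d_def if_distrib cong: if_cong)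
    also have "(\<Sum>*a. d a a) = complex_of_real m" by (simp add: d_def m)
    also have "(\<Sum>*a. E g a * x a) = y g" by (simp add: y_def app_def)
    finally have "(\<Sum>*a. Z g a a) = 1 / 2 * (x g * (\<Sum>*a. E a a) + y g) - c * (y g * of_real m + y g)" .
    moreover have "c * (y g * of_real m + y g) = y g / 2"
    proof -
      have "1 / (2 * k) * (Y * k) = Y / 2" if "k \<noteq> 0" for k Y :: complex using that by simp
      from this[OF mc, of "y g"] show ?thesis by (simp only: c_def distrib_left mult_1_right)
    qed
    ultimately show ?thesis by (simp add: traceless)
  qed
  have Zsym: "Z g a b = Z a g b" for g a b by (simp add: Z_def ac_simps add.commute)
  \<comment> \<open>The corrections pair with W through its traces. The second trace becomes the
    first after exchanging g and a.\<close>
  have orth: "(\<Sum>*g a b. W g a b * cnj (y g * d a b)) = 0"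
    "(\<Sum>*g a b. W g a b * cnj (y a * d g b)) = 0"
    if W: "\<And>g. (\<Sum>*a. W g a a) = 0" "\<And>g a b. W g a b = W a g b" for W
  proof -
    have "(\<Sum>*g a b. W g a b * cnj (y g * d a b)) = (\<Sum>*g. cnj (y g) * (\<Sum>*a. W g a a))"
      by (simp add: d_def if_distrib sum_distrib_left mult.commute cong: if_cong)
    then show 1: "(\<Sum>*g a b. W g a b * cnj (y g * d a b)) = 0" by (simp add: W(1))
    have "(\<Sum>*g a b. W g a b * cnj (y a * d g b)) = (\<Sum>*a g b. W g a b * cnj (y a * d g b))"
      by (rule sum.swap)
    also have "\<dots> = (\<Sum>*a g b. W a g b * cnj (y a * d g b))"
      by (simp only: W(2))
    finally show "(\<Sum>*g a b. W g a b * cnj (y a * d g b)) = 0" using 1 by simp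
  qed
  have cnj_Z: "cnj (Z g a b) = (1/2) * (cnj (x g) * E b a) + (1/2) * (cnj (x a) * E b g) - c * cnj (y g * d a b) - c * cnj (y a * d g b)" for g a b
    by (simp add: Z_def herm cnj_c field_simps)
  \<comment> \<open>Against a tensor with the symmetries of T the corrections drop out and the two
    halves of the main part agree, so Z pairs like x \<otimes> E. Applied to T this gives |x|^2,
    applied to Z itself the norm of Z.\<close>
  have pair: "(\<Sum>*g a b. W g a b * cnj (Z g a b)) = (\<Sum>*g. cnj (x g) * (\<Sum>*a b. E b a * W g a b))"
    if W: "\<And>g. (\<Sum>*a. W g a a) = 0" "\<And>g a b. W g a b = W a g b" for W
  proof -
    have 1: "(\<Sum>*g a b. W g a b * (cnj (x g) * E b a)) = (\<Sum>*g. cnj (x g) * (\<Sum>*a b. E b a * W g a b))"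
      by (simp add: sum_distrib_left ac_simps)
    have "(\<Sum>*g a b. W g a b * (cnj (x a) * E b g)) = (\<Sum>*a g b. W g a b * (cnj (x a) * E b g))"
      by (rule sum.swap)
    also have "\<dots> = (\<Sum>*a g b. W a g b * (cnj (x a) * E b g))" by (simp only: W(2))
    also have "\<dots> = (\<Sum>*g. cnj (x g) * (\<Sum>*a b. E b a * W g a b))" by (rule 1)
    finally have 2: "(\<Sum>*g a b. W g a b * (cnj (x a) * E b g)) = (\<Sum>*g. cnj (x g) * (\<Sum>*a b. E b a * W g a b))" .
    have "W g a b * cnj (Z g a b) = (1/2) * (W g a b * (cnj (x g) * E b a)) + (1/2) * (W g a b * (cnj (x a) * E b g))
       - c * (W g a b * cnj (y g * d a b)) - c * (W g a b * cnj (y a * d g b))" for g a b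
      unfolding cnj_Z by (simp add: field_simps)
    then show ?thesis
      by (simp only: sum.distrib sum_subtractf sum_distrib_left[symmetric] 1 2 orth[OF W]) simp
  qed
  define NT where "NT = (\<Sum>*g a b. (cmod (T g a b))\<^sup>2)"
  define NZ where "NZ = (\<Sum>*g a b. (cmod (Z g a b))\<^sup>2)"
  have NT0: "NT \<ge> 0" unfolding NT_def by (intro sum_nonneg) simp
  have TZ: "(\<Sum>*g a b. T g a b * cnj (Z g a b)) = of_real (nsq x)"
  proof -
    have "(\<Sum>*a b. E b a * T g a b) = x g" for g by (simp add: x_def)
    then show ?thesis unfolding pair[OF tr sym] by (simp only: nsq_cnj)
  qed
  have EZ: "(\<Sum>*a b. E b a * Z g a b) = x g * of_real (t2 / 2) + (1/2 - c) * (\<Sum>*b. E g b * y b)" for g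
  proof -
    have 1: "(\<Sum>*a b. E b a * E a b) = of_real t2" by (subst sum.swap) (rule t2_E)
    have 2: "(\<Sum>*a b. E b a * (x a * E g b)) = (\<Sum>*b. E g b * y b)"
      by (subst sum.swap) (simp add: y_def app_def sum_distrib_left ac_simps)
    have 3: "(\<Sum>*a b. E b a * (y g * d a b)) = 0"
    proof -
      have "(\<Sum>*a b. E b a * (y g * d a b)) = (\<Sum>*a. E a a) * y g"
        by (simp add: d_def if_distrib sum_distrib_right cong: if_cong)
      then show ?thesis by (simp add: traceless)
    qed
    have 4: "(\<Sum>*a b. E b a * (y a * d g b)) = (\<Sum>*b. E g b * y b)"
      by (simp add: d_def if_distrib cong: if_cong)
    have "E b a * Z g a b = (x g / 2) * (E b a * E a b) + (1/2) * (E b a * (x a * E g b)) - c * (E b a * (y g * d a b)) - c * (E b a * (y a * d g b))" for a b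
      by (simp add: Z_def field_simps)
    then have "(\<Sum>*a b. E b a * Z g a b) = (x g / 2) * of_real t2 + (1/2) * (\<Sum>*b. E g b * y b) - c * 0 - c * (\<Sum>*b. E g b * y b)"
      by (simp only: sum.distrib sum_subtractf sum_distrib_left[symmetric] 1 2 3 4)
    then show ?thesis by (simp add: field_simps)
  qed
  have yy: "(\<Sum>*g. cnj (x g) * (\<Sum>*b. E g b * y b)) = of_real (nsq y)"
  proof -
    have "(\<Sum>*g. cnj (x g) * (\<Sum>*b. E g b * y b)) = (\<Sum>*b. (\<Sum>*g. cnj (x g) * E g b) * y b)"
      unfolding sum_distrib_left sum_distrib_right by (subst sum.swap) (simp add: ac_simps)
    also have "\<dots> = (\<Sum>*b. cnj (y b) * y b)" by (simp only: y_def cnj_app)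
    finally show ?thesis by (simp add: nsq_cnj)
  qed
  have "(\<Sum>*g a b. Z g a b * cnj (Z g a b))
     = (\<Sum>*g. of_real (t2 / 2) * (cnj (x g) * x g) + (1/2 - c) * (cnj (x g) * (\<Sum>*b. E g b * y b)))"
    unfolding pair[OF Z1 Zsym] EZ by (simp add: algebra_simps)
  also have "\<dots> = of_real (t2 / 2) * of_real (nsq x) + (1/2 - c) * of_real (nsq y)"
    by (simp only: sum.distrib sum_distrib_left[symmetric] nsq_cnj yy)
  also have "\<dots> = of_real (t2 / 2 * nsq x + (1/2 - 1 / (2 * (m + 1))) * nsq y)" by (simp add: c_def)
  finally have "complex_of_real NZ = of_real (t2 / 2 * nsq x + (1/2 - 1 / (2 * (m + 1))) * nsq y)"
    by (simp add: NZ_def mult_cnj_cmod)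
  then have NZ: "NZ = t2 / 2 * nsq x + (1/2 - 1 / (2 * (m + 1))) * nsq y" by (simp only: of_real_eq_iff)
  \<comment> \<open>\<open>app_bound\<close> produces the Kato constant: 1/2 + m/(2(m+1)) times
    (m-1)/m equals m/(m+1).\<close>
  have NZ_le: "NZ \<le> m / (m + 1) * (t2 * nsq x)"
  proof -
    have y: "nsq y \<le> (m - 1) / m * (nsq x * t2)" using app_bound[of x] m_ge_2 by (simp add: y_def field_simps)
    have "(1/2 - 1 / (2 * (m + 1))) * nsq y \<le> (1/2 - 1 / (2 * (m + 1))) * ((m - 1) / m * (nsq x * t2))"
      by (rule mult_left_mono[OF y]) (use m_ge_2 in \<open>simp add: field_simps\<close>)
    also have "(1/2 - 1 / (2 * (m + 1))) * ((m - 1) / m * (nsq x * t2)) = (m / (m + 1) - 1/2) * (t2 * nsq x)"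
      using m_ge_2 by (simp add: divide_simps)
    finally show ?thesis unfolding NZ by (simp add: algebra_simps)
  qed
  have "(nsq x)\<^sup>2 \<le> NT * NZ"
    using cauchy_schwarz_cnj3[of T Z] unfolding TZ by (simp add: NT_def NZ_def)
  also have "\<dots> \<le> NT * (m / (m + 1) * (t2 * nsq x))" by (rule mult_left_mono[OF NZ_le NT0])
  finally have le: "nsq x * nsq x \<le> nsq x * (NT * (m / (m + 1) * t2))" by (simp add: power2_eq_square ac_simps)
  have "nsq x \<le> NT * (m / (m + 1) * t2)"
  proof (cases "nsq x = 0")
    case True
    then show ?thesis using NT0 t2_nonneg m_ge_2 by simp
  next
    case False
    then show ?thesis using le nsq_nonneg[of x] by (metis less_eq_real_def mult_le_cancel_left_pos)
  qed
  then have "(m + 1) * nsq x \<le> (m + 1) * (NT * (m / (m + 1) * t2))" using m_ge_2 by (intro mult_left_mono) auto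
  also have "\<dots> = m * t2 * NT" using m_ge_2 by (simp add: field_simps)
  finally show ?thesis by (simp add: NT_def)
qed

definition "E2 i j = (\<Sum>*k. E i k * E k j)"

definition "t4 = (\<Sum>*i j. (cmod (E2 i j))\<^sup>2)"

lemma cnj_E2: "cnj (E2 i j) = E2 j i"
  by (simp add: E2_def herm mult.commute)

text \<open>In matrix terms tr E^4 <= (tr E^2)^2, by Cauchy-Schwarz for each entry of E^2.\<close>

lemma t4_le: "t4 \<le> t2\<^sup>2"
proof -
  have "(cmod (E2 i j))\<^sup>2 \<le> (\<Sum>*k. (cmod (E i k))\<^sup>2) * (\<Sum>*k. (cmod (E k j))\<^sup>2)" for i j
  proof -
    have "cmod (E2 i j) \<le> (\<Sum>*k. cmod (E i k) * cmod (E k j))"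
      unfolding E2_def by (rule order.trans[OF norm_sum]) (simp add: norm_mult)
    then have "(cmod (E2 i j))\<^sup>2 \<le> (\<Sum>*k. cmod (E i k) * cmod (E k j))\<^sup>2" by (simp add: power_mono)
    also have "\<dots> \<le> (\<Sum>*k. (cmod (E i k))\<^sup>2) * (\<Sum>*k. (cmod (E k j))\<^sup>2)" by (rule Cauchy_Schwarz_ineq_sum)
    finally show ?thesis .
  qed
  then have "t4 \<le> (\<Sum>*i j. (\<Sum>*k. (cmod (E i k))\<^sup>2) * (\<Sum>*k. (cmod (E k j))\<^sup>2))"
    unfolding t4_def by (intro sum_mono)
  also have "\<dots> = t2 * (\<Sum>*j k. (cmod (E k j))\<^sup>2)" by (simp add: t2_def sum_product)
  also have "(\<Sum>*j k. (cmod (E k j))\<^sup>2) = t2" unfolding t2_def by (rule sum.swap)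
  finally show ?thesis by (simp add: power2_eq_square)
qed

lemma trace_cube_bound: "\<bar>Re (\<Sum>*i j. E2 i j * E j i)\<bar> \<le> t2 * sqrt t2"
proof -
  have "(Re (\<Sum>*i j. E2 i j * cnj (E i j)))\<^sup>2 \<le> t4 * t2"
    using cauchy_schwarz_cnj2[of E2 E] by (simp add: t4_def t2_def)
  also have "\<dots> \<le> t2\<^sup>2 * t2" by (rule mult_right_mono[OF t4_le t2_nonneg])
  finally have "\<bar>Re (\<Sum>*i j. E2 i j * E j i)\<bar> \<le> sqrt (t2\<^sup>2 * t2)"
    by (simp only: herm) (metis real_sqrt_abs real_sqrt_le_mono)
  then show ?thesis using t2_nonneg by (simp add: real_sqrt_mult)
qed

text \<open>Only the component S of E \<otimes> E with the symmetries and the vanishing traces of B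
  contributes to the pairing. The constant bounds the squared norm of S; its square root is the
  \<open>\<kappa>\<close> of the main estimate.\<close>

lemma bochner_bound:
  fixes B :: "'m \<Rightarrow> 'm \<Rightarrow> 'm \<Rightarrow> 'm \<Rightarrow> complex"
  assumes sym1: "\<And>a b c d. B a b c d = B c b a d" and sym2: "\<And>a b c d. B a b c d = B a d c b"
    and tr: "\<And>a b. (\<Sum>*c. B a b c c) = 0"
  shows "(Re (\<Sum>*a b c d. B a b c d * (E b a * E d c)))\<^sup>2
    \<le> (\<Sum>*a b c d. (cmod (B a b c d))\<^sup>2)
       * ((2 * m\<^sup>2 + 4 * m + 3) / (2 * (m + 1) * (m + 2)) * t2\<^sup>2)"
proof -
  define d where "d a b = (if a = b then 1 else 0 :: complex)" for a b :: 'm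
  have cnj_d: "cnj (d a b) = d b a" for a b by (simp add: d_def)
  \<comment> \<open>The trace of the correction A. Trace freeness of S demands (m+2) A + \<mu> d =
    E^2 / 2, and the trace of this equation is (2m+2) \<mu> = t2 / 2.\<close>
  define \<mu> where "\<mu> = t2 / (4 * (m + 1))"
  define A where "A i j = (E2 i j / 2 - of_real \<mu> * d i j) / (of_real m + 2)" for i j
  have cnj_A: "cnj (A i j) = A j i" for i j by (simp add: A_def cnj_E2 cnj_d)
  have m2: "complex_of_real m + 2 \<noteq> 0" using m_ge_2 by (simp add: complex_eq_iff)
  have trE2: "(\<Sum>*i. E2 i i) = of_real t2" unfolding E2_def by (rule t2_E)
  have trd: "(\<Sum>*i. d i i) = of_real m" by (simp add: d_def m)
  have trA: "(\<Sum>*i. A i i) = of_real \<mu>"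
  proof -
    have "(\<Sum>*i. A i i) = ((\<Sum>*i. E2 i i) / 2 - of_real \<mu> * (\<Sum>*i. d i i)) / (of_real m + 2)"
      by (simp add: A_def sum_divide_distrib[symmetric] sum_subtractf sum_distrib_left)
    also have "\<dots> = of_real ((t2 / 2 - \<mu> * m) / (m + 2))" by (simp add: trE2 trd)
    also have "(t2 / 2 - \<mu> * m) / (m + 2) = \<mu>"
    proof -
      have "t2 = 4 * (m + 1) * \<mu>" using m_ge_2 by (simp add: \<mu>_def)
      then have "t2 / 2 - \<mu> * m = \<mu> * (m + 2)" by (simp add: algebra_simps)
      then show ?thesis using m_ge_2 by simp
    qed
    finally show ?thesis .
  qed
  define S where "S a b c e = (E a b * E c e + E c b * E a e) / 2 - (A a b * d c e + A c b * d a e + d a b * A c e + d c b * A a e)" for a b c e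
  have S_sym1: "S a b c e = S c b a e" and S_sym2: "S a b c e = S a e c b" for a b c e
    by (simp_all add: S_def algebra_simps)
  have S_tr: "(\<Sum>*c. S a b c c) = 0" for a b
  proof -
    have "(\<Sum>*c. S a b c c) = (E a b * (\<Sum>*c. E c c) + (\<Sum>*c. E a c * E c b)) / 2
       - (A a b * (\<Sum>*c. d c c) + (\<Sum>*c. A c b * d a c) + d a b * (\<Sum>*c. A c c) + (\<Sum>*c. d c b * A a c))"
      by (simp add: S_def sum_subtractf sum.distrib sum_divide_distrib[symmetric] sum_distrib_left mult.commute)
    also have "(\<Sum>*c. A c b * d a c) = A a b" by (simp add: d_def if_distrib cong: if_cong)
    also have "(\<Sum>*c. d c b * A a c) = A a b" by (simp add: d_def if_distrib if_distribR cong: if_cong)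
    also have "(\<Sum>*c. E a c * E c b) = E2 a b" by (simp add: E2_def)
    finally have "(\<Sum>*c. S a b c c) = E2 a b / 2 - ((of_real m + 2) * A a b + of_real \<mu> * d a b)"
      by (simp add: traceless trd trA algebra_simps)
    moreover have "(of_real m + 2) * A a b = E2 a b / 2 - of_real \<mu> * d a b" using m2 by (simp add: A_def)
    ultimately show ?thesis by simp
  qed
  \<comment> \<open>S is an orthogonal projection: a tensor with the symmetries and vanishing traces
    of B sees only the E \<otimes> E part of S.\<close>
  have contr: "(\<Sum>*a b c e. W a b c e * cnj (S a b c e))
      = (\<Sum>*a b c e. W a b c e * (E b a * E e c))"
    if W: "\<And>a b c d. W a b c d = W c b a d" "\<And>a b c d. W a b c d = W a d c b" "\<And>a b. (\<Sum>*c. W a b c c) = 0" for W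
  proof -
    have swp13: "(\<Sum>*a b c e. W a b c e * f a b c e) = (\<Sum>*a b c e. W a b c e * f c b a e)" for f
    proof -
      have "(\<Sum>*a b c e. W a b c e * f a b c e) = (\<Sum>*b a c e. W a b c e * f a b c e)"
        by (rule sum.swap)
      also have "\<dots> = (\<Sum>*b c a e. W a b c e * f a b c e)"
        by (rule sum.cong[OF refl], rule sum.swap)
      also have "\<dots> = (\<Sum>*b a c e. W a b c e * f c b a e)"
        by (simp only: W(1))
      also have "\<dots> = (\<Sum>*a b c e. W a b c e * f c b a e)"
        by (rule sum.swap)
      finally show ?thesis .
    qed
    have swp24: "(\<Sum>*a b c e. W a b c e * f a b c e) = (\<Sum>*a b c e. W a b c e * f a e c b)" for f
    proof -
      have "(\<Sum>*a b c e. W a b c e * f a b c e) = (\<Sum>*a c b e. W a b c e * f a b c e)"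
        by (rule sum.cong[OF refl], rule sum.swap)
      also have "\<dots> = (\<Sum>*a c e b. W a b c e * f a b c e)"
        by (rule sum.cong[OF refl], rule sum.cong[OF refl], rule sum.swap)
      also have "\<dots> = (\<Sum>*a c b e. W a b c e * f a e c b)"
        by (simp only: W(2))
      also have "\<dots> = (\<Sum>*a b c e. W a b c e * f a e c b)"
        by (rule sum.cong[OF refl], rule sum.swap)
      finally show ?thesis .
    qed
    have g1: "(\<Sum>*a b c e. W a b c e * (A b a * d e c)) = 0"
    proof -
      have "(\<Sum>*a b c e. W a b c e * (A b a * d e c)) = (\<Sum>*a b. A b a * (\<Sum>*c. W a b c c))"
        by (simp add: d_def if_distrib sum_distrib_left mult.commute cong: if_cong)
      then show ?thesis by (simp add: W(3))
    qed
    have g2: "(\<Sum>*a b c e. W a b c e * (A b c * d e a)) = 0"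
      using swp13[of "\<lambda>a b c e. A b a * d e c"] g1 by simp
    have g4: "(\<Sum>*a b c e. W a b c e * (A e a * d b c)) = 0"
      using swp24[of "\<lambda>a b c e. A b a * d e c"] g1 by simp
    have g3: "(\<Sum>*a b c e. W a b c e * (A e c * d b a)) = 0"
      using swp13[of "\<lambda>a b c e. A e a * d b c"] g4 by simp
    have q: "(\<Sum>*a b c e. W a b c e * (E b c * E e a)) = (\<Sum>*a b c e. W a b c e * (E b a * E e c))"
      using swp13[of "\<lambda>a b c e. E b a * E e c"] by simp
    have "W a b c e * cnj (S a b c e) = (1/2) * (W a b c e * (E b a * E e c)) + (1/2) * (W a b c e * (E b c * E e a))
       - W a b c e * (A b a * d e c) - W a b c e * (A b c * d e a) - W a b c e * (A e c * d b a) - W a b c e * (A e a * d b c)" for a b c e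
      by (simp add: S_def herm cnj_A cnj_d field_simps)
    then show ?thesis
      by (simp only: sum.distrib sum_subtractf sum_distrib_left[symmetric] g1 g2 g3 g4 q) simp
  qed
  define NS where "NS = (\<Sum>*a b c e. (cmod (S a b c e))\<^sup>2)"
  have t4E: "(\<Sum>*a b. E2 a b * E2 b a) = of_real t4"
    unfolding t4_def of_real_sum mult_cnj_cmod[symmetric] cnj_E2 ..
  have SE: "(\<Sum>*a b c e. S a b c e * (E b a * E e c))
    = of_real ((t2\<^sup>2 + t4) / 2 - 2 * ((t4 / 2 - \<mu> * t2) / (m + 2)))"
  proof -
    have 1: "(\<Sum>*a b c e. (E a b * E b a) * (E c e * E e c)) = of_real t2 * of_real t2"
      by (simp only: sum_distrib_left[symmetric] sum_distrib_right[symmetric] t2_E)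
    have 2: "(\<Sum>*a b c e. E c b * E a e * (E b a * E e c)) = of_real t4"
    proof -
      have "(\<Sum>*a b c e. E c b * E a e * (E b a * E e c)) = (\<Sum>*a c b e. E c b * E a e * (E b a * E e c))"
        by (rule sum.cong[OF refl], rule sum.swap)
      also have "\<dots> = (\<Sum>*a c. (\<Sum>*b. E c b * E b a) * (\<Sum>*e. E a e * E e c))"
        unfolding sum_product by (intro sum.cong refl) (simp add: ac_simps)
      also have "\<dots> = (\<Sum>*a c. E2 a c * E2 c a)" by (simp add: E2_def mult.commute)
      finally show ?thesis by (simp add: t4E)
    qed
    have EA: "(\<Sum>*a b. A a b * E2 b a) = of_real ((t4 / 2 - \<mu> * t2) / (m + 2))"
    proof -
      have "A a b * E2 b a = (1 / (of_real m + 2)) * ((1/2) * (E2 a b * E2 b a) - of_real \<mu> * (d a b * E2 b a))" for a b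
        by (simp add: A_def field_simps)
      then have "(\<Sum>*a b. A a b * E2 b a) = (1 / (of_real m + 2)) * ((1/2) * of_real t4 - of_real \<mu> * (\<Sum>*a b. d a b * E2 b a))"
        by (simp only: sum_subtractf sum_distrib_left[symmetric] t4E)
      also have "(\<Sum>*a b. d a b * E2 b a) = of_real t2"
        unfolding trE2[symmetric] by (simp add: d_def if_distrib if_distribR cong: if_cong)
      finally show ?thesis by simp
    qed
    have h1: "(\<Sum>*a b c e. A a b * d c e * (E b a * E e c)) = 0"
    proof -
      have "(\<Sum>*a b c e. A a b * d c e * (E b a * E e c)) = (\<Sum>*a b. A a b * E b a * (\<Sum>*c. E c c))"
        by (simp add: d_def if_distrib if_distribR sum_distrib_left ac_simps cong: if_cong)
      then show ?thesis by (simp add: traceless)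
    qed
    have h3: "(\<Sum>*a b c e. d a b * A c e * (E b a * E e c)) = 0"
    proof -
      have "(\<Sum>*a b c e. d a b * A c e * (E b a * E e c)) = (\<Sum>*a b. (d a b * E b a) * (\<Sum>*c e. A c e * E e c))"
        by (simp only: sum_distrib_left ac_simps)
      also have "\<dots> = (\<Sum>*a b. d a b * E b a) * (\<Sum>*c e. A c e * E e c)"
        by (simp only: sum_distrib_right)
      also have "(\<Sum>*a b. d a b * E b a) = 0"
        using traceless by (simp add: d_def if_distrib if_distribR cong: if_cong)
      finally show ?thesis by simp
    qed
    have h2: "(\<Sum>*a b c e. A c b * d a e * (E b a * E e c)) = (\<Sum>*a b. A a b * E2 b a)"
    proof -
      have "(\<Sum>*a b c e. A c b * d a e * (E b a * E e c)) = (\<Sum>*a b c. A c b * (E b a * E a c))"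
        by (simp add: d_def if_distrib if_distribR cong: if_cong)
      also have "\<dots> = (\<Sum>*a c b. A c b * (E b a * E a c))"
        by (rule sum.cong[OF refl], rule sum.swap)
      also have "\<dots> = (\<Sum>*c a b. A c b * (E b a * E a c))" by (rule sum.swap)
      also have "\<dots> = (\<Sum>*c b a. A c b * (E b a * E a c))"
        by (rule sum.cong[OF refl], rule sum.swap)
      also have "\<dots> = (\<Sum>*c b. A c b * E2 b c)" by (simp only: E2_def sum_distrib_left)
      finally show ?thesis .
    qed
    have h4: "(\<Sum>*a b c e. d c b * A a e * (E b a * E e c)) = (\<Sum>*a b. A a b * E2 b a)"
    proof -
      have "(\<Sum>*a b c e. d c b * A a e * (E b a * E e c)) = (\<Sum>*a b e c. d c b * A a e * (E b a * E e c))"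
        by (rule sum.cong[OF refl], rule sum.cong[OF refl], rule sum.swap)
      also have "\<dots> = (\<Sum>*a b e. A a e * (E b a * E e b))"
        by (simp add: d_def if_distrib if_distribR cong: if_cong)
      also have "\<dots> = (\<Sum>*a e b. A a e * (E b a * E e b))"
        by (rule sum.cong[OF refl], rule sum.swap)
      also have "\<dots> = (\<Sum>*a e. A a e * E2 e a)" by (simp only: E2_def sum_distrib_left ac_simps)
      finally show ?thesis .
    qed
    have "S a b c e * (E b a * E e c) = (1/2) * ((E a b * E b a) * (E c e * E e c)) + (1/2) * (E c b * E a e * (E b a * E e c))
       - A a b * d c e * (E b a * E e c) - A c b * d a e * (E b a * E e c) - d a b * A c e * (E b a * E e c) - d c b * A a e * (E b a * E e c)" for a b c e
      by (simp add: S_def field_simps)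
    then have "(\<Sum>*a b c e. S a b c e * (E b a * E e c))
       = (1/2) * (of_real t2 * of_real t2) + (1/2) * of_real t4 - 0 - of_real ((t4 / 2 - \<mu> * t2) / (m + 2)) - 0 - of_real ((t4 / 2 - \<mu> * t2) / (m + 2))"
      by (simp only: sum.distrib sum_subtractf sum_distrib_left[symmetric] 1 2 h1 h2 h3 h4 EA)
        (simp only: t2_E sum_distrib_right[symmetric])
    then show ?thesis by (simp add: power2_eq_square field_simps)
  qed
  \<comment> \<open>S has these symmetries itself, so its squared norm is its product with E
    \<otimes> E.\<close>
  have "complex_of_real NS = (\<Sum>*a b c e. S a b c e * cnj (S a b c e))"
    by (simp add: NS_def mult_cnj_cmod)
  also have "\<dots> = of_real ((t2\<^sup>2 + t4) / 2 - 2 * ((t4 / 2 - \<mu> * t2) / (m + 2)))"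
    unfolding contr[OF S_sym1 S_sym2 S_tr] by (rule SE)
  finally have NS: "NS = (t2\<^sup>2 + t4) / 2 - 2 * ((t4 / 2 - \<mu> * t2) / (m + 2))" by (simp only: of_real_eq_iff)
  also have "\<dots> = m / (2 * (m + 2)) * t4 + (1/2 + 1 / (2 * (m + 1) * (m + 2))) * t2\<^sup>2"
    using m_ge_2 by (simp add: \<mu>_def divide_simps) (simp add: algebra_simps power2_eq_square)
  \<comment> \<open>The coefficient of t4 is nonnegative, so t4 may be replaced by t2^2; this
    produces the polynomial 2m^2 + 4m + 3.\<close>
  also have "\<dots> \<le> m / (2 * (m + 2)) * t2\<^sup>2 + (1/2 + 1 / (2 * (m + 1) * (m + 2))) * t2\<^sup>2"
    using m_ge_2 by (intro add_mono mult_left_mono t4_le) auto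
  also have "\<dots> = (2 * m\<^sup>2 + 4 * m + 3) / (2 * (m + 1) * (m + 2)) * t2\<^sup>2"
    using m_ge_2 by (simp add: divide_simps) (simp add: algebra_simps power2_eq_square)
  finally have NS_le: "NS \<le> (2 * m\<^sup>2 + 4 * m + 3) / (2 * (m + 1) * (m + 2)) * t2\<^sup>2" .
  have "(Re (\<Sum>*a b c e. B a b c e * cnj (S a b c e)))\<^sup>2
      \<le> (\<Sum>*a b c d. (cmod (B a b c d))\<^sup>2) * NS"
    unfolding NS_def by (rule cauchy_schwarz_cnj4)
  also have "\<dots> \<le> (\<Sum>*a b c d. (cmod (B a b c d))\<^sup>2) * ((2 * m\<^sup>2 + 4 * m + 3) / (2 * (m + 1) * (m + 2)) * t2\<^sup>2)"
    by (intro mult_left_mono[OF NS_le] sum_nonneg) simp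
  finally show ?thesis unfolding contr[OF sym1 sym2 tr] .
qed

end

section \<open>The Weitzenboeck inequality\<close>

lemma
  assumes "open S" "z \<in> S" "\<And>y. y \<in> S \<Longrightarrow> F y = G y"
  shows Lap_cong: "Lap H F z = Lap H G z" and grad2_cong: "grad2 H F z = grad2 H G z"
proof -
  have "dz a (dzb b F) z = dz a (dzb b G) z" for a b
    by (rule dz_cong_open[OF assms(1,2)]) (rule dzb_cong_open[OF assms(1) _ assms(3)])
  then show "Lap H F z = Lap H G z" by (simp add: Lap_def)
  show "grad2 H F z = grad2 H G z"
    by (simp add: grad2_def dz_cong_open[OF assms] dzb_cong_open[OF assms])
qed

text \<open>The Bochner tensor in a unitary frame, with K the curvature of opposite sign, as in
  \<open>KM\<close>.\<close>

definition boch :: "('m::finite \<Rightarrow> 'm \<Rightarrow> 'm \<Rightarrow> 'm \<Rightarrow> complex) \<Rightarrow> ('m \<Rightarrow> 'm \<Rightarrow> complex) \<Rightarrow> real \<Rightarrow> 'm \<Rightarrow> 'm \<Rightarrow> 'm \<Rightarrow> 'm \<Rightarrow> complex" where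
  "boch K R r a b c e = (let m = of_nat CARD('m); d = (\<lambda>a b. if a = b then 1 else 0) in
     - K a b c e + 1 / (m + 2) * (R a b * d c e + R c b * d a e + d a b * R c e + d c b * R a e)
     - of_real r / ((m + 1) * (m + 2)) * (d a b * d c e + d c b * d a e))"

text \<open>The linear algebra of the estimate, freed from geometry: K, P and T stand for minus the
  curvature, the Ricci tensor and its covariant derivative in a unitary frame. Then f2 is |E|^2 and
  q is |\<nabla>E|^2. The first claim is Kato's inequality; the bracket in the second is what
  commuting derivatives leaves over in the Laplacian.\<close>

lemma algebraic_curvature_bound:
  fixes K :: "'m::finite \<Rightarrow> 'm \<Rightarrow> 'm \<Rightarrow> 'm \<Rightarrow> complex" and P :: "'m \<Rightarrow> 'm \<Rightarrow> complex"
    and T :: "'m \<Rightarrow> 'm \<Rightarrow> 'm \<Rightarrow> complex" and r m :: real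
  assumes card: "CARD('m) \<ge> 2" and m: "m = real CARD('m)"
    and K1: "\<And>a b c d. K a b c d = K c b a d" and K2: "\<And>a b c d. K a b c d = K a d c b"
    and KP: "\<And>a b. (\<Sum>*c. K a b c c) = P a b"
    and P_herm: "\<And>a b. cnj (P a b) = P b a" and P_tr: "(\<Sum>*a. P a a) = of_real r"
    and T_sym: "\<And>g a b. T g a b = T a g b" and T_tr: "\<And>g. (\<Sum>*a. T g a a) = 0"
  defines "E \<equiv> \<lambda>a b. P a b - of_real (r / m) * (if a = b then 1 else 0)"
  defines "f2 \<equiv> 2 * (\<Sum>*a b. (cmod (E a b))\<^sup>2)"
  defines "bn \<equiv> sqrt (4 * (\<Sum>*a b c d. (cmod (boch K P r a b c d))\<^sup>2))"
  defines "q \<equiv> 4 * (\<Sum>*g a b. (cmod (T g a b))\<^sup>2)"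
  defines "\<kappa> \<equiv> sqrt ((2 * m\<^sup>2 + 4 * m + 3) / (2 * (m + 1) * (m + 2)))"
  shows "(m + 1) * (2 * (\<Sum>*g. (cmod (2 * (\<Sum>*a b. P b a * T g a b)))\<^sup>2)) \<le> m * f2 * q"
    and "q + 2 * r / (m + 1) * f2 - \<kappa> * (sqrt 2 * sqrt f2 + bn) * f2
      \<le> 4 * Re ((\<Sum>*a b c. P a b * P b c * P c a)
          - (\<Sum>*a b c d. K a b c d * (P b a * P d c))) + q"
    and "(\<Sum>*a b. P a b * P b a) = of_real (f2 / 2 + r\<^sup>2 / m)"
proof -
  define d where "d a b = (if a = b then 1 else 0 :: complex)" for a b :: 'm
  define \<rho> where "\<rho> = complex_of_real (r / m)"
  have m2: "m \<ge> 2" using card m by simp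
  have trd: "(\<Sum>*a. d a a) = of_real m" by (simp add: d_def m)
  have E: "E a b = P a b - \<rho> * d a b" for a b by (simp add: E_def d_def \<rho>_def)
  have PE: "P a b = E a b + \<rho> * d a b" for a b by (simp add: E)
  have \<rho>m: "\<rho> * of_real m = of_real r" using m2 by (simp add: \<rho>_def)
  have d_mult: "(\<Sum>*b. d a b * x b) = x a" "(\<Sum>*b. d b a * x b) = x a"
    "(\<Sum>*b. x b * d a b) = x a" "(\<Sum>*b. x b * d b a) = x a" for a and x :: "'m \<Rightarrow> complex"
    by (simp_all add: d_def if_distrib if_distribR cong: if_cong)
  interpret TH: traceless_hermitian E m
  proof
    show "m = real CARD('m)" by (rule m)
    show "CARD('m) \<ge> 2" by (rule card)
    show "cnj (E i j) = E j i" for i j by (simp add: E P_herm d_def \<rho>_def)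
    have "(\<Sum>*i. E i i) = (\<Sum>*i. P i i) - \<rho> * (\<Sum>*i. d i i)"
      by (simp add: E sum_subtractf sum_distrib_left)
    then show "(\<Sum>*i. E i i) = 0" by (simp add: P_tr trd \<rho>m)
  qed
  note trE = TH.traceless
  have f2: "f2 = 2 * TH.t2" by (simp add: f2_def TH.t2_def)
  have t2_nonneg: "TH.t2 \<ge> 0" by (rule TH.t2_nonneg)
  define x where "x g = (\<Sum>*a b. E b a * T g a b)" for g
  \<comment> \<open>T is trace free, so the scalar part of P drops out of the gradient.\<close>
  have PT: "(\<Sum>*a b. P b a * T g a b) = x g" for g
  proof -
    have "(\<Sum>*a b. P b a * T g a b) = x g + \<rho> * (\<Sum>*a b. d b a * T g a b)"
      by (simp add: PE x_def distrib_right sum.distrib sum_distrib_left mult.assoc)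
    then show ?thesis by (simp add: d_mult T_tr)
  qed
  have "(m + 1) * TH.nsq x \<le> m * TH.t2 * (q / 4)"
    using TH.kato[of T, OF T_sym T_tr] by (simp add: q_def x_def[symmetric])
  then show "(m + 1) * (2 * (\<Sum>*g. (cmod (2 * (\<Sum>*a b. P b a * T g a b)))\<^sup>2)) \<le> m * f2 * q"
    by (simp add: PT f2 TH.nsq_def norm_mult power_mult_distrib sum_distrib_left[symmetric] ac_simps)
  have EP: "(\<Sum>*a b. P a b * E b a) = of_real TH.t2"
  proof -
    have "(\<Sum>*a b. P a b * E b a) = (\<Sum>*a b. E a b * E b a) + \<rho> * (\<Sum>*a b. d a b * E b a)"
      by (simp add: PE[of _ _] distrib_right sum.distrib sum_distrib_left mult.assoc)
    then show ?thesis by (simp add: d_mult trE TH.t2_E)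
  qed
  have PP: "(\<Sum>*a b. P a b * P b a) = of_real TH.t2 + \<rho> * of_real r"
  proof -
    have "P a b * P b a = P a b * E b a + \<rho> * (P a b * d b a)" for a b by (subst PE[of b a]) (simp add: algebra_simps)
    then have "(\<Sum>*a b. P a b * P b a) = of_real TH.t2 + \<rho> * (\<Sum>*a b. P a b * d b a)"
      by (simp only: sum.distrib sum_distrib_left[symmetric] EP)
    then show ?thesis by (simp add: d_mult P_tr)
  qed
  then show "(\<Sum>*a b. P a b * P b a) = of_real (f2 / 2 + r\<^sup>2 / m)"
    by (simp add: f2 \<rho>_def power2_eq_square)
  define c3 where "c3 = (\<Sum>*i j. TH.E2 i j * E j i)"
  have c3_alt: "c3 = (\<Sum>*a b c. E a b * E b c * E c a)"
    unfolding c3_def TH.E2_def sum_distrib_right by (rule sum.cong[OF refl], rule sum.swap)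
  have PEE: "(\<Sum>*a b c. P a b * E b c * E c a) = c3 + \<rho> * of_real TH.t2"
  proof -
    have "P a b * E b c * E c a = E a b * E b c * E c a + \<rho> * (d a b * (E b c * E c a))" for a b c
      by (subst PE) (simp add: algebra_simps)
    then have "(\<Sum>*a b c. P a b * E b c * E c a) = c3 + \<rho> * (\<Sum>*a b. d a b * (\<Sum>*c. E b c * E c a))"
      by (simp only: sum.distrib sum_distrib_left[symmetric] c3_alt)
    then show ?thesis by (simp add: d_mult TH.t2_E)
  qed
  have PPE: "(\<Sum>*a b c. P a b * P b c * E c a) = c3 + 2 * \<rho> * of_real TH.t2"
  proof -
    have "P a b * P b c * E c a = P a b * E b c * E c a + \<rho> * (d b c * (P a b * E c a))" for a b c
      by (subst (2) PE) (simp add: algebra_simps)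
    then have "(\<Sum>*a b c. P a b * P b c * E c a) = c3 + \<rho> * of_real TH.t2 + \<rho> * (\<Sum>*a b c. d b c * (P a b * E c a))"
      by (simp only: sum.distrib sum_distrib_left[symmetric] PEE)
    then show ?thesis by (simp add: d_mult EP)
  qed
  \<comment> \<open>The summand free of E recurs in \<open>V\<close> below and cancels in the
    difference.\<close>
  have PPP: "(\<Sum>*a b c. P a b * P b c * P c a) = c3 + 3 * \<rho> * of_real TH.t2 + \<rho> * (\<rho> * of_real r)"
  proof -
    have "P a b * P b c * P c a = P a b * P b c * E c a + \<rho> * (d c a * (P a b * P b c))" for a b c
      by (subst (3) PE) (simp add: algebra_simps)
    then have "(\<Sum>*a b c. P a b * P b c * P c a) = c3 + 2 * \<rho> * of_real TH.t2 + \<rho> * (\<Sum>*a b c. d c a * (P a b * P b c))"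
      by (simp only: sum.distrib sum_distrib_left[symmetric] PPE)
    also have "(\<Sum>*a b c. d c a * (P a b * P b c)) = of_real TH.t2 + \<rho> * of_real r"
      by (simp only: d_mult PP)
    finally show ?thesis by (simp add: algebra_simps)
  qed
  have KP': "(\<Sum>*a. K a a c e) = P c e" for c e
  proof -
    have "(\<Sum>*a. K a a c e) = (\<Sum>*a. K c e a a)" by (rule sum.cong[OF refl]) (metis K1 K2)
    then show ?thesis by (simp add: KP)
  qed
  define VE where "VE = (\<Sum>*a b c e. K a b c e * (E b a * E e c))"
  have V: "(\<Sum>*a b c e. K a b c e * (P b a * P e c)) = VE + 2 * \<rho> * of_real TH.t2 + \<rho> * (\<rho> * of_real r)"
  proof -
    have 1: "(\<Sum>*a b c e. d e c * (K a b c e * X b a)) = (\<Sum>*a b. P a b * X b a)" for X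
      by (simp add: d_mult sum_distrib_right[symmetric] KP)
    have 2: "(\<Sum>*a b. d b a * (\<Sum>*c e. K a b c e * X e c)) = (\<Sum>*c e. P c e * X e c)" for X
    proof -
      have "(\<Sum>*a b. d b a * (\<Sum>*c e. K a b c e * X e c)) = (\<Sum>*a c e. K a a c e * X e c)" by (simp only: d_mult)
      also have "\<dots> = (\<Sum>*c a e. K a a c e * X e c)" by (rule sum.swap)
      also have "\<dots> = (\<Sum>*c e a. K a a c e * X e c)"
        by (rule sum.cong[OF refl], rule sum.swap)
      finally show ?thesis by (simp add: sum_distrib_right[symmetric] KP')
    qed
    have "K a b c e * (P b a * P e c) = K a b c e * (E b a * E e c) + \<rho> * (d b a * (K a b c e * E e c)) + \<rho> * (d e c * (K a b c e * P b a))" for a b c e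
      by (simp add: E algebra_simps)
    then have "(\<Sum>*a b c e. K a b c e * (P b a * P e c))
       = VE + \<rho> * (\<Sum>*c e. P c e * E e c) + \<rho> * (\<Sum>*a b. P a b * P b a)"
      by (simp only: sum.distrib sum_distrib_left[symmetric] VE_def 1 2)
    from this[unfolded EP PP] show ?thesis by (simp add: algebra_simps)
  qed
  define B where "B = boch K P r"
  have B: "B a b c e = - K a b c e + 1 / (of_real m + 2) * (P a b * d c e + P c b * d a e + d a b * P c e + d c b * P a e)
     - of_real r / ((of_real m + 1) * (of_real m + 2)) * (d a b * d c e + d c b * d a e)" for a b c e
    by (simp add: B_def boch_def Let_def d_def m)
  define k1 where "k1 = 1 / (complex_of_real m + 2)"
  define k2 where "k2 = complex_of_real r / ((of_real m + 1) * (of_real m + 2))"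
  note B = B[folded k1_def k2_def]
  have mc: "complex_of_real m + 2 \<noteq> 0" "complex_of_real m + 1 \<noteq> 0" using m2 by (simp_all add: complex_eq_iff)
  have B1: "B a b c e = B c b a e" for a b c e using K1[of a b c e] by (simp add: B ac_simps)
  have B2: "B a b c e = B a e c b" for a b c e using K2[of a b c e] by (simp add: B ac_simps)
  have B_tr: "(\<Sum>*c. B a b c c) = 0" for a b
  proof -
    have "(\<Sum>*c. B a b c c) = - (\<Sum>*c. K a b c c) + k1 * (P a b * (\<Sum>*c. d c c) + (\<Sum>*c. P c b * d a c) + d a b * (\<Sum>*c. P c c) + (\<Sum>*c. d c b * P a c))
       - k2 * (d a b * (\<Sum>*c. d c c) + (\<Sum>*c. d c b * d a c))"
      by (simp only: B sum.distrib sum_subtractf sum_negf sum_distrib_left[symmetric])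
    also have "\<dots> = - P a b + 1 / (of_real m + 2) * (P a b * (of_real m + 2) + d a b * of_real r)
       - of_real r / ((of_real m + 1) * (of_real m + 2)) * (d a b * (of_real m + 1))"
      unfolding k1_def[symmetric] k2_def[symmetric] by (simp add: KP trd d_mult P_tr algebra_simps)
    also have "\<dots> = 0"
    proof -
      have "- p + 1 / n2 * (p * n2 + D * s) - s / (n1 * n2) * (D * n1) = 0" if "n1 \<noteq> 0" "n2 \<noteq> 0" for p n1 n2 D s :: complex
        using that by (simp add: field_simps)
      from this[OF mc(2,1)] show ?thesis .
    qed
    finally show ?thesis .
  qed
  define BE where "BE = (\<Sum>*a b c e. B a b c e * (E b a * E e c))"
  have BE: "BE = - VE + 2 / (of_real m + 2) * (c3 + \<rho> * of_real TH.t2) - of_real r / ((of_real m + 1) * (of_real m + 2)) * of_real TH.t2"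
  proof -
    have h1: "(\<Sum>*a b c e. d c e * (X a b * (E b a * E e c))) = 0" for X
    proof -
      have "(\<Sum>*a b c e. d c e * (X a b * (E b a * E e c))) = (\<Sum>*a b. (X a b * E b a) * (\<Sum>*c. E c c))"
        by (simp only: d_mult sum_distrib_left mult.assoc)
      then show ?thesis by (simp add: trE)
    qed
    have h3: "(\<Sum>*a b. d a b * (\<Sum>*c e. X c e * (E b a * E e c))) = 0" for X
    proof -
      have "(\<Sum>*a b. d a b * (\<Sum>*c e. X c e * (E b a * E e c))) = (\<Sum>*a b. d a b * (E b a * (\<Sum>*c e. X c e * E e c)))"
        by (simp only: sum_distrib_left mult.left_commute)
      also have "\<dots> = (\<Sum>*a. E a a) * (\<Sum>*c e. X c e * E e c)"
        by (simp only: d_mult sum_distrib_right[symmetric])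
      finally show ?thesis by (simp add: trE)
    qed
    have h2: "(\<Sum>*a b c e. d a e * (X c b * (E b a * E e c))) = (\<Sum>*a b c. X a b * E b c * E c a)" for X
    proof -
      have "(\<Sum>*a b c e. d a e * (X c b * (E b a * E e c))) = (\<Sum>*a b c. X c b * E b a * E a c)"
        by (simp only: d_mult mult.assoc)
      also have "\<dots> = (\<Sum>*a c b. X c b * E b a * E a c)" by (rule sum.cong[OF refl], rule sum.swap)
      also have "\<dots> = (\<Sum>*c a b. X c b * E b a * E a c)" by (rule sum.swap)
      also have "\<dots> = (\<Sum>*c b a. X c b * E b a * E a c)" by (rule sum.cong[OF refl], rule sum.swap)
      finally show ?thesis .
    qed
    have h4: "(\<Sum>*a b c. d c b * (\<Sum>*e. X a e * (E b a * E e c))) = (\<Sum>*a b c. X a b * E b c * E c a)" for X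
    proof -
      have "(\<Sum>*a b c. d c b * (\<Sum>*e. X a e * (E b a * E e c))) = (\<Sum>*a b e. X a e * (E b a * E e b))" by (simp only: d_mult)
      also have "\<dots> = (\<Sum>*a e b. X a e * (E b a * E e b))" by (rule sum.cong[OF refl], rule sum.swap)
      finally show ?thesis by (simp add: mult.assoc mult.commute[of "E _ _" "E _ _"])
    qed
    have dEE: "(\<Sum>*a b c. d a b * E b c * E c a) = of_real TH.t2"
    proof -
      have "(\<Sum>*a b c. d a b * E b c * E c a) = (\<Sum>*a b. d a b * (\<Sum>*c. E b c * E c a))"
        by (simp only: sum_distrib_left mult.assoc)
      then show ?thesis by (simp only: d_mult TH.t2_E)
    qed
    have "B a b c e * (E b a * E e c) = - (K a b c e * (E b a * E e c))
       + k1 * (d c e * (P a b * (E b a * E e c))) + k1 * (d a e * (P c b * (E b a * E e c)))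
       + k1 * (d a b * (P c e * (E b a * E e c))) + k1 * (d c b * (P a e * (E b a * E e c)))
       - k2 * (d c e * (d a b * (E b a * E e c)))
       - k2 * (d a e * (d c b * (E b a * E e c)))" for a b c e
      by (simp add: B algebra_simps)
    then have "BE = - VE + k1 * 0 + k1 * (c3 + \<rho> * of_real TH.t2)
        + k1 * 0 + k1 * (c3 + \<rho> * of_real TH.t2) - k2 * 0 - k2 * of_real TH.t2"
      by (simp only: BE_def VE_def sum.distrib sum_subtractf sum_negf sum_distrib_left[symmetric] h1 h2 h3 h4 PEE dEE)
    then show ?thesis by (simp add: k1_def k2_def)
  qed
  \<comment> \<open>Once K is eliminated in favour of B, what remains is tr E^3, the Bochner pairing
    and the term r |E|^2 with the coefficient that makes the scalar curvature help.\<close>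
  have main: "c3 + 3 * \<rho> * of_real TH.t2 + \<rho> * (\<rho> * of_real r) - (VE + 2 * \<rho> * of_real TH.t2 + \<rho> * (\<rho> * of_real r))
     = of_real (m / (m + 2)) * c3 + BE + of_real (r / (m + 1) * TH.t2)"
  proof -
    have r: "of_real r = \<rho> * of_real m" using \<rho>m by simp
    have alg: "c + 3 * p * t + z - (V + 2 * p * t + z) = n / (n + 2) * c + (- V + 2 / (n + 2) * (c + p * t) - p * n / ((n + 1) * (n + 2)) * t) + p * n / (n + 1) * t"
      if "n + 2 \<noteq> 0" "n + 1 \<noteq> 0" for c p t z V n :: complex
    proof -
      \<comment> \<open>Partial fractions remove n and leave a polynomial identity in \<alpha> and
        \<beta>.\<close>
      define \<alpha> \<beta> where "\<alpha> = 1 / (n + 2)" and "\<beta> = 1 / (n + 1)"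
      have e1: "n / (n + 2) = 1 - 2 * \<alpha>" using that by (simp add: \<alpha>_def field_simps)
      have "n / ((n + 1) * (n + 2)) = 2 * \<alpha> - \<beta>"
        using that by (simp add: \<alpha>_def \<beta>_def divide_simps)
      then have e2: "p * n / ((n + 1) * (n + 2)) = p * (2 * \<alpha> - \<beta>)" by (metis times_divide_eq_right)
      have "n / (n + 1) = 1 - \<beta>" using that by (simp add: \<beta>_def field_simps)
      then have e3: "p * n / (n + 1) = p * (1 - \<beta>)" by (metis times_divide_eq_right)
      have e4: "2 / (n + 2) = 2 * \<alpha>" by (simp add: \<alpha>_def)
      show ?thesis unfolding e1 e2 e3 e4 by (simp add: algebra_simps)
    qed
    show ?thesis unfolding BE using alg[OF mc, of c3 \<rho> "of_real TH.t2" "\<rho> * (\<rho> * of_real r)" VE] by (simp add: r)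
  qed
  have \<kappa>: "\<kappa> \<ge> 0" unfolding \<kappa>_def using m2 by simp
  have \<kappa>_sq: "\<kappa>\<^sup>2 = (2 * m\<^sup>2 + 4 * m + 3) / (2 * (m + 1) * (m + 2))"
    unfolding \<kappa>_def using m2 by (intro real_sqrt_pow2) simp
  \<comment> \<open>tr E^3 carries the coefficient m/(m+2), which is at most
    \<open>\<kappa>\<close>; thus one constant serves the Ricci and the Bochner part.\<close>
  have \<kappa>_ge: "m / (m + 2) \<le> \<kappa>"
  proof (rule power2_le_imp_le[OF _ \<kappa>])
    have "m\<^sup>2 * (2 * (m + 1)) \<le> (2 * m\<^sup>2 + 4 * m + 3) * (m + 2)"
      using m2 by (simp add: algebra_simps power2_eq_square)
    then have "m\<^sup>2 * (2 * (m + 1)) / (2 * (m + 1) * (m + 2)\<^sup>2) \<le> (2 * m\<^sup>2 + 4 * m + 3) * (m + 2) / (2 * (m + 1) * (m + 2)\<^sup>2)"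
      using m2 by (intro divide_right_mono) auto
    also have "m\<^sup>2 * (2 * (m + 1)) / (2 * (m + 1) * (m + 2)\<^sup>2) = (m / (m + 2))\<^sup>2"
      using m2 by (simp add: power_divide)
    also have "(2 * m\<^sup>2 + 4 * m + 3) * (m + 2) / (2 * (m + 1) * (m + 2)\<^sup>2) = \<kappa>\<^sup>2"
    proof -
      have "n * k / (c * k\<^sup>2) = n / (c * k)" if "k \<noteq> 0" for n k c :: real
        using that by (simp add: power2_eq_square)
      from this[of "m + 2"] show ?thesis using m2 unfolding \<kappa>_sq by simp
    qed
    finally show "(m / (m + 2))\<^sup>2 \<le> \<kappa>\<^sup>2" .
  qed
  have sf: "sqrt f2 = sqrt 2 * sqrt TH.t2" by (simp add: f2 real_sqrt_mult)
  have bound1: "- (\<kappa> * (TH.t2 * sqrt TH.t2)) \<le> Re (of_real (m / (m + 2)) * c3)"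
  proof -
    have "\<bar>Re (of_real (m / (m + 2)) * c3)\<bar> = m / (m + 2) * \<bar>Re c3\<bar>" using m2 by (simp add: abs_mult)
    also have "\<dots> \<le> \<kappa> * (TH.t2 * sqrt TH.t2)"
      using TH.trace_cube_bound t2_nonneg \<kappa> m2 by (intro mult_mono \<kappa>_ge) (auto simp: c3_def)
    finally show ?thesis by linarith
  qed
  have bound2: "- (\<kappa> * (bn / 2 * TH.t2)) \<le> Re BE"
  proof -
    define N where "N = (\<Sum>*a b c e. (cmod (B a b c e))\<^sup>2)"
    have N0: "N \<ge> 0" unfolding N_def by (intro sum_nonneg) simp
    have bn: "bn = 2 * sqrt N" by (simp add: bn_def N_def B_def real_sqrt_mult)
    have "(Re BE)\<^sup>2 \<le> N * (\<kappa>\<^sup>2 * TH.t2\<^sup>2)"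
      using TH.bochner_bound[of B, OF B1 B2 B_tr] by (simp add: BE_def N_def \<kappa>_sq)
    also have "\<dots> = (\<kappa> * (bn / 2 * TH.t2))\<^sup>2" using N0 by (simp add: bn power_mult_distrib mult.commute mult.left_commute)
    finally have "\<bar>Re BE\<bar> \<le> \<kappa> * (bn / 2 * TH.t2)"
      using \<kappa> t2_nonneg N0 by (intro abs_le_square_iff[THEN iffD2, THEN order.trans[OF _ eq_refl]]) (auto simp: bn)
    then show ?thesis by linarith
  qed
  have "- (\<kappa> * (TH.t2 * sqrt TH.t2)) + - (\<kappa> * (bn / 2 * TH.t2)) + r / (m + 1) * TH.t2 \<le> Re (of_real (m / (m + 2)) * c3 + BE + of_real (r / (m + 1) * TH.t2))"
    using bound1 bound2 by simp
  then have "4 * (- (\<kappa> * (TH.t2 * sqrt TH.t2)) + - (\<kappa> * (bn / 2 * TH.t2)) + r / (m + 1) * TH.t2)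
     \<le> 4 * Re ((\<Sum>*a b c. P a b * P b c * P c a)
          - (\<Sum>*a b c e. K a b c e * (P b a * P e c)))"
    unfolding PPP V main by simp
  moreover have "4 * (- (\<kappa> * (TH.t2 * sqrt TH.t2)) + - (\<kappa> * (bn / 2 * TH.t2)) + r / (m + 1) * TH.t2)
     = 2 * r / (m + 1) * f2 - \<kappa> * (sqrt 2 * sqrt f2 + bn) * f2"
  proof -
    have "sqrt 2 * sqrt f2 = 2 * sqrt TH.t2" by (simp add: sf mult.assoc[symmetric])
    then show ?thesis by (simp add: f2 algebra_simps)
  qed
  ultimately show "q + 2 * r / (m + 1) * f2 - \<kappa> * (sqrt 2 * sqrt f2 + bn) * f2
      \<le> 4 * Re ((\<Sum>*a b c. P a b * P b c * P c a)
          - (\<Sum>*a b c d. K a b c d * (P b a * P d c))) + q"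
    by linarith
qed

section \<open>The Weitzenboeck formula at the centre of normal coordinates\<close>

context kaehler_chart
begin

context
  fixes z assumes z: "z \<in> S" and H1: "H z = mat 1" and dH0: "\<And>c. mdz c H z = 0"
begin

lemma W1: "Win H z = mat 1"
  using Win_mult[OF z] by (simp add: H1)

lemma dbH0: "mdzb c H z = 0"
proof -
  have "hadj 0 = (0 :: 'm cmat)" by (rule matrix_eqI) simp
  then show ?thesis by (simp add: mdzb_H[OF z] dH0)
qed

lemma dW0: "mdz c (Win H) z = 0" and dbW0: "mdzb c (Win H) z = 0"
  by (simp_all add: mdz_Win[OF z] mdzb_Win[OF z] dH0 dbH0 mm.zero_left mm.zero_right)

lemma KM1: "KM H a b z = - mdz a (mdzb b H) z"
  by (simp add: KM_def dH0 mm.zero_left)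

text \<open>First derivatives of the metric vanish at z, so second derivatives of the inverse metric
  are minus those of H, and these are the curvature. Through this lemma curvature enters the
  Laplacian.\<close>

lemma ddW: "mdz a (mdzb b (Win H)) z = KM H a b z"
proof -
  have d: "mdiff (mdzb b H) z" "mdiff (Win H) z"
    using mCk_mdiff[OF smooth_mdzb z] mdiff_Win[OF z] by auto
  have "mdz a (mdzb b (Win H)) z = mdz a (\<lambda>y. - (Win H y ** mdzb b H y ** Win H y)) z"
    by (rule mdz_cong_open[OF open_S z mdzb_Win])
  also have "\<dots> = - mdz a (\<lambda>y. Win H y ** mdzb b H y ** Win H y) z"
    by (rule mdz_uminus) (intro mdiff_mult d)
  also have "mdz a (\<lambda>y. Win H y ** mdzb b H y ** Win H y) z = mdz a (mdzb b H) z"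
    by (simp add: mdz_mult mdiff_mult d W1 dW0 mm.zero_left mm.zero_right)
  finally show ?thesis by (simp add: KM1)
qed

lemma KM_sym1: "KM H a b z $ c $ d = KM H c b z $ a $ d"
proof -
  have "mdz a (mdzb b H) z $ c $ d = dzb b (\<lambda>z. mdz a H z $ c $ d) z" for a c
    unfolding mdz_mdzb_commute[OF open_S z smooth, of a b] by (rule mdzb_nth)
  moreover have "dzb b (\<lambda>z. mdz a H z $ c $ d) z = dzb b (\<lambda>z. mdz c H z $ a $ d) z"
    by (rule dzb_cong_open[OF open_S z]) (rule kaehler)
  ultimately have "mdz a (mdzb b H) z $ c $ d = mdz c (mdzb b H) z $ a $ d" by (simp only:)
  then show ?thesis unfolding KM1 by (simp only: vector_uminus_component)
qed

lemma KM_sym2: "KM H a b z $ c $ d = KM H a d z $ c $ b"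
proof -
  have "mdz a (mdzb b H) z $ c $ d = dz a (\<lambda>z. mdzb b H z $ c $ d) z" for b d
    by (rule mdz_nth)
  moreover have "dz a (\<lambda>z. mdzb b H z $ c $ d) z = dz a (\<lambda>z. mdzb d H z $ c $ b) z"
    by (rule dz_cong_open[OF open_S z]) (rule kaehler_b)
  ultimately have "mdz a (mdzb b H) z $ c $ d = mdz a (mdzb d H) z $ c $ b" by (simp only:)
  then show ?thesis unfolding KM1 by (simp only: vector_uminus_component)
qed

lemma RicM1: "RicM H z $ a $ b = (\<Sum>*c. KM H a b z $ c $ c)"
  by (simp add: RicM_def W1 trace_def)

lemma Lap1: "Lap H F z = (\<Sum>*a. dz a (dzb a F) z)"
  by (simp add: Lap_def W1 mat_1_nth if_distrib if_distribR cong: if_cong)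

lemma grad2_1: "grad2 H F z = (\<Sum>*a. dz a F z * dzb a F z)"
  by (simp add: grad2_def W1 mat_1_nth if_distrib if_distribR mult.assoc cong: if_cong)

abbreviation "Q y \<equiv> RicM H y ** Win H y"

lemma mdiff_Ric: "mdiff (RicM H) z" "mdiff Q z" "mdiff (mdzb a (RicM H)) z" "mdiff (mdzb a Q) z" "mdiff (mdzb a (Win H)) z"
  using mCk_mdiff[OF smooth_RicM z] mCk_mdiff[OF mCk_mult[OF open_S smooth_RicM smooth_Win] z]
    mCk_mdiff[OF mCk_mdzb[OF open_S smooth_RicM] z] mCk_mdiff[OF mCk_mdzb[OF open_S smooth_Win] z]
    mCk_mdiff[OF mCk_mdzb[OF open_S mCk_mult[OF open_S smooth_RicM smooth_Win]] z] by auto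

lemma dQ: "mdz e Q z = mdz e (RicM H) z" and dbQ: "mdzb e Q z = mdzb e (RicM H) z"
  by (simp_all add: mdz_mult mdzb_mult mdiff_Ric mdiff_Win[OF z] W1 dW0 dbW0 mm.zero_right)

lemma ddQ: "mdz a (mdzb b Q) z = mdz a (mdzb b (RicM H)) z + RicM H z ** KM H a b z"
proof -
  have "mdz a (mdzb b Q) z = mdz a (\<lambda>y. mdzb b (RicM H) y ** Win H y + RicM H y ** mdzb b (Win H) y) z"
    by (rule mdz_cong_open[OF open_S z], rule mdzb_mult)
       (auto intro: mCk_mdiff[OF smooth_RicM] mdiff_Win)
  also have "\<dots> = mdz a (mdzb b (RicM H)) z + RicM H z ** KM H a b z"
    by (simp add: mdz_add mdz_mult mdiff_mult mdiff_Ric mdiff_Win[OF z] W1 dW0 dbW0 ddW mm.zero_right)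
  finally show ?thesis .
qed

lemma dz_ricci_sq: "dz e (ricci_sq H) z = 2 * trace (mdz e (RicM H) z ** RicM H z)"
proof -
  have "dz e (ricci_sq H) z = trace (mdz e Q z ** Q z + Q z ** mdz e Q z)"
    unfolding ricci_sq_def[abs_def] by (simp add: dz_trace mdiff_mult mdiff_Ric mdz_mult)
  then show ?thesis by (simp add: dQ W1 trace_add trace_mul_sym[of "RicM H z"])
qed

lemma dzb_ricci_sq: "y \<in> S \<Longrightarrow> dzb e (ricci_sq H) y = 2 * trace (mdzb e Q y ** Q y)"
proof -
  assume y: "y \<in> S"
  have d: "mdiff Q y" by (rule mCk_mdiff[OF mCk_mult[OF open_S smooth_RicM smooth_Win] y])
  have "dzb e (ricci_sq H) y = trace (mdzb e Q y ** Q y + Q y ** mdzb e Q y)"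
    unfolding ricci_sq_def[abs_def] by (simp only: dzb_trace[OF mdiff_mult[OF d d]] mdzb_mult[OF d d])
  then show ?thesis by (simp only: trace_add trace_mul_sym[of "Q y"]) simp
qed

lemma dz_dzb_ricci_sq: "dz e (dzb e (ricci_sq H)) z =
   2 * (trace (mdz e (mdzb e (RicM H)) z ** RicM H z) + trace (RicM H z ** KM H e e z ** RicM H z)
     + trace (mdzb e (RicM H) z ** mdz e (RicM H) z))"
proof -
  have "dz e (dzb e (ricci_sq H)) z = dz e (\<lambda>y. 2 * trace (mdzb e Q y ** Q y)) z"
    by (rule dz_cong_open[OF open_S z dzb_ricci_sq])
  also have "\<dots> = 2 * dz e (\<lambda>y. trace (mdzb e Q y ** Q y)) z"
  proof (rule dz_cmult)
    have "Ck (Suc 0) S (\<lambda>y. trace (mdzb e Q y ** Q y))"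
      by (intro Ck_trace mCk_mult mCk_mdzb open_S smooth_RicM smooth_Win)
    then show "(\<lambda>y. trace (mdzb e Q y ** Q y)) differentiable (at z)" using z by (rule Ck_differentiable)
  qed
  also have "dz e (\<lambda>y. trace (mdzb e Q y ** Q y)) z = trace (mdz e (mdzb e Q) z ** Q z + mdzb e Q z ** mdz e Q z)"
    by (simp only: dz_trace[OF mdiff_mult[OF mdiff_Ric(4,2)]] mdz_mult[OF mdiff_Ric(4,2)])
  finally show ?thesis by (simp add: ddQ dQ dbQ W1 trace_add mm.add_left)
qed

lemma dz_ScM: "dz e (ScM H) z = trace (mdz e (RicM H) z)"
  unfolding ScM_def[abs_def] by (simp only: dz_trace[OF mdiff_Ric(2)] dQ)

lemma ddScM: "dz a (dzb b (ScM H)) z = trace (mdz a (mdzb b (RicM H)) z) + trace (RicM H z ** KM H a b z)"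
proof -
  have "dz a (dzb b (ScM H)) z = dz a (\<lambda>y. trace (mdzb b Q y)) z"
    unfolding ScM_def[abs_def]
    by (rule dz_cong_open[OF open_S z], rule dzb_trace)
      (rule mCk_mdiff[OF mCk_mult[OF open_S smooth_RicM smooth_Win]])
  also have "\<dots> = trace (mdz a (mdzb b Q) z)" by (rule dz_trace[OF mdiff_Ric(4)])
  finally show ?thesis by (simp add: ddQ trace_add)
qed

text \<open>Closedness of the Ricci form, used once for barred and once for unbarred indices,
  exchanges the Laplacian of a component for the Hessian of a diagonal entry.\<close>

lemma ddRic: "mdz e (mdzb e (RicM H)) z $ a $ b = mdz a (mdzb b (RicM H)) z $ e $ e"
proof -
  let ?P = "\<lambda>a b y. RicM H y $ a $ b"
  have s: "Ck k S (?P a b)" for k a b using smooth_RicM by (simp add: mCk_def)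
  have "mdz e (mdzb e (RicM H)) z $ a $ b = dz e (dzb e (?P a b)) z" by simp
  also have "\<dots> = dz e (dzb b (?P a e)) z"
    by (rule dz_cong_open[OF open_S z RicM_closed_b])
  also have "\<dots> = dzb b (dz e (?P a e)) z" by (rule dz_dzb_commute[OF open_S z s])
  also have "\<dots> = dzb b (dz a (?P e e)) z"
    by (rule dzb_cong_open[OF open_S z RicM_closed])
  also have "\<dots> = dz a (dzb b (?P e e)) z" by (rule dz_dzb_commute[OF open_S z s, symmetric])
  finally show ?thesis by simp
qed

lemma trace_mult_nth: "trace (A ** B) = (\<Sum>*a b. A $ a $ b * B $ b $ a)"
  by (simp add: trace_def matrix_mult_nth)

text \<open>After \<open>ddRic\<close> the trace of second derivatives of Ric appears, which is the
  Hessian of the scalar curvature minus a curvature term; the Hessian vanishes. What is left is the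
  derivative of Ric squared, tr Ric^3, and the curvature contracted with Ric \<otimes> Ric.\<close>

lemma weitzenboeck_normal:
  fixes r :: real
  assumes Sc: "\<And>y. y \<in> S \<Longrightarrow> ScM H y = of_real r"
  shows "Lap H (ricci_sq H) z = 2 * ((\<Sum>*g a b. of_real ((cmod (mdz g (RicM H) z $ a $ b))\<^sup>2))
     + ((\<Sum>*a b c. RicM H z $ a $ b * RicM H z $ b $ c * RicM H z $ c $ a)
     - (\<Sum>*a b c d. KM H a b z $ c $ d * (RicM H z $ b $ a * RicM H z $ d $ c))))"
    and "trace (mdz g (RicM H) z) = 0"
proof -
  let ?P = "RicM H z"
  have "dz a (dzb b (ScM H)) z = dz a (dzb b (\<lambda>_. of_real r)) z" for a b
    by (rule dz_cong_open[OF open_S z], rule dzb_cong_open[OF open_S _ Sc])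
  then have ScM0: "trace (mdz a (mdzb b (RicM H)) z) = - trace (?P ** KM H a b z)" for a b
    using ddScM[of a b] by (simp add: dzb_const[abs_def] add_eq_0_iff2)
  have "dz g (ScM H) z = dz g (\<lambda>_. of_real r) z" by (rule dz_cong_open[OF open_S z Sc])
  then show "trace (mdz g (RicM H) z) = 0" using dz_ScM[of g] by simp
  have P: "hadj ?P = ?P" by (rule hadj_RicM[OF z])
  have dbP: "mdzb e (RicM H) z = hadj (mdz e (RicM H) z)" for e
    using mdzb_hadj[OF mdiff_Ric(1), of e] mdzb_cong_open[OF open_S z hadj_RicM, where a=e] by simp
  have A: "(\<Sum>*e. trace (mdz e (mdzb e (RicM H)) z ** ?P))
     = - (\<Sum>*a b c d. KM H a b z $ c $ d * (?P $ b $ a * ?P $ d $ c))"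
  proof -
    have "(\<Sum>*e. trace (mdz e (mdzb e (RicM H)) z ** ?P)) = (\<Sum>*e a b. mdz a (mdzb b (RicM H)) z $ e $ e * ?P $ b $ a)"
      unfolding trace_mult_nth by (intro sum.cong refl arg_cong2[where f="(*)"] ddRic)
    also have "\<dots> = (\<Sum>*a e b. mdz a (mdzb b (RicM H)) z $ e $ e * ?P $ b $ a)" by (rule sum.swap)
    also have "\<dots> = (\<Sum>*a b e. mdz a (mdzb b (RicM H)) z $ e $ e * ?P $ b $ a)"
      by (rule sum.cong[OF refl], rule sum.swap)
    also have "\<dots> = (\<Sum>*a b. trace (mdz a (mdzb b (RicM H)) z) * ?P $ b $ a)"
      by (simp only: sum_distrib_right[symmetric] trace_def)
    also have "\<dots> = (\<Sum>*a b. - (trace (KM H a b z ** ?P) * ?P $ b $ a))"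
      by (simp only: ScM0 trace_mul_sym[of ?P] mult_minus_left)
    also have "\<dots> = (\<Sum>*a b. - (\<Sum>*c d. KM H a b z $ c $ d * (?P $ b $ a * ?P $ d $ c)))"
      by (simp only: trace_mult_nth sum_distrib_right mult.assoc mult.commute[of "?P $ _ $ _" "?P $ _ $ _"])
    finally show ?thesis by (simp only: sum_negf)
  qed
  \<comment> \<open>By the symmetries of the curvature, contracting the first index pair gives the
    Ricci tensor as well.\<close>
  have KP: "(\<Sum>*e. KM H e e z) = ?P"
  proof (rule matrix_eqI)
    fix a b
    have "KM H e e z $ a $ b = KM H a b z $ e $ e" for e using KM_sym1[of e e a b] KM_sym2[of a e e b] by simp
    then show "(\<Sum>*e. KM H e e z) $ a $ b = ?P $ a $ b" by (simp add: sum_component RicM1)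
  qed
  have B: "(\<Sum>*e. trace (?P ** KM H e e z ** ?P)) = (\<Sum>*a b c. ?P $ a $ b * ?P $ b $ c * ?P $ c $ a)"
  proof -
    have "(\<Sum>*e. trace (?P ** KM H e e z ** ?P)) = trace (?P ** (\<Sum>*e. KM H e e z) ** ?P)"
      by (simp only: mm.sum_left mm.sum_right trace_sum)
    also have "\<dots> = (\<Sum>*a c b. ?P $ a $ b * ?P $ b $ c * ?P $ c $ a)"
      by (simp only: KP trace_mult_nth[of "?P ** ?P"] matrix_mult_nth sum_distrib_right)
    also have "\<dots> = (\<Sum>*a b c. ?P $ a $ b * ?P $ b $ c * ?P $ c $ a)"
      by (rule sum.cong[OF refl], rule sum.swap)
    finally show ?thesis .
  qed
  have C: "trace (mdzb e (RicM H) z ** mdz e (RicM H) z) = (\<Sum>*a b. of_real ((cmod (mdz e (RicM H) z $ a $ b))\<^sup>2))" for e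
  proof -
    have "trace (mdzb e (RicM H) z ** mdz e (RicM H) z) = (\<Sum>*b a. of_real ((cmod (mdz e (RicM H) z $ a $ b))\<^sup>2))"
      by (simp only: dbP trace_mult_nth hadj_nth mult_cnj_cmod)
    also have "\<dots> = (\<Sum>*a b. of_real ((cmod (mdz e (RicM H) z $ a $ b))\<^sup>2))" by (rule sum.swap)
    finally show ?thesis .
  qed
  show "Lap H (ricci_sq H) z = 2 * ((\<Sum>*g a b. of_real ((cmod (mdz g (RicM H) z $ a $ b))\<^sup>2))
     + ((\<Sum>*a b c. RicM H z $ a $ b * RicM H z $ b $ c * RicM H z $ c $ a)
     - (\<Sum>*a b c d. KM H a b z $ c $ d * (RicM H z $ b $ a * RicM H z $ d $ c))))"
    unfolding Lap1 dz_dzb_ricci_sq sum_distrib_left[symmetric] sum.distrib A B C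
    by (simp add: algebra_simps)
qed

end

lemma ricci_sq_real: assumes z: "z \<in> S" shows "cnj (ricci_sq H z) = ricci_sq H z"
proof -
  have tr: "cnj (trace X) = trace (hadj X)" for X :: "'m cmat" by (simp add: trace_def)
  have "cnj (ricci_sq H z) = trace (Win H z ** (RicM H z ** Win H z ** RicM H z))"
    unfolding ricci_sq_def tr hadj_mult hadj_Win[OF z] hadj_RicM[OF z] by (simp add: matrix_mul_assoc)
  also have "\<dots> = trace (RicM H z ** Win H z ** RicM H z ** Win H z)" by (rule trace_mul_sym)
  finally show ?thesis by (simp add: ricci_sq_def matrix_mul_assoc)
qed

text \<open>\<open>U\<close> is a unitary frame at \<open>z0\<close>, given by its rows.\<close>

lemma weitzenboeck_inequality:
  fixes r m :: real and U :: "'m cmat"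
  assumes card: "CARD('m) \<ge> 2" and m: "m = real CARD('m)"
    and Sc: "\<And>y. y \<in> S \<Longrightarrow> ScM H y = of_real r"
    and z0: "z0 \<in> S" and U: "U ** H z0 ** hadj U = mat 1"
  defines "Rc \<equiv> \<lambda>a b. (U ** RicM H z0 ** hadj U) $ a $ b"
    and "K \<equiv> \<lambda>a b c d. \<Sum>*p q s t. U $ a $ p * cnj (U $ b $ q) * U $ c $ s * cnj (U $ d $ t) * KM H p q z0 $ s $ t"
  defines "f2 \<equiv> 2 * (\<Sum>*a b. (cmod (Rc a b - of_real (r / m) * (if a = b then 1 else 0)))\<^sup>2)"
    and "bn \<equiv> sqrt (4 * (\<Sum>*a b c d. (cmod (boch K Rc r a b c d))\<^sup>2))"
    and "\<kappa> \<equiv> sqrt ((2 * m\<^sup>2 + 4 * m + 3) / (2 * (m + 1) * (m + 2)))"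
  obtains q where "q \<ge> 0"
    "(m + 1) * (2 * Re (grad2 H (ricci_sq H) z0)) \<le> m * f2 * q"
    "q + 2 * r / (m + 1) * f2 - \<kappa> * (sqrt 2 * sqrt f2 + bn) * f2 \<le> 2 * Re (Lap H (ricci_sq H) z0)"
    "ricci_sq H z0 = of_real (f2 / 2 + r\<^sup>2 / m)"
proof -
  \<comment> \<open>Everything involved is tensorial, so it is computed at 0 in normal coordinates
    whose coordinate frame is U.\<close>
  obtain S' \<tau> where hp: "holo_pullback S H S' \<tau>" and S0: "0 \<in> S'" and tau0: "\<tau> 0 = z0" and jac0: "jac \<tau> 0 = U"
    and H1: "pullb H \<tau> 0 = mat 1" and dH0: "\<And>b. mdz b (pullb H \<tau>) 0 = 0"
    using normal_coordinates[OF z0 U] by blast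
  interpret P: holo_pullback S H S' \<tau> by (rule hp)
  let ?H = "pullb H \<tau>"
  interpret N: kaehler_chart S' ?H by (rule P.kaehler_pullb)
  note normal = S0 H1 dH0
  have Rc: "RicM ?H 0 $ a $ b = Rc a b" for a b
    by (simp add: Rc_def P.RicM_pullb[OF S0] jac0 tau0)
  have K: "KM ?H a b 0 $ c $ d = K a b c d" for a b c d
    by (simp add: K_def P.KM_pullb_nth[OF S0] jac0 tau0)
  have ScN: "ScM ?H y = of_real r" if "y \<in> S'" for y
    using P.ScM_pullb[OF that] Sc[OF P.tau_in[OF that]] by simp
  \<comment> \<open>At the centre partial derivatives are covariant ones. Their symmetry is
    closedness of the Ricci form, their trace the derivative of the constant scalar
    curvature.\<close>
  define T where "T g a b = mdz g (RicM ?H) 0 $ a $ b" for g a b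
  have T_sym: "T g a b = T a g b" for g a b
    using N.RicM_closed[OF S0, of g a b] by (simp add: T_def)
  have T_tr: "(\<Sum>*a. T g a a) = 0" for g
    using N.weitzenboeck_normal(2)[OF normal ScN] by (simp add: T_def trace_def)
  have Rc_herm: "cnj (Rc a b) = Rc b a" for a b
    using N.hadj_RicM[OF S0] Rc by (metis hadj_nth)
  have Rc_tr: "(\<Sum>*a. Rc a a) = of_real r"
    using ScN[OF S0] by (simp add: ScM_def N.W1[OF normal] trace_def Rc)
  have K1: "K a b c d = K c b a d" for a b c d
    using N.KM_sym1[OF normal, of a b c d] by (simp only: K)
  have K2: "K a b c d = K a d c b" for a b c d
    using N.KM_sym2[OF normal, of a b c d] by (simp only: K)
  have KP: "(\<Sum>*c. K a b c c) = Rc a b" for a b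
    using N.RicM1[OF normal, of a b] by (simp only: K Rc)
  define q where "q = 4 * (\<Sum>*g a b. (cmod (T g a b))\<^sup>2)"
  note bound = algebraic_curvature_bound[OF card m K1 K2 KP Rc_herm Rc_tr T_sym T_tr, folded f2_def bn_def \<kappa>_def q_def]
  have cong: "ricci_sq ?H y = ricci_sq H (\<tau> y)" if "y \<in> S'" for y by (rule P.ricci_sq_pullb[OF that])
  have lap: "Lap H (ricci_sq H) z0 = Lap ?H (ricci_sq ?H) 0"
    using P.Lap_pullb[OF smooth_ricci_sq S0] Lap_cong[OF P.open_S' S0 cong, where H="?H"] by (simp add: tau0)
  have grad: "grad2 H (ricci_sq H) z0 = grad2 ?H (ricci_sq ?H) 0"
  proof -
    have "ricci_sq H differentiable (at (\<tau> 0))" using Ck_differentiable[OF smooth_ricci_sq P.tau_in[OF S0]] .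
    then show ?thesis
      using P.grad2_pullb[OF _ S0, of "ricci_sq H"] grad2_cong[OF P.open_S' S0 cong, where H="?H"] by (simp add: tau0)
  qed
  have L: "Lap H (ricci_sq H) z0 = 2 * (of_real (q / 4) + ((\<Sum>*a b c. Rc a b * Rc b c * Rc c a)
     - (\<Sum>*a b c d. K a b c d * (Rc b a * Rc d c))))"
  proof -
    have "of_real (q / 4) = (\<Sum>*g a b. complex_of_real ((cmod (mdz g (RicM ?H) 0 $ a $ b))\<^sup>2))"
      by (simp add: q_def T_def)
    then show ?thesis unfolding lap using N.weitzenboeck_normal(1)[OF normal ScN] by (simp only: Rc K)
  qed
  have dzr: "dz g (ricci_sq ?H) 0 = 2 * (\<Sum>*a b. Rc b a * T g a b)" for g
    by (simp only: N.dz_ricci_sq[OF normal] N.trace_mult_nth[OF normal] T_def Rc mult.commute)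
  have dzbr: "dzb g (ricci_sq ?H) 0 = cnj (dz g (ricci_sq ?H) 0)" for g
  proof -
    have "dzb g (ricci_sq ?H) 0 = dzb g (\<lambda>y. cnj (ricci_sq ?H y)) 0"
      by (rule dzb_cong_open[OF P.open_S' S0]) (simp add: N.ricci_sq_real)
    also have "\<dots> = cnj (dz g (ricci_sq ?H) 0)"
      by (rule dzb_cnj) (rule Ck_differentiable[OF N.smooth_ricci_sq S0])
    finally show ?thesis .
  qed
  have G: "Re (grad2 H (ricci_sq H) z0) = (\<Sum>*g. (cmod (2 * (\<Sum>*a b. Rc b a * T g a b)))\<^sup>2)"
    unfolding grad N.grad2_1[OF normal] dzbr dzr mult_cnj_cmod by simp
  show thesis
  proof (rule that)
    show "q \<ge> 0" unfolding q_def by (intro mult_nonneg_nonneg sum_nonneg) auto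
    show "(m + 1) * (2 * Re (grad2 H (ricci_sq H) z0)) \<le> m * f2 * q"
      unfolding G by (rule bound(1))
    show "q + 2 * r / (m + 1) * f2 - \<kappa> * (sqrt 2 * sqrt f2 + bn) * f2 \<le> 2 * Re (Lap H (ricci_sq H) z0)"
      using bound(2) unfolding L by simp
    have "ricci_sq H z0 = ricci_sq ?H 0" using cong[OF S0] by (simp add: tau0)
    also have "\<dots> = (\<Sum>*a b. Rc a b * Rc b a)"
      by (simp add: ricci_sq_def N.W1[OF normal] N.trace_mult_nth[OF normal] Rc)
    also have "\<dots> = of_real (f2 / 2 + r\<^sup>2 / m)" by (rule bound(3))
    finally show "ricci_sq H z0 = of_real (f2 / 2 + r\<^sup>2 / m)" .
  qed
qed

end

section \<open>Complex components of the curvature\<close>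

definition cext2 :: "(complex ^ 'm \<Rightarrow> complex ^ 'm \<Rightarrow> complex) \<Rightarrow> complex ^ 'm \<Rightarrow> complex ^ 'm::finite \<Rightarrow> complex" where
  "cext2 F a b = cext (\<lambda>x. cext (\<lambda>y. F x y) (antihol b)) (hol a)"

lemma comp2_cext2: "comp2 T = cext2 (\<lambda>x y. complex_of_real (T x y))"
  by (simp add: comp2_def cext2_def fun_eq_iff)

lemma comp4_cext2: "comp4 T a b c d = cext2 (\<lambda>x y. comp2 (T x y) c d) a b"
  by (simp add: comp4_def comp2_def cext2_def)

lemma scaleR_eq_smult: "r *\<^sub>R (v :: complex ^ 'm) = complex_of_real r *s v"
  by (simp add: vec_eq_iff scaleR_conv_of_real[where 'a=complex])

definition sesqui :: "(complex ^ 'm \<Rightarrow> complex ^ 'm::finite \<Rightarrow> complex) \<Rightarrow> bool" where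
  "sesqui R \<longleftrightarrow> (\<forall>c x y. R (c *s x) y = c * R x y \<and> R x (c *s y) = cnj c * R x y)"

lemma sesquiD: "sesqui R \<Longrightarrow> R (c *s x) y = c * R x y" "sesqui R \<Longrightarrow> R x (c *s y) = cnj c * R x y"
  by (simp_all add: sesqui_def)

lemma hol_smult: "hol v = ((1/2) *s v, (- \<i>/2) *s v)" and antihol_smult: "antihol v = ((1/2) *s v, (\<i>/2) *s v)"
  by (simp_all add: hol_def antihol_def scaleR_eq_smult vec_eq_iff)

text \<open>Type decomposition: \<open>hol\<close> annihilates maps antilinear in the first slot,
  \<open>antihol\<close> maps linear in the second. Hence R and the conjugate of R with swapped
  arguments survive and the other two variants vanish.\<close>

lemma cext2_sesqui:
  assumes "sesqui R"
  shows "cext2 R a b = R a b" "cext2 (\<lambda>x y. cnj (R x y)) a b = 0" "cext2 (\<lambda>x y. R y x) a b = 0"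
    "cext2 (\<lambda>x y. cnj (R y x)) a b = cnj (R b a)"
  unfolding cext2_def cext_def hol_smult antihol_smult fst_conv snd_conv
  by (simp_all only: sesquiD[OF assms]) (simp_all add: complex_eq_iff)

lemma cext2_diff: "cext2 (\<lambda>x y. F x y - G x y) a b = cext2 F a b - cext2 G a b"
  and cext2_add: "cext2 (\<lambda>x y. F x y + G x y) a b = cext2 F a b + cext2 G a b"
  by (simp_all add: cext2_def cext_def algebra_simps)

text \<open>The tool for reading off complex components: in 2 Re R = R + conj R the conjugate is of
  the wrong type and disappears.\<close>

lemma comp2_Re:
  assumes "sesqui R" and T: "\<And>x y. T x y = 2 * Re (R x y)"
  shows "comp2 T a b = R a b"
proof -
  have "complex_of_real (T x y) = R x y + cnj (R x y)" for x y by (simp add: T complex_add_cnj)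
  then show ?thesis by (simp add: comp2_cext2 cext2_add cext2_sesqui[OF assms(1)])
qed

text \<open>Vectors are rows, in accordance with \<open>jac\<close>: a complex linear map acts by a
  matrix from the right.\<close>

definition mform :: "'m cmat \<Rightarrow> complex ^ 'm \<Rightarrow> complex ^ 'm::finite \<Rightarrow> complex" where
  "mform A v w = (\<Sum>*a b. v $ a * cnj (w $ b) * A $ a $ b)"

lemma sesqui_mform: "sesqui (mform A)"
  by (simp add: sesqui_def mform_def sum_distrib_left ac_simps)

lemma mform_add: "mform A (v + v') w = mform A v w + mform A v' w" "mform A v (w + w') = mform A v w + mform A v w'"
  by (simp_all add: mform_def sum.distrib algebra_simps)

lemma mform_hadj: "cnj (mform A v w) = mform (hadj A) w v"
  unfolding mform_def cnj_sum by (subst sum.swap) (simp add: ac_simps)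

lemma mform_axis: "mform A (axis a 1) (axis b 1) = A $ a $ b"
proof -
  have e: "axis a 1 $ p = (if p = a then 1 else 0 :: complex)" "cnj (axis b 1 $ p) = (if p = b then 1 else 0)" for p
    by (simp_all add: axis_def)
  have e': "(if Q then 1 else 0) * x = (if Q then x else 0 :: complex)" for Q x by simp
  show ?thesis
    unfolding mform_def e mult.assoc sum_distrib_left[symmetric] unfolding e' by simp
qed

lemma mform_vm: "mform A (v v* B) w = mform (B ** A) v w"
proof -
  have "mform A (v v* B) w = (\<Sum>*p b a. v $ a * cnj (w $ b) * (B $ a $ p * A $ p $ b))"
    by (simp add: mform_def vector_matrix_mult_def sum_distrib_right sum_distrib_left ac_simps)
  also have "\<dots> = (\<Sum>*p a b. v $ a * cnj (w $ b) * (B $ a $ p * A $ p $ b))"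
    by (rule sum.cong[OF refl], rule sum.swap)
  also have "\<dots> = (\<Sum>*a p b. v $ a * cnj (w $ b) * (B $ a $ p * A $ p $ b))" by (rule sum.swap)
  also have "\<dots> = (\<Sum>*a b p. v $ a * cnj (w $ b) * (B $ a $ p * A $ p $ b))"
    by (rule sum.cong[OF refl], rule sum.swap)
  finally show ?thesis by (simp add: mform_def matrix_mult_nth sum_distrib_left)
qed

lemma mform_rows: "mform A (U $ a) (U $ b) = (U ** A ** hadj U) $ a $ b"
  by (simp add: mform_def matrix_triple_nth)

lemma sum_Basis_complex_vec:
  fixes f :: "complex ^ 'm::finite \<Rightarrow> 'b::comm_monoid_add"
  shows "(\<Sum>b\<in>Basis. f b) = (\<Sum>*a. f (axis a 1) + f (axis a \<i>))"
proof -
  have inj: "inj_on (\<lambda>(a, u). axis a u) (UNIV \<times> {1, \<i>} :: ('m \<times> complex) set)"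
    by (auto simp: inj_on_def axis_eq_axis)
  have "(Basis :: (complex ^ 'm) set) = (\<lambda>(a, u). axis a u) ` (UNIV \<times> {1, \<i>})"
    by (auto simp: Basis_vec_def Basis_complex_def)
  then have "(\<Sum>b\<in>Basis. f b) = sum f ((\<lambda>(a, u). axis a u) ` (UNIV \<times> {1, \<i>}))" by (simp only:)
  also have "\<dots> = sum (f \<circ> (\<lambda>(a, u). axis a u)) (UNIV \<times> {1, \<i>})" by (rule sum.reindex[OF inj])
  also have "\<dots> = (\<Sum>(a, u)\<in>UNIV \<times> {1, \<i>}. f (axis a u))" by (simp add: o_def split_beta)
  also have "\<dots> = (\<Sum>*a. \<Sum>u\<in>{1, \<i>}. f (axis a u))" by (rule sum.cartesian_product[symmetric])
  finally show ?thesis by simp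
qed

lemma inner_axis_complex: "x \<bullet> axis a 1 = Re (x $ a)" "x \<bullet> axis a \<i> = Im (x $ a)"
  by (simp_all add: inner_axis inner_complex_def)

text \<open>The first map is complex linear. The second is antilinear, so its diagonal contributions
  at \<open>axis a 1\<close> and \<open>axis a \<i>\<close> are opposite and its real trace
  vanishes.\<close>

lemma real_trace:
  fixes A B :: "'m::finite cmat"
  shows "(\<Sum>b\<in>Basis. (b v* A) \<bullet> b) = 2 * Re (trace A)"
    and "(\<Sum>b\<in>Basis. ((\<chi> i. cnj (b $ i)) v* B) \<bullet> b) = 0"
proof -
  have 1: "(axis a u v* A) $ a = u * A $ a $ a" for a u and A :: "'m cmat"
    by (simp add: vector_matrix_mult_def axis_def if_distrib if_distribR mult.commute cong: if_cong)
  have 2: "((\<chi> i. cnj (axis a u $ i)) v* A) $ a = cnj u * A $ a $ a" for a u and A :: "'m cmat"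
    by (simp add: vector_matrix_mult_def axis_def if_distrib if_distribR mult.commute cong: if_cong)
  show "(\<Sum>b\<in>Basis. (b v* A) \<bullet> b) = 2 * Re (trace A)"
    by (simp add: sum_Basis_complex_vec inner_axis_complex 1 trace_def sum_distrib_left)
  show "(\<Sum>b\<in>Basis. ((\<chi> i. cnj (b $ i)) v* B) \<bullet> b) = 0"
    by (simp add: sum_Basis_complex_vec inner_axis_complex 2)
qed

section \<open>The Chern connection and its curvature in matrix form\<close>

context kaehler_chart
begin

text \<open>As \<open>KM_sym1\<close>, at an arbitrary point: the quadratic term has the symmetry
  too, by the Kaehler condition in its first factor.\<close>

lemma KM_sym: assumes z: "z \<in> S" shows "KM H a b z $ c $ d = KM H c b z $ a $ d"
proof -
  have "mdz a (mdzb b H) z $ c $ d = dzb b (\<lambda>z. mdz a H z $ c $ d) z" for a c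
    unfolding mdz_mdzb_commute[OF open_S z smooth, of a b] by (rule mdzb_nth)
  moreover have "dzb b (\<lambda>z. mdz a H z $ c $ d) z = dzb b (\<lambda>z. mdz c H z $ a $ d) z"
    by (rule dzb_cong_open[OF open_S z]) (rule kaehler)
  ultimately have "mdz a (mdzb b H) z $ c $ d = mdz c (mdzb b H) z $ a $ d" by (simp only:)
  moreover have "(mdz a H z ** Win H z ** mdzb b H z) $ c $ d = (mdz c H z ** Win H z ** mdzb b H z) $ a $ d"
    unfolding matrix_triple_nth by (simp only: kaehler[OF z, of a c] matrix_mult_nth)
  ultimately show ?thesis unfolding KM_def by (simp only: vector_minus_component)
qed

text \<open>The Christoffel symbols: entry (a, b) of \<open>NC c\<close> is \<Gamma>^b_ca. The
  formula is that of the Chern connection, which for a Kaehler metric is the Levi-Civita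
  connection.\<close>

definition NC :: "'m \<Rightarrow> complex ^ 'm \<Rightarrow> 'm cmat" where
  "NC c z = mdz c H z ** Win H z"

lemma smooth_NC: "mCk k S (NC c)"
  unfolding NC_def[abs_def] by (intro mCk_mult open_S smooth_mdz smooth_Win)

lemma mdz_NC: assumes z: "z \<in> S" shows "mdz e (NC c) z = mdz e (mdz c H) z ** Win H z - NC c z ** NC e z"
  and mdzb_NC: "mdzb e (NC c) z = - (KM H c e z ** Win H z)"
proof -
  have d: "mdiff (mdz c H) z" "mdiff (Win H) z"
    using mCk_mdiff[OF smooth_mdz z] mdiff_Win[OF z] by auto
  show "mdz e (NC c) z = mdz e (mdz c H) z ** Win H z - NC c z ** NC e z"
    unfolding NC_def[abs_def] mdz_mult[OF d] mdz_Win[OF z] by (simp add: mm.minus_right matrix_mul_assoc)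
  have "mdzb e (mdz c H) z = mdz c (mdzb e H) z" by (rule mdz_mdzb_commute[OF open_S z smooth, symmetric])
  then show "mdzb e (NC c) z = - (KM H c e z ** Win H z)"
    unfolding NC_def[abs_def] mdzb_mult[OF d] mdzb_Win[OF z] KM_def
    by (simp add: mm.minus_right mm.diff_left matrix_mul_assoc)
qed

definition NN :: "complex ^ 'm \<Rightarrow> complex ^ 'm \<Rightarrow> 'm cmat" where
  "NN z v = (\<Sum>*c. smat (v $ c) (NC c z))"

definition KU :: "complex ^ 'm \<Rightarrow> complex ^ 'm \<Rightarrow> complex ^ 'm \<Rightarrow> 'm cmat" where
  "KU z u v = (\<Sum>*c e. smat (u $ c * cnj (v $ e)) (KM H c e z))"

lemma vm_nth: "(w v* A) $ \<mu> = (\<Sum>*a. w $ a * A $ a $ \<mu>)" for w :: "complex ^ 'm" and A :: "'m cmat"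
  by (simp add: vector_matrix_mult_def mult.commute)

lemma frechet_NN:
  assumes z: "z \<in> S"
  shows "((\<lambda>y. w v* NN y v) has_derivative (\<lambda>u. w v* (\<Sum>*c e. 
      smat (v $ c) (smat (u $ e) (mdz e (NC c) z) + smat (cnj (u $ e)) (mdzb e (NC c) z))))) (at z)"
proof -
  have c: "Ck (Suc 0) S (\<lambda>y. (NC c y) $ a $ \<mu>)" for c a \<mu> using smooth_NC by (simp only: mCk_def)
  have eq: "(w v* NN y v) $ \<mu> = (\<Sum>*a c. w $ a * v $ c * NC c y $ a $ \<mu>)" for y \<mu>
    by (simp add: vm_nth NN_def sum_component sum_distrib_left mult.assoc)
  have "Ck (Suc 0) S (\<lambda>y. w v* NN y v)"
    by (rule Ck_vec[OF open_S]) (unfold eq, intro Ck_sum Ck_mult Ck_const open_S c)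
  then have d: "((\<lambda>y. w v* NN y v) has_derivative frechet_derivative (\<lambda>y. w v* NN y v) (at z)) (at z)"
    using z by (rule Ck_has_derivative)
  have "frechet_derivative (\<lambda>y. w v* NN y v) (at z) u $ \<mu> = (w v* (\<Sum>*c e. 
      smat (v $ c) (smat (u $ e) (mdz e (NC c) z) + smat (cnj (u $ e)) (mdzb e (NC c) z)))) $ \<mu>" for u \<mu>
  proof -
    have dNC: "(\<lambda>y. NC c y $ a $ \<mu>) differentiable (at z)" for c a using Ck_differentiable[OF c z] .
    have d1: "((\<lambda>y. (w v* NN y v) $ \<mu>) has_derivative (\<lambda>u. \<Sum>*a c. w $ a * v $ c * frechet_derivative (\<lambda>y. NC c y $ a $ \<mu>) (at z) u)) (at z)"
      unfolding eq by (intro has_derivative_sum has_derivative_mult_right differentiable_imp_has_derivative dNC)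
    have d2: "((\<lambda>y. (w v* NN y v) $ \<mu>) has_derivative (\<lambda>u. frechet_derivative (\<lambda>y. w v* NN y v) (at z) u $ \<mu>)) (at z)"
      by (rule bounded_linear.has_derivative[OF bounded_linear_vec_nth d])
    have "frechet_derivative (\<lambda>y. w v* NN y v) (at z) u $ \<mu> = (\<Sum>*a c. w $ a * v $ c * frechet_derivative (\<lambda>y. NC c y $ a $ \<mu>) (at z) u)"
      by (rule fun_cong[OF has_derivative_unique[OF d2 d1]])
    also have "\<dots> = (w v* (\<Sum>*c e. smat (v $ c) (smat (u $ e) (mdz e (NC c) z) + smat (cnj (u $ e)) (mdzb e (NC c) z)))) $ \<mu>"
      unfolding frechet_derivative_expansion[OF dNC] vm_nth sum_component smat_nth vector_add_component mdz_nth mdzb_nth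
      by (simp add: sum_distrib_left mult.assoc)
    finally show ?thesis .
  qed
  then have "frechet_derivative (\<lambda>y. w v* NN y v) (at z) = (\<lambda>u. w v* (\<Sum>*c e. 
      smat (v $ c) (smat (u $ e) (mdz e (NC c) z) + smat (cnj (u $ e)) (mdzb e (NC c) z))))"
    by (simp add: fun_eq_iff vec_eq_iff)
  then show ?thesis using d by simp
qed

lemma smat_add: "smat c (A + B) = smat c A + smat c B" and smat_diff: "smat c (A - B) = smat c A - smat c B"
  and smat_smat: "smat c (smat e A) = smat (c * e) A" and smat_minus: "smat c (- A) = - smat c A"
  for A B :: "'m cmat"
  by (auto intro!: matrix_eqI simp: algebra_simps)

text \<open>The curvature is of type (1,1): its (2,0)-part cancels.\<close>

lemma curvature_cancel:
  assumes z: "z \<in> S"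
  defines "DN \<equiv> \<lambda>u v. \<Sum>*c e. smat (v $ c) (smat (u $ e) (mdz e (NC c) z) + smat (cnj (u $ e)) (mdzb e (NC c) z))"
  shows "DN u v - DN v u + NN z v ** NN z u - NN z u ** NN z v = (KU z u v - KU z v u) ** Win H z"
proof -
  have NNNN: "NN z v ** NN z u = (\<Sum>*c e. smat (v $ c * u $ e) (NC c z ** NC e z))" for u v
    using sum_smat_mult[where w="mat 1" and x="\<lambda>c. v $ c" and y="\<lambda>c. u $ c" and A="\<lambda>c. NC c z" and B="\<lambda>c. NC c z" and I=UNIV and J=UNIV]
    by (simp add: NN_def)
  have KW: "KU z v u ** Win H z = (\<Sum>*c e. smat (v $ c * cnj (u $ e)) (KM H c e z ** Win H z))" for u v
    by (simp add: KU_def mm.sum_left smat_mult_left)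
  \<comment> \<open>The part with second unbarred derivatives of the metric; it is symmetric in u
    and v and so absent from the commutator.\<close>
  define Z where "Z u v = (\<Sum>*c e. smat (v $ c * u $ e) (mdz e (mdz c H) z ** Win H z))" for u v
  have DN: "DN u v = Z u v - NN z v ** NN z u - KU z v u ** Win H z" for u v
    unfolding DN_def mdz_NC[OF z] mdzb_NC[OF z] NNNN KW Z_def
    by (simp add: smat_add smat_diff smat_smat smat_minus sum.distrib sum_subtractf sum_negf)
  have "Z v u = (\<Sum>*e c. smat (u $ c * v $ e) (mdz e (mdz c H) z ** Win H z))"
    unfolding Z_def by (rule sum.swap)
  also have "\<dots> = Z u v"
    unfolding Z_def by (intro sum.cong refl) (simp only: mult.commute mdz_mdz_commute[OF open_S z smooth])
  finally have Z: "Z v u = Z u v" .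
  show ?thesis unfolding DN Z by (simp add: mm.diff_left)
qed

end

section \<open>From a real Kaehler metric to its Hermitian matrix\<close>

locale kaehler_metric =
  fixes S :: "(complex ^ 'm::finite) set" and h :: "(complex ^ 'm) metric"
  assumes open_S: "open S"
    and bil: "\<And>z. z \<in> S \<Longrightarrow> bilinear (h z)"
    and h_sym: "\<And>z v w. z \<in> S \<Longrightarrow> h z v w = h z w v"
    and h_pos: "\<And>z v. z \<in> S \<Longrightarrow> v \<noteq> 0 \<Longrightarrow> h z v v > 0"
    and h_smooth: "\<And>v w. smooth_fun_on S (\<lambda>z. h z v w)"
    and h_J: "\<And>z v w. z \<in> S \<Longrightarrow> h z (\<i> *s v) (\<i> *s w) = h z v w"
    and closed: "\<And>z u v w. z \<in> S \<Longrightarrow> frechet_derivative (\<lambda>y. h y (\<i> *s v) w) (at z) u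
                + frechet_derivative (\<lambda>y. h y (\<i> *s w) u) (at z) v
                + frechet_derivative (\<lambda>y. h y (\<i> *s u) v) (at z) w = 0"
begin

definition H :: "complex ^ 'm \<Rightarrow> 'm cmat" where
  "H z = (\<chi> a b. g_comp h z coord_frame a b)"

lemma h_linear: assumes "z \<in> S"
  shows "h z (x + x') y = h z x y + h z x' y" "h z x (y + y') = h z x y + h z x y'"
    "h z (r *\<^sub>R x) y = r * h z x y" "h z x (r *\<^sub>R y) = r * h z x y" "h z (- x) y = - h z x y" "h z x (- y) = - h z x y"
  using bilinear_ladd[OF bil[OF assms]] bilinear_radd[OF bil[OF assms]] bilinear_lmul[OF bil[OF assms]]
    bilinear_rmul[OF bil[OF assms]] bilinear_lneg[OF bil[OF assms]] bilinear_rneg[OF bil[OF assms]] by simp_all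

lemma J_J: "\<i> *s (\<i> *s v) = - (v :: complex ^ 'm)"
  by (simp add: vec_eq_iff)

lemma h_J1: "z \<in> S \<Longrightarrow> h z (\<i> *s v) w = - h z v (\<i> *s w)"
  using h_J[of z v "\<i> *s w"] h_linear[of z] by (simp add: J_J)

text \<open>Invariance under J makes the four terms of the complexified product pairwise
  equal.\<close>

lemma comp2_h: assumes z: "z \<in> S" shows "comp2 (h z) v w = (complex_of_real (h z v w) + \<i> * h z v (\<i> *s w)) / 2"
proof -
  have "comp2 (h z) v w = (complex_of_real (h z v w) + \<i> * h z v (\<i> *s w) - \<i> * h z (\<i> *s v) w + h z (\<i> *s v) (\<i> *s w)) / 4"
    using h_linear[OF z] by (simp add: comp2_def cext_def hol_def antihol_def field_simps)
  then show ?thesis unfolding h_J[OF z] h_J1[OF z, of v w] by (simp add: complex_eq_iff)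
qed

lemma linear_h2: assumes z: "z \<in> S" shows "linear (\<lambda>v. comp2 (h z) v w)" "linear (\<lambda>w. comp2 (h z) v w)"
proof -
  have i: "\<i> *s (x + y) = \<i> *s x + \<i> *s y" "\<i> *s (r *\<^sub>R x) = r *\<^sub>R (\<i> *s x)" for r and x y :: "complex ^ 'm"
    by (simp_all add: vec_eq_iff distrib_left)
  show "linear (\<lambda>v. comp2 (h z) v w)" unfolding comp2_h[OF z]
    by (rule linearI) (simp_all add: h_linear[OF z] complex_eq_iff add_divide_distrib)
  show "linear (\<lambda>w. comp2 (h z) v w)" unfolding comp2_h[OF z]
    by (rule linearI) (simp_all add: h_linear[OF z] i complex_eq_iff add_divide_distrib)
qed

lemma sesqui_h: assumes z: "z \<in> S" shows "sesqui (comp2 (h z))"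
proof -
  have dec: "c *s v = Re c *\<^sub>R v + Im c *\<^sub>R (\<i> *s v)" for c and v :: "complex ^ 'm"
    by (simp add: vec_eq_iff complex_eq_iff)
  have J: "comp2 (h z) (\<i> *s v) w = \<i> * comp2 (h z) v w" "comp2 (h z) v (\<i> *s w) = - \<i> * comp2 (h z) v w" for v w
    unfolding comp2_h[OF z] using h_J[OF z] h_J1[OF z] h_linear[OF z] by (simp_all add: J_J field_simps)
  show ?thesis unfolding sesqui_def
  proof (intro allI conjI)
    fix c x y
    show "comp2 (h z) (c *s x) y = c * comp2 (h z) x y"
      by (subst dec) (simp add: linear_add[OF linear_h2(1)[OF z]] linear_cmul[OF linear_h2(1)[OF z]] J complex_eq_iff algebra_simps)
    show "comp2 (h z) x (c *s y) = cnj c * comp2 (h z) x y"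
      by (subst dec) (simp add: linear_add[OF linear_h2(2)[OF z]] linear_cmul[OF linear_h2(2)[OF z]] J complex_eq_iff algebra_simps)
  qed
qed

lemma comp2_h_mform: assumes z: "z \<in> S" shows "comp2 (h z) v w = mform (H z) v w"
proof -
  have e: "v = (\<Sum>*a. v $ a *s axis a 1)" for v :: "complex ^ 'm"
    by (simp add: vec_eq_iff sum_component axis_def if_distrib cong: if_cong)
  have "comp2 (h z) v w = comp2 (h z) (\<Sum>*a. v $ a *s axis a 1) (\<Sum>*b. w $ b *s axis b 1)"
    by (simp flip: e)
  also have "\<dots> = (\<Sum>*a. v $ a * comp2 (h z) (axis a 1) (\<Sum>*b. w $ b *s axis b 1))"
    by (simp only: linear_sum[OF linear_h2(1)[OF z]] sesquiD[OF sesqui_h[OF z]])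
  also have "\<dots> = (\<Sum>*a. v $ a * (\<Sum>*b. cnj (w $ b) * comp2 (h z) (axis a 1) (axis b 1)))"
    by (simp only: linear_sum[OF linear_h2(2)[OF z]] sesquiD[OF sesqui_h[OF z]])
  also have "\<dots> = mform (H z) v w"
    by (simp add: mform_def H_def g_comp_def coord_frame_def sum_distrib_left mult.assoc)
  finally show ?thesis .
qed

lemma h_mform: "z \<in> S \<Longrightarrow> h z v w = 2 * Re (mform (H z) v w)"
  using comp2_h_mform[of z v w] by (simp add: comp2_h complex_eq_iff)

lemma H_nth: "z \<in> S \<Longrightarrow> H z $ a $ b = (complex_of_real (h z (axis a 1) (axis b 1)) + \<i> * h z (axis a 1) (axis b \<i>)) / 2"
proof -
  assume z: "z \<in> S"
  have "\<i> *s axis b (1::complex) = axis b \<i>" by (auto simp: vec_eq_iff axis_def)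
  then show ?thesis by (simp add: H_def g_comp_def coord_frame_def comp2_h[OF z])
qed

lemma Ck_h: "Ck k S (\<lambda>z. h z v w)"
  using h_smooth[of v w] by (simp add: smooth_fun_on_def Ck_on_eq_Ck)

lemma h_has_derivative: "z \<in> S \<Longrightarrow> ((\<lambda>y. h y v w) has_derivative frechet_derivative (\<lambda>y. h y v w) (at z)) (at z)"
  by (rule Ck_has_derivative[OF Ck_h])

lemma dz_H: assumes z: "z \<in> S"
  shows "4 * dz c (\<lambda>y. H y $ a $ b) z
    = (frechet_derivative (\<lambda>y. h y (axis a 1) (axis b 1)) (at z) (axis c 1) + frechet_derivative (\<lambda>y. h y (axis a 1) (axis b \<i>)) (at z) (axis c \<i>))
    + \<i> * (frechet_derivative (\<lambda>y. h y (axis a 1) (axis b \<i>)) (at z) (axis c 1) - frechet_derivative (\<lambda>y. h y (axis a 1) (axis b 1)) (at z) (axis c \<i>))"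
proof -
  have "dz c (\<lambda>y. H y $ a $ b) z = dz c (\<lambda>y. (complex_of_real (h y (axis a 1) (axis b 1)) + \<i> * h y (axis a 1) (axis b \<i>)) / 2) z"
    by (rule dz_cong_open[OF open_S z H_nth])
  also have "((\<lambda>y. (complex_of_real (h y (axis a 1) (axis b 1)) + \<i> * h y (axis a 1) (axis b \<i>)) / 2) has_derivative
     (\<lambda>u. (complex_of_real (frechet_derivative (\<lambda>y. h y (axis a 1) (axis b 1)) (at z) u) + \<i> * frechet_derivative (\<lambda>y. h y (axis a 1) (axis b \<i>)) (at z) u) / 2)) (at z)"
    by (auto intro!: derivative_eq_intros h_has_derivative[OF z])
  note dz_eq[OF this, of c]
  finally show ?thesis by (simp add: complex_eq_iff field_simps)
qed

text \<open>The (2,1)-part of closedness. Real and imaginary part of the claim come from the cyclic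
  identity on (c, a, Jb), (Jc, Ja, Jb), (c, a, b) and (Jc, Ja, b), where J-invariance moves J
  between the arguments.\<close>

lemma kaehler_H: assumes z: "z \<in> S"
  shows "mdz c H z $ a $ b = mdz a H z $ c $ b"
proof -
  define \<Phi> where "\<Phi> u v w = frechet_derivative (\<lambda>y. h y (\<i> *s v) w) (at z) u" for u v w
  have cyc: "\<Phi> u v w + \<Phi> v w u + \<Phi> w u v = 0" for u v w
    using closed[OF z, of v w u] by (simp add: \<Phi>_def)
  have fc: "frechet_derivative F (at z) = frechet_derivative G (at z)" if "\<And>y. y \<in> S \<Longrightarrow> F y = G y" for F G :: "complex ^ 'm \<Rightarrow> real"
    by (rule frechet_derivative_cong_open[OF open_S z that])
  have JJ: "\<Phi> u (\<i> *s v) (\<i> *s w) = \<Phi> u v w" for u v w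
    unfolding \<Phi>_def by (subst fc[OF h_J]) auto
  have iax: "\<i> *s axis b (1::complex) = axis b \<i>" "\<i> *s axis b \<i> = - axis b (1::complex)" for b :: 'm
    by (auto simp: vec_eq_iff axis_def)
  have e1: "frechet_derivative (\<lambda>y. h y (axis a 1) (axis b 1)) (at z) u = \<Phi> u (axis a 1) (axis b \<i>)" for a b u
    unfolding \<Phi>_def by (rule fun_cong[OF fc]) (metis h_J iax(1))
  have e2: "frechet_derivative (\<lambda>y. h y (axis a 1) (axis b \<i>)) (at z) u = - \<Phi> u (axis a 1) (axis b 1)" for a b u
  proof -
    have "frechet_derivative (\<lambda>y. h y (axis a 1) (axis b \<i>)) (at z) = frechet_derivative (\<lambda>y. - h y (\<i> *s axis a 1) (axis b 1)) (at z)"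
      by (rule fc) (use h_J1[of _ "axis a 1" "axis b 1"] in \<open>simp add: iax\<close>)
    then show ?thesis
      unfolding \<Phi>_def using frechet_derivative_eq[OF has_derivative_minus[OF h_has_derivative[OF z]]] by metis
  qed
  have anti: "\<Phi> u v w = - \<Phi> u w v" for u v w
  proof -
    have "frechet_derivative (\<lambda>y. h y (\<i> *s v) w) (at z) = frechet_derivative (\<lambda>y. - h y (\<i> *s w) v) (at z)"
      by (rule fc) (metis h_J1 h_sym)
    then show ?thesis
      unfolding \<Phi>_def using frechet_derivative_eq[OF has_derivative_minus[OF h_has_derivative[OF z]]] by metis
  qed
  let ?c = "axis c (1::complex)" and ?a = "axis a (1::complex)" and ?b = "axis b (1::complex)"
  let ?Jc = "axis c \<i>" and ?Ja = "axis a \<i>" and ?Jb = "axis b \<i>"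
  have r1: "\<Phi> ?c ?a ?Jb - \<Phi> ?a ?c ?Jb = - \<Phi> ?Jb ?c ?a" using cyc[of ?c ?a ?Jb] anti[of ?a ?Jb ?c] by simp
  have r2: "\<Phi> ?Jc ?a ?b - \<Phi> ?Ja ?c ?b = - \<Phi> ?Jb ?c ?a"
  proof -
    have "\<Phi> ?Jc ?a ?b = \<Phi> ?Jc ?Ja ?Jb" "\<Phi> ?Ja ?c ?b = \<Phi> ?Ja ?Jc ?Jb" "\<Phi> ?Jb ?c ?a = \<Phi> ?Jb ?Jc ?Ja"
      using JJ[of ?Jc ?a ?b] JJ[of ?Ja ?c ?b] JJ[of ?Jb ?c ?a] by (simp_all add: iax)
    then show ?thesis using cyc[of ?Jc ?Ja ?Jb] anti[of ?Ja ?Jb ?Jc] by simp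
  qed
  have r3: "\<Phi> ?c ?a ?b - \<Phi> ?a ?c ?b = - \<Phi> ?b ?c ?a" using cyc[of ?c ?a ?b] anti[of ?a ?b ?c] by simp
  have r4: "\<Phi> ?Jc ?a ?Jb - \<Phi> ?Ja ?c ?Jb = \<Phi> ?b ?c ?a"
  proof -
    have lin: "\<Phi> u (- v) w = - \<Phi> u v w" "\<Phi> u v (- w) = - \<Phi> u v w" for u v w
    proof -
      have "frechet_derivative (\<lambda>y. h y (\<i> *s (- v)) w) (at z) = frechet_derivative (\<lambda>y. - h y (\<i> *s v) w) (at z)"
        "frechet_derivative (\<lambda>y. h y (\<i> *s v) (- w)) (at z) = frechet_derivative (\<lambda>y. - h y (\<i> *s v) w) (at z)"
        by (rule fc, simp add: h_linear)+
      then show "\<Phi> u (- v) w = - \<Phi> u v w" "\<Phi> u v (- w) = - \<Phi> u v w"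
        unfolding \<Phi>_def using frechet_derivative_eq[OF has_derivative_minus[OF h_has_derivative[OF z]]] by metis+
    qed
    have "\<Phi> ?Jc ?a ?Jb = - \<Phi> ?Jc ?Ja ?b" "\<Phi> ?Ja ?c ?Jb = - \<Phi> ?Ja ?Jc ?b" "\<Phi> ?b ?c ?a = \<Phi> ?b ?Jc ?Ja"
      using JJ[of ?Jc ?a ?Jb] JJ[of ?Ja ?c ?Jb] JJ[of ?b ?c ?a] by (simp_all add: iax lin)
    then show ?thesis using cyc[of ?Jc ?Ja ?b] anti[of ?Ja ?b ?Jc] by simp
  qed
  have "4 * dz c (\<lambda>y. H y $ a $ b) z = 4 * dz a (\<lambda>y. H y $ c $ b) z"
    unfolding dz_H[OF z] e1 e2 using r1 r2 r3 r4 by (simp add: complex_eq_iff)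
  then show ?thesis by simp
qed

sublocale kaehler_chart S H
proof
  show "open S" by (rule open_S)
  show "mCk k S H" for k
    unfolding mCk_def
  proof (intro allI)
    fix i j
    have "Ck k S (\<lambda>z. (complex_of_real (h z (axis i 1) (axis j 1)) + \<i> * complex_of_real (h z (axis i 1) (axis j \<i>))) * (1/2))"
      by (intro Ck_mult Ck_add Ck_of_real Ck_const Ck_h open_S)
    then show "Ck k S (\<lambda>z. H z $ i $ j)"
      by (rule iffD1[OF Ck_cong[OF open_S], rotated]) (simp add: H_nth)
  qed
  show "hadj (H z) = H z" if z: "z \<in> S" for z
  proof (rule matrix_eqI)
    fix a b
    have "h z (axis b 1) (\<i> *s axis a 1) = - h z (axis a 1) (\<i> *s axis b 1)"
      using h_J1[OF z, of "axis a 1" "axis b 1"] h_sym[OF z] by simp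
    then show "hadj (H z) $ a $ b = H z $ a $ b"
      using h_sym[OF z, of "axis a 1" "axis b 1"]
      by (simp add: H_def g_comp_def coord_frame_def comp2_h[OF z])
  qed
  show "Re (\<Sum>*a b. v $ a * cnj (v $ b) * H z $ a $ b) > 0" if "z \<in> S" "v \<noteq> 0" for z v
    using h_pos[OF that] h_mform[OF that(1)] by (simp add: mform_def)
  show "mdz c H z $ a $ b = mdz a H z $ c $ b" if "z \<in> S" for z a b c
    by (rule kaehler_H[OF that])
qed

end

section \<open>Connection, curvature and Ricci tensor of the real metric\<close>

context kaehler_metric
begin

lemma sharp_eqI:
  assumes z: "z \<in> S" and u: "\<And>x. h z u x = l x"
  shows "sharp h z l = u"
  unfolding sharp_def
proof (rule the_equality)
  show "\<forall>x. h z u x = l x" using u by simp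
next
  fix u' assume u': "\<forall>x. h z u' x = l x"
  have "h z (u' - u) (u' - u) = h z (u' + - u) (u' - u)" by simp
  also have "\<dots> = 0" unfolding h_linear[OF z] using u u' by simp
  finally show "u' = u" using h_pos[OF z, of "u' - u"] by force
qed

lemma frechet_h: assumes z: "z \<in> S"
  shows "frechet_derivative (\<lambda>y. h y w x) (at z) v = 2 * Re (mform (\<Sum>*c. smat (v $ c) (mdz c H z)) w x)
    + 2 * Re (mform (\<Sum>*c. smat (v $ c) (mdz c H z)) x w)"
proof -
  let ?A = "\<Sum>*c. smat (v $ c) (mdz c H z)"
  have d: "(\<lambda>y. H y $ a $ b) differentiable (at z)" for a b using mdiff_H[OF z] by (simp add: mdiff_def)
  have D: "((\<lambda>y. mform (H y) w x) has_derivative (\<lambda>v. \<Sum>*a b. w $ a * cnj (x $ b) * frechet_derivative (\<lambda>y. H y $ a $ b) (at z) v)) (at z)"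
    unfolding mform_def by (intro has_derivative_sum has_derivative_mult_right differentiable_imp_has_derivative d)
  have "frechet_derivative (\<lambda>y. H y $ a $ b) (at z) v = ?A $ a $ b + hadj ?A $ a $ b" for a b
  proof -
    have "mdzb c H z $ a $ b = cnj (mdz c H z $ b $ a)" for c by (simp only: mdzb_H[OF z] hadj_nth)
    then show ?thesis
      unfolding frechet_derivative_expansion[OF d] by (simp add: sum_component sum.distrib)
  qed
  then have "(\<Sum>*a b. w $ a * cnj (x $ b) * frechet_derivative (\<lambda>y. H y $ a $ b) (at z) v)
      = mform ?A w x + mform (hadj ?A) w x"
    by (simp only: mform_def distrib_left sum.distrib)
  also have "mform (hadj ?A) w x = cnj (mform ?A x w)" by (simp only: mform_hadj)
  finally have e: "(\<Sum>*a b. w $ a * cnj (x $ b) * frechet_derivative (\<lambda>y. H y $ a $ b) (at z) v)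
      = mform ?A w x + cnj (mform ?A x w)" .
  have "((\<lambda>y. 2 * Re (mform (H y) w x)) has_derivative (\<lambda>v. 2 * Re (\<Sum>*a b. w $ a * cnj (x $ b) * frechet_derivative (\<lambda>y. H y $ a $ b) (at z) v))) (at z)"
    by (rule has_derivative_mult_right, rule bounded_linear.has_derivative[OF bounded_linear_Re D])
  then have "((\<lambda>y. h y w x) has_derivative (\<lambda>v. 2 * Re (\<Sum>*a b. w $ a * cnj (x $ b) * frechet_derivative (\<lambda>y. H y $ a $ b) (at z) v))) (at z)"
    by (rule has_derivative_transform_within_open[OF _ open_S z]) (simp add: h_mform)
  then have "frechet_derivative (\<lambda>y. h y w x) (at z) v = 2 * Re (\<Sum>*a b. w $ a * cnj (x $ b) * frechet_derivative (\<lambda>y. H y $ a $ b) (at z) v)"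
    by (simp add: frechet_derivative_eq)
  then show ?thesis by (simp add: e)
qed

text \<open>The Kaehler condition contracted with vectors: the derivative of the metric along v,
  applied to w, is symmetric in v and w.\<close>

lemma mform_A_sym: assumes z: "z \<in> S"
  shows "mform (\<Sum>*c. smat (v $ c) (mdz c H z)) w x = mform (\<Sum>*c. smat (w $ c) (mdz c H z)) v x"
proof -
  have e: "mform (\<Sum>*c. smat (v $ c) (mdz c H z)) w x = (\<Sum>*a c b. v $ c * w $ a * cnj (x $ b) * mdz c H z $ a $ b)" for v w
  proof -
    have "mform (\<Sum>*c. smat (v $ c) (mdz c H z)) w x = (\<Sum>*a b c. v $ c * w $ a * cnj (x $ b) * mdz c H z $ a $ b)"
      unfolding mform_def sum_component smat_nth sum_distrib_left by (intro sum.cong refl) (simp only: ac_simps)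
    also have "\<dots> = (\<Sum>*a c b. v $ c * w $ a * cnj (x $ b) * mdz c H z $ a $ b)"
      by (rule sum.cong[OF refl], rule sum.swap)
    finally show ?thesis .
  qed
  have "(\<Sum>*a c b. v $ c * w $ a * cnj (x $ b) * mdz c H z $ a $ b)
     = (\<Sum>*c a b. w $ a * v $ c * cnj (x $ b) * mdz a H z $ c $ b)"
    by (subst sum.swap) (intro sum.cong refl arg_cong2[where f="(*)"] kaehler[OF z] mult.commute)
  then show ?thesis unfolding e .
qed

lemma NN_mult_H: assumes z: "z \<in> S" shows "NN z v ** H z = (\<Sum>*c. smat (v $ c) (mdz c H z))"
  unfolding NN_def NC_def mm.sum_left smat_mult_left by (simp add: matrix_mul_assoc[symmetric] Win_mult[OF z])

text \<open>By \<open>frechet_h\<close> the Koszul formula has six terms. The symmetry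
  \<open>mform_A_sym\<close> cancels four of them and makes the other two equal, which leaves the
  Chern connection.\<close>

lemma levi_civita_eq: assumes z: "z \<in> S"
  shows "levi_civita h z v w = w v* NN z v"
  unfolding levi_civita_def
proof (rule sharp_eqI[OF z])
  fix x
  have "h z (w v* NN z v) x = 2 * Re (mform (\<Sum>*c. smat (v $ c) (mdz c H z)) w x)"
    by (simp add: h_mform[OF z] mform_vm NN_mult_H[OF z])
  then show "h z (w v* NN z v) x = (frechet_derivative (\<lambda>y. h y w x) (at z) v
      + frechet_derivative (\<lambda>y. h y v x) (at z) w - frechet_derivative (\<lambda>y. h y v w) (at z) x) / 2"
    unfolding frechet_h[OF z] mform_A_sym[OF z, of w v x] mform_A_sym[OF z, of x v w] mform_A_sym[OF z, of x w v] by simp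
qed

lemma vm_add: "w v* (A + B) = w v* A + w v* B" and vm_diff: "w v* (A - B) = w v* A - w v* B"
  for w :: "complex ^ 'm" and A B :: "'m cmat"
  by (simp_all add: vec_eq_iff vm_nth algebra_simps sum.distrib sum_subtractf)

lemma curvature_eq: assumes z: "z \<in> S"
  shows "curvature h z u v w = w v* ((KU z u v - KU z v u) ** Win H z)"
proof -
  have f: "frechet_derivative (\<lambda>y. levi_civita h y v w) (at z) u = w v* (\<Sum>*c e. 
      smat (v $ c) (smat (u $ e) (mdz e (NC c) z) + smat (cnj (u $ e)) (mdzb e (NC c) z)))" for u v
  proof -
    have "frechet_derivative (\<lambda>y. levi_civita h y v w) (at z) = frechet_derivative (\<lambda>y. w v* NN y v) (at z)"
      by (rule frechet_derivative_cong_open[OF open_S z levi_civita_eq])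
    then show ?thesis by (simp only: frechet_derivative_eq[OF frechet_NN[OF z]])
  qed
  show ?thesis
    unfolding curvature_def f levi_civita_eq[OF z] curvature_cancel[OF z, symmetric]
    by (simp add: vm_add vm_diff vector_matrix_mul_assoc)
qed

lemma ricci_tensor_eq: assumes z: "z \<in> S"
  shows "ricci_tensor h z v w = 2 * Re (mform (RicM H z) w v)"
proof -
  \<comment> \<open>The curvature is the difference of a part complex linear in the traced vector,
    with matrix A, and an antilinear part, with matrix B. The real trace sees A only.\<close>
  define A where "A = (\<chi> c a. \<Sum>*e. cnj (v $ e) * (w v* (KM H c e z ** Win H z)) $ a)"
  define B where "B = (\<chi> c a. \<Sum>*e. v $ e * (w v* (KM H e c z ** Win H z)) $ a)"
  have 1: "w v* (KU z b v ** Win H z) = b v* A" for b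
  proof -
    have "(w v* (KU z b v ** Win H z)) $ a = (b v* A) $ a" for a
    proof -
      have "(w v* (KU z b v ** Win H z)) $ a = (\<Sum>*p c e. w $ p * (b $ c * cnj (v $ e) * (KM H c e z ** Win H z) $ p $ a))"
        by (simp add: vm_nth KU_def mm.sum_left smat_mult_left sum_component sum_distrib_left)
      also have "\<dots> = (\<Sum>*c p e. w $ p * (b $ c * cnj (v $ e) * (KM H c e z ** Win H z) $ p $ a))" by (rule sum.swap)
      also have "\<dots> = (\<Sum>*c e p. w $ p * (b $ c * cnj (v $ e) * (KM H c e z ** Win H z) $ p $ a))"
        by (rule sum.cong[OF refl], rule sum.swap)
      also have "\<dots> = (b v* A) $ a" by (simp add: vm_nth A_def sum_distrib_left ac_simps)
      finally show ?thesis .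
    qed
    then show ?thesis by (simp add: vec_eq_iff)
  qed
  have 2: "w v* (KU z v b ** Win H z) = (\<chi> i. cnj (b $ i)) v* B" for b
  proof -
    have "(w v* (KU z v b ** Win H z)) $ a = ((\<chi> i. cnj (b $ i)) v* B) $ a" for a
    proof -
      have "(w v* (KU z v b ** Win H z)) $ a = (\<Sum>*p e c. w $ p * (v $ e * cnj (b $ c) * (KM H e c z ** Win H z) $ p $ a))"
        by (simp add: vm_nth KU_def mm.sum_left smat_mult_left sum_component sum_distrib_left)
      also have "\<dots> = (\<Sum>*e p c. w $ p * (v $ e * cnj (b $ c) * (KM H e c z ** Win H z) $ p $ a))" by (rule sum.swap)
      also have "\<dots> = (\<Sum>*e c p. w $ p * (v $ e * cnj (b $ c) * (KM H e c z ** Win H z) $ p $ a))"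
        by (rule sum.cong[OF refl], rule sum.swap)
      also have "\<dots> = (\<Sum>*c e p. w $ p * (v $ e * cnj (b $ c) * (KM H e c z ** Win H z) $ p $ a))" by (rule sum.swap)
      also have "\<dots> = ((\<chi> i. cnj (b $ i)) v* B) $ a" by (simp add: vm_nth B_def sum_distrib_left ac_simps)
      finally show ?thesis .
    qed
    then show ?thesis by (simp add: vec_eq_iff)
  qed
  have "ricci_tensor h z v w = (\<Sum>b\<in>Basis. (b v* A) \<bullet> b) - (\<Sum>b\<in>Basis. ((\<chi> i. cnj (b $ i)) v* B) \<bullet> b)"
    unfolding ricci_tensor_def curvature_eq[OF z] mm.diff_left vm_diff 1 2 inner_diff_left by (rule sum_subtractf)
  also have "\<dots> = 2 * Re (trace A)" by (simp only: real_trace diff_0_right)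
  also have "trace A = (\<Sum>*a e p q. cnj (v $ e) * w $ p * KM H p e z $ a $ q * Win H z $ q $ a)"
    unfolding trace_def A_def vec_lambda_beta vm_nth matrix_mult_nth sum_distrib_left
    by (intro sum.cong refl) (simp only: KM_sym[OF z] mult.assoc)
  also have "\<dots> = (\<Sum>*a p e q. cnj (v $ e) * w $ p * KM H p e z $ a $ q * Win H z $ q $ a)"
    by (rule sum.cong[OF refl], rule sum.swap)
  also have "\<dots> = (\<Sum>*p a e q. cnj (v $ e) * w $ p * KM H p e z $ a $ q * Win H z $ q $ a)"
    by (rule sum.swap)
  also have "\<dots> = (\<Sum>*p e a q. cnj (v $ e) * w $ p * KM H p e z $ a $ q * Win H z $ q $ a)"
    by (rule sum.cong[OF refl], rule sum.swap)
  also have "\<dots> = mform (RicM H z) w v"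
    unfolding mform_def RicM_def vec_lambda_beta trace_def matrix_mult_nth sum_distrib_left
    by (intro sum.cong refl) (simp only: ac_simps)
  finally show ?thesis .
qed

lemma mform_herm: assumes "hadj A = A" shows "Re (mform A v w) = Re (mform A w v)"
proof -
  have "Re (mform A v w) = Re (cnj (mform A v w))" by simp
  then show ?thesis by (simp only: mform_hadj assms)
qed

lemma comp2_ricci: assumes z: "z \<in> S" shows "comp2 (ricci_tensor h z) a b = mform (RicM H z) a b"
  by (rule comp2_Re[OF sesqui_mform]) (simp add: ricci_tensor_eq[OF z] mform_herm[OF hadj_RicM[OF z]])

lemma scalar_curvature_eq: assumes z: "z \<in> S"
  shows "scalar_curvature h z = 2 * Re (ScM H z)"
proof -
  have "sharp h z (ricci_tensor h z b) = b v* (RicM H z ** Win H z)" for b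
  proof (rule sharp_eqI[OF z])
    fix x
    show "h z (b v* (RicM H z ** Win H z)) x = ricci_tensor h z b x"
      using Win_mult[OF z] mform_herm[OF hadj_RicM[OF z], of x b]
      by (simp add: h_mform[OF z] mform_vm matrix_mul_assoc[symmetric] ricci_tensor_eq[OF z])
  qed
  then show ?thesis by (simp only: scalar_curvature_def ScM_def real_trace)
qed

lemma ScM_real: assumes z: "z \<in> S" shows "ScM H z = of_real (Re (ScM H z))"
proof -
  have tr: "cnj (trace X) = trace (hadj X)" for X :: "'m cmat" by (simp add: trace_def)
  have "cnj (ScM H z) = ScM H z"
    unfolding ScM_def tr hadj_mult hadj_Win[OF z] hadj_RicM[OF z] by (rule trace_mul_sym)
  then show ?thesis by (simp add: complex_eq_iff)
qed

lemma KU_form: "mform (KU z x y) w u = (\<Sum>*p q s t. x $ p * cnj (y $ q) * w $ s * cnj (u $ t) * KM H p q z $ s $ t)"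
proof -
  have "mform (KU z x y) w u = (\<Sum>*s t p q. x $ p * cnj (y $ q) * w $ s * cnj (u $ t) * KM H p q z $ s $ t)"
    unfolding mform_def KU_def sum_component smat_nth sum_distrib_left by (intro sum.cong refl) (simp only: ac_simps)
  also note sum_swap4
  finally show ?thesis .
qed

lemma sesqui_KU: "sesqui (\<lambda>x y. mform (KU z x y) w u)"
  unfolding sesqui_def KU_form by (simp add: sum_distrib_left ac_simps)

lemma hadj_KU: assumes z: "z \<in> S" shows "hadj (KU z x y) = KU z y x"
proof (rule matrix_eqI)
  fix i j
  have "cnj (KM H c e z $ j $ i) = KM H e c z $ i $ j" for c e using hadj_KM[OF z, of c e] by (metis hadj_nth)
  then have "hadj (KU z x y) $ i $ j = (\<Sum>*c e. y $ e * cnj (x $ c) * KM H e c z $ i $ j)"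
    by (simp add: KU_def sum_component ac_simps)
  also have "\<dots> = KU z y x $ i $ j" unfolding KU_def sum_component smat_nth by (rule sum.swap)
  finally show "hadj (KU z x y) $ i $ j = KU z y x $ i $ j" .
qed

text \<open>Of the two curvature terms only one has the type (1,1) in the first index pair and
  survives; it is the subtracted one, whence the sign between \<open>riemann_tensor\<close> and
  \<open>KM\<close>.\<close>

lemma comp4_riemann: assumes z: "z \<in> S"
  shows "comp4 (riemann_tensor h z) a b c d = - mform (KU z a b) c d"
proof -
  have inner: "comp2 (riemann_tensor h z x y) c d = cnj (mform (KU z x y) d c) - cnj (mform (KU z y x) d c)" for x y
  proof -
    define R where "R u w = cnj (mform (KU z x y - KU z y x) w u)" for u w
    have "sesqui R" unfolding R_def sesqui_def by (simp add: sesquiD[OF sesqui_mform])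
    moreover have "riemann_tensor h z x y u w = 2 * Re (R u w)" for u w
      using Win_mult[OF z]
      by (simp add: riemann_tensor_def curvature_eq[OF z] h_mform[OF z] mform_vm R_def matrix_mul_assoc[symmetric])
    ultimately have "comp2 (riemann_tensor h z x y) c d = R c d" by (rule comp2_Re)
    moreover have "mform (KU z x y - KU z y x) d c = mform (KU z x y) d c - mform (KU z y x) d c"
      by (simp add: mform_def right_diff_distrib sum_subtractf)
    ultimately show ?thesis by (simp only: R_def complex_cnj_diff)
  qed
  have "comp4 (riemann_tensor h z) a b c d = - cnj (mform (KU z b a) d c)"
    unfolding comp4_cext2 inner cext2_diff cext2_sesqui[OF sesqui_KU] by simp
  also have "\<dots> = - mform (KU z a b) c d" by (simp only: mform_hadj hadj_KU[OF z])
  finally show ?thesis .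
qed

text \<open>Frame vectors as rows, so that the frame components of a Hermitian form are
  \<open>U ** A ** hadj U\<close>.\<close>

definition frame_mat :: "'m frame \<Rightarrow> 'm cmat" where
  "frame_mat e = (\<chi> a p. e a $ p)"

lemma frame_mat_row: "frame_mat e $ a = e a"
  by (simp add: frame_mat_def vec_eq_iff)

lemma g_comp_eq: "z \<in> S \<Longrightarrow> g_comp h z e a b = (frame_mat e ** H z ** hadj (frame_mat e)) $ a $ b"
  unfolding mform_rows[symmetric] frame_mat_row by (simp add: g_comp_def comp2_h_mform)

lemma ricci_comp_eq: "z \<in> S \<Longrightarrow> ricci_comp h z e a b = (frame_mat e ** RicM H z ** hadj (frame_mat e)) $ a $ b"
  unfolding mform_rows[symmetric] frame_mat_row by (simp add: ricci_comp_def comp2_ricci)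

lemma unitary_frame_iff: "z \<in> S \<Longrightarrow> unitary_frame h z e \<longleftrightarrow> frame_mat e ** H z ** hadj (frame_mat e) = mat 1"
  by (simp add: unitary_frame_def g_comp_eq vec_eq_iff mat_1_nth)

text \<open>For a unitary frame U the inverse metric is U^* U, so the trace in the frame is the
  contraction with the inverse metric.\<close>

lemma unitary_frame_ScM:
  assumes z: "z \<in> S" and e: "unitary_frame h z e"
  shows "complex_scalar h z e = ScM H z"
proof -
  let ?U = "frame_mat e"
  have U: "?U ** H z ** hadj ?U = mat 1" using e by (simp add: unitary_frame_iff[OF z])
  have "?U ** (H z ** hadj ?U) = mat 1" using U by (simp add: matrix_mul_assoc)
  from matrix_left_right_inverse[THEN iffD1, OF this]
  have "H z ** (hadj ?U ** ?U) = mat 1" by (simp only: matrix_mul_assoc)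
  then have W: "Win H z = hadj ?U ** ?U" unfolding Win_def by (rule matrix_inv_eqI)
  have g: "(\<chi> i j. g_comp h z e i j) = mat 1" using e by (simp add: unitary_frame_def vec_eq_iff mat_1_nth)
  have "matrix_inv (mat 1 :: 'm cmat) = mat 1" by (rule matrix_inv_eqI) simp
  then have "complex_scalar h z e = trace (?U ** RicM H z ** hadj ?U)"
    unfolding complex_scalar_def g_inv_def g ricci_comp_eq[OF z] trace_def
    by (simp add: mat_1_nth if_distrib if_distribR cong: if_cong)
  also have "\<dots> = trace (RicM H z ** hadj ?U ** ?U)"
    using trace_mul_sym[of ?U "RicM H z ** hadj ?U"] by (simp only: matrix_mul_assoc)
  also have "\<dots> = ScM H z" by (simp add: ScM_def W matrix_mul_assoc)
  finally show ?thesis .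
qed

lemma coord_frame_ScM: assumes z: "z \<in> S" shows "complex_scalar h z coord_frame = ScM H z"
proof -
  have "frame_mat coord_frame = (mat 1 :: 'm cmat)"
    by (rule matrix_eqI) (simp add: frame_mat_def coord_frame_def axis_def mat_1_nth)
  then have "ricci_comp h z coord_frame a b = RicM H z $ a $ b" for a b by (simp add: ricci_comp_eq[OF z])
  moreover have "(\<chi> i j. g_comp h z coord_frame i j) = H z" by (simp add: H_def)
  ultimately show ?thesis
    unfolding complex_scalar_def g_inv_def ScM_def trace_def matrix_mult_nth Win_def by (simp add: mult.commute)
qed

lemma riemann_comp_eq: assumes z: "z \<in> S"
  shows "riemann_comp h z e a b c d = - (\<Sum>*p q s t. 
    frame_mat e $ a $ p * cnj (frame_mat e $ b $ q) * frame_mat e $ c $ s * cnj (frame_mat e $ d $ t) * KM H p q z $ s $ t)"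
  unfolding riemann_comp_def comp4_riemann[OF z] KU_form frame_mat_row ..

lemma grad_norm_sq_eq:
  fixes f :: "complex ^ 'm \<Rightarrow> real"
  assumes z: "z \<in> S" and f: "f differentiable (at z)"
  shows "grad_norm_sq h f z = 2 * Re (grad2 H (\<lambda>y. complex_of_real (f y)) z)"
proof -
  let ?F = "\<lambda>y. complex_of_real (f y)"
  have FD: "(?F has_derivative (\<lambda>v. complex_of_real (frechet_derivative f (at z) v))) (at z)"
    by (rule bounded_linear.has_derivative[OF bounded_linear_of_real differentiable_imp_has_derivative[OF f]])
  have Fd: "?F differentiable (at z)" using FD by (auto simp: differentiable_def)
  have cnj_dz: "dz b ?F z = cnj (dzb b ?F z)" for b
    using dz_cnj[OF Fd, of b] by simp
  define Y where "Y = (\<chi> b. dzb b ?F z)"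
  define X where "X = Y v* Win H z"
  have df: "frechet_derivative f (at z) x = 2 * Re (\<Sum>*b. cnj (x $ b) * Y $ b)" for x
  proof -
    have "complex_of_real (frechet_derivative f (at z) x) = frechet_derivative ?F (at z) x"
      by (simp add: frechet_derivative_eq[OF FD])
    also have "\<dots> = (\<Sum>*b. cnj (cnj (x $ b) * Y $ b) + cnj (x $ b) * Y $ b)"
      unfolding frechet_derivative_expansion[OF Fd] by (simp add: Y_def cnj_dz)
    finally have "Re (complex_of_real (frechet_derivative f (at z) x)) = Re (\<Sum>*b. cnj (cnj (x $ b) * Y $ b) + cnj (x $ b) * Y $ b)"
      by (rule arg_cong)
    then show ?thesis by (simp add: sum.distrib sum_distrib_left)
  qed
  have X: "mform (H z) X x = (\<Sum>*b. cnj (x $ b) * Y $ b)" for x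
  proof -
    have "mform (H z) X x = mform (mat 1) Y x" unfolding X_def mform_vm by (simp only: Win_mult[OF z])
    also have "\<dots> = (\<Sum>*b. Y $ b * cnj (x $ b))"
      by (simp add: mform_def mat_1_nth if_distrib cong: if_cong)
    finally show ?thesis by (simp add: mult.commute)
  qed
  have sh: "sharp h z (frechet_derivative f (at z)) = X"
    by (rule sharp_eqI[OF z]) (simp only: h_mform[OF z] X df)
  have "grad2 H ?F z = (\<Sum>*a b. Win H z $ b $ a * cnj (Y $ a) * Y $ b)"
    by (simp add: grad2_def cnj_dz Y_def)
  also have "\<dots> = (\<Sum>*b a. Win H z $ b $ a * cnj (Y $ a) * Y $ b)" by (rule sum.swap)
  also have "\<dots> = (\<Sum>*b. cnj (X $ b) * Y $ b)"
  proof -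
    have "cnj (Win H z $ a $ b) = Win H z $ b $ a" for a b using hadj_Win[OF z] by (metis hadj_nth)
    then have "cnj (X $ b) = (\<Sum>*a. Win H z $ b $ a * cnj (Y $ a))" for b
      by (simp add: X_def vm_nth mult.commute)
    then show ?thesis by (simp add: sum_distrib_right)
  qed
  finally have "grad2 H ?F z = mform (H z) X X" by (simp add: X)
  then show ?thesis by (simp add: grad_norm_sq_def sh Let_def h_mform[OF z])
qed

lemma grad_norm_sq_nonneg:
  assumes z: "z \<in> S" and f: "f differentiable (at z)"
  shows "grad_norm_sq h f z \<ge> 0"
proof -
  have D: "linear (frechet_derivative f (at z))"
    by (rule has_derivative_linear[OF differentiable_imp_has_derivative[OF f]])
  let ?X = "sharp h z (frechet_derivative f (at z))"
  show ?thesis using h_pos[OF z, of ?X] h_linear(3)[OF z, of 0 0 0]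
    by (cases "?X = 0") (auto simp: grad_norm_sq_def Let_def)
qed

text \<open>Gram-Schmidt, one index at a time. The next vector lies in the kernel of the map L
  recording the products with the previous vectors: L misses the k-th coordinate, so it is not onto
  and hence not injective.\<close>

lemma unitary_frame_exists: assumes z: "z \<in> S" shows "\<exists>e. unitary_frame h z e"
proof -
  let ?G = "mform (H z)"
  have herm: "cnj (?G v w) = ?G w v" for v w by (simp only: mform_hadj herm[OF z])
  have "\<exists>e :: 'm frame. \<forall>a\<in>A. \<forall>b\<in>A. ?G (e a) (e b) = (if a = b then 1 else 0)" if "finite A" for A
    using that
  proof (induction A rule: finite_induct)
    case empty
    show ?case by simp
  next
    case (insert k A)
    then obtain e :: "'m frame" where e: "\<And>a b. a \<in> A \<Longrightarrow> b \<in> A \<Longrightarrow> ?G (e a) (e b) = (if a = b then 1 else 0)" by blast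
    define L :: "complex ^ 'm \<Rightarrow> complex ^ 'm" where "L v = (\<chi> a. if a \<in> A then ?G v (e a) else 0)" for v
    have L: "linear L"
      by (rule linearI) (auto simp: L_def vec_eq_iff mform_add scaleR_eq_smult sesquiD[OF sesqui_mform])
    have "\<not> surj L"
    proof
      assume "surj L"
      then obtain v where "L v = axis k 1" by (metis surjD)
      then have "L v $ k = 1" by (simp add: axis_def)
      then show False using insert.hyps by (simp add: L_def)
    qed
    then have "\<not> inj L" using linear_injective_imp_surjective[OF L] by blast
    then obtain v where v: "L v = 0" "v \<noteq> 0" using linear_injective_0[OF L] by blast
    have Lv: "?G v (e a) = 0" if "a \<in> A" for a
    proof -
      have "L v $ a = 0" using v(1) by simp
      then show ?thesis using that by (simp add: L_def)
    qed
    define n where "n = Re (?G v v)"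
    have n: "n > 0" "?G v v = of_real n"
      using h_pos[OF z v(2)] herm[of v v] by (simp_all add: n_def h_mform[OF z] complex_eq_iff)
    define w where "w = of_real (1 / sqrt n) *s v"
    have ww: "?G w w = 1"
    proof -
      have "?G w w = of_real (1 / sqrt n) * (of_real (1 / sqrt n) * of_real n)"
        by (simp only: w_def sesquiD[OF sesqui_mform] n(2) complex_cnj_complex_of_real)
      also have "\<dots> = of_real (1 / sqrt n * (1 / sqrt n * n))" by (simp only: of_real_mult)
      also have "1 / sqrt n * (1 / sqrt n * n) = 1" using n(1) by simp
      finally show ?thesis by simp
    qed
    have we: "?G w (e a) = 0" "?G (e a) w = 0" if "a \<in> A" for a
      using Lv[OF that] herm[of v "e a"] by (simp_all add: w_def sesquiD[OF sesqui_mform])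
    have "\<forall>a\<in>insert k A. \<forall>b\<in>insert k A. ?G ((e(k := w)) a) ((e(k := w)) b) = (if a = b then 1 else 0)"
      using e ww we insert.hyps by auto
    then show ?case by blast
  qed
  from this[of UNIV] obtain e :: "'m frame" where "\<And>a b. ?G (e a) (e b) = (if a = b then 1 else 0)" by auto
  then have "unitary_frame h z e" by (simp add: unitary_frame_def g_comp_def comp2_h_mform[OF z])
  then show ?thesis by blast
qed

end

section \<open>The norms of the traceless Ricci and Bochner tensors\<close>

definition frame4 :: "'m::finite cmat \<Rightarrow> ('m \<Rightarrow> 'm \<Rightarrow> 'm \<Rightarrow> 'm \<Rightarrow> complex) \<Rightarrow> 'm \<Rightarrow> 'm \<Rightarrow> 'm \<Rightarrow> 'm \<Rightarrow> complex" where
  "frame4 U X a b c d = (\<Sum>*p q s t. 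
     U $ a $ p * cnj (U $ b $ q) * U $ c $ s * cnj (U $ d $ t) * X p q s t)"

text \<open>A squared norm by contraction with the inverse metric W. The norms to be integrated are
  defined with a chosen unitary frame, which may jump from point to point; this expression is
  visibly continuous.\<close>

definition norm4 :: "'m::finite cmat \<Rightarrow> ('m \<Rightarrow> 'm \<Rightarrow> 'm \<Rightarrow> 'm \<Rightarrow> complex) \<Rightarrow> complex" where
  "norm4 W X = (\<Sum>*p q s t p' q' s' t'. 
     W $ p' $ p * W $ q $ q' * W $ s' $ s * W $ t $ t' * X p q s t * cnj (X p' q' s' t'))"

lemma sum_mult4: "(\<Sum>a\<in>A. \<Sum>b\<in>B. \<Sum>c\<in>C. \<Sum>d\<in>D. f a * g b * h c * k d) = sum f A * sum g B * sum h C * (sum k D :: complex)"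
  by (simp only: sum_distrib_left[symmetric] sum_distrib_right[symmetric])

lemma sum_UNIV4: "(\<Sum>*a b c d. f a b c d) = (\<Sum>(a, b, c, d)\<in>UNIV. f a b c d)"
  for f :: "'m::finite \<Rightarrow> 'm \<Rightarrow> 'm \<Rightarrow> 'm \<Rightarrow> complex"
  by (simp add: sum.cartesian_product split_beta flip: UNIV_Times_UNIV)

lemma norm4_frame4:
  assumes W: "W = hadj U ** U"
  shows "of_real (\<Sum>*a b c d. (cmod (frame4 U X a b c d))\<^sup>2) = norm4 W X"
proof -
  \<comment> \<open>Quadruples of indices are packed into one index, so that a change of frame is a
    single matrix product.\<close>
  define V where "V = (\<lambda>(a, b, c, d) (p, q, s, t). U $ a $ p * cnj (U $ b $ q) * U $ c $ s * cnj (U $ d $ t))"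
  define Y where "Y = (\<lambda>(p, q, s, t). X p q s t)"
  have fr: "frame4 U X a b c d = (\<Sum>*i. V (a, b, c, d) i * Y i)" for a b c d
    unfolding frame4_def sum_UNIV4 by (rule sum.cong) (auto simp: V_def Y_def)
  have VV: "(\<Sum>A\<in>UNIV. V A (p, q, s, t) * cnj (V A (p', q', s', t'))) = W $ p' $ p * W $ q $ q' * W $ s' $ s * W $ t $ t'" for p q s t p' q' s' t'
  proof -
    have "(\<Sum>A\<in>UNIV. V A (p, q, s, t) * cnj (V A (p', q', s', t')))
      = (\<Sum>(a, b, c, d)\<in>UNIV. (U $ a $ p * cnj (U $ a $ p')) * (cnj (U $ b $ q) * U $ b $ q') * (U $ c $ s * cnj (U $ c $ s')) * (cnj (U $ d $ t) * U $ d $ t'))"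
      by (rule sum.cong[OF refl]) (auto simp: V_def ac_simps)
    also have "\<dots> = W $ p' $ p * W $ q $ q' * W $ s' $ s * W $ t $ t'"
      unfolding sum_UNIV4[symmetric] sum_mult4 by (simp add: W matrix_mult_nth mult.commute)
    finally show ?thesis .
  qed
  have "of_real (\<Sum>*a b c d. (cmod (frame4 U X a b c d))\<^sup>2)
     = (\<Sum>*a b c d. (\<Sum>*i. V (a, b, c, d) i * Y i) * cnj (\<Sum>*i. V (a, b, c, d) i * Y i))"
    by (simp only: fr of_real_sum mult_cnj_cmod)
  also have "\<dots> = (\<Sum>A\<in>UNIV. (\<Sum>*i. V A i * Y i) * cnj (\<Sum>*i. V A i * Y i))"
    unfolding sum_UNIV4 by (rule sum.cong) auto
  also have "\<dots> = (\<Sum>A\<in>UNIV. \<Sum>*i j. V A i * cnj (V A j) * (Y i * cnj (Y j)))"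
    by (simp add: sum_product ac_simps)
  also have "\<dots> = (\<Sum>*i. \<Sum>A\<in>UNIV. \<Sum>*j. V A i * cnj (V A j) * (Y i * cnj (Y j)))" by (rule sum.swap)
  also have "\<dots> = (\<Sum>*i j. \<Sum>A\<in>UNIV. V A i * cnj (V A j) * (Y i * cnj (Y j)))"
    by (rule sum.cong[OF refl], rule sum.swap)
  also have "\<dots> = (\<Sum>*i j. (\<Sum>A\<in>UNIV. V A i * cnj (V A j)) * (Y i * cnj (Y j)))"
    by (simp only: sum_distrib_right)
  also have "\<dots> = (\<Sum>(p, q, s, t)\<in>UNIV. \<Sum>(p', q', s', t')\<in>UNIV. W $ p' $ p * W $ q $ q' * W $ s' $ s * W $ t $ t' * X p q s t * cnj (X p' q' s' t'))"
    by (intro sum.cong refl) (auto simp: VV Y_def mult.assoc intro!: sum.cong)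
  also have "\<dots> = norm4 W X" by (simp add: norm4_def sum_UNIV4)
  finally show ?thesis .
qed

text \<open>The Bochner tensor in coordinates, for a metric of complex scalar curvature \<open>r\<close>.\<close>

definition BM :: "(complex ^ 'm::finite \<Rightarrow> 'm cmat) \<Rightarrow> real \<Rightarrow> complex ^ 'm \<Rightarrow> 'm \<Rightarrow> 'm \<Rightarrow> 'm \<Rightarrow> 'm \<Rightarrow> complex" where
  "BM H r z p q s t = (let m = of_nat CARD('m); G = H z; R = RicM H z in
     - KM H p q z $ s $ t + 1 / (m + 2) * (R $ p $ q * G $ s $ t + R $ s $ q * G $ p $ t + G $ p $ q * R $ s $ t + G $ s $ q * R $ p $ t)
     - of_real r / ((m + 1) * (m + 2)) * (G $ p $ q * G $ s $ t + G $ s $ q * G $ p $ t))"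

lemma frame4_add: "frame4 U (\<lambda>p q s t. X p q s t + Y p q s t) a b c d = frame4 U X a b c d + frame4 U Y a b c d"
  and frame4_diff: "frame4 U (\<lambda>p q s t. X p q s t - Y p q s t) a b c d = frame4 U X a b c d - frame4 U Y a b c d"
  and frame4_minus: "frame4 U (\<lambda>p q s t. - X p q s t) a b c d = - frame4 U X a b c d"
  by (simp_all add: frame4_def distrib_left right_diff_distrib sum.distrib sum_subtractf sum_negf)

lemma frame4_cmult: "frame4 U (\<lambda>p q s t. k * X p q s t) a b c d = k * frame4 U X a b c d"
  by (simp add: frame4_def sum_distrib_left mult.left_commute)

lemma frame4_prod1: "frame4 U (\<lambda>p q s t. A $ p $ q * B $ s $ t) a b c d = (U ** A ** hadj U) $ a $ b * (U ** B ** hadj U) $ c $ d"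
proof -
  have "frame4 U (\<lambda>p q s t. A $ p $ q * B $ s $ t) a b c d
    = (\<Sum>*p q s t. (U $ a $ p * cnj (U $ b $ q) * A $ p $ q) * (U $ c $ s * cnj (U $ d $ t) * B $ s $ t))"
    unfolding frame4_def by (intro sum.cong refl) (simp add: ac_simps)
  also have "\<dots> = (\<Sum>*p q. U $ a $ p * cnj (U $ b $ q) * A $ p $ q) * (\<Sum>*s t. U $ c $ s * cnj (U $ d $ t) * B $ s $ t)"
    by (simp only: sum_distrib_left[symmetric] sum_distrib_right[symmetric])
  finally show ?thesis by (simp add: matrix_triple_nth)
qed

lemma frame4_prod2: "frame4 U (\<lambda>p q s t. A $ s $ q * B $ p $ t) a b c d = (U ** A ** hadj U) $ c $ b * (U ** B ** hadj U) $ a $ d"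
proof -
  have "frame4 U (\<lambda>p q s t. A $ s $ q * B $ p $ t) a b c d = frame4 U (\<lambda>p q s t. A $ p $ q * B $ s $ t) c b a d"
  proof -
    have "frame4 U (\<lambda>p q s t. A $ s $ q * B $ p $ t) a b c d
      = (\<Sum>*q p s t. U $ a $ p * cnj (U $ b $ q) * U $ c $ s * cnj (U $ d $ t) * (A $ s $ q * B $ p $ t))"
      unfolding frame4_def by (rule sum.swap)
    also have "\<dots> = (\<Sum>*q s p t. U $ a $ p * cnj (U $ b $ q) * U $ c $ s * cnj (U $ d $ t) * (A $ s $ q * B $ p $ t))"
      by (rule sum.cong[OF refl], rule sum.swap)
    also have "\<dots> = (\<Sum>*q s p t. U $ c $ s * cnj (U $ b $ q) * U $ a $ p * cnj (U $ d $ t) * (A $ s $ q * B $ p $ t))"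
      by (intro sum.cong refl) (simp add: ac_simps)
    also have "\<dots> = frame4 U (\<lambda>p q s t. A $ p $ q * B $ s $ t) c b a d"
      unfolding frame4_def by (rule sum.swap)
    finally show ?thesis .
  qed
  then show ?thesis by (simp only: frame4_prod1)
qed

lemma boch_frame4:
  assumes U: "U ** H z ** hadj U = mat 1"
  shows "boch (frame4 U (\<lambda>p q s t. KM H p q z $ s $ t)) (\<lambda>a b. (U ** RicM H z ** hadj U) $ a $ b) r = frame4 U (BM H r z)"
proof (intro ext)
  fix a b c d
  show "boch (frame4 U (\<lambda>p q s t. KM H p q z $ s $ t)) (\<lambda>a b. (U ** RicM H z ** hadj U) $ a $ b) r a b c d = frame4 U (BM H r z) a b c d"
    unfolding BM_def[abs_def] Let_def frame4_add frame4_diff frame4_minus frame4_cmult frame4_prod1 frame4_prod2 U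
    by (simp add: boch_def Let_def mat_1_nth)
qed

context kaehler_chart
begin

lemma unitary_Win:
  fixes U :: "'m cmat"
  assumes U: "U ** H z ** hadj U = mat 1"
  shows "Win H z = hadj U ** U"
proof -
  have "U ** (H z ** hadj U) = mat 1" using U by (simp only: matrix_mul_assoc)
  from matrix_left_right_inverse[THEN iffD1, OF this]
  have "H z ** (hadj U ** U) = mat 1" by (simp only: matrix_mul_assoc)
  then show ?thesis unfolding Win_def by (rule matrix_inv_eqI)
qed

lemma continuous_norm4: "continuous_on S (\<lambda>z. norm4 (Win H z) (BM H r z))"
proof -
  have c: "mCk 0 S F \<Longrightarrow> continuous_on S (\<lambda>z. F z $ i $ j)" for F i j by (simp add: mCk_def)
  note cc = c[OF smooth_Win] c[OF smooth_KM] c[OF smooth_RicM] c[OF smooth]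
  have b: "continuous_on S (\<lambda>z. BM H r z p q s t)" for p q s t
    unfolding BM_def Let_def
    by (intro continuous_on_add continuous_on_diff continuous_on_minus continuous_on_mult continuous_on_const cc)
  show ?thesis
    unfolding norm4_def
    by (intro continuous_on_sum continuous_on_mult continuous_on_cnj b cc)
qed

end

lemma KM_cong:
  assumes "open S" "z \<in> S" "\<And>y. y \<in> S \<Longrightarrow> H y = H' y"
  shows "KM H a b z = KM H' a b z"
proof -
  have "mdz a H z = mdz a H' z" "mdzb b H z = mdzb b H' z"
    by (rule mdz_cong_open[OF assms(1,2)], rule assms(3), assumption, rule mdzb_cong_open[OF assms(1,2)], rule assms(3))
  moreover have "mdz a (mdzb b H) z = mdz a (mdzb b H') z"
    by (rule mdz_cong_open[OF assms(1,2)], rule mdzb_cong_open[OF assms(1)], assumption, rule assms(3))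
  ultimately show ?thesis by (simp add: KM_def Win_def assms(2,3))
qed

lemma
  assumes "open S" "z \<in> S" "\<And>y. y \<in> S \<Longrightarrow> H y = H' y"
  shows RicM_cong: "RicM H z = RicM H' z" and ricci_sq_cong: "ricci_sq H z = ricci_sq H' z"
    and BM_cong: "BM H r z = BM H' r z" and grad2_cong_metric: "grad2 H F z = grad2 H' F z"
    and Lap_cong_metric: "Lap H F z = Lap H' F z"
proof -
  have k: "KM H a b z = KM H' a b z" for a b by (rule KM_cong[OF assms])
  have w: "Win H z = Win H' z" by (simp add: Win_def assms(2,3))
  show r: "RicM H z = RicM H' z" by (simp add: RicM_def k w)
  show "ricci_sq H z = ricci_sq H' z" by (simp add: ricci_sq_def r w)
  show "BM H r z = BM H' r z" by (intro ext) (simp add: BM_def r k assms(2,3))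
  show "grad2 H F z = grad2 H' F z" "Lap H F z = Lap H' F z" by (simp_all add: grad2_def Lap_def w)
qed

section \<open>Constant scalar curvature: the pointwise differential inequality\<close>

locale csc_kaehler_metric = kaehler_metric S h for S :: "(complex ^ 'm::finite) set" and h +
  fixes s m :: real
  assumes m: "m = real CARD('m)" and card: "CARD('m) \<ge> 2"
    and scal: "\<And>z. z \<in> S \<Longrightarrow> scalar_curvature h z = s"
begin

lemma m2: "m \<ge> 2" using m card by simp

lemma ScM_eq: "z \<in> S \<Longrightarrow> ScM H z = of_real (s / 2)"
  using ScM_real[of z] scalar_curvature_eq[of z] scal[of z] by simp

text \<open>This is |E|^2, written through \<open>ricci_sq\<close> so that its smoothness does not
  depend on the frame chosen in \<open>E_norm\<close>; s / 2 is the complex scalar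
  curvature.\<close>

definition f2 :: "complex ^ 'm \<Rightarrow> real" where
  "f2 z = 2 * (Re (ricci_sq H z) - (s / 2)\<^sup>2 / m)"

lemma E_comp_unitary:
  assumes z: "z \<in> S" and e: "unitary_frame h z e"
  shows "E_comp h z e a b = (frame_mat e ** RicM H z ** hadj (frame_mat e)) $ a $ b - of_real (s / 2 / m) * (if a = b then 1 else 0)"
  using e unfolding E_comp_def unitary_frame_ScM[OF z e] ScM_eq[OF z] ricci_comp_eq[OF z]
  by (simp add: unitary_frame_def m)

lemma bochner_comp_unitary:
  assumes z: "z \<in> S" and e: "unitary_frame h z e"
  shows "bochner_comp h z e a b c d = boch (frame4 (frame_mat e) (\<lambda>p q s t. KM H p q z $ s $ t)) (\<lambda>a b. (frame_mat e ** RicM H z ** hadj (frame_mat e)) $ a $ b) (s / 2) a b c d"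
  using e unfolding bochner_comp_def Let_def unitary_frame_ScM[OF z e] ScM_eq[OF z] riemann_comp_eq[OF z] frame4_def[symmetric]
  by (simp add: unitary_frame_def boch_def Let_def ricci_comp_eq[OF z])

lemma bochner_norm_eq: assumes z: "z \<in> S"
  shows "bochner_norm h z = sqrt (4 * Re (norm4 (Win H z) (BM H (s / 2) z)))"
proof -
  define e where "e = (SOME e. unitary_frame h z e)"
  have e: "unitary_frame h z e" unfolding e_def by (rule someI_ex[OF unitary_frame_exists[OF z]])
  then have U: "frame_mat e ** H z ** hadj (frame_mat e) = mat 1" by (simp add: unitary_frame_iff[OF z])
  have "norm4 (Win H z) (BM H (s / 2) z) = of_real (\<Sum>*a b c d. (cmod (bochner_comp h z e a b c d))\<^sup>2)"
    unfolding norm4_frame4[OF unitary_Win[OF U], symmetric] bochner_comp_unitary[OF z e] boch_frame4[of "frame_mat e" H z, OF U] ..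
  then show ?thesis by (simp add: bochner_norm_def e_def[symmetric] Let_def del: of_real_sum of_real_power)
qed

text \<open>The Weitzenboeck inequality is applied to the very frame that \<open>E_norm\<close> and
  \<open>bochner_norm\<close> choose, so their values can be inserted. The last clause carries
  vanishing of E from that frame back to coordinates.\<close>

lemma pointwise_raw:
  assumes z: "z \<in> S"
  defines "\<kappa> \<equiv> sqrt ((2 * m\<^sup>2 + 4 * m + 3) / (2 * (m + 1) * (m + 2)))"
  obtains q where "q \<ge> 0" "(m + 1) * (2 * Re (grad2 H (ricci_sq H) z)) \<le> m * f2 z * q"
    "q + s / (m + 1) * f2 z - \<kappa> * (sqrt 2 * sqrt (f2 z) + bochner_norm h z) * f2 z \<le> 2 * Re (Lap H (ricci_sq H) z)"
    "E_norm h z = sqrt (f2 z)" "f2 z \<ge> 0"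
    "ricci_sq H z = of_real (f2 z / 2 + (s / 2)\<^sup>2 / m)"
    "f2 z = 0 \<longrightarrow> RicM H z = smat (of_real (s / 2 / m)) (H z)"
proof -
  define e where "e = (SOME e. unitary_frame h z e)"
  have e: "unitary_frame h z e" unfolding e_def by (rule someI_ex[OF unitary_frame_exists[OF z]])
  let ?U = "frame_mat e"
  have U: "?U ** H z ** hadj ?U = mat 1" using e by (simp add: unitary_frame_iff[OF z])
  let ?f = "2 * (\<Sum>*a b. (cmod ((?U ** RicM H z ** hadj ?U) $ a $ b - of_real (s / 2 / m) * (if a = b then 1 else 0)))\<^sup>2)"
  obtain q where q: "q \<ge> 0" "(m + 1) * (2 * Re (grad2 H (ricci_sq H) z)) \<le> m * ?f * q"
     "q + 2 * (s / 2) / (m + 1) * ?f - \<kappa> * (sqrt 2 * sqrt ?f + sqrt (4 * (\<Sum>*a b c d. (cmod (boch (\<lambda>a b c d. \<Sum>*p q s t. ?U $ a $ p * cnj (?U $ b $ q) * ?U $ c $ s * cnj (?U $ d $ t) * KM H p q z $ s $ t)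
        (\<lambda>a b. (?U ** RicM H z ** hadj ?U) $ a $ b) (s / 2) a b c d))\<^sup>2))) * ?f \<le> 2 * Re (Lap H (ricci_sq H) z)"
     "ricci_sq H z = of_real (?f / 2 + (s / 2)\<^sup>2 / m)"
    using weitzenboeck_inequality[OF card m ScM_eq z U] unfolding \<kappa>_def by blast
  have f: "?f = f2 z" using q(4) by (simp add: f2_def)
  have f0: "f2 z \<ge> 0" unfolding f[symmetric] by (intro mult_nonneg_nonneg sum_nonneg) auto
  have fr: "(\<lambda>a b c d. \<Sum>*p q s t. ?U $ a $ p * cnj (?U $ b $ q) * ?U $ c $ s * cnj (?U $ d $ t) * KM H p q z $ s $ t) = frame4 ?U (\<lambda>p q s t. KM H p q z $ s $ t)"
    by (simp add: frame4_def fun_eq_iff)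
  have bn: "bochner_norm h z = sqrt (4 * (\<Sum>*a b c d. (cmod (boch (frame4 ?U (\<lambda>p q s t. KM H p q z $ s $ t)) (\<lambda>a b. (?U ** RicM H z ** hadj ?U) $ a $ b) (s / 2) a b c d))\<^sup>2))"
    unfolding bochner_norm_def e_def[symmetric] Let_def bochner_comp_unitary[OF z e] ..
  have en: "E_norm h z = sqrt (f2 z)"
    unfolding E_norm_def e_def[symmetric] Let_def E_comp_unitary[OF z e] f ..
  have ke: "f2 z = 0 \<longrightarrow> RicM H z = smat (of_real (s / 2 / m)) (H z)"
  proof
    let ?E = "\<lambda>a b. (?U ** RicM H z ** hadj ?U) $ a $ b - of_real (s / 2 / m) * (if a = b then 1 else 0)"
    assume "f2 z = 0"
    then have "(\<Sum>*a b. (cmod (?E a b))\<^sup>2) = 0" using f by simp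
    then have "?E a b = 0" for a b
      by (simp add: sum_nonneg_eq_0_iff sum_nonneg)
    then have P: "?U ** RicM H z ** hadj ?U = smat (of_real (s / 2 / m)) (mat 1)"
      by (intro matrix_eqI) (simp add: mat_1_nth)
    have W: "hadj ?U ** ?U ** H z = mat 1" "H z ** (hadj ?U ** ?U) = mat 1"
      using Win_mult[OF z] by (simp_all add: unitary_Win[OF U])
    have "H z ** (hadj ?U ** (?U ** RicM H z ** hadj ?U) ** ?U) ** H z = (H z ** (hadj ?U ** ?U)) ** RicM H z ** (hadj ?U ** ?U ** H z)"
      by (simp only: matrix_mul_assoc)
    then have "RicM H z = H z ** (hadj ?U ** (?U ** RicM H z ** hadj ?U) ** ?U) ** H z" by (simp add: W)
    also have "\<dots> = smat (of_real (s / 2 / m)) (H z ** (hadj ?U ** ?U) ** H z)"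
      unfolding P smat_mult_left smat_mult_right by simp
    finally show "RicM H z = smat (of_real (s / 2 / m)) (H z)" by (simp add: W)
  qed
  show thesis
  proof (rule that[OF q(1) _ _ en f0 _ ke])
    show "(m + 1) * (2 * Re (grad2 H (ricci_sq H) z)) \<le> m * f2 z * q" using q(2) unfolding f .
    show "q + s / (m + 1) * f2 z - \<kappa> * (sqrt 2 * sqrt (f2 z) + bochner_norm h z) * f2 z \<le> 2 * Re (Lap H (ricci_sq H) z)"
      using q(3) unfolding f fr bn[symmetric] by simp
    show "ricci_sq H z = of_real (f2 z / 2 + (s / 2)\<^sup>2 / m)" using q(4) unfolding f .
  qed
qed

lemma E_norm_eq: "z \<in> S \<Longrightarrow> E_norm h z = sqrt (f2 z)" and f2_nonneg: "z \<in> S \<Longrightarrow> f2 z \<ge> 0"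
  and ricci_sq_f2: "z \<in> S \<Longrightarrow> ricci_sq H z = of_real (f2 z / 2 + (s / 2)\<^sup>2 / m)"
  by (erule pointwise_raw, assumption)+

lemma E_comp_zero: assumes z: "z \<in> S" "f2 z = 0" shows "E_comp h z coord_frame a b = 0"
proof -
  have R: "RicM H z = smat (of_real (s / 2 / m)) (H z)" using z by (elim pointwise_raw) simp
  have "frame_mat coord_frame = (mat 1 :: 'm cmat)"
    by (rule matrix_eqI) (simp add: frame_mat_def coord_frame_def axis_def mat_1_nth)
  then show ?thesis
    by (simp add: E_comp_def ricci_comp_eq[OF z(1)] g_comp_eq[OF z(1)] coord_frame_ScM[OF z(1)] ScM_eq[OF z(1)] R m)
qed

lemma Ck_f2: "Ck k S f2"
proof -
  have "Ck k S (\<lambda>z. 2 * (Re (ricci_sq H z) - (s / 2)\<^sup>2 / m))"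
    by (intro Ck_mult Ck_diff Ck_const Ck_Re smooth_ricci_sq open_S)
  then show ?thesis by (simp add: f2_def[abs_def])
qed

lemma continuous_bochner_norm: "continuous_on S (bochner_norm h)"
proof -
  have "continuous_on S (\<lambda>z. sqrt (4 * Re (norm4 (Win H z) (BM H (s / 2) z))))"
    by (intro continuous_intros continuous_norm4)
  then show ?thesis by (subst continuous_on_cong[OF refl bochner_norm_eq])
qed

text \<open>The Riemannian Laplacian, with the sign of a sum of second derivatives.\<close>

definition laplacian :: "(complex ^ 'm \<Rightarrow> real) \<Rightarrow> complex ^ 'm \<Rightarrow> real" where
  "laplacian F z = 2 * Re (Lap H (\<lambda>y. of_real (F y)) z)"

text \<open>|E| may fail to be differentiable where E vanishes, hence the smoothing by \<epsilon>.
  It costs only the factor f2 / (f2 + \<epsilon>) <= 1 in the Kato inequality.\<close>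

lemma laplacian_inequality:
  assumes z: "z \<in> S" and \<epsilon>: "\<epsilon> > 0"
  defines "\<kappa> \<equiv> sqrt ((2 * m\<^sup>2 + 4 * m + 3) / (2 * (m + 1) * (m + 2)))"
  shows "(m + 1) / m * grad_norm_sq h (\<lambda>y. sqrt (f2 y + \<epsilon>)) z + s / (m + 1) * f2 z
     - \<kappa> * (sqrt 2 * E_norm h z + bochner_norm h z) * f2 z \<le> laplacian f2 z / 2"
proof -
  obtain q where q: "q \<ge> 0" "(m + 1) * (2 * Re (grad2 H (ricci_sq H) z)) \<le> m * f2 z * q"
    "q + s / (m + 1) * f2 z - \<kappa> * (sqrt 2 * sqrt (f2 z) + bochner_norm h z) * f2 z \<le> 2 * Re (Lap H (ricci_sq H) z)"
    "E_norm h z = sqrt (f2 z)" "f2 z \<ge> 0"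
    using pointwise_raw[OF z] unfolding \<kappa>_def by metis
  let ?u = "\<lambda>y. sqrt (f2 y + \<epsilon>)"
  let ?G = "Re (grad2 H (ricci_sq H) z)"
  have F: "complex_of_real (f2 y) = 2 * ricci_sq H y - of_real (2 * ((s / 2)\<^sup>2 / m))" if "y \<in> S" for y
    using ricci_sq_f2[OF that] by simp
  have dr: "ricci_sq H differentiable (at y)" if "y \<in> S" for y by (rule Ck_differentiable[OF smooth_ricci_sq that])
  have F1: "dz a (\<lambda>y. complex_of_real (f2 y)) y = 2 * dz a (ricci_sq H) y" "dzb a (\<lambda>y. complex_of_real (f2 y)) y = 2 * dzb a (ricci_sq H) y" if y: "y \<in> S" for a y
  proof -
    have d: "(\<lambda>y. 2 * ricci_sq H y) differentiable (at y)"
      by (intro differentiable_mult differentiable_const dr y)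
    show "dz a (\<lambda>y. complex_of_real (f2 y)) y = 2 * dz a (ricci_sq H) y" "dzb a (\<lambda>y. complex_of_real (f2 y)) y = 2 * dzb a (ricci_sq H) y"
      using dz_cong_open[OF open_S y F, where a = a] dzb_cong_open[OF open_S y F, where a = a]
      by (simp_all add: dz_diff dzb_diff d dz_cmult dzb_cmult dr y)
  qed
  have L: "laplacian f2 z = 4 * Re (Lap H (ricci_sq H) z)"
  proof -
    have "dz a (dzb b (\<lambda>y. complex_of_real (f2 y))) z = 2 * dz a (dzb b (ricci_sq H)) z" for a b
    proof -
      have "dz a (dzb b (\<lambda>y. complex_of_real (f2 y))) z = dz a (\<lambda>y. 2 * dzb b (ricci_sq H) y) z"
        by (rule dz_cong_open[OF open_S z F1(2)])
      also have "\<dots> = 2 * dz a (dzb b (ricci_sq H)) z"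
        by (rule dz_cmult) (rule Ck_differentiable[OF Ck_dzb[OF open_S smooth_ricci_sq] z])
      finally show ?thesis .
    qed
    then have "Lap H (\<lambda>y. complex_of_real (f2 y)) z = 2 * Lap H (ricci_sq H) z"
      by (simp add: Lap_def sum_distrib_left mult.left_commute)
    then show ?thesis by (simp add: laplacian_def)
  qed
  have fpos: "f2 y + \<epsilon> > 0" if "y \<in> S" for y using f2_nonneg[OF that] \<epsilon> by simp
  have u_pos: "?u z > 0" using fpos[OF z] by simp
  have ud: "(?u has_derivative (\<lambda>v. frechet_derivative f2 (at z) v * (1 / (2 * ?u z)))) (at z)"
  proof -
    have "((\<lambda>y. f2 y + \<epsilon>) has_derivative (\<lambda>v. frechet_derivative f2 (at z) v)) (at z)"
      using has_derivative_add[OF Ck_has_derivative[OF Ck_f2 z] has_derivative_const[of \<epsilon>]] by simp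
    from has_derivative_real_sqrt[OF fpos[OF z] this] show ?thesis by (simp add: field_simps)
  qed
  have f2d: "((\<lambda>y. complex_of_real (f2 y)) has_derivative (\<lambda>v. of_real (frechet_derivative f2 (at z) v))) (at z)"
    by (rule bounded_linear.has_derivative[OF bounded_linear_of_real Ck_has_derivative[OF Ck_f2 z]])
  have ucd: "((\<lambda>y. complex_of_real (?u y)) has_derivative (\<lambda>v. of_real (frechet_derivative f2 (at z) v * (1 / (2 * ?u z))))) (at z)"
    by (rule bounded_linear.has_derivative[OF bounded_linear_of_real ud])
  have du: "dz a (\<lambda>y. complex_of_real (?u y)) z = dz a (ricci_sq H) z / of_real (?u z)"
    "dzb a (\<lambda>y. complex_of_real (?u y)) z = dzb a (ricci_sq H) z / of_real (?u z)" for a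
  proof -
    have "dz a (\<lambda>y. complex_of_real (?u y)) z = dz a (\<lambda>y. complex_of_real (f2 y)) z * of_real (1 / (2 * ?u z))"
      "dzb a (\<lambda>y. complex_of_real (?u y)) z = dzb a (\<lambda>y. complex_of_real (f2 y)) z * of_real (1 / (2 * ?u z))"
      unfolding dz_eq[OF ucd] dz_eq[OF f2d] dzb_eq[OF ucd] dzb_eq[OF f2d] of_real_mult by (simp_all add: algebra_simps)
    then show "dz a (\<lambda>y. complex_of_real (?u y)) z = dz a (ricci_sq H) z / of_real (?u z)"
      "dzb a (\<lambda>y. complex_of_real (?u y)) z = dzb a (ricci_sq H) z / of_real (?u z)"
      by (simp_all add: F1[OF z])
  qed
  have uu: "complex_of_real (?u z) * of_real (?u z) = of_real (f2 z + \<epsilon>)"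
    using fpos[OF z] by (simp only: of_real_mult[symmetric]) simp
  have "grad2 H (\<lambda>y. complex_of_real (?u y)) z = grad2 H (ricci_sq H) z / of_real (f2 z + \<epsilon>)"
    unfolding grad2_def du sum_divide_distrib uu[symmetric] by (intro sum.cong refl) simp
  then have gu: "grad_norm_sq h ?u z = 2 * ?G / (f2 z + \<epsilon>)"
    using grad_norm_sq_eq[OF z, of ?u] ud by (simp add: differentiable_def Re_divide_of_real) blast
  have "(m + 1) / m * grad_norm_sq h ?u z \<le> q"
  proof -
    have "(m + 1) / m * grad_norm_sq h ?u z = ((m + 1) * (2 * ?G)) / (m * (f2 z + \<epsilon>))" by (simp add: gu)
    also have "\<dots> \<le> (m * f2 z * q) / (m * (f2 z + \<epsilon>))"
      using m2 fpos[OF z] by (intro divide_right_mono q(2)) simp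
    also have "\<dots> = q * (f2 z / (f2 z + \<epsilon>))" using m2 by simp
    also have "\<dots> \<le> q * 1" using q(1,5) \<epsilon> fpos[OF z] by (intro mult_left_mono) (auto simp: field_simps)
    finally show ?thesis by simp
  qed
  then show ?thesis using q(3) unfolding L q(4) by simp
qed

end

section \<open>Invariance under holomorphic isometries\<close>

lemma mform_vm2:
  fixes A M :: "'m::finite cmat"
  shows "mform A (v v* M) (w v* M) = mform (M ** A ** hadj M) v w"
proof -
  have r: "mform A v (w v* B) = mform (A ** hadj B) v w" for A B :: "'m cmat" and v w
  proof -
    have "mform A v (w v* B) = cnj (mform (hadj A) (w v* B) v)" by (simp add: mform_hadj hadj_hadj)
    also have "\<dots> = mform (A ** hadj B) v w"
      unfolding mform_vm mform_hadj hadj_mult hadj_hadj ..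
    finally show ?thesis .
  qed
  show ?thesis by (simp only: mform_vm r matrix_mul_assoc)
qed

text \<open>A sesquilinear form is recovered from its real part by passing to complex
  components.\<close>

lemma mform_Re_eqI:
  assumes "\<And>v w. Re (mform A v w) = Re (mform B v w)"
  shows "A = B"
proof (rule matrix_eqI)
  fix i j
  have "comp2 (\<lambda>x y. 2 * Re (mform A x y)) v w = mform A v w" for v w
    by (rule comp2_Re[OF sesqui_mform refl])
  moreover have "comp2 (\<lambda>x y. 2 * Re (mform A x y)) v w = mform B v w" for v w
    by (rule comp2_Re[OF sesqui_mform]) (simp add: assms)
  ultimately have "mform A v w = mform B v w" for v w by metis
  then show "A $ i $ j = B $ i $ j" by (metis mform_axis)
qed

lemma frame4_frame4: "frame4 U (frame4 M X) a b c d = frame4 (U ** M) X a b c d"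
proof -
  define V where "V = (\<lambda>(U :: 'a cmat) (a, b, c, d) (p, q, s, t). U $ a $ p * cnj (U $ b $ q) * U $ c $ s * cnj (U $ d $ t))"
  define Y where "Y = (\<lambda>Z (p :: 'a, q :: 'a, s :: 'a, t :: 'a). Z p q s t :: complex)"
  have fr: "frame4 U Z a b c d = (\<Sum>*i. V U (a, b, c, d) i * Y Z i)" for U Z a b c d
    unfolding frame4_def sum_UNIV4 by (rule sum.cong) (auto simp: V_def Y_def)
  have Yf: "Y (frame4 M X) j = (\<Sum>*i. V M j i * Y X i)" for j
    by (cases j) (simp add: Y_def fr)
  have VV: "(\<Sum>*j. V U k j * V M j i) = V (U ** M) k i" for k i
  proof -
    obtain a b c d where k: "k = (a, b, c, d)" by (cases k)
    obtain p q s t where i: "i = (p, q, s, t)" by (cases i)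
    have "(\<Sum>*j. V U k j * V M j i)
      = (\<Sum>(a', b', c', d')\<in>UNIV. (U $ a $ a' * M $ a' $ p) * cnj (U $ b $ b' * M $ b' $ q) * (U $ c $ c' * M $ c' $ s) * cnj (U $ d $ d' * M $ d' $ t))"
      by (rule sum.cong[OF refl]) (auto simp: V_def k i ac_simps)
    also have "\<dots> = V (U ** M) k i"
      unfolding sum_UNIV4[symmetric] sum_mult4 cnj_sum[symmetric] by (simp only: V_def k i prod.case matrix_mult_nth)
    finally show ?thesis .
  qed
  have "frame4 U (frame4 M X) a b c d = (\<Sum>*j i. V U (a, b, c, d) j * V M j i * Y X i)"
    unfolding fr Yf by (simp add: sum_distrib_left mult.assoc)
  also have "\<dots> = (\<Sum>*i j. V U (a, b, c, d) j * V M j i * Y X i)" by (rule sum.swap)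
  also have "\<dots> = frame4 (U ** M) X a b c d" unfolding sum_distrib_right[symmetric] VV fr ..
  finally show ?thesis .
qed

locale kaehler_transition = M1: csc_kaehler_metric S1 h1 s m + M2: csc_kaehler_metric S2 h2 s m
  for S1 S2 :: "(complex ^ 'm::finite) set" and h1 h2 s m +
  fixes T and \<tau> :: "complex ^ 'm \<Rightarrow> complex ^ 'm"
  assumes open_T: "open T" and T_sub: "T \<subseteq> S1" and tau_image: "\<tau> ` T \<subseteq> S2"
    and tau_holomorphic: "holomorphic_map_on T \<tau>"
    and isometry: "\<And>z v w. z \<in> T \<Longrightarrow>
      h1 z v w = h2 (\<tau> z) (frechet_derivative \<tau> (at z) v) (frechet_derivative \<tau> (at z) w)"
begin

lemma frechet_tau: assumes z: "z \<in> T" shows "frechet_derivative \<tau> (at z) v = v v* jac \<tau> z"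
proof (rule vec_eq_iff[THEN iffD2], rule allI)
  fix p
  obtain D where D: "(\<tau> has_derivative D) (at z)"
    using tau_holomorphic z unfolding holomorphic_map_on_def by blast
  have d: "((\<lambda>z. \<tau> z $ p) has_derivative (\<lambda>v. D v $ p)) (at z)"
    by (rule bounded_linear.has_derivative[OF bounded_linear_vec_nth D])
  then have dd: "(\<lambda>z. \<tau> z $ p) differentiable (at z)" by (auto simp: differentiable_def)
  have "frechet_derivative \<tau> (at z) v $ p = frechet_derivative (\<lambda>z. \<tau> z $ p) (at z) v"
    by (simp add: frechet_derivative_eq[OF D] frechet_derivative_eq[OF d])
  also have "\<dots> = (v v* jac \<tau> z) $ p"
    by (simp add: frechet_derivative_expansion[OF dd] holo_dzb[OF holo_component[OF tau_holomorphic] z] M1.vm_nth jac_def)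
  finally show "frechet_derivative \<tau> (at z) v $ p = (v v* jac \<tau> z) $ p" .
qed

lemma tau_S: "z \<in> T \<Longrightarrow> \<tau> z \<in> S2" and T_S: "z \<in> T \<Longrightarrow> z \<in> S1"
  using tau_image T_sub by auto

lemma H_pullb: assumes z: "z \<in> T" shows "M1.H z = pullb M2.H \<tau> z"
proof (rule mform_Re_eqI)
  fix v w
  have "2 * Re (mform (M1.H z) v w) = 2 * Re (mform (pullb M2.H \<tau> z) v w)"
    using isometry[OF z, of v w]
    unfolding M1.h_mform[OF T_S[OF z]] M2.h_mform[OF tau_S[OF z]] frechet_tau[OF z] mform_vm2 pullb_def .
  then show "Re (mform (M1.H z) v w) = Re (mform (pullb M2.H \<tau> z) v w)" by simp
qed

text \<open>The invertible matrix of the first metric factors through the Jacobian, as \<tau> is an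
  isometry.\<close>

lemma invertible_jac: assumes z: "z \<in> T" shows "invertible (jac \<tau> z)"
proof -
  have "jac \<tau> z ** (M2.H (\<tau> z) ** hadj (jac \<tau> z) ** Win M1.H z) = M1.H z ** Win M1.H z"
    unfolding H_pullb[OF z] pullb_def by (simp only: matrix_mul_assoc)
  also have "\<dots> = mat 1" by (rule M1.Win_mult[OF T_S[OF z]])
  finally show ?thesis unfolding invertible_right_inverse by blast
qed

sublocale pull: holo_pullback S2 M2.H T \<tau>
  by unfold_locales (fact open_T tau_holomorphic tau_image invertible_jac)+

lemma f2_transition: assumes z: "z \<in> T" shows "M1.f2 z = M2.f2 (\<tau> z)"
proof -
  have "ricci_sq M1.H z = ricci_sq (pullb M2.H \<tau>) z" by (rule ricci_sq_cong[OF open_T z H_pullb])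
  then show ?thesis by (simp add: M1.f2_def M2.f2_def pull.ricci_sq_pullb[OF z])
qed

lemma E_norm_transition: assumes z: "z \<in> T" shows "E_norm h1 z = E_norm h2 (\<tau> z)"
  by (simp add: M1.E_norm_eq[OF T_S[OF z]] M2.E_norm_eq[OF tau_S[OF z]] f2_transition[OF z])

lemma BM_transition: assumes z: "z \<in> T"
  shows "BM M1.H r z a b c d = frame4 (jac \<tau> z) (BM M2.H r (\<tau> z)) a b c d"
proof -
  have k: "KM (pullb M2.H \<tau>) a b z $ c $ d = frame4 (jac \<tau> z) (\<lambda>p q s t. KM M2.H p q (\<tau> z) $ s $ t) a b c d" for a b c d
    by (simp add: pull.KM_pullb_nth[OF z] frame4_def)
  have b: "BM M1.H r z = BM (pullb M2.H \<tau>) r z" by (rule BM_cong[OF open_T z H_pullb])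
  show ?thesis
    unfolding b
    unfolding BM_def[abs_def] Let_def frame4_add frame4_diff frame4_minus frame4_cmult frame4_prod1 frame4_prod2 k pull.RicM_pullb[OF z]
    by (simp only: pullb_def)
qed

text \<open>The Jacobian carries a unitary frame of the first metric to one of the second, and the
  Bochner tensor has the same components in both.\<close>

lemma bochner_norm_transition: assumes z: "z \<in> T" shows "bochner_norm h1 z = bochner_norm h2 (\<tau> z)"
proof -
  obtain e where "unitary_frame h1 z e" using M1.unitary_frame_exists[OF T_S[OF z]] ..
  then have U: "M1.frame_mat e ** M1.H z ** hadj (M1.frame_mat e) = mat 1" by (simp add: M1.unitary_frame_iff[OF T_S[OF z]])
  then have U2: "(M1.frame_mat e ** jac \<tau> z) ** M2.H (\<tau> z) ** hadj (M1.frame_mat e ** jac \<tau> z) = mat 1"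
    unfolding H_pullb[OF z] pullb_def hadj_mult matrix_mul_assoc .
  have BM: "BM M1.H (s / 2) z = frame4 (jac \<tau> z) (BM M2.H (s / 2) (\<tau> z))"
    by (intro ext BM_transition z)
  have "norm4 (Win M1.H z) (BM M1.H (s / 2) z) = norm4 (Win M2.H (\<tau> z)) (BM M2.H (s / 2) (\<tau> z))"
    unfolding norm4_frame4[OF M1.unitary_Win[OF U], symmetric] norm4_frame4[OF M2.unitary_Win[OF U2], symmetric]
    unfolding frame4_frame4[symmetric] BM ..
  then show ?thesis by (simp add: M1.bochner_norm_eq[OF T_S[OF z]] M2.bochner_norm_eq[OF tau_S[OF z]])
qed

lemma grad_norm_sq_transition:
  assumes z: "z \<in> T" and F: "F differentiable (at (\<tau> z))"
  shows "grad_norm_sq h1 (\<lambda>y. F (\<tau> y)) z = grad_norm_sq h2 F (\<tau> z)"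
proof -
  obtain D where D: "(\<tau> has_derivative D) (at z)"
    using tau_holomorphic z unfolding holomorphic_map_on_def by blast
  then have d: "(\<lambda>y. F (\<tau> y)) differentiable (at z)"
    using differentiable_chain_at[of \<tau> z F] F by (auto simp: differentiable_def o_def)
  have F': "(\<lambda>y. complex_of_real (F y)) differentiable (at (\<tau> z))"
    using bounded_linear.has_derivative[OF bounded_linear_of_real] F by (force simp: differentiable_def)
  have c: "grad2 M1.H F z = grad2 (pullb M2.H \<tau>) F z" for F by (rule grad2_cong_metric[OF open_T z H_pullb])
  show ?thesis
    unfolding M1.grad_norm_sq_eq[OF T_S[OF z] d] M2.grad_norm_sq_eq[OF tau_S[OF z] F] c pull.grad2_pullb[OF F' z] ..
qed

lemma laplacian_transition:
  assumes z: "z \<in> T" and F: "Ck 2 S2 F"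
  shows "M1.laplacian (\<lambda>y. F (\<tau> y)) z = M2.laplacian F (\<tau> z)"
proof -
  have F': "Ck 2 S2 (\<lambda>y. complex_of_real (F y))" by (rule Ck_of_real[OF M2.open_S F])
  have c: "Lap M1.H F z = Lap (pullb M2.H \<tau>) F z" for F by (rule Lap_cong_metric[OF open_T z H_pullb])
  show ?thesis
    unfolding M1.laplacian_def M2.laplacian_def c pull.Lap_pullb[OF F' z] ..
qed

end

section \<open>Volume density and change of variables\<close>

primrec rcoord :: "'m::finite + 'm \<Rightarrow> complex ^ 'm \<Rightarrow> real" where
  "rcoord (Inl a) x = Re (x $ a)"
| "rcoord (Inr a) x = Im (x $ a)"

lemma sum_UNIV_Plus: "(\<Sum>*i. f i) = (\<Sum>*a. f (Inl a)) + (\<Sum>*a. f (Inr a))"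
  for f :: "'a::finite + 'b::finite \<Rightarrow> 'c::comm_monoid_add"
  unfolding UNIV_Plus_UNIV[symmetric] by (subst sum.Plus) auto

lemma rcoord_real_frame: "rcoord k (real_frame i) = (if k = i then 1 else 0)"
  by (cases k; cases i) (auto simp: axis_def)

lemma real_frame_expansion: "(\<Sum>*k. rcoord k x *\<^sub>R real_frame k) = x"
proof (rule vec_eq_iff[THEN iffD2], rule allI)
  fix p
  have "(\<Sum>*k. rcoord k x *\<^sub>R real_frame k) $ p
    = (\<Sum>*a. if a = p then complex_of_real (Re (x $ a)) else 0) + (\<Sum>*a. if a = p then \<i> * complex_of_real (Im (x $ a)) else 0)"
    unfolding sum_UNIV_Plus vector_add_component sum_component
    by (intro arg_cong2[where f = "(+)"] sum.cong refl) (auto simp: axis_def complex_eq_iff)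
  then show "(\<Sum>*k. rcoord k x *\<^sub>R real_frame k) $ p = x $ p" by (simp add: complex_eq_iff)
qed

definition rmat :: "(complex ^ 'm::finite \<Rightarrow> complex ^ 'm) \<Rightarrow> real ^ ('m + 'm) ^ ('m + 'm)" where
  "rmat L = (\<chi> k i. rcoord k (L (real_frame i)))"

definition gram :: "(complex ^ 'm::finite \<Rightarrow> complex ^ 'm \<Rightarrow> real) \<Rightarrow> real ^ ('m + 'm) ^ ('m + 'm)" where
  "gram b = (\<chi> i j. b (real_frame i) (real_frame j))"

lemma gram_pullback:
  assumes b: "bilinear b"
  shows "gram (\<lambda>v w. b (L v) (L' w)) = transpose (rmat L) ** gram b ** rmat L'"
proof (rule vec_eq_iff[THEN iffD2, OF allI], rule vec_eq_iff[THEN iffD2, OF allI])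
  fix i j
  have "b (L (real_frame i)) (L' (real_frame j))
    = b (\<Sum>*k. rmat L $ k $ i *\<^sub>R real_frame k) (\<Sum>*l. rmat L' $ l $ j *\<^sub>R real_frame l)"
    by (simp add: rmat_def real_frame_expansion)
  also have "\<dots> = (\<Sum>*k l. rmat L $ k $ i * rmat L' $ l $ j * gram b $ k $ l)"
    unfolding bilinear_sum[OF b] sum.cartesian_product[symmetric]
    by (simp add: bilinear_lmul[OF b] bilinear_rmul[OF b] gram_def ac_simps)
  also have "\<dots> = (\<Sum>*l k. rmat L $ k $ i * rmat L' $ l $ j * gram b $ k $ l)" by (rule sum.swap)
  also have "\<dots> = (transpose (rmat L) ** gram b ** rmat L') $ i $ j"
    by (simp add: matrix_matrix_mult_def transpose_def sum_distrib_right sum_distrib_left ac_simps)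
  finally show "gram (\<lambda>v w. b (L v) (L' w)) $ i $ j = (transpose (rmat L) ** gram b ** rmat L') $ i $ j"
    by (simp add: gram_def)
qed

lemma volume_density_eq: "volume_density h z = sqrt (det (gram (h z)))"
  by (simp add: volume_density_def gram_def)

text \<open>A permutation other than the identity moves at least two points; after one factor has
  been differentiated, an off-diagonal entry of the identity remains and kills the term.\<close>

lemma det_has_derivative_at_1:
  fixes F :: "'v::real_normed_vector \<Rightarrow> 'b::real_normed_field ^ 'n ^ 'n"
  assumes F: "\<And>i j. ((\<lambda>y. F y $ i $ j) has_derivative (\<lambda>v. F' v $ i $ j)) (at z)"
    and 1: "F z = mat 1"
  shows "((\<lambda>y. det (F y)) has_derivative (\<lambda>v. trace (F' v))) (at z)"
proof -
  have D: "((\<lambda>y. det (F y)) has_derivative (\<lambda>v. \<Sum>p\<in>{p. p permutes (UNIV::'n set)}. of_int (sign p) * (\<Sum>*i. F' v $ i $ p i * (\<Prod>j\<in>UNIV - {i}. F z $ j $ p j)))) (at z)"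
    unfolding det_def
    by (intro has_derivative_sum has_derivative_mult_right has_derivative_prod F)
  have "(\<Sum>*i. F' v $ i $ p i * (\<Prod>j\<in>UNIV - {i}. F z $ j $ p j)) = 0" if p: "p permutes UNIV" "p \<noteq> id" for p v
  proof -
    have "(\<Prod>j\<in>UNIV - {i}. F z $ j $ p j) = 0" for i
    proof -
      obtain k where k: "p k \<noteq> k" using p(2) by (auto simp: fun_eq_iff)
      have "p (p k) \<noteq> p k" using k permutes_inj[OF p(1)] by (auto dest: injD)
      with k obtain l where "l \<noteq> i" "p l \<noteq> l" by (metis (full_types))
      then show ?thesis by (auto simp: 1 mat_def intro!: prod_zero bexI[of _ l])
    qed
    then show ?thesis by (simp del: prod_zero_iff)
  qed
  then have "(\<Sum>p\<in>{p. p permutes (UNIV::'n set)}. of_int (sign p) * (\<Sum>*i. F' v $ i $ p i * (\<Prod>j\<in>UNIV - {i}. F z $ j $ p j)))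
     = (\<Sum>p\<in>{id}. of_int (sign p) * (\<Sum>*i. F' v $ i $ p i * (\<Prod>j\<in>UNIV - {i}. F z $ j $ p j)))" for v
    by (intro sum.mono_neutral_right) (auto simp: finite_permutations permutes_id)
  also have "\<dots> v = trace (F' v)" for v by (simp add: 1 mat_def trace_def)
  finally show ?thesis using D by simp
qed

lemma trace_rmat: "trace (rmat (\<lambda>v. v v* B)) = 2 * Re (trace B)"
proof -
  have 1: "(axis a u v* A) $ a = u * A $ a $ a" for a u and A :: "'m::finite cmat"
    by (simp add: vector_matrix_mult_def axis_def if_distrib if_distribR mult.commute cong: if_cong)
  show ?thesis by (simp add: trace_def rmat_def sum_UNIV_Plus 1 sum_distrib_left)
qed

lemma mform_mat_1: "mform (mat 1) v w = (\<Sum>*b. v $ b * cnj (w $ b))"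
  by (simp add: mform_def mat_1_nth if_distrib cong: if_cong)

lemma sum_axis: "(\<Sum>*b. axis a u $ b * cnj (axis c w $ b)) = (if a = c then u * cnj w else 0)"
proof -
  have "axis a u $ b * cnj (axis c w $ b) = (if b = a then if a = c then u * cnj w else 0 else 0)" for b
    by (auto simp: axis_def)
  then show ?thesis by simp
qed

lemma trace_transpose: "trace (transpose A) = trace A"
  by (simp add: trace_def transpose_def)

section \<open>Positivity and logarithmic derivative of the volume density\<close>

context kaehler_metric
begin

text \<open>In a unitary frame the Gram matrix is twice the identity, and the change of frame
  multiplies its determinant by a square.\<close>

lemma det_gram_pos: assumes z: "z \<in> S" shows "det (gram (h z)) > 0"
proof -
  obtain e where "unitary_frame h z e" using unitary_frame_exists[OF z] ..
  then have U: "frame_mat e ** H z ** hadj (frame_mat e) = mat 1" by (simp add: unitary_frame_iff[OF z])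
  let ?L = "\<lambda>v. v v* frame_mat e"
  have "gram (\<lambda>v w. h z (?L v) (?L w)) = gram (\<lambda>v w. 2 * Re (mform (mat 1) v w))"
    by (simp add: h_mform[OF z] mform_vm2 U)
  moreover have "gram (\<lambda>v w. 2 * Re (mform (mat 1) v w)) $ i $ j = (if i = j then 2 else 0)" for i j :: "'m + 'm"
    by (cases i; cases j) (auto simp: gram_def mform_mat_1 sum_axis simp del: Re_sum)
  moreover have "gram (\<lambda>v w. h z (?L v) (?L w)) = transpose (rmat ?L) ** gram (h z) ** rmat ?L"
    by (rule gram_pullback[OF bil[OF z]])
  ultimately have "det (transpose (rmat ?L) ** gram (h z) ** rmat ?L) = (\<Prod>i\<in>(UNIV :: ('m + 'm) set). 2)"
    by (subst det_diagonal) auto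
  then have "(det (rmat ?L))\<^sup>2 * det (gram (h z)) = 2 ^ CARD('m + 'm)"
    by (simp add: det_mul power2_eq_square ac_simps)
  then have "(det (rmat ?L))\<^sup>2 * det (gram (h z)) > 0" by simp
  then show ?thesis by (simp add: zero_less_mult_iff)
qed

lemma density_pos: "z \<in> S \<Longrightarrow> volume_density h z > 0"
  by (simp add: volume_density_eq det_gram_pos)

lemma Ck_det_gram: "Ck k S (\<lambda>z. det (gram (h z)))"
  by (rule Ck_det[OF open_S]) (simp add: gram_def Ck_h)

lemma Ck_density: "Ck k S (volume_density h)"
  unfolding volume_density_eq[abs_def] by (intro Ck_sqrt Ck_det_gram open_S det_gram_pos)

text \<open>Jacobi's formula, applied to \<open>G(z)\<^sup>-\<^sup>1 G(y)\<close> at \<open>y = z\<close>.\<close>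

lemma frechet_det_gram: assumes z: "z \<in> S"
  shows "frechet_derivative (\<lambda>y. det (gram (h y))) (at z) v
    = det (gram (h z)) * (4 * Re (\<Sum>*c. v $ c * trace (mdz c H z ** Win H z)))"
proof -
  let ?G = "gram (h z)"
  define A where "A = (\<Sum>*c. smat (v $ c) (mdz c H z))"
  define G' where "G' v = gram (\<lambda>x y. frechet_derivative (\<lambda>w. h w x y) (at z) v)" for v
  have "invertible ?G" using det_gram_pos[OF z] by (simp add: invertible_det_nz)
  then obtain N where N: "?G ** N = mat 1" "N ** ?G = mat 1" unfolding invertible_def by blast
  have "((\<lambda>y. det (N ** gram (h y))) has_derivative (\<lambda>v. trace (N ** G' v))) (at z)"
  proof (rule det_has_derivative_at_1)
    show "((\<lambda>y. (N ** gram (h y)) $ i $ j) has_derivative (\<lambda>v. (N ** G' v) $ i $ j)) (at z)" for i j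
      unfolding matrix_matrix_mult_def gram_def G'_def
      by (simp, intro has_derivative_sum has_derivative_mult_right h_has_derivative[OF z])
    show "N ** ?G = mat 1" by (rule N)
  qed
  then have "((\<lambda>y. det ?G * det (N ** gram (h y))) has_derivative (\<lambda>v. det ?G * trace (N ** G' v))) (at z)"
    by (rule has_derivative_mult_right)
  moreover have "det ?G * det (N ** gram (h y)) = det (gram (h y))" for y
  proof -
    have "det ?G * det (N ** gram (h y)) = det ((?G ** N) ** gram (h y))"
      by (simp add: det_mul)
    also have "?G ** N = mat 1" by (rule N)
    finally show ?thesis by simp
  qed
  ultimately have "((\<lambda>y. det (gram (h y))) has_derivative (\<lambda>v. det ?G * trace (N ** G' v))) (at z)" by simp
  then have 1: "frechet_derivative (\<lambda>y. det (gram (h y))) (at z) v = det ?G * trace (N ** G' v)"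
    by (simp add: frechet_derivative_eq)
  \<comment> \<open>The complex linear endomorphism through which the differentiated metric factors:
    it sends (x, y) to h(xB, y). The trace of N G' is therefore the real trace of B.\<close>
  let ?B = "(A + hadj A) ** Win H z"
  have B: "?B ** H z = A + hadj A"
    using Win_mult[OF z] by (simp flip: matrix_mul_assoc)
  have mf: "2 * Re (mform (A + hadj A) x y) = 2 * Re (mform A x y) + 2 * Re (mform A y x)" for x y
  proof -
    have "mform (A + hadj A) x y = mform A x y + mform (hadj A) x y"
      by (simp add: mform_def distrib_left sum.distrib)
    also have "mform (hadj A) x y = cnj (mform A y x)" by (simp only: mform_hadj)
    finally show ?thesis by simp
  qed
  have "G' v = gram (\<lambda>x y. h z (x v* ?B) y)"
    unfolding G'_def by (simp add: frechet_h[OF z] h_mform[OF z] mform_vm B mf A_def[symmetric])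
  also have "\<dots> = transpose (rmat (\<lambda>x. x v* ?B)) ** ?G ** rmat (\<lambda>x. x)"
    by (rule gram_pullback[OF bil[OF z]])
  also have "rmat (\<lambda>x. x) = (mat 1 :: real ^ ('m + 'm) ^ ('m + 'm))"
    by (simp add: rmat_def rcoord_real_frame mat_def)
  finally have "trace (N ** G' v) = trace (N ** (transpose (rmat (\<lambda>x. x v* ?B)) ** ?G))" by simp
  also have "\<dots> = trace ((transpose (rmat (\<lambda>x. x v* ?B)) ** ?G) ** N)" by (rule trace_mul_sym)
  also have "\<dots> = trace (transpose (rmat (\<lambda>x. x v* ?B)))"
    using N(1) by (simp flip: matrix_mul_assoc)
  also have "\<dots> = 2 * Re (trace ?B)" by (simp add: trace_transpose trace_rmat)
  also have "trace ?B = trace (A ** Win H z) + cnj (trace (A ** Win H z))"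
  proof -
    have "cnj (trace (A ** Win H z)) = trace (hadj (A ** Win H z))" by (simp add: trace_def hadj_nth)
    also have "\<dots> = trace (Win H z ** hadj A)" by (simp only: hadj_mult hadj_Win[OF z])
    also have "\<dots> = trace (hadj A ** Win H z)" by (rule trace_mul_sym)
    finally show ?thesis by (simp only: mm.add_left trace_add)
  qed
  also have "trace (A ** Win H z) = (\<Sum>*c. v $ c * trace (mdz c H z ** Win H z))"
    unfolding A_def mm.sum_left smat_mult_left by (simp add: trace_def sum_component smat_nth sum_distrib_left) (rule sum.swap)
  finally show ?thesis by (simp add: 1)
qed

text \<open>The density is det H up to a constant factor, so its logarithmic derivative is the
  trace. It is obtained from the Gram determinant by taking the square root, which halves the factor
  4.\<close>

lemma dz_density: assumes z: "z \<in> S"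
  shows "dz a (\<lambda>y. complex_of_real (volume_density h y)) z = of_real (volume_density h z) * trace (mdz a H z ** Win H z)"
    and "frechet_derivative (volume_density h) (at z) v = volume_density h z * (2 * Re (\<Sum>*c. v $ c * trace (mdz c H z ** Win H z)))"
proof -
  let ?T = "\<lambda>c. trace (mdz c H z ** Win H z)" and ?D = "volume_density h z"
  have d: "((\<lambda>y. det (gram (h y))) has_derivative frechet_derivative (\<lambda>y. det (gram (h y))) (at z)) (at z)"
    by (rule Ck_has_derivative[OF Ck_det_gram z])
  have dd: "(volume_density h has_derivative (\<lambda>v. ?D * (2 * Re (\<Sum>*c. v $ c * ?T c)))) (at z)"
  proof -
    have "det (gram (h z)) = ?D * ?D" using det_gram_pos[OF z] by (simp add: volume_density_eq)
    moreover have "?D \<noteq> 0" using density_pos[OF z] by simp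
    ultimately have e: "det (gram (h z)) * (4 * x) * (inverse ?D / 2) = ?D * (2 * x)" for x by simp
    show ?thesis
      using has_derivative_real_sqrt[OF det_gram_pos[OF z] d] unfolding frechet_det_gram[OF z] volume_density_eq[symmetric, abs_def]
      unfolding e .
  qed
  then show fd: "frechet_derivative (volume_density h) (at z) v = ?D * (2 * Re (\<Sum>*c. v $ c * ?T c))"
    by (simp add: frechet_derivative_eq)
  have c: "((\<lambda>y. complex_of_real (volume_density h y)) has_derivative (\<lambda>v. complex_of_real (?D * (2 * Re (\<Sum>*c. v $ c * ?T c))))) (at z)"
    by (rule bounded_linear.has_derivative[OF bounded_linear_of_real dd])
  have s: "(\<Sum>*c. axis a u $ c * ?T c) = u * ?T a" for u
  proof -
    have "axis a u $ c * ?T c = (if c = a then u * ?T a else 0)" for c by (simp add: axis_def)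
    then show ?thesis by simp
  qed
  show "dz a (\<lambda>y. complex_of_real (volume_density h y)) z = of_real ?D * ?T a"
    unfolding dz_eq[OF c] s by (simp add: complex_eq_iff)
qed

end

section \<open>Transport of the change of variables formula to complex vectors\<close>

lemma det_reindex:
  fixes A :: "'b::comm_ring_1 ^ 'k ^ 'k" and \<beta> :: "'n::finite \<Rightarrow> 'k::finite"
  assumes \<beta>: "bij \<beta>"
  shows "det (\<chi> i j. A $ \<beta> i $ \<beta> j) = det A"
proof -
  \<comment> \<open>Conjugation by \<beta> maps the permutations of one index type bijectively to
    those of the other and keeps the sign.\<close>
  let ?m = "map_permutation UNIV \<beta>"
  have ap: "?m p (\<beta> i) = \<beta> (p i)" for p i
    by (rule map_permutation_apply) (simp_all add: bij_is_inj[OF \<beta>])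
  have per: "?m p permutes UNIV" if "p permutes UNIV" for p
    using that \<beta> by (intro map_permutation_permutes[where A = UNIV]) auto
  have bij: "bij_betw ?m {p. p permutes UNIV} {p. p permutes UNIV}"
  proof (rule bij_betw_imageI)
    show "inj_on ?m {p. p permutes UNIV}"
      by (rule inj_onI, rule ext) (metis ap bij_is_inj[OF \<beta>] injD)
    then have "card (?m ` {p. p permutes (UNIV :: 'n set)}) = card {p. p permutes (UNIV :: 'k set)}"
      using bij_betw_same_card[OF \<beta>] by (simp add: card_image card_permutations)
    then show "?m ` {p. p permutes UNIV} = {p. p permutes UNIV}"
      by (intro card_subset_eq) (auto simp: finite_permutations per)
  qed
  have "det A = (\<Sum>p\<in>{p. p permutes (UNIV :: 'n set)}. of_int (sign (?m p)) * (\<Prod>k\<in>UNIV. A $ k $ ?m p k))"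
    unfolding det_def by (rule sum.reindex_bij_betw[OF bij, symmetric])
  also have "\<dots> = (\<Sum>p\<in>{p. p permutes (UNIV :: 'n set)}. of_int (sign p) * (\<Prod>i\<in>UNIV. A $ \<beta> i $ \<beta> (p i)))"
  proof (rule sum.cong[OF refl])
    fix p assume "p \<in> {p. p permutes (UNIV :: 'n set)}"
    then have s: "sign (?m p) = sign p" by (intro sign_map_permutation) (auto simp: bij_is_inj[OF \<beta>] inj_on_subset)
    have "(\<Prod>k\<in>UNIV. A $ k $ ?m p k) = (\<Prod>i\<in>UNIV. A $ \<beta> i $ ?m p (\<beta> i))"
      by (rule prod.reindex_bij_betw[OF \<beta>, symmetric])
    then show "of_int (sign (?m p)) * (\<Prod>k\<in>UNIV. A $ k $ ?m p k) = of_int (sign p) * (\<Prod>i\<in>UNIV. A $ \<beta> i $ \<beta> (p i))"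
      by (simp add: s ap)
  qed
  finally show ?thesis by (simp add: det_def)
qed

text \<open>The library states the change of variables only for well-ordered index types, hence the
  index type \<open>'m bit0\<close> of cardinality \<open>2 * CARD('m)\<close> as an intermediate step.\<close>

definition real_index :: "'m::finite bit0 \<Rightarrow> 'm + 'm" where
  "real_index = (SOME \<beta>. bij \<beta>)"

lemma bij_real_index: "bij (real_index :: 'm::finite bit0 \<Rightarrow> 'm + 'm)"
proof -
  have "card (UNIV :: 'm bit0 set) = card (UNIV :: ('m + 'm) set)" by (simp add: card_bit0)
  then have "\<exists>\<beta> :: 'm bit0 \<Rightarrow> 'm + 'm. bij \<beta>"
    by (intro finite_same_card_bij) auto
  then show ?thesis unfolding real_index_def by (rule someI_ex)
qed

definition of_real_vec :: "real ^ ('m::finite bit0) \<Rightarrow> complex ^ 'm" where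
  "of_real_vec x = (\<Sum>*i. x $ i *\<^sub>R real_frame (real_index i))"

definition to_real_vec :: "complex ^ 'm::finite \<Rightarrow> real ^ ('m bit0)" where
  "to_real_vec y = (\<chi> i. rcoord (real_index i) y)"

lemma rcoord_linear: "rcoord k (x + y) = rcoord k x + rcoord k y" "rcoord k (r *\<^sub>R x) = r * rcoord k x"
  by (cases k; simp)+

lemma rcoord_sum: "rcoord k (sum f A) = (\<Sum>i\<in>A. rcoord k (f i))"
  by (cases k; simp)+

lemma of_to_real_vec: "of_real_vec (to_real_vec y) = y"
proof -
  have "(\<Sum>*i. rcoord (real_index i) y *\<^sub>R real_frame (real_index i)) = (\<Sum>*k. rcoord k y *\<^sub>R real_frame k)"
    by (rule sum.reindex_bij_betw[OF bij_real_index])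
  then show ?thesis by (simp add: of_real_vec_def to_real_vec_def real_frame_expansion)
qed

lemma to_of_real_vec: "to_real_vec (of_real_vec x) = x"
proof -
  have "(\<Sum>*i. x $ i * (if real_index k = real_index i then 1 else 0)) = (\<Sum>*i. if i = k then x $ i else 0)" for k
    using injD[OF bij_is_inj[OF bij_real_index]] by (intro sum.cong refl) auto
  then show ?thesis
    by (simp add: of_real_vec_def to_real_vec_def vec_eq_iff rcoord_sum rcoord_linear rcoord_real_frame)
qed

lemma linear_of_real_vec: "linear of_real_vec"
  by (rule linearI) (simp_all add: of_real_vec_def scaleR_add_left sum.distrib scaleR_sum_right)

lemma linear_to_real_vec: "linear to_real_vec"
  by (rule linearI) (simp_all add: to_real_vec_def rcoord_linear vec_eq_iff)

lemma measurable_of_real_vec: "of_real_vec \<in> borel_measurable borel"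
  by (intro borel_measurable_continuous_onI linear_continuous_on linear_conv_bounded_linear[THEN iffD1] linear_of_real_vec)

lemma prod_Basis_complex_vec: "(\<Prod>b\<in>Basis. f b) = (\<Prod>k\<in>UNIV. f (real_frame k :: complex ^ 'm::finite))"
proof (rule prod.reindex_bij_betw[symmetric], rule bij_betw_imageI)
  show "inj (real_frame :: 'm + 'm \<Rightarrow> complex ^ 'm)" by (rule injI) (metis rcoord_real_frame zero_neq_one)
  show "range real_frame = (Basis :: (complex ^ 'm) set)"
  proof (intro set_eqI iffI)
    fix x :: "complex ^ 'm" assume "x \<in> range real_frame"
    then obtain k :: "'m + 'm" where "x = real_frame k" by blast
    then show "x \<in> Basis" by (cases k) (auto simp: Basis_vec_def Basis_complex_def)
  next
    fix x :: "complex ^ 'm" assume "x \<in> Basis"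
    then obtain a where "x = axis a 1 \<or> x = axis a \<i>" by (auto simp: Basis_vec_def Basis_complex_def)
    then show "x \<in> range real_frame" by (metis real_frame.simps rangeI)
  qed
qed

lemma inner_real_frame: "x \<bullet> real_frame k = rcoord k x"
  by (cases k) (simp_all add: inner_axis_complex)

text \<open>Lebesgue measure is determined by its values on boxes, and the coordinate isomorphism
  matches boxes with boxes of the same side lengths.\<close>

lemma distr_of_real_vec: "distr lborel borel of_real_vec = (lborel :: (complex ^ 'm::finite) measure)"
proof (rule lborel_eqI[symmetric])
  fix l u :: "complex ^ 'm"
  assume lu: "\<And>b. b \<in> Basis \<Longrightarrow> l \<bullet> b \<le> u \<bullet> b"
  have rf: "real_frame k \<in> (Basis :: (complex ^ 'm) set)" for k :: "'m + 'm"
    by (cases k) (auto simp: Basis_vec_def Basis_complex_def)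
  have le: "rcoord k l \<le> rcoord k u" for k using lu[OF rf, of k] by (simp add: inner_real_frame)
  have bx: "x \<in> box l u \<longleftrightarrow> (\<forall>k. rcoord k l < rcoord k x \<and> rcoord k x < rcoord k u)" for x
  proof -
    have "(\<forall>b\<in>Basis. P b) \<longleftrightarrow> (\<forall>k :: 'm + 'm. P (real_frame k))" for P :: "complex ^ 'm \<Rightarrow> bool"
    proof
      assume *: "\<forall>k :: 'm + 'm. P (real_frame k)"
      show "\<forall>b\<in>Basis. P b"
      proof
        fix b :: "complex ^ 'm" assume "b \<in> Basis"
        then obtain a where "b = axis a 1 \<or> b = axis a \<i>" by (auto simp: Basis_vec_def Basis_complex_def)
        then show "P b" using *[rule_format, of "Inl a"] *[rule_format, of "Inr a"] by auto
      qed
    qed (use rf in blast)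
    then show ?thesis by (simp add: mem_box inner_real_frame)
  qed
  have "of_real_vec -` box l u = box (to_real_vec l) (to_real_vec u)"
  proof (rule set_eqI)
    fix x :: "real ^ ('m bit0)"
    have "of_real_vec x \<in> box l u \<longleftrightarrow> (\<forall>k. rcoord (real_index k) l < x $ k \<and> x $ k < rcoord (real_index k) u)"
    proof -
      have x: "rcoord (real_index k) (of_real_vec x) = x $ k" for k
        using to_of_real_vec[of x] by (metis to_real_vec_def vec_lambda_beta)
      show ?thesis unfolding bx
        using bij_is_surj[OF bij_real_index] x by (metis surjD)
    qed
    then show "x \<in> of_real_vec -` box l u \<longleftrightarrow> x \<in> box (to_real_vec l) (to_real_vec u)"
      by (simp add: mem_box_cart to_real_vec_def)
  qed
  then have "emeasure (distr lborel borel of_real_vec) (box l u) = emeasure lborel (box (to_real_vec l) (to_real_vec u))"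
    using measurable_of_real_vec by (subst emeasure_distr) auto
  also have "\<dots> = ennreal (\<Prod>b\<in>Basis. (to_real_vec u - to_real_vec l) \<bullet> b)"
    by (rule emeasure_lborel_box) (auto simp: Basis_vec_def inner_axis to_real_vec_def le)
  also have "(\<Prod>b\<in>Basis. (to_real_vec u - to_real_vec l) \<bullet> b) = (\<Prod>i\<in>UNIV. rcoord (real_index i) u - rcoord (real_index i) l)"
  proof -
    have "inj (\<lambda>i :: 'm bit0. axis i (1 :: real))" by (rule injI) (simp add: axis_eq_axis)
    note inj = this
    have B: "Basis = range (\<lambda>i :: 'm bit0. axis i (1 :: real))" by (auto simp: Basis_vec_def)
    show ?thesis unfolding B prod.reindex[OF inj] by (simp add: inner_axis to_real_vec_def)
  qed
  also have "\<dots> = (\<Prod>k\<in>UNIV. rcoord k u - rcoord k l)" by (rule prod.reindex_bij_betw[OF bij_real_index])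
  also have "\<dots> = (\<Prod>b\<in>Basis. (u - l) \<bullet> b)"
    by (simp add: prod_Basis_complex_vec inner_diff_left inner_real_frame)
  finally show "emeasure (distr lborel borel of_real_vec) (box l u) = ennreal (\<Prod>b\<in>Basis. (u - l) \<bullet> b)" .
qed simp

theorem emeasure_image_rmat:
  fixes \<tau> :: "complex ^ 'm::finite \<Rightarrow> complex ^ 'm"
  assumes S: "S \<in> sets borel" and im: "\<tau> ` S \<in> sets borel" and inj: "inj_on \<tau> S"
    and der: "\<And>z. z \<in> S \<Longrightarrow> (\<tau> has_derivative L z) (at z)"
    and meas: "(\<lambda>z. \<bar>det (rmat (L z))\<bar> * indicator S z) \<in> borel_measurable borel"
  shows "emeasure lborel (\<tau> ` S) = (\<integral>\<^sup>+z. ennreal (\<bar>det (rmat (L z))\<bar> * indicator S z) \<partial>lborel)"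
proof -
  let ?S = "of_real_vec -` S"
  let ?f = "\<lambda>x. to_real_vec (\<tau> (of_real_vec x))"
  let ?L = "\<lambda>x v. to_real_vec (L (of_real_vec x) (of_real_vec v))"
  note bl = linear_conv_bounded_linear[THEN iffD1]
  have e: "emeasure lborel A = emeasure lborel (of_real_vec -` A)" if "A \<in> sets borel" for A :: "(complex ^ 'm) set"
    using emeasure_distr[of of_real_vec lborel borel A] measurable_of_real_vec that by (simp add: distr_of_real_vec)
  have vim: "of_real_vec -` A \<in> sets borel" if "A \<in> sets borel" for A :: "(complex ^ 'm) set"
    using measurable_sets[OF measurable_of_real_vec that] by simp
  have fS: "?f ` ?S = of_real_vec -` (\<tau> ` S)"
  proof (intro set_eqI iffI)
    fix x assume "x \<in> of_real_vec -` (\<tau> ` S)"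
    then obtain z where z: "z \<in> S" "of_real_vec x = \<tau> z" by auto
    then have "x = ?f (to_real_vec z)" "to_real_vec z \<in> ?S" by (metis of_to_real_vec to_of_real_vec, simp add: of_to_real_vec z)
    then show "x \<in> ?f ` ?S" by blast
  qed (auto simp: of_to_real_vec)
  have det: "det (matrix (?L x)) = det (rmat (L (of_real_vec x)))" if "x \<in> ?S" for x
  proof -
    have fr: "of_real_vec (axis i 1) = real_frame (real_index i)" for i :: "'m bit0"
    proof -
      have "axis i 1 $ j *\<^sub>R real_frame (real_index j) = (if j = i then real_frame (real_index i) else (0 :: complex ^ 'm))" for j
        by (simp add: axis_def)
      then show ?thesis by (simp add: of_real_vec_def)
    qed
    have "matrix (?L x) = (\<chi> i j. rmat (L (of_real_vec x)) $ real_index i $ real_index j)"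
      unfolding matrix_def fr by (simp add: to_real_vec_def rmat_def)
    then show ?thesis using det_reindex[OF bij_real_index] by metis
  qed
  have hm: "?f ` ?S \<in> lmeasurable \<and> measure lebesgue (?f ` ?S) = r \<longleftrightarrow> ((\<lambda>x. \<bar>det (matrix (?L x))\<bar>) has_integral r) ?S" for r
  proof (rule has_measure_differentiable_image)
    show "?S \<in> sets lebesgue" using vim[OF S] by simp
    show "(?f has_derivative ?L x) (at x within ?S)" if "x \<in> ?S" for x
    proof (rule has_derivative_at_withinI)
      have "((\<lambda>x. \<tau> (of_real_vec x)) has_derivative (\<lambda>v. L (of_real_vec x) (of_real_vec v))) (at x)"
        using has_derivative_compose[OF bounded_linear.has_derivative[OF bl[OF linear_of_real_vec] has_derivative_ident] der, of x] that by simp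
      then show "(?f has_derivative ?L x) (at x)"
        by (rule bounded_linear.has_derivative[OF bl[OF linear_to_real_vec]])
    qed
    show "inj_on ?f ?S"
    proof (rule inj_onI)
      fix x y assume xy: "x \<in> ?S" "y \<in> ?S" "?f x = ?f y"
      have "\<tau> (of_real_vec x) = \<tau> (of_real_vec y)" using arg_cong[OF xy(3), of of_real_vec] unfolding of_to_real_vec .
      then have "of_real_vec x = of_real_vec y" using xy by (auto intro: inj_onD[OF inj])
      from arg_cong[OF this, of to_real_vec] show "x = y" unfolding to_of_real_vec .
    qed
  qed
  let ?g = "\<lambda>x. \<bar>det (rmat (L (of_real_vec x)))\<bar> * indicator S (of_real_vec x)"
  have g: "?g \<in> borel_measurable borel" by (rule measurable_compose[OF measurable_of_real_vec meas])
  have hg: "((\<lambda>x. \<bar>det (matrix (?L x))\<bar>) has_integral r) ?S \<longleftrightarrow> (?g has_integral r) UNIV" for r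
  proof -
    have "((\<lambda>x. \<bar>det (matrix (?L x))\<bar>) has_integral r) ?S \<longleftrightarrow> ((\<lambda>x. if x \<in> ?S then \<bar>det (matrix (?L x))\<bar> else 0) has_integral r) UNIV"
      by (rule has_integral_restrict_UNIV[symmetric])
    also have "(\<lambda>x. if x \<in> ?S then \<bar>det (matrix (?L x))\<bar> else 0) = ?g"
      by (auto simp: fun_eq_iff det indicator_def)
    finally show ?thesis .
  qed
  have "(\<integral>\<^sup>+z. ennreal (\<bar>det (rmat (L z))\<bar> * indicator S z) \<partial>lborel) = (\<integral>\<^sup>+x. ennreal (?g x) \<partial>lborel)"
    unfolding distr_of_real_vec[symmetric] by (rule nn_integral_distr) (use measurable_of_real_vec meas in auto)
  also have "\<dots> = emeasure lborel (?f ` ?S)"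
  proof (cases "?f ` ?S \<in> lmeasurable")
    case True
    then have "((\<lambda>x. \<bar>det (matrix (?L x))\<bar>) has_integral measure lebesgue (?f ` ?S)) ?S" using hm by blast
    then have "(\<integral>\<^sup>+x. ennreal (?g x) \<partial>lborel) = measure lebesgue (?f ` ?S)"
      unfolding hg by (intro nn_integral_has_integral_lborel g) auto
    also have "\<dots> = emeasure lebesgue (?f ` ?S)" by (rule emeasure_eq_measure2[OF True, symmetric])
    finally show ?thesis using vim[OF im] by (simp add: fS)
  next
    \<comment> \<open>Infinite measure on the left; a finite integral would, by the equivalence
      \<open>hm\<close>, give the image finite measure.\<close>
    case False
    then have "emeasure lborel (?f ` ?S) = \<infinity>"
      using vim[OF im] by (simp add: fS fmeasurable_def less_top[symmetric])
    moreover have "(\<integral>\<^sup>+x. ennreal (?g x) \<partial>lborel) = \<infinity>"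
    proof (rule ccontr)
      assume "(\<integral>\<^sup>+x. ennreal (?g x) \<partial>lborel) \<noteq> \<infinity>"
      then obtain r where r: "0 \<le> r" "(\<integral>\<^sup>+x. ennreal (?g x) \<partial>lborel) = ennreal r"
        by (cases "\<integral>\<^sup>+x. ennreal (?g x) \<partial>lborel" rule: ennreal_cases) auto
      have "(?g has_integral r) UNIV" by (rule nn_integral_has_integral[OF g _ r(2,1)]) simp
      then show False using False hm hg by blast
    qed
    ultimately show ?thesis by simp
  qed
  finally show ?thesis by (simp add: e[OF im] fS)
qed

lemma borel_measurable_extension:
  assumes f: "continuous_on T f" and T: "T \<in> sets borel"
  shows "(\<lambda>z. if z \<in> T then f z else c) \<in> borel_measurable borel"
proof -
  have "f \<in> borel_measurable (restrict_space borel T)" by (rule borel_measurable_continuous_on_restrict[OF f])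
  then show ?thesis using T by (intro measurable_If_restrict_space_iff[THEN iffD2]) auto
qed

text \<open>By the formula for sets, the measure with density |det D\<tau>| pushed forward by \<tau>
  is Lebesgue measure on the image. Integrating F against this equality of measures gives the
  claim.\<close>

theorem nn_integral_image_rmat:
  fixes \<tau> :: "complex ^ 'm::finite \<Rightarrow> complex ^ 'm"
  assumes T: "open T" "open (\<tau> ` T)" and \<sigma>: "continuous_on (\<tau> ` T) \<sigma>" "\<And>z. z \<in> T \<Longrightarrow> \<sigma> (\<tau> z) = z"
    and der: "\<And>z. z \<in> T \<Longrightarrow> (\<tau> has_derivative L z) (at z)"
    and cont: "continuous_on T (\<lambda>z. \<bar>det (rmat (L z))\<bar>)"
    and F: "F \<in> borel_measurable borel"
  shows "(\<integral>\<^sup>+y. F y * indicator (\<tau> ` T) y \<partial>lborel)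
    = (\<integral>\<^sup>+z. F (\<tau> z) * ennreal \<bar>det (rmat (L z))\<bar> * indicator T z \<partial>lborel)"
proof -
  have cont\<tau>: "continuous_on T \<tau>"
    using der by (intro continuous_at_imp_continuous_on) (auto intro: has_derivative_continuous)
  \<comment> \<open>Extension by zero turns functions continuous on an open set into Borel functions
    on the whole space.\<close>
  let ?\<tau> = "\<lambda>z. if z \<in> T then \<tau> z else 0"
  let ?\<sigma> = "\<lambda>y. if y \<in> \<tau> ` T then \<sigma> y else 0"
  let ?J = "\<lambda>z. if z \<in> T then \<bar>det (rmat (L z))\<bar> else 0"
  have m\<tau>: "?\<tau> \<in> borel_measurable borel" and m\<sigma>: "?\<sigma> \<in> borel_measurable borel" and mJ: "?J \<in> borel_measurable borel"
    using T by (intro borel_measurable_extension cont\<tau> \<sigma>(1) cont; simp)+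
  have inj: "inj_on \<tau> T" by (rule inj_on_inverseI[of _ \<sigma>]) (rule \<sigma>(2))
  have eq: "distr (density lborel (\<lambda>z. ennreal (?J z))) borel ?\<tau> = density lborel (indicator (\<tau> ` T))"
  proof (rule measure_eqI)
    fix Y assume "Y \<in> sets (distr (density lborel (\<lambda>z. ennreal (?J z))) borel ?\<tau>)"
    then have Y: "Y \<in> sets borel" by simp
    have vY: "?\<tau> -` Y \<in> sets borel" using measurable_sets[OF m\<tau> Y] by simp
    let ?B = "?\<tau> -` Y \<inter> T"
    have B: "?B \<in> sets borel" "?B \<subseteq> T" using vY T by auto
    have im: "\<tau> ` ?B = Y \<inter> \<tau> ` T" by auto
    have "emeasure (distr (density lborel (\<lambda>z. ennreal (?J z))) borel ?\<tau>) Y = (\<integral>\<^sup>+z. ennreal (?J z) * indicator (?\<tau> -` Y) z \<partial>lborel)"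
      using m\<tau> mJ Y vY by (subst emeasure_distr) (auto simp: emeasure_density)
    also have "\<dots> = (\<integral>\<^sup>+z. ennreal (\<bar>det (rmat (L z))\<bar> * indicator ?B z) \<partial>lborel)"
      by (intro nn_integral_cong) (auto simp: indicator_def)
    also have "\<dots> = emeasure lborel (\<tau> ` ?B)"
    proof (rule emeasure_image_rmat[symmetric])
      show "\<tau> ` ?B \<in> sets borel" unfolding im using Y T by auto
      show "inj_on \<tau> ?B" by (rule inj_on_subset[OF inj]) auto
      have "(\<lambda>z. \<bar>det (rmat (L z))\<bar> * indicator ?B z) = (\<lambda>z. ?J z * indicator ?B z)"
        by (auto simp: fun_eq_iff indicator_def)
      moreover have "(\<lambda>z. ?J z * indicator ?B z) \<in> borel_measurable borel"
        by (rule borel_measurable_times[OF mJ borel_measurable_indicator[OF B(1)]])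
      ultimately show "(\<lambda>z. \<bar>det (rmat (L z))\<bar> * indicator ?B z) \<in> borel_measurable borel" by (simp only:)
    qed (use B der in auto)
    also have "\<dots> = (\<integral>\<^sup>+y. indicator (\<tau> ` T) y * indicator Y y \<partial>lborel)"
    proof -
      have "(\<lambda>y. indicator (\<tau> ` T) y * indicator Y y :: ennreal) = indicator (Y \<inter> \<tau> ` T)"
        by (auto simp: fun_eq_iff indicator_def)
      then show ?thesis unfolding im using Y T by (simp add: borel_open)
    qed
    also have "\<dots> = emeasure (density lborel (indicator (\<tau> ` T))) Y"
      using Y T by (simp add: emeasure_density)
    finally show "emeasure (distr (density lborel (\<lambda>z. ennreal (?J z))) borel ?\<tau>) Y = emeasure (density lborel (indicator (\<tau> ` T))) Y" .
  qed simp
  have "(\<integral>\<^sup>+y. F y * indicator (\<tau> ` T) y \<partial>lborel) = (\<integral>\<^sup>+y. F y \<partial>density lborel (indicator (\<tau> ` T)))"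
    using F T by (subst nn_integral_density) (auto simp: mult.commute)
  also have "\<dots> = (\<integral>\<^sup>+z. F (?\<tau> z) \<partial>density lborel (\<lambda>z. ennreal (?J z)))"
    unfolding eq[symmetric] by (rule nn_integral_distr) (use m\<tau> F in auto)
  also have "\<dots> = (\<integral>\<^sup>+z. ennreal (?J z) * F (?\<tau> z) \<partial>lborel)"
    using mJ measurable_compose[OF m\<tau> F] by (subst nn_integral_density) auto
  also have "\<dots> = (\<integral>\<^sup>+z. F (\<tau> z) * ennreal \<bar>det (rmat (L z))\<bar> * indicator T z \<partial>lborel)"
    by (intro nn_integral_cong) (auto simp: indicator_def mult.commute)
  finally show ?thesis .
qed

context kaehler_transition
begin

lemma tau_has_derivative: assumes "z \<in> T" shows "(\<tau> has_derivative (\<lambda>v. v v* jac \<tau> z)) (at z)"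
proof -
  obtain D where D: "(\<tau> has_derivative D) (at z)"
    using tau_holomorphic assms unfolding holomorphic_map_on_def by blast
  then have "D = (\<lambda>v. v v* jac \<tau> z)" using frechet_tau[OF assms] by (simp add: frechet_derivative_eq[OF D] fun_eq_iff)
  then show ?thesis using D by simp
qed

lemma density_transition: assumes z: "z \<in> T"
  shows "volume_density h1 z = \<bar>det (rmat (\<lambda>v. v v* jac \<tau> z))\<bar> * volume_density h2 (\<tau> z)"
proof -
  let ?L = "\<lambda>v. v v* jac \<tau> z"
  have "gram (h1 z) = gram (\<lambda>v w. h2 (\<tau> z) (?L v) (?L w))"
    by (simp add: gram_def isometry[OF z] frechet_tau[OF z])
  also have "\<dots> = transpose (rmat ?L) ** gram (h2 (\<tau> z)) ** rmat ?L"
    by (rule gram_pullback[OF M2.bil[OF tau_S[OF z]]])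
  finally have "det (gram (h1 z)) = (det (rmat ?L))\<^sup>2 * det (gram (h2 (\<tau> z)))"
    by (simp add: det_mul power2_eq_square)
  then show ?thesis by (simp add: volume_density_eq real_sqrt_mult)
qed

lemma continuous_det_rmat: "continuous_on T (\<lambda>z. \<bar>det (rmat (\<lambda>v. v v* jac \<tau> z))\<bar>)"
proof -
  have "continuous_on T (\<lambda>z. jac \<tau> z $ a $ b)" for a b using pull.smooth_jac[of 0] by (simp add: mCk_def)
  then have "continuous_on T (\<lambda>z. v v* jac \<tau> z)" for v
    unfolding vector_matrix_mult_def by (intro continuous_on_vec_lambda continuous_on_sum continuous_on_mult continuous_on_const)
  then have "continuous_on T (\<lambda>z. rcoord k (v v* jac \<tau> z))" for k v
    by (cases k) (auto intro!: continuous_intros)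
  then have "continuous_on T (\<lambda>z. rmat (\<lambda>v. v v* jac \<tau> z) $ i $ j)" for i j by (simp add: rmat_def)
  then show ?thesis unfolding det_def
    by (intro continuous_on_rabs continuous_on_sum continuous_on_mult continuous_on_const continuous_on_prod)
qed

lemma density_integral_transition:
  assumes \<sigma>: "open (\<tau> ` T)" "continuous_on (\<tau> ` T) \<sigma>" "\<And>z. z \<in> T \<Longrightarrow> \<sigma> (\<tau> z) = z"
    and B: "B \<subseteq> T" "\<tau> ` B \<in> sets borel"
  shows "(\<integral>\<^sup>+y. ennreal (volume_density h2 y) * indicator (\<tau> ` B) y \<partial>lborel)
    = (\<integral>\<^sup>+z. ennreal (volume_density h1 z) * indicator B z \<partial>lborel)"
proof -
  let ?F = "\<lambda>y. ennreal (if y \<in> S2 then volume_density h2 y else 0) * indicator (\<tau> ` B) y"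
  have F: "?F \<in> borel_measurable borel"
  proof (intro borel_measurable_times_ennreal measurable_compose[OF _ measurable_ennreal] borel_measurable_indicator B)
    have "continuous_on S2 (volume_density h2)" using M2.Ck_density[of 0] by simp
    then show "(\<lambda>y. if y \<in> S2 then volume_density h2 y else 0) \<in> borel_measurable borel"
      using M2.open_S by (intro borel_measurable_extension) auto
  qed
  have inj: "inj_on \<tau> T" by (rule inj_on_inverseI[of _ \<sigma>]) (rule \<sigma>(3))
  have "(\<integral>\<^sup>+y. ennreal (volume_density h2 y) * indicator (\<tau> ` B) y \<partial>lborel) = (\<integral>\<^sup>+y. ?F y * indicator (\<tau> ` T) y \<partial>lborel)"
    using B tau_S by (intro nn_integral_cong) (auto simp: indicator_def)
  also have "\<dots> = (\<integral>\<^sup>+z. ?F (\<tau> z) * ennreal \<bar>det (rmat (\<lambda>v. v v* jac \<tau> z))\<bar> * indicator T z \<partial>lborel)"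
    by (rule nn_integral_image_rmat[OF open_T \<sigma> tau_has_derivative continuous_det_rmat F])
  also have "\<dots> = (\<integral>\<^sup>+z. ennreal (volume_density h1 z) * indicator B z \<partial>lborel)"
  proof (intro nn_integral_cong)
    fix z
    show "?F (\<tau> z) * ennreal \<bar>det (rmat (\<lambda>v. v v* jac \<tau> z))\<bar> * indicator T z = ennreal (volume_density h1 z) * indicator B z"
    proof (cases "z \<in> T")
      case True
      then have "\<tau> z \<in> \<tau> ` B \<longleftrightarrow> z \<in> B" using B(1) inj by (auto dest: inj_onD)
      then show ?thesis using True tau_S[OF True] M2.density_pos[OF tau_S[OF True]]
        by (auto simp: indicator_def density_transition ennreal_mult mult.commute)
    qed (use B in \<open>auto simp: indicator_def\<close>)
  qed
  finally show ?thesis .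
qed

end

section \<open>The Riemannian volume\<close>

locale csc_kaehler_manifold =
  fixes X :: "'a topology" and A :: "('a, 'm::finite) chart set" and g :: "('a, 'm) mfd_metric" and s :: real
  assumes kaehler_manifold: "kaehler_manifold X A g"
    and compact_space: "compact_space X"
    and card: "CARD('m) \<ge> 2"
    and scal: "\<And>c z. c \<in> A \<Longrightarrow> z \<in> chart_image c \<Longrightarrow> scalar_curvature (g c) z = s"
begin

lemma complex_manifold: "complex_manifold X A" and riemannian_metric: "riemannian_metric A g"
  using kaehler_manifold by (simp_all add: kaehler_manifold_def)

lemma
  assumes "c \<in> A"
  shows openin_chart: "openin X (fst c)" and open_chart_image: "open (chart_image c)"
    and chart_homeomorphic: "homeomorphic_map (subtopology X (fst c)) (top_of_set (chart_image c)) (snd c)"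
  using complex_manifold assms by (auto simp: complex_manifold_def is_chart_def)

lemma cover: "(\<Union>c\<in>A. fst c) = topspace X" and topspace_nonempty: "topspace X \<noteq> {}"
  using complex_manifold by (auto simp: complex_manifold_def)

lemma chart_subset: "c \<in> A \<Longrightarrow> fst c \<subseteq> topspace X"
  by (rule openin_subset[OF openin_chart])

lemma chart_inj: assumes "c \<in> A" shows "inj_on (snd c) (fst c)"
  using homeomorphic_imp_injective_map[OF chart_homeomorphic[OF assms]] chart_subset[OF assms]
  by (simp add: Int_absorb1)

lemma chart_inv_snd [simp]: "c \<in> A \<Longrightarrow> p \<in> fst c \<Longrightarrow> chart_inv c (snd c p) = p"
  by (simp add: chart_inv_def inv_into_f_f[OF chart_inj])

lemma snd_chart_inv [simp]: "z \<in> chart_image c \<Longrightarrow> snd c (chart_inv c z) = z"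
  and chart_inv_in [simp]: "z \<in> chart_image c \<Longrightarrow> chart_inv c z \<in> fst c"
  by (auto simp: chart_image_def chart_inv_def f_inv_into_f inv_into_into)

lemma snd_in [simp]: "p \<in> fst c \<Longrightarrow> snd c p \<in> chart_image c"
  by (simp add: chart_image_def)

lemma open_snd_image: assumes c: "c \<in> A" and U: "openin X U" shows "open (snd c ` (U \<inter> fst c))"
proof -
  have "openin (subtopology X (fst c)) (U \<inter> fst c)" using U by (auto simp: openin_subtopology)
  then have "openin (top_of_set (chart_image c)) (snd c ` (U \<inter> fst c))"
    using homeomorphic_imp_open_map[OF chart_homeomorphic[OF c]] by (simp add: open_map_def)
  then show ?thesis using open_chart_image[OF c] by (metis openin_open_eq)
qed

lemma chart_inv_image: assumes c: "c \<in> A" shows "chart_inv c ` (V \<inter> chart_image c) = {p \<in> fst c. snd c p \<in> V}"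
  using c by (force simp: chart_image_def)

lemma openin_chart_inv_image: assumes c: "c \<in> A" and V: "open V" shows "openin X (chart_inv c ` (V \<inter> chart_image c))"
proof -
  have "continuous_map (subtopology X (fst c)) (top_of_set (chart_image c)) (snd c)"
    by (rule homeomorphic_imp_continuous_map[OF chart_homeomorphic[OF c]])
  moreover have "openin (top_of_set (chart_image c)) (V \<inter> chart_image c)" using V by (auto simp: openin_open)
  ultimately have "openin (subtopology X (fst c)) {p \<in> topspace (subtopology X (fst c)). snd c p \<in> V \<inter> chart_image c}"
    by (rule openin_continuous_map_preimage)
  also have "{p \<in> topspace (subtopology X (fst c)). snd c p \<in> V \<inter> chart_image c} = chart_inv c ` (V \<inter> chart_image c)"
    using chart_subset[OF c] by (auto simp: chart_inv_image[OF c])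
  finally show ?thesis using openin_chart[OF c] by (rule openin_trans_full)
qed

lemma metric_in_chart: assumes c: "c \<in> A" shows "csc_kaehler_metric (chart_image c) (g c) s (real CARD('m))"
proof
  show "open (chart_image c)" by (rule open_chart_image[OF c])
  show "real CARD('m) = real CARD('m)" "2 \<le> CARD('m)" "\<And>z. z \<in> chart_image c \<Longrightarrow> scalar_curvature (g c) z = s"
    using card scal c by auto
next
  fix z u v w assume z: "z \<in> chart_image c"
  have r: "bilinear (g c z) \<and> (\<forall>v w. g c z v w = g c z w v) \<and> (\<forall>v. v \<noteq> 0 \<longrightarrow> g c z v v > 0)"
    using riemannian_metric c z unfolding riemannian_metric_def by blast
  show "bilinear (g c z)" "g c z v w = g c z w v" "v \<noteq> 0 \<Longrightarrow> g c z v v > 0" using r by blast+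
  have k: "(\<forall>v w. g c z (\<i> *s v) (\<i> *s w) = g c z v w) \<and>
    (\<forall>u v w. frechet_derivative (\<lambda>y. g c y (\<i> *s v) w) (at z) u + frechet_derivative (\<lambda>y. g c y (\<i> *s w) u) (at z) v
       + frechet_derivative (\<lambda>y. g c y (\<i> *s u) v) (at z) w = 0)"
    using kaehler_manifold c z unfolding kaehler_manifold_def Let_def by blast
  show "g c z (\<i> *s v) (\<i> *s w) = g c z v w" using k by blast
  show "frechet_derivative (\<lambda>y. g c y (\<i> *s v) w) (at z) u + frechet_derivative (\<lambda>y. g c y (\<i> *s w) u) (at z) v
       + frechet_derivative (\<lambda>y. g c y (\<i> *s u) v) (at z) w = 0" using k by blast
next
  fix v w show "smooth_fun_on (chart_image c) (\<lambda>z. g c z v w)"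
    using riemannian_metric c unfolding riemannian_metric_def by blast
qed

lemma transition: assumes c: "c \<in> A" and d: "d \<in> A"
  shows "kaehler_transition (chart_image c) (chart_image d) (g c) (g d) s (real CARD('m)) (snd c ` (fst c \<inter> fst d)) (snd d \<circ> chart_inv c)"
proof -
  interpret M1: csc_kaehler_metric "chart_image c" "g c" s "real CARD('m)" by (rule metric_in_chart[OF c])
  interpret M2: csc_kaehler_metric "chart_image d" "g d" s "real CARD('m)" by (rule metric_in_chart[OF d])
  show ?thesis
  proof unfold_locales
    show "open (snd c ` (fst c \<inter> fst d))"
      using open_snd_image[OF c openin_chart[OF d]] by (simp add: Int_commute)
    show "snd c ` (fst c \<inter> fst d) \<subseteq> chart_image c" "(snd d \<circ> chart_inv c) ` snd c ` (fst c \<inter> fst d) \<subseteq> chart_image d"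
      using c by auto
    show "holomorphic_map_on (snd c ` (fst c \<inter> fst d)) (snd d \<circ> chart_inv c)"
      using complex_manifold c d by (simp add: complex_manifold_def)
    fix z v w assume "z \<in> snd c ` (fst c \<inter> fst d)"
    then obtain p where p: "p \<in> fst c \<inter> fst d" "z = snd c p" by blast
    show "g c z v w = g d ((snd d \<circ> chart_inv c) z) (frechet_derivative (snd d \<circ> chart_inv c) (at z) v) (frechet_derivative (snd d \<circ> chart_inv c) (at z) w)"
    proof -
      have "g c (snd c p) v w = g d (snd d p) (frechet_derivative (snd d \<circ> chart_inv c) (at (snd c p)) v) (frechet_derivative (snd d \<circ> chart_inv c) (at (snd c p)) w)"
        using riemannian_metric c d p(1) unfolding riemannian_metric_def Let_def by blast
      then show ?thesis using p c by simp
    qed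
  qed
qed

section \<open>Gluing the measures of the charts\<close>

definition borel_X :: "'a measure" where "borel_X = sigma (topspace X) {S. openin X S}"

lemma space_borel_X [simp]: "space borel_X = topspace X"
  and sets_borel_X: "sets borel_X = sigma_sets (topspace X) {S. openin X S}"
proof -
  have "{S. openin X S} \<subseteq> Pow (topspace X)" by (auto dest: openin_subset)
  then show "space borel_X = topspace X" "sets borel_X = sigma_sets (topspace X) {S. openin X S}"
    by (simp_all add: borel_X_def)
qed

lemma openin_borel_X: "openin X U \<Longrightarrow> U \<in> sets borel_X"
  by (simp add: sets_borel_X)

text \<open>A total version of \<open>chart_inv\<close>, measurable from the whole coordinate space
  to X. Outside the chart image it takes some fixed point of X, which is harmless because the
  density paired with it is zero there.\<close>

definition cinv :: "('a, 'm) chart \<Rightarrow> complex ^ 'm \<Rightarrow> 'a" where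
  "cinv c z = (if z \<in> chart_image c then chart_inv c z else (SOME p. p \<in> topspace X))"

lemma cinv_vimage: assumes c: "c \<in> A"
  shows "cinv c -` S \<inter> chart_image c = snd c ` (S \<inter> fst c)"
  using c by (auto simp: cinv_def chart_image_def)

lemma measurable_cinv: assumes c: "c \<in> A" shows "cinv c \<in> measurable borel borel_X"
  unfolding borel_X_def
proof (rule measurable_measure_of)
  show "{S. openin X S} \<subseteq> Pow (topspace X)" by (auto dest: openin_subset)
  have "(SOME p. p \<in> topspace X) \<in> topspace X" using topspace_nonempty by (simp add: some_in_eq)
  then show "cinv c \<in> space borel \<rightarrow> topspace X" using chart_subset[OF c] by (auto simp: cinv_def dest!: chart_inv_in)
  fix U assume U: "U \<in> {S. openin X S}"
  have "cinv c -` U = snd c ` (U \<inter> fst c) \<union> (if (SOME p. p \<in> topspace X) \<in> U then - chart_image c else {})"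
    unfolding cinv_vimage[OF c, symmetric] by (auto simp: cinv_def split: if_splits)
  moreover have "open (snd c ` (U \<inter> fst c))" using U by (intro open_snd_image[OF c]) simp
  ultimately show "cinv c -` U \<inter> space borel \<in> sets borel"
    using open_chart_image[OF c] by (auto intro!: sets.Un borel_open borel_closed)
qed

lemma borel_snd_image: assumes c: "c \<in> A" and S: "S \<in> sets borel_X" shows "snd c ` (S \<inter> fst c) \<in> sets borel"
  using measurable_sets[OF measurable_cinv[OF c] S] open_chart_image[OF c]
  by (simp flip: cinv_vimage[OF c])

text \<open>A measure on all of X, concentrated on the chart domain, so that measures of different
  charts can be compared and added.\<close>

definition chart_volume :: "('a, 'm) chart \<Rightarrow> 'a measure" where
  "chart_volume c = distr (density lborel (\<lambda>z. ennreal (if z \<in> chart_image c then volume_density (g c) z else 0))) borel_X (cinv c)"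

lemma measurable_density: assumes c: "c \<in> A"
  shows "(\<lambda>z. if z \<in> chart_image c then volume_density (g c) z else 0) \<in> borel_measurable borel"
proof -
  interpret csc_kaehler_metric "chart_image c" "g c" s "real CARD('m)" by (rule metric_in_chart[OF c])
  show ?thesis using Ck_density[of 0] open_S by (intro borel_measurable_extension) auto
qed

lemma emeasure_chart_volume: assumes c: "c \<in> A" and S: "S \<in> sets borel_X"
  shows "emeasure (chart_volume c) S = (\<integral>\<^sup>+z. ennreal (volume_density (g c) z) * indicator (snd c ` (S \<inter> fst c)) z \<partial>lborel)"
proof -
  have "cinv c -` S \<in> sets borel" using measurable_sets[OF measurable_cinv[OF c] S] by simp
  then have "emeasure (chart_volume c) S
    = (\<integral>\<^sup>+z. ennreal (if z \<in> chart_image c then volume_density (g c) z else 0) * indicator (cinv c -` S) z \<partial>lborel)"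
    unfolding chart_volume_def using measurable_cinv[OF c] measurable_density[OF c] S
    by (subst emeasure_distr) (auto simp: emeasure_density)
  also have "\<dots> = (\<integral>\<^sup>+z. ennreal (volume_density (g c) z) * indicator (snd c ` (S \<inter> fst c)) z \<partial>lborel)"
    unfolding cinv_vimage[OF c, symmetric] by (intro nn_integral_cong) (auto simp: indicator_def)
  finally show ?thesis .
qed

text \<open>Change of variables for the transition map, whose Jacobian determinant is absorbed by
  the densities.\<close>

lemma chart_volume_consistent:
  assumes c: "c \<in> A" and d: "d \<in> A" and S: "S \<in> sets borel_X" "S \<subseteq> fst c" "S \<subseteq> fst d"
  shows "emeasure (chart_volume c) S = emeasure (chart_volume d) S"
proof -
  interpret kaehler_transition "chart_image c" "chart_image d" "g c" "g d" s "real CARD('m)" "snd c ` (fst c \<inter> fst d)" "snd d \<circ> chart_inv c"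
    by (rule transition[OF c d])
  interpret inv: kaehler_transition "chart_image d" "chart_image c" "g d" "g c" s "real CARD('m)" "snd d ` (fst d \<inter> fst c)" "snd c \<circ> chart_inv d"
    by (rule transition[OF d c])
  have im: "(snd d \<circ> chart_inv c) ` snd c ` (fst c \<inter> fst d) = snd d ` (fst d \<inter> fst c)"
    "(snd d \<circ> chart_inv c) ` snd c ` S = snd d ` S"
    using c S(2) by (force simp: image_image)+
  have cont: "continuous_on (snd d ` (fst d \<inter> fst c)) (snd c \<circ> chart_inv d)"
    using inv.tau_has_derivative by (intro continuous_at_imp_continuous_on) (auto intro: has_derivative_continuous)
  have "(\<integral>\<^sup>+y. ennreal (volume_density (g d) y) * indicator ((snd d \<circ> chart_inv c) ` snd c ` S) y \<partial>lborel)
    = (\<integral>\<^sup>+z. ennreal (volume_density (g c) z) * indicator (snd c ` S) z \<partial>lborel)"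
  proof (rule density_integral_transition[where \<sigma> = "snd c \<circ> chart_inv d"])
    show "open ((snd d \<circ> chart_inv c) ` snd c ` (fst c \<inter> fst d))" unfolding im by (rule inv.open_T)
    show "continuous_on ((snd d \<circ> chart_inv c) ` snd c ` (fst c \<inter> fst d)) (snd c \<circ> chart_inv d)" unfolding im by (rule cont)
    show "(snd c \<circ> chart_inv d) ((snd d \<circ> chart_inv c) z) = z" if "z \<in> snd c ` (fst c \<inter> fst d)" for z
      using that c d by auto
    show "snd c ` S \<subseteq> snd c ` (fst c \<inter> fst d)" using S by auto
    show "(snd d \<circ> chart_inv c) ` snd c ` S \<in> sets borel"
      unfolding im using borel_snd_image[OF d S(1)] S(3) by (simp add: Int_absorb2)
  qed
  from this[unfolded im] show ?thesis
    using S(2,3) by (simp add: emeasure_chart_volume[OF c S(1)] emeasure_chart_volume[OF d S(1)] Int_absorb2)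
qed

lemma finite_cover: obtains cs where "set cs \<subseteq> A" "(\<Union>c\<in>set cs. fst c) = topspace X"
proof -
  obtain F where F: "finite F" "F \<subseteq> fst ` A" "topspace X \<subseteq> \<Union>F"
    using compact_space cover openin_chart unfolding compact_space_alt
    by (metis (no_types, lifting) imageE order_refl)
  obtain K where K: "K \<subseteq> A" "finite K" "F = fst ` K" using F finite_subset_image by metis
  obtain cs where "set cs = K" using finite_list[OF K(2)] ..
  moreover have "(\<Union>c\<in>K. fst c) = topspace X"
  proof
    show "(\<Union>c\<in>K. fst c) \<subseteq> topspace X" using K(1) chart_subset by blast
    show "topspace X \<subseteq> (\<Union>c\<in>K. fst c)" using F(3) K(3) by simp
  qed
  ultimately show thesis using K(1) that by blast
qed

text \<open>For measures, disjoint Borel pieces of a finite cover do the work of a partition of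
  unity.\<close>

lemma partition: obtains n \<gamma> Q where
    "\<And>i. i < n \<Longrightarrow> \<gamma> i \<in> A" "\<And>i. i < (n::nat) \<Longrightarrow> Q i \<in> sets borel_X" "\<And>i. i < n \<Longrightarrow> Q i \<subseteq> fst (\<gamma> i)"
    "disjoint_family_on Q {..<n}" "(\<Union>i<n. Q i) = topspace X"
proof -
  obtain cs where cs: "set cs \<subseteq> A" "(\<Union>c\<in>set cs. fst c) = topspace X" by (rule finite_cover)
  let ?n = "length cs" and ?D = "disjointed (\<lambda>i. if i < length cs then fst (cs ! i) else {})"
  show thesis
  proof (rule that[of ?n "\<lambda>i. cs ! i" ?D])
    show cA: "cs ! i \<in> A" if "i < ?n" for i using cs(1) that by auto
    have "range (\<lambda>i. if i < ?n then fst (cs ! i) else {}) \<subseteq> sets borel_X"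
      using openin_borel_X[OF openin_chart[OF cA]] by auto
    from sets.range_disjointed_sets[OF this] show "?D i \<in> sets borel_X" for i by blast
    show "?D i \<subseteq> fst (cs ! i)" if "i < ?n" for i
      using disjointed_subset[of "\<lambda>i. if i < length cs then fst (cs ! i) else {}" i] that by simp
    show "disjoint_family_on ?D {..<?n}" using disjoint_family_disjointed disjoint_family_on_mono subset_UNIV by metis
    have "(\<Union>i<?n. ?D i) = (\<Union>i. ?D i)"
    proof -
      have "?D i = {}" if "\<not> i < ?n" for i
        using disjointed_subset[of "\<lambda>i. if i < length cs then fst (cs ! i) else {}" i] that by simp
      then show ?thesis by auto
    qed
    also have "\<dots> = (\<Union>i. if i < ?n then fst (cs ! i) else {})" by (rule UN_disjointed_eq)
    also have "\<dots> = (\<Union>c\<in>set cs. fst c)" by (force simp: in_set_conv_nth split: if_splits)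
    finally show "(\<Union>i<?n. ?D i) = topspace X" using cs(2) by simp
  qed
qed

lemma emeasure_partition:
  assumes "sets \<mu> = sets borel_X" and Q: "\<And>i. i < (n::nat) \<Longrightarrow> Q i \<in> sets borel_X"
    "disjoint_family_on Q {..<n}" "(\<Union>i<n. Q i) = topspace X" and S: "S \<in> sets borel_X"
  shows "(\<Sum>i<n. emeasure \<mu> (S \<inter> Q i)) = emeasure \<mu> S"
proof -
  have "(\<Sum>i<n. emeasure \<mu> (S \<inter> Q i)) = emeasure \<mu> (\<Union>i<n. S \<inter> Q i)"
  proof (rule sum_emeasure)
    show "(\<lambda>i. S \<inter> Q i) ` {..<n} \<subseteq> sets \<mu>" using assms by auto
    show "disjoint_family_on (\<lambda>i. S \<inter> Q i) {..<n}" using Q(2) by (auto simp: disjoint_family_on_def)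
  qed simp
  also have "(\<Union>i<n. S \<inter> Q i) = S" using Q(3) sets.sets_into_space[OF S] by auto
  finally show ?thesis .
qed

definition is_volume :: "'a measure \<Rightarrow> bool" where
  "is_volume \<mu> \<longleftrightarrow> space \<mu> = topspace X \<and> sets \<mu> = sigma_sets (topspace X) {S. openin X S} \<and>
     (\<forall>c\<in>A. \<forall>S\<in>sets \<mu>. S \<subseteq> fst c \<longrightarrow>
        emeasure \<mu> S = (\<integral>\<^sup>+ z. ennreal (volume_density (g c) z) * indicator (snd c ` S) z \<partial>lborel))"

lemma is_volume_iff: "is_volume \<mu> \<longleftrightarrow> sets \<mu> = sets borel_X \<and>
    (\<forall>c\<in>A. \<forall>S\<in>sets borel_X. S \<subseteq> fst c \<longrightarrow> emeasure \<mu> S = emeasure (chart_volume c) S)"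
proof -
  have "sets \<mu> = sets borel_X \<Longrightarrow> space \<mu> = topspace X" using sets_eq_imp_space_eq[of \<mu> borel_X] by simp
  then show ?thesis
    by (auto simp: is_volume_def sets_borel_X[symmetric] emeasure_chart_volume Int_absorb2)
qed

lemma is_volume_unique: assumes "is_volume \<mu>" "is_volume \<nu>" shows "\<mu> = \<nu>"
proof -
  obtain n \<gamma> Q where Q: "\<And>i. i < n \<Longrightarrow> \<gamma> i \<in> A" "\<And>i. i < (n::nat) \<Longrightarrow> Q i \<in> sets borel_X" "\<And>i. i < n \<Longrightarrow> Q i \<subseteq> fst (\<gamma> i)"
    "disjoint_family_on Q {..<n}" "(\<Union>i<n. Q i) = topspace X" by (rule partition) blast
  note V = assms[unfolded is_volume_iff]
  show ?thesis
  proof (rule measure_eqI)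
    show "sets \<mu> = sets \<nu>" using V by simp
    fix S assume "S \<in> sets \<mu>"
    then have S: "S \<in> sets borel_X" using V by simp
    have "(\<Sum>i<n. emeasure \<mu> (S \<inter> Q i)) = (\<Sum>i<n. emeasure \<nu> (S \<inter> Q i))"
    proof (rule sum.cong[OF refl])
      fix i assume "i \<in> {..<n}"
      then have "S \<inter> Q i \<in> sets borel_X" "S \<inter> Q i \<subseteq> fst (\<gamma> i)" "\<gamma> i \<in> A" using Q S by auto
      then show "emeasure \<mu> (S \<inter> Q i) = emeasure \<nu> (S \<inter> Q i)" using V by metis
    qed
    then show "emeasure \<mu> S = emeasure \<nu> S"
      using emeasure_partition[OF _ Q(2,4,5) S] V by metis
  qed
qed

lemma is_volume_exists: "\<exists>\<mu>. is_volume \<mu>"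
proof -
  obtain n \<gamma> Q where Q: "\<And>i. i < n \<Longrightarrow> \<gamma> i \<in> A" "\<And>i. i < (n::nat) \<Longrightarrow> Q i \<in> sets borel_X" "\<And>i. i < n \<Longrightarrow> Q i \<subseteq> fst (\<gamma> i)"
    "disjoint_family_on Q {..<n}" "(\<Union>i<n. Q i) = topspace X" by (rule partition) blast
  \<comment> \<open>Each piece is measured in its own chart; by consistency on overlaps any other
    chart containing the set gives the same value.\<close>
  define F where "F S = (\<Sum>i<n. emeasure (chart_volume (\<gamma> i)) (S \<inter> Q i))" for S
  define \<mu> where "\<mu> = measure_of (topspace X) (sets borel_X) F"
  have sc: "sets (chart_volume c) = sets borel_X" for c by (simp add: chart_volume_def)
  have sig: "sigma_algebra (topspace X) (sets borel_X)" using sets.sigma_algebra_axioms[of borel_X] by simp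
  have pos: "positive (sets borel_X) F" by (simp add: positive_def F_def)
  have ca: "countably_additive (sets borel_X) F"
  proof (rule countably_additiveI)
    fix B :: "nat \<Rightarrow> 'a set"
    assume B: "range B \<subseteq> sets borel_X" "disjoint_family B"
    have "(\<Sum>k. F (B k)) = (\<Sum>i<n. \<Sum>k. emeasure (chart_volume (\<gamma> i)) (B k \<inter> Q i))"
      unfolding F_def by (rule suminf_sum) simp
    also have "\<dots> = F (\<Union>k. B k)"
      unfolding F_def
    proof (rule sum.cong[OF refl])
      fix i assume i: "i \<in> {..<n}"
      have "(\<Sum>k. emeasure (chart_volume (\<gamma> i)) (B k \<inter> Q i)) = emeasure (chart_volume (\<gamma> i)) (\<Union>k. B k \<inter> Q i)"
        using B Q(2)[of i] i by (intro suminf_emeasure) (auto simp: sc disjoint_family_on_def)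
      also have "(\<Union>k. B k \<inter> Q i) = (\<Union>k. B k) \<inter> Q i" by auto
      finally show "(\<Sum>k. emeasure (chart_volume (\<gamma> i)) (B k \<inter> Q i)) = emeasure (chart_volume (\<gamma> i)) ((\<Union>k. B k) \<inter> Q i)" .
    qed
    finally show "(\<Sum>k. F (B k)) = F (\<Union>k. B k)" .
  qed
  have s: "sets \<mu> = sets borel_X"
    unfolding \<mu>_def using sig by (simp add: sigma_algebra.sets_measure_of_eq)
  have e: "emeasure \<mu> S = F S" if "S \<in> sets borel_X" for S
    unfolding \<mu>_def by (rule emeasure_measure_of_sigma[OF sig pos ca that])
  have "emeasure \<mu> S = emeasure (chart_volume c) S" if "c \<in> A" "S \<in> sets borel_X" "S \<subseteq> fst c" for c S
  proof -
    have "emeasure \<mu> S = (\<Sum>i<n. emeasure (chart_volume c) (S \<inter> Q i))"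
      unfolding e[OF that(2)] F_def
    proof (intro sum.cong refl chart_volume_consistent that)
      fix i assume "i \<in> {..<n}"
      then have i: "i < n" by simp
      show "\<gamma> i \<in> A" "S \<inter> Q i \<in> sets borel_X" "S \<inter> Q i \<subseteq> fst c" "S \<inter> Q i \<subseteq> fst (\<gamma> i)"
        using Q(1-3)[OF i] that by auto
    qed
    also have "\<dots> = emeasure (chart_volume c) S" by (rule emeasure_partition[OF sc Q(2,4,5) that(2)])
    finally show ?thesis .
  qed
  then show ?thesis using s by (auto simp: is_volume_iff)
qed

abbreviation vol :: "'a measure" where "vol \<equiv> volume X A g"

text \<open>Existence and uniqueness give the definite description in \<open>volume\<close> its
  meaning.\<close>

lemma is_volume_vol: "is_volume vol"
proof -
  have "vol = (THE \<mu>. is_volume \<mu>)" by (simp add: volume_def is_volume_def)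
  then show ?thesis using theI'[of is_volume] is_volume_exists is_volume_unique by metis
qed

lemma sets_vol: "sets vol = sets borel_X" and space_vol: "space vol = topspace X"
  and emeasure_vol: "c \<in> A \<Longrightarrow> S \<in> sets borel_X \<Longrightarrow> S \<subseteq> fst c \<Longrightarrow> emeasure vol S = emeasure (chart_volume c) S"
  using is_volume_vol unfolding is_volume_def by (simp_all add: is_volume_iff sets_borel_X is_volume_vol[unfolded is_volume_iff])

text \<open>Integrals of functions carried by one chart become Lebesgue integrals by means of this
  equality.\<close>

lemma density_vol: assumes c: "c \<in> A" shows "density vol (indicator (fst c)) = chart_volume c"
proof (rule measure_eqI)
  show "sets (density vol (indicator (fst c))) = sets (chart_volume c)" by (simp add: sets_vol chart_volume_def)
  fix S assume "S \<in> sets (density vol (indicator (fst c)))"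
  then have S: "S \<in> sets borel_X" by (simp add: sets_vol)
  have f: "fst c \<in> sets borel_X" by (rule openin_borel_X[OF openin_chart[OF c]])
  have "emeasure (density vol (indicator (fst c))) S = (\<integral>\<^sup>+p. indicator (S \<inter> fst c) p \<partial>vol)"
  proof -
    have "emeasure (density vol (indicator (fst c))) S = (\<integral>\<^sup>+p. indicator (fst c) p * indicator S p \<partial>vol)"
      using S f by (intro emeasure_density borel_measurable_indicator) (simp_all add: sets_vol)
    also have "\<dots> = (\<integral>\<^sup>+p. indicator (S \<inter> fst c) p \<partial>vol)"
      by (rule arg_cong[where f = "nn_integral vol"]) (auto simp: fun_eq_iff indicator_def)
    finally show ?thesis .
  qed
  also have "\<dots> = emeasure vol (S \<inter> fst c)" using S f by (intro nn_integral_indicator) (auto simp: sets_vol)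
  also have "\<dots> = emeasure (chart_volume c) (S \<inter> fst c)" using S f by (intro emeasure_vol[OF c]) auto
  also have "\<dots> = emeasure (chart_volume c) S" using S f by (simp add: emeasure_chart_volume[OF c] sets.Int)
  finally show "emeasure (density vol (indicator (fst c))) S = emeasure (chart_volume c) S" .
qed

end

section \<open>Functions on the manifold and their integrals\<close>

lemma Ck_Un: "open S \<Longrightarrow> open T \<Longrightarrow> Ck k S f \<Longrightarrow> Ck k T f \<Longrightarrow> Ck k (S \<union> T) f"
  by (induction k arbitrary: f) (auto intro: continuous_on_open_Un)

context csc_kaehler_manifold
begin

definition CkX :: "nat \<Rightarrow> ('a \<Rightarrow> real) \<Rightarrow> bool" where
  "CkX k f \<longleftrightarrow> (\<forall>c\<in>A. Ck k (chart_image c) (\<lambda>z. f (chart_inv c z)))"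

lemma CkXD: "CkX k f \<Longrightarrow> c \<in> A \<Longrightarrow> Ck k (chart_image c) (\<lambda>z. f (chart_inv c z))"
  by (simp add: CkX_def)

lemma CkX_le: "j \<le> k \<Longrightarrow> CkX k f \<Longrightarrow> CkX j f"
  by (auto simp: CkX_def intro: Ck_le)

lemma CkX_const: "CkX k (\<lambda>p. c)" by (simp add: CkX_def Ck_const)

lemma CkX_add: "CkX k f \<Longrightarrow> CkX k h \<Longrightarrow> CkX k (\<lambda>p. f p + h p)"
  and CkX_mult: "CkX k f \<Longrightarrow> CkX k h \<Longrightarrow> CkX k (\<lambda>p. f p * h p)"
  by (auto simp: CkX_def intro!: Ck_add Ck_mult open_chart_image)

lemma CkX_sum: "(\<And>i. i \<in> I \<Longrightarrow> CkX k (f i)) \<Longrightarrow> CkX k (\<lambda>p. \<Sum>i\<in>I. f i p)"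
  by (auto simp: CkX_def intro!: Ck_sum open_chart_image)

lemma CkX_inverse: "CkX k f \<Longrightarrow> (\<And>p. p \<in> topspace X \<Longrightarrow> f p \<noteq> 0) \<Longrightarrow> CkX k (\<lambda>p. inverse (f p))"
  and CkX_sqrt: "CkX k f \<Longrightarrow> (\<And>p. p \<in> topspace X \<Longrightarrow> f p > 0) \<Longrightarrow> CkX k (\<lambda>p. sqrt (f p))"
  using chart_subset chart_inv_in by (auto simp: CkX_def intro!: Ck_inverse Ck_sqrt open_chart_image) blast+

lemma openin_preimage: assumes f: "CkX 0 f" and U: "open U" shows "openin X {p \<in> topspace X. f p \<in> U}"
proof -
  have "{p \<in> topspace X. f p \<in> U} = (\<Union>c\<in>A. chart_inv c ` ({z \<in> chart_image c. f (chart_inv c z) \<in> U} \<inter> chart_image c))"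
  proof -
    have "chart_inv c ` ({z \<in> chart_image c. f (chart_inv c z) \<in> U} \<inter> chart_image c) = {p \<in> fst c. f p \<in> U}" if "c \<in> A" for c
      using that by (simp add: chart_inv_image) (auto)
    then show ?thesis using cover by auto
  qed
  also have "openin X \<dots>"
  proof (intro openin_Union ballI, elim imageE, simp only:, rule openin_chart_inv_image)
    fix c assume c: "c \<in> A"
    have "openin (top_of_set (chart_image c)) (chart_image c \<inter> (\<lambda>z. f (chart_inv c z)) -` U)"
      using CkXD[OF f c] U by (intro continuous_openin_preimage_gen) auto
    then have "open (chart_image c \<inter> (\<lambda>z. f (chart_inv c z)) -` U)"
      using open_chart_image[OF c] by (metis openin_open_eq)
    then show "open {z \<in> chart_image c. f (chart_inv c z) \<in> U}" by (simp add: Int_def vimage_def)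
  qed
  finally show ?thesis .
qed

lemma continuous_map_CkX: "CkX 0 f \<Longrightarrow> continuous_map X euclideanreal f"
  by (simp add: continuous_map openin_preimage)

lemma measurable_CkX: assumes "CkX 0 f" shows "f \<in> borel_measurable vol"
proof (rule borel_measurableI)
  fix U :: "real set" assume "open U"
  have "f -` U \<inter> space vol = {p \<in> topspace X. f p \<in> U}" by (auto simp: space_vol)
  then show "f -` U \<inter> space vol \<in> sets vol"
    using openin_borel_X[OF openin_preimage[OF assms \<open>open U\<close>]] by (simp add: sets_vol)
qed

lemma bounded_CkX: assumes "CkX 0 f" obtains B :: real where "\<And>p. p \<in> topspace X \<Longrightarrow> \<bar>f p\<bar> \<le> B"
proof -
  have "compactin X (topspace X)" using compact_space by (simp add: compact_space_def)
  then have "compactin euclideanreal (f ` topspace X)" by (rule image_compactin[OF _ continuous_map_CkX[OF assms]])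
  then have "bounded (f ` topspace X)" by (simp add: compact_imp_bounded)
  then obtain B where "\<forall>y\<in>f ` topspace X. norm y \<le> B" by (auto simp: bounded_iff)
  then show thesis using that by auto
qed

lemma fst_chart_borel: "c \<in> A \<Longrightarrow> fst c \<in> sets borel_X"
  by (rule openin_borel_X[OF openin_chart])

lemma emeasure_vol_chart:
  assumes c: "c \<in> A" and V: "V \<subseteq> chart_image c" "open V"
  shows "emeasure vol (chart_inv c ` V) = (\<integral>\<^sup>+z. ennreal (volume_density (g c) z) * indicator V z \<partial>lborel)"
proof -
  have V': "V \<inter> chart_image c = V" using V by auto
  have S: "chart_inv c ` V \<in> sets borel_X"
    using openin_borel_X[OF openin_chart_inv_image[OF c V(2)]] by (simp add: V')
  have sub: "chart_inv c ` V \<subseteq> fst c" using V by auto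
  have "snd c ` (chart_inv c ` V \<inter> fst c) = V"
    using V sub by (force simp: Int_absorb2 image_image)
  then show ?thesis
    by (simp add: emeasure_vol[OF c S sub] emeasure_chart_volume[OF c S])
qed

text \<open>Every point has a coordinate ball with bounded density and hence finite volume; by
  compactness finitely many of them suffice.\<close>

lemma finite_measure_vol: "finite_measure vol"
proof
  have "\<exists>U. openin X U \<and> p \<in> U \<and> emeasure vol U < \<infinity>" if p: "p \<in> topspace X" for p
  proof -
    obtain c where c: "c \<in> A" "p \<in> fst c" using p cover by blast
    interpret csc_kaehler_metric "chart_image c" "g c" s "real CARD('m)" by (rule metric_in_chart[OF c(1)])
    obtain r where r: "r > 0" "cball (snd c p) r \<subseteq> chart_image c"
      using open_contains_cball[THEN iffD1, OF open_S] snd_in[OF c(2)] by blast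
    let ?V = "ball (snd c p) r"
    have V: "?V \<subseteq> chart_image c" using r ball_subset_cball by blast
    have "compact (volume_density (g c) ` cball (snd c p) r)"
      using Ck_density[of 0] r by (intro compact_continuous_image) (auto intro: continuous_on_subset)
    from compact_imp_bounded[OF this] obtain B where "\<forall>y\<in>volume_density (g c) ` cball (snd c p) r. norm y \<le> B"
      unfolding bounded_iff by blast
    have B: "volume_density (g c) z \<le> B" if "z \<in> ?V" for z
    proof -
      have "z \<in> cball (snd c p) r" using that by simp
      then have "norm (volume_density (g c) z) \<le> B" using \<open>\<forall>y\<in>_. norm y \<le> B\<close> by blast
      then show ?thesis by simp
    qed
    have "emeasure vol (chart_inv c ` ?V) = (\<integral>\<^sup>+z. ennreal (volume_density (g c) z) * indicator ?V z \<partial>lborel)"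
      using emeasure_vol_chart[OF c(1) V] by simp
    also have "\<dots> \<le> (\<integral>\<^sup>+z. ennreal B * indicator ?V z \<partial>lborel)"
      using B by (intro nn_integral_mono) (auto simp: indicator_def intro!: ennreal_leI)
    also have "\<dots> = ennreal B * emeasure lborel ?V" by (simp add: nn_integral_cmult_indicator)
    also have "\<dots> < \<infinity>" using emeasure_bounded_finite[of ?V] by (simp add: ennreal_mult_less_top)
    finally have "emeasure vol (chart_inv c ` ?V) < \<infinity>" .
    moreover have "openin X (chart_inv c ` ?V)"
      using openin_chart_inv_image[OF c(1), of ?V] V by (simp add: Int_absorb2)
    moreover have "p \<in> chart_inv c ` ?V" using c r by (metis chart_inv_snd centre_in_ball image_eqI)
    ultimately show ?thesis by blast
  qed
  then obtain U where U: "\<And>p. p \<in> topspace X \<Longrightarrow> openin X (U p) \<and> p \<in> U p \<and> emeasure vol (U p) < \<infinity>" by metis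
  obtain F where F: "finite F" "F \<subseteq> U ` topspace X" "topspace X \<subseteq> \<Union>F"
  proof -
    have "\<forall>V\<in>U ` topspace X. openin X V" "topspace X \<subseteq> \<Union>(U ` topspace X)" using U by auto
    then show thesis using compact_space that unfolding compact_space_alt by meson
  qed
  have FU: "V \<in> sets vol \<and> emeasure vol V < \<infinity>" if "V \<in> F" for V
    using F(2) U that openin_borel_X by (auto simp: sets_vol)
  have "emeasure vol (space vol) \<le> emeasure vol (\<Union>F)"
  proof (rule emeasure_mono)
    show "space vol \<subseteq> \<Union>F" using F(3) by (simp add: space_vol)
    show "\<Union>F \<in> sets vol" using FU F(1) by (intro sets.finite_Union) auto
  qed
  also have "\<dots> = emeasure vol (\<Union>V\<in>F. V)" by simp
  also have "\<dots> \<le> (\<Sum>V\<in>F. emeasure vol V)" by (rule emeasure_subadditive_finite) (use F(1) FU in auto)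
  also have "\<dots> < \<infinity>" using FU F(1) by simp
  finally show "emeasure vol (space vol) \<noteq> \<infinity>" by simp
qed

lemma integrable_bounded:
  fixes f :: "'a \<Rightarrow> real"
  assumes "f \<in> borel_measurable vol" "\<And>p. p \<in> topspace X \<Longrightarrow> \<bar>f p\<bar> \<le> B"
  shows "integrable vol f"
proof -
  interpret finite_measure vol by (rule finite_measure_vol)
  show ?thesis by (rule integrable_const_bound[of _ B]) (use assms in \<open>auto simp: space_vol\<close>)
qed

lemma integrable_CkX: assumes "CkX 0 f" shows "integrable vol f"
proof -
  obtain B where "\<And>p. p \<in> topspace X \<Longrightarrow> \<bar>f p\<bar> \<le> B" by (rule bounded_CkX[OF assms]) blast
  then show ?thesis by (rule integrable_bounded[OF measurable_CkX[OF assms]])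
qed

lemma integral_chart:
  assumes c: "c \<in> A" and f: "f \<in> borel_measurable vol" and 0: "\<And>p. p \<in> topspace X \<Longrightarrow> p \<notin> fst c \<Longrightarrow> f p = 0"
  shows "(LINT p|vol. f p) = (LINT z|lborel. (if z \<in> chart_image c then volume_density (g c) z * f (chart_inv c z) else 0))"
proof -
  interpret csc_kaehler_metric "chart_image c" "g c" s "real CARD('m)" by (rule metric_in_chart[OF c])
  let ?D = "\<lambda>z. if z \<in> chart_image c then volume_density (g c) z else 0"
  have ind: "indicator (fst c) \<in> borel_measurable vol"
    by (rule borel_measurable_indicator) (simp add: sets_vol fst_chart_borel[OF c])
  have fX: "f \<in> borel_measurable borel_X" using f by (simp add: measurable_def space_vol sets_vol)
  have mc: "cinv c \<in> measurable lborel borel_X" using measurable_cinv[OF c] by simp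
  have "(LINT p|vol. f p) = (LINT p|vol. indicator (fst c) p *\<^sub>R f p)"
    using 0 by (intro Bochner_Integration.integral_cong refl) (auto simp: space_vol indicator_def)
  also have "\<dots> = (LINT p|density vol (\<lambda>p. ennreal (indicator (fst c) p)). f p)"
    by (rule integral_density[symmetric]) (use f ind in auto)
  also have "density vol (\<lambda>p. ennreal (indicator (fst c) p)) = chart_volume c"
    by (simp only: ennreal_indicator density_vol[OF c])
  also have "(LINT p|chart_volume c. f p) = (LINT z|density lborel (\<lambda>z. ennreal (?D z)). f (cinv c z))"
    unfolding chart_volume_def by (rule integral_distr) (use mc fX in auto)
  also have "\<dots> = (LINT z|lborel. ?D z *\<^sub>R f (cinv c z))"
    using measurable_compose[OF mc fX] measurable_density[OF c] density_pos
    by (intro integral_density) (auto simp: less_imp_le)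
  also have "\<dots> = (LINT z|lborel. (if z \<in> chart_image c then volume_density (g c) z * f (chart_inv c z) else 0))"
    by (intro Bochner_Integration.integral_cong refl) (auto simp: cinv_def)
  finally show ?thesis .
qed

text \<open>A positive value of f would make it positive on a nonempty open set of the chart. That
  set has volume zero and, as the density is positive, Lebesgue measure zero, which is impossible
  for a nonempty open set.\<close>

lemma integral_zero_imp_zero:
  assumes f: "CkX 0 f" and nonneg: "\<And>p. p \<in> topspace X \<Longrightarrow> f p \<ge> 0" and I: "(LINT p|vol. f p) = 0"
    and p: "p \<in> topspace X"
  shows "f p = 0"
proof (rule ccontr)
  assume "f p \<noteq> 0"
  then have fp: "f p > 0" using nonneg[OF p] by simp
  obtain c where c: "c \<in> A" "p \<in> fst c" using p cover by blast
  interpret csc_kaehler_metric "chart_image c" "g c" s "real CARD('m)" by (rule metric_in_chart[OF c(1)])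
  define V where "V = chart_image c \<inter> (\<lambda>z. f (chart_inv c z)) -` {0<..}"
  have "openin (top_of_set (chart_image c)) V"
    unfolding V_def using CkXD[OF f c(1)] by (intro continuous_openin_preimage_gen) auto
  then have V: "open V" "V \<subseteq> chart_image c" using open_S by (metis openin_open_eq, simp add: V_def)
  have "AE q in vol. f q = 0"
  proof -
    have "AE q in vol. 0 \<le> f q" using nonneg by (intro AE_I2) (simp add: space_vol)
    then show ?thesis using integral_nonneg_eq_0_iff_AE[OF integrable_CkX[OF f]] I by simp
  qed
  then have N: "{q \<in> space vol. f q \<noteq> 0} \<in> null_sets vol"
    using measurable_CkX[OF f] by (subst AE_iff_null[symmetric]) simp_all
  have "chart_inv c ` V \<subseteq> {q \<in> space vol. f q \<noteq> 0}"
    using chart_subset[OF c(1)] chart_inv_in[of _ c] by (auto simp: V_def space_vol)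
  moreover have "chart_inv c ` V \<in> sets vol"
    using openin_chart_inv_image[OF c(1) V(1)] V(2) by (simp add: sets_vol Int_absorb2 openin_borel_X)
  ultimately have "emeasure vol (chart_inv c ` V) = 0" using N by (meson null_sets_subset null_setsD1)
  then have "(\<integral>\<^sup>+z. ennreal (volume_density (g c) z) * indicator V z \<partial>lborel) = 0"
    by (simp add: emeasure_vol_chart[OF c(1) V(2,1)])
  also have "(\<integral>\<^sup>+z. ennreal (volume_density (g c) z) * indicator V z \<partial>lborel)
     = (\<integral>\<^sup>+z. ennreal (if z \<in> chart_image c then volume_density (g c) z else 0) * indicator V z \<partial>lborel)"
    using V(2) by (intro nn_integral_cong) (auto simp: indicator_def)
  finally have "AE z in lborel. ennreal (if z \<in> chart_image c then volume_density (g c) z else 0) * indicator V z = 0"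
    using measurable_density[OF c(1)] V(1) by (subst (asm) nn_integral_0_iff_AE) (auto intro!: borel_measurable_times_ennreal)
  then have "AE z in lborel. z \<notin> V"
    by eventually_elim (use V(2) density_pos in \<open>force simp: indicator_def split: if_splits\<close>)
  then have "V \<in> null_sets lborel" using V(1) by (simp add: AE_iff_null_sets)
  then have "negligible V" using null_sets_completionI by (auto simp: negligible_iff_null_sets)
  then have "V = {}" using open_not_negligible V(1) by blast
  moreover have "snd c p \<in> V" using c fp by (simp add: V_def)
  ultimately show False by simp
qed

text \<open>Agreement on overlaps makes the choice of the chart in \<open>at_point\<close>
  irrelevant.\<close>

lemma at_point_eq:
  assumes "\<And>c d q. c \<in> A \<Longrightarrow> d \<in> A \<Longrightarrow> q \<in> fst c \<Longrightarrow> q \<in> fst d \<Longrightarrow> F c (snd c q) = F d (snd d q)"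
    and "c \<in> A" "p \<in> fst c"
  shows "at_point A F p = F c (snd c p)"
proof -
  define d where "d = (SOME c. c \<in> A \<and> p \<in> fst c)"
  have "d \<in> A \<and> p \<in> fst d" unfolding d_def by (rule someI[of _ c]) (intro conjI assms(2,3))
  then have "F d (snd d p) = F c (snd c p)" using assms(1)[OF _ assms(2) _ assms(3), of d] by blast
  then show ?thesis unfolding at_point_def d_def[symmetric] Let_def .
qed

lemma at_point_E_norm: "c \<in> A \<Longrightarrow> p \<in> fst c \<Longrightarrow> at_point A (\<lambda>c. E_norm (g c)) p = E_norm (g c) (snd c p)"
  and at_point_bochner_norm: "c \<in> A \<Longrightarrow> p \<in> fst c \<Longrightarrow> at_point A (\<lambda>c. bochner_norm (g c)) p = bochner_norm (g c) (snd c p)"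
proof -
  have *: "E_norm (g c) (snd c q) = E_norm (g d) (snd d q) \<and> bochner_norm (g c) (snd c q) = bochner_norm (g d) (snd d q)"
    if "c \<in> A" "d \<in> A" "q \<in> fst c" "q \<in> fst d" for c d q
  proof -
    interpret kaehler_transition "chart_image c" "chart_image d" "g c" "g d" s "real CARD('m)" "snd c ` (fst c \<inter> fst d)" "snd d \<circ> chart_inv c"
      by (rule transition[OF that(1,2)])
    have "snd c q \<in> snd c ` (fst c \<inter> fst d)" using that by auto
    from E_norm_transition[OF this] bochner_norm_transition[OF this] show ?thesis using that by simp
  qed
  show "c \<in> A \<Longrightarrow> p \<in> fst c \<Longrightarrow> at_point A (\<lambda>c. E_norm (g c)) p = E_norm (g c) (snd c p)"
    by (rule at_point_eq) (use * in blast)+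
  show "c \<in> A \<Longrightarrow> p \<in> fst c \<Longrightarrow> at_point A (\<lambda>c. bochner_norm (g c)) p = bochner_norm (g c) (snd c p)"
    by (rule at_point_eq) (use * in blast)+
qed

lemma at_point_scalar: "p \<in> topspace X \<Longrightarrow> at_point A (\<lambda>c. scalar_curvature (g c)) p = s"
proof -
  assume "p \<in> topspace X"
  then obtain c where c: "c \<in> A" "p \<in> fst c" using cover by blast
  have "at_point A (\<lambda>c. scalar_curvature (g c)) p = scalar_curvature (g c) (snd c p)"
    by (rule at_point_eq[OF _ c]) (simp add: scal)
  then show ?thesis using c by (simp add: scal)
qed

lemma grad_norm_sq_cong_open:
  assumes "open T" "z \<in> T" "\<And>y. y \<in> T \<Longrightarrow> u y = v y"
  shows "grad_norm_sq h u z = grad_norm_sq h v z"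
  using frechet_derivative_cong_open[OF assms] by (simp add: grad_norm_sq_def)

lemma at_point_grad:
  assumes u: "CkX 1 u" and c: "c \<in> A" "p \<in> fst c"
  shows "at_point A (\<lambda>c. grad_norm_sq (g c) (u \<circ> chart_inv c)) p = grad_norm_sq (g c) (u \<circ> chart_inv c) (snd c p)"
proof (rule at_point_eq[OF _ c])
  fix c d q assume cd: "c \<in> A" "d \<in> A" "q \<in> fst c" "q \<in> fst d"
  interpret kaehler_transition "chart_image c" "chart_image d" "g c" "g d" s "real CARD('m)" "snd c ` (fst c \<inter> fst d)" "snd d \<circ> chart_inv c"
    by (rule transition[OF cd(1,2)])
  have q: "snd c q \<in> snd c ` (fst c \<inter> fst d)" using cd by auto
  have "(u \<circ> chart_inv d) differentiable (at ((snd d \<circ> chart_inv c) (snd c q)))"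
    using Ck_differentiable[of 0] CkXD[OF u cd(2)] cd by (simp add: o_def)
  from grad_norm_sq_transition[OF q this]
  have "grad_norm_sq (g d) (u \<circ> chart_inv d) (snd d q) = grad_norm_sq (g c) (\<lambda>y. (u \<circ> chart_inv d) ((snd d \<circ> chart_inv c) y)) (snd c q)"
    using cd by simp
  also have "\<dots> = grad_norm_sq (g c) (u \<circ> chart_inv c) (snd c q)"
    by (rule grad_norm_sq_cong_open[OF open_T q]) (use cd in auto)
  finally show "grad_norm_sq (g c) (u \<circ> chart_inv c) (snd c q) = grad_norm_sq (g d) (u \<circ> chart_inv d) (snd d q)" ..
qed

definition chart_laplacian :: "('a, 'm) chart \<Rightarrow> (complex ^ 'm \<Rightarrow> real) \<Rightarrow> complex ^ 'm \<Rightarrow> real" where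
  "chart_laplacian c F z = 2 * Re (Lap (kaehler_metric.H (g c)) (\<lambda>y. of_real (F y)) z)"

definition LapX :: "('a \<Rightarrow> real) \<Rightarrow> 'a \<Rightarrow> real" where
  "LapX u = at_point A (\<lambda>c. chart_laplacian c (u \<circ> chart_inv c))"

lemma LapX_eq:
  assumes u: "CkX 2 u" and c: "c \<in> A" "p \<in> fst c"
  shows "LapX u p = chart_laplacian c (u \<circ> chart_inv c) (snd c p)"
  unfolding LapX_def
proof (rule at_point_eq[OF _ c])
  fix c d q assume cd: "c \<in> A" "d \<in> A" "q \<in> fst c" "q \<in> fst d"
  interpret kaehler_transition "chart_image c" "chart_image d" "g c" "g d" s "real CARD('m)" "snd c ` (fst c \<inter> fst d)" "snd d \<circ> chart_inv c"
    by (rule transition[OF cd(1,2)])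
  have q: "snd c q \<in> snd c ` (fst c \<inter> fst d)" using cd by auto
  have "Ck 2 (chart_image d) (u \<circ> chart_inv d)"
    using CkXD[OF u cd(2)] by (simp add: o_def)
  from laplacian_transition[OF q this]
  have "chart_laplacian d (u \<circ> chart_inv d) (snd d q) = chart_laplacian c (\<lambda>y. (u \<circ> chart_inv d) ((snd d \<circ> chart_inv c) y)) (snd c q)"
    using cd by (simp add: chart_laplacian_def M1.laplacian_def M2.laplacian_def)
  also have "\<dots> = chart_laplacian c (u \<circ> chart_inv c) (snd c q)"
    unfolding chart_laplacian_def
    by (intro arg_cong[where f = "\<lambda>x. 2 * Re x"] Lap_cong[OF open_T q]) (use cd in auto)
  finally show "chart_laplacian c (u \<circ> chart_inv c) (snd c q) = chart_laplacian d (u \<circ> chart_inv d) (snd d q)" ..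
qed

end

section \<open>The divergence theorem\<close>

lemma integrable_compact_support:
  fixes Y :: "'v::euclidean_space \<Rightarrow> 'b::{banach, second_countable_topology}"
  assumes "continuous_on UNIV Y" "compact K" "\<And>x. x \<notin> K \<Longrightarrow> Y x = 0"
  shows "integrable lborel Y"
proof -
  have "(\<lambda>x. indicator K x *\<^sub>R Y x) = Y" using assms(3) by (force simp: fun_eq_iff indicator_def)
  then show ?thesis
    using borel_integrable_compact[OF assms(2) continuous_on_subset[OF assms(1) subset_UNIV]] by simp
qed

text \<open>Differentiate the translation invariance of Lebesgue measure under the integral.\<close>

lemma integral_directional_derivative:
  fixes Y :: "'v::euclidean_space \<Rightarrow> 'b::euclidean_space"
  assumes Y: "Ck 1 UNIV Y" and K: "compact K" and 0: "\<And>x. x \<notin> K \<Longrightarrow> Y x = 0"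
  shows "has_bochner_integral lborel (\<lambda>x. frechet_derivative Y (at x) v) 0"
proof -
  let ?Y' = "\<lambda>x. frechet_derivative Y (at x) v"
  have Yd: "(Y has_derivative frechet_derivative Y (at x)) (at x)" for x
    using Ck_has_derivative[of 0 UNIV Y x] Y by simp
  have Yc: "continuous_on UNIV Y" using Ck_le[of 0 1 UNIV Y] Y by simp
  have Y'c: "continuous_on UNIV ?Y'" using Y by simp
  have Y'0: "?Y' x = 0" if "x \<notin> K" for x
  proof -
    have "open (- K)" using K by (simp add: compact_imp_closed open_Compl)
    then have "frechet_derivative Y (at x) = frechet_derivative (\<lambda>_. 0) (at x)"
      using that 0 by (intro frechet_derivative_cong_open[of "- K"]) auto
    then show ?thesis by (simp add: frechet_derivative_const)
  qed
  obtain R where R: "K \<subseteq> cball 0 R" 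
  proof -
    have "\<exists>R. \<forall>x\<in>K. norm x \<le> R" using compact_imp_bounded[OF K] by (simp only: bounded_iff)
    then obtain R where "\<forall>x\<in>K. norm x \<le> R" by (rule exE)
    then show thesis by (intro that[of R]) auto
  qed
  obtain C where C: "\<And>x. norm (?Y' x) \<le> C"
  proof -
    have "bounded (?Y' ` K)" using K by (intro compact_imp_bounded compact_continuous_image continuous_on_subset[OF Y'c]) auto
    then have "\<exists>C. \<forall>y\<in>?Y' ` K. norm y \<le> C" by (simp only: bounded_iff)
    then obtain C where "\<forall>y\<in>?Y' ` K. norm y \<le> C" by (rule exE)
    have "norm (?Y' x) \<le> max C 0" for x
    proof (cases "x \<in> K")
      case True
      then have "norm (?Y' x) \<le> C" using \<open>\<forall>y\<in>?Y' ` K. norm y \<le> C\<close> by blast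
      then show ?thesis by simp
    qed (simp add: Y'0)
    then show thesis by (rule that)
  qed
  define t where "t n = inverse (real (Suc n))" for n
  have t: "0 < t n" "t n \<le> 1" for n by (simp_all add: t_def field_simps)
  \<comment> \<open>Difference quotients along v; each has integral zero by translation
    invariance.\<close>
  define q where "q n x = (1 / t n) *\<^sub>R (Y (t n *\<^sub>R v + x) - Y x)" for n x
  have Yi: "integrable lborel Y" by (rule integrable_compact_support[OF Yc K 0])
  have Ysh: "integrable lborel (\<lambda>x. Y (c + x))" "(LINT x|lborel. Y (c + x)) = (LINT x|lborel. Y x)" for c
  proof -
    have "continuous_on UNIV (\<lambda>x. Y (c + x))"
      by (rule continuous_on_compose2[OF Yc]) (auto intro!: continuous_intros)
    then show "integrable lborel (\<lambda>x. Y (c + x))"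
    proof (rule integrable_compact_support)
      show "compact ((\<lambda>x. x - c) ` K)" using K by (intro compact_continuous_image continuous_intros)
      show "Y (c + x) = 0" if "x \<notin> (\<lambda>x. x - c) ` K" for x
        using that by (intro 0) (auto simp: image_iff)
    qed
    have "(LINT x|lborel. Y x) = (LINT x|distr lborel borel ((+) c). Y x)" by (simp add: lborel_distr_plus)
    also have "\<dots> = (LINT x|lborel. Y (c + x))"
      using borel_measurable_continuous_onI[OF Yc] by (intro integral_distr) auto
    finally show "(LINT x|lborel. Y (c + x)) = (LINT x|lborel. Y x)" ..
  qed
  have q0: "(LINT x|lborel. q n x) = 0" for n
    unfolding q_def using Ysh[of "t n *\<^sub>R v"] Yi by simp
  \<comment> \<open>The dominating function: C bounds the derivative, and since the shifts are at
    most v all quotients vanish outside the enlarged ball.\<close>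
  have qb: "norm (q n x) \<le> C * indicator (cball 0 (R + norm v)) x" for n x
  proof (cases "x \<in> cball 0 (R + norm v)")
    case True
    have "norm (Y (x + t n *\<^sub>R v) - Y (x + 0 *\<^sub>R v)) \<le> C * norm (t n - 0)"
    proof (rule differentiable_bound[where S = "{0..t n}" and f = "\<lambda>r. Y (x + r *\<^sub>R v)" and f' = "\<lambda>r h. h *\<^sub>R ?Y' (x + r *\<^sub>R v)"])
      fix r assume "r \<in> {0..t n}"
      have "((\<lambda>r. Y (x + r *\<^sub>R v)) has_derivative (\<lambda>h. frechet_derivative Y (at (x + r *\<^sub>R v)) (h *\<^sub>R v))) (at r)"
        by (rule has_derivative_compose[OF _ Yd]) (auto intro!: derivative_eq_intros)
      then show "((\<lambda>r. Y (x + r *\<^sub>R v)) has_derivative (\<lambda>h. h *\<^sub>R ?Y' (x + r *\<^sub>R v))) (at r within {0..t n})"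
        using linear_scale[OF has_derivative_linear[OF Yd]] by (auto intro: has_derivative_at_withinI)
      show "onorm (\<lambda>h. h *\<^sub>R ?Y' (x + r *\<^sub>R v)) \<le> C"
      proof (rule onorm_le)
        show "norm (h *\<^sub>R ?Y' (x + r *\<^sub>R v)) \<le> C * norm h" for h
          using mult_right_mono[OF C norm_ge_zero[of h]] by (simp add: mult.commute)
      qed
    qed (use t in \<open>auto intro: less_imp_le\<close>)
    then have "norm (Y (t n *\<^sub>R v + x) - Y x) \<le> C * t n" using t[of n] by (simp add: add.commute)
    then have "norm (q n x) \<le> C" unfolding q_def norm_scaleR using t[of n] by (simp add: divide_le_eq)
    then show ?thesis using True by simp
  next
    case False
    then have nx: "norm x > R + norm v" by simp
    have "norm x \<le> norm (t n *\<^sub>R v + x) + norm (t n *\<^sub>R v)" using norm_triangle_ineq4[of "t n *\<^sub>R v + x" "t n *\<^sub>R v"] by simp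
    moreover have "norm (t n *\<^sub>R v) \<le> norm v" using t[of n] by (simp add: mult_left_le_one_le)
    ultimately have "norm (t n *\<^sub>R v + x) > R" using nx by linarith
    moreover have "norm x > R" using nx norm_ge_zero[of v] by linarith
    ultimately have "x \<notin> K" "t n *\<^sub>R v + x \<notin> K" using R by auto
    then show ?thesis using False by (simp add: q_def 0)
  qed
  have ql: "(\<lambda>n. q n x) \<longlonglongrightarrow> ?Y' x" for x
  proof -
    have "((\<lambda>r. Y (x + r *\<^sub>R v)) has_derivative (\<lambda>h. frechet_derivative Y (at (x + 0 *\<^sub>R v)) (h *\<^sub>R v))) (at 0)"
      by (rule has_derivative_compose[OF _ Yd]) (auto intro!: derivative_eq_intros)
    then have "((\<lambda>r. Y (x + r *\<^sub>R v)) has_vector_derivative ?Y' x) (at 0)"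
      using linear_scale[OF has_derivative_linear[OF Yd]] by (simp add: has_vector_derivative_def)
    then have "((\<lambda>r. norm (Y (x + r *\<^sub>R v) - Y x - r *\<^sub>R ?Y' x) / norm r) \<longlongrightarrow> 0) (at 0)"
      by (simp add: has_vector_derivative_def has_derivative_iff_norm)
    moreover have "filterlim t (at 0) sequentially"
      unfolding filterlim_at t_def using LIMSEQ_inverse_real_of_nat by auto
    ultimately have "(\<lambda>n. norm (Y (x + t n *\<^sub>R v) - Y x - t n *\<^sub>R ?Y' x) / norm (t n)) \<longlonglongrightarrow> 0"
      by (rule filterlim_compose)
    moreover have "norm (Y (x + t n *\<^sub>R v) - Y x - t n *\<^sub>R ?Y' x) / norm (t n) = norm (q n x - ?Y' x)" for n
    proof -
      have "q n x - ?Y' x = (1 / t n) *\<^sub>R (Y (x + t n *\<^sub>R v) - Y x - t n *\<^sub>R ?Y' x)"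
        using t(1)[of n] by (simp add: q_def scaleR_diff_right add.commute)
      then show ?thesis using t(1)[of n] by (simp only: norm_scaleR) simp
    qed
    ultimately have "(\<lambda>n. norm (q n x - ?Y' x)) \<longlonglongrightarrow> 0" by simp
    then show ?thesis by (simp add: tendsto_norm_zero_iff LIM_zero_iff)
  qed
  have ib: "integrable lborel (\<lambda>x. C * indicator (cball (0::'v) (R + norm v)) x)"
    using emeasure_bounded_finite[of "cball (0::'v) (R + norm v)"] by (intro integrable_mult_right integrable_real_indicator) auto
  have "(\<lambda>n. LINT x|lborel. q n x) \<longlonglongrightarrow> (LINT x|lborel. ?Y' x)"
  proof (rule integral_dominated_convergence[where w = "\<lambda>x. C * indicator (cball 0 (R + norm v)) x"])
    show "?Y' \<in> borel_measurable lborel" using borel_measurable_continuous_onI[OF Y'c] by simp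
    show "q n \<in> borel_measurable lborel" for n
      unfolding q_def using borel_measurable_integrable[OF Yi] borel_measurable_integrable[OF Ysh(1)] by measurable
  qed (use ib ql qb in auto)
  then have "(LINT x|lborel. ?Y' x) = 0" by (simp add: q0 LIMSEQ_const_iff)
  moreover have "integrable lborel ?Y'" by (rule integrable_compact_support[OF Y'c K Y'0])
  ultimately show ?thesis by (simp add: has_bochner_integral_iff)
qed

lemma integral_dz:
  assumes Y: "Ck 1 UNIV Y" and K: "compact K" and 0: "\<And>x. x \<notin> K \<Longrightarrow> Y x = 0"
  shows "has_bochner_integral lborel (\<lambda>z. dz a Y z) 0"
proof -
  note I = integral_directional_derivative[OF Y K 0]
  have "has_bochner_integral lborel (\<lambda>z. (frechet_derivative Y (at z) (axis a 1) - \<i> * frechet_derivative Y (at z) (axis a \<i>)) * (1 / 2)) ((0 - \<i> * 0) * (1 / 2))"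
    by (intro has_bochner_integral_mult_left has_bochner_integral_diff has_bochner_integral_mult_right I)
  then show ?thesis by (simp add: dz_def)
qed

context kaehler_metric
begin

text \<open>With this identity the density times \<open>Lap\<close> is a divergence. The derivative
  of the density yields a trace, that of the inverse metric a matrix product; the Kaehler symmetry
  identifies the two sums.\<close>

lemma density_Win_divergence: assumes z: "z \<in> S"
  shows "(\<Sum>*a. dz a (\<lambda>y. complex_of_real (volume_density h y) * Win H y $ b $ a) z) = 0"
proof -
  let ?D = "complex_of_real (volume_density h z)" and ?W = "Win H z"
  have dD: "(\<lambda>y. complex_of_real (volume_density h y)) differentiable (at z)"
    by (rule Ck_differentiable[OF Ck_of_real[OF open_S Ck_density] z])
  have dW: "(\<lambda>y. Win H y $ b $ a) differentiable (at z)" for a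
    using Ck_differentiable[of 0 S "\<lambda>y. Win H y $ b $ a" z] smooth_Win[of 1] z by (simp add: mCk_def)
  have "dz a (\<lambda>y. complex_of_real (volume_density h y) * Win H y $ b $ a) z
     = ?D * trace (mdz a H z ** ?W) * ?W $ b $ a - ?D * (?W ** mdz a H z ** ?W) $ b $ a" for a
  proof -
    have "dz a (\<lambda>y. Win H y $ b $ a) z = - (?W ** mdz a H z ** ?W) $ b $ a"
      unfolding mdz_nth[symmetric] mdz_Win[OF z] by (simp only: vector_uminus_component)
    then show ?thesis
      unfolding dz_mult[OF dD dW] dz_density(1)[OF z] by (simp only: mult_minus_right add_uminus_conv_diff)
  qed
  then have "(\<Sum>*a. dz a (\<lambda>y. complex_of_real (volume_density h y) * Win H y $ b $ a) z)
    = ?D * ((\<Sum>*a. trace (mdz a H z ** ?W) * ?W $ b $ a) - (\<Sum>*a. (?W ** mdz a H z ** ?W) $ b $ a))"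
    by (simp add: sum_subtractf sum_distrib_left mult.assoc right_diff_distrib del: mdz_nth)
  also have "(\<Sum>*a. trace (mdz a H z ** ?W) * ?W $ b $ a) = (\<Sum>*a p q. mdz a H z $ p $ q * ?W $ q $ p * ?W $ b $ a)"
    by (simp add: trace_def matrix_mult_nth sum_distrib_right del: mdz_nth)
  also have "\<dots> = (\<Sum>*p a q. mdz a H z $ p $ q * ?W $ q $ p * ?W $ b $ a)" by (rule sum.swap)
  also have "\<dots> = (\<Sum>*p a q. ?W $ b $ a * mdz p H z $ a $ q * ?W $ q $ p)"
    by (intro sum.cong refl) (simp add: kaehler[OF z, symmetric] ac_simps del: mdz_nth)
  also have "\<dots> = (\<Sum>*p. (?W ** mdz p H z ** ?W) $ b $ p)"
    by (intro sum.cong refl) (simp add: matrix_mult_nth sum_distrib_right sum_distrib_left del: mdz_nth, rule sum.swap)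
  finally show ?thesis by simp
qed

lemma integral_Lap_chart:
  fixes F :: "complex ^ 'm \<Rightarrow> complex"
  assumes F: "Ck 2 S F" and K: "compact K" "K \<subseteq> S" and 0: "\<And>z. z \<in> S \<Longrightarrow> z \<notin> K \<Longrightarrow> F z = 0"
  shows "has_bochner_integral lborel (\<lambda>z. if z \<in> S then of_real (volume_density h z) * Lap H F z else 0) 0"
proof -
  \<comment> \<open>The vector field whose divergence is the density times the Laplacian. It
    vanishes off K, so its extension by zero is C^1 on the whole space.\<close>
  define V where "V a z = (if z \<in> S then \<Sum>*b. of_real (volume_density h z) * Win H z $ b $ a * dzb b F z else 0)" for a z
  have dF: "Ck 1 S (dzb b F)" for b using Ck_dzb[OF open_S, of 1] F by (simp add: numeral_2_eq_2)
  have dW: "Ck k S (\<lambda>z. of_real (volume_density h z) * Win H z $ b $ a)" for a b k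
    using smooth_Win[of k] by (intro Ck_mult Ck_of_real Ck_density open_S) (simp_all add: mCk_def)
  have oK: "open (- K)" using K by (simp add: compact_imp_closed open_Compl)
  have V0: "V a z = 0" if "z \<notin> K" for a z
  proof (cases "z \<in> S")
    case True
    have "dzb b F z = dzb b (\<lambda>_. 0) z" for b
      using True that by (intro dzb_cong_open[of "S \<inter> - K"]) (auto intro: 0 open_Int open_S oK)
    then show ?thesis by (simp add: V_def)
  qed (simp add: V_def)
  have "Ck 1 S (\<lambda>z. \<Sum>*b. of_real (volume_density h z) * Win H z $ b $ a * dzb b F z)" for a
    by (intro Ck_sum Ck_mult[of S 1] open_S dW dF)
  then have "Ck 1 S (V a)" for a
    by (subst Ck_cong[OF open_S, where g = "\<lambda>z. \<Sum>*b. of_real (volume_density h z) * Win H z $ b $ a * dzb b F z"]) (simp_all add: V_def)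
  moreover have "Ck 1 (- K) (V a)" for a
    by (subst Ck_cong[OF oK, where g = "\<lambda>_. 0"]) (simp_all add: V0 Ck_const del: Ck.simps)
  ultimately have "Ck 1 (S \<union> - K) (V a)" for a by (rule Ck_Un[OF open_S oK])
  moreover have "S \<union> - K = UNIV" using K(2) by auto
  ultimately have CV: "Ck 1 UNIV (V a)" for a by simp
  have "has_bochner_integral lborel (\<lambda>z. \<Sum>*a. dz a (V a) z) (\<Sum>a\<in>(UNIV :: 'm set). 0)"
    by (intro has_bochner_integral_sum integral_dz[OF CV K(1) V0])
  moreover have "(\<Sum>*a. dz a (V a) z) = (if z \<in> S then of_real (volume_density h z) * Lap H F z else 0)" for z
  proof (cases "z \<in> S")
    case True
    have d1: "(\<lambda>y. of_real (volume_density h y) * Win H y $ b $ a) differentiable (at z)" for a b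
      by (rule Ck_differentiable[OF dW True])
    have d2: "dzb b F differentiable (at z)" for b using Ck_differentiable[of 0 S "dzb b F" z] dF True by simp
    have "dz a (V a) z = dz a (\<lambda>z. \<Sum>*b. of_real (volume_density h z) * Win H z $ b $ a * dzb b F z) z" for a
      by (rule dz_cong_open[OF open_S True]) (simp add: V_def)
    also have "\<dots> a = (\<Sum>*b. dz a (\<lambda>z. of_real (volume_density h z) * Win H z $ b $ a) z * dzb b F z
        + of_real (volume_density h z) * Win H z $ b $ a * dz a (dzb b F) z)" for a
      by (subst dz_sum) (auto intro!: differentiable_mult d1 d2 simp: dz_mult[OF d1 d2])
    finally have "(\<Sum>*a. dz a (V a) z) = (\<Sum>*a b. dz a (\<lambda>z. of_real (volume_density h z) * Win H z $ b $ a) z * dzb b F z)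
        + (\<Sum>*a b. of_real (volume_density h z) * Win H z $ b $ a * dz a (dzb b F) z)"
      by (simp only: sum.distrib)
    also have "(\<Sum>*a b. dz a (\<lambda>z. of_real (volume_density h z) * Win H z $ b $ a) z * dzb b F z)
      = (\<Sum>*b a. dz a (\<lambda>z. of_real (volume_density h z) * Win H z $ b $ a) z * dzb b F z)" by (rule sum.swap)
    also have "\<dots> = 0" by (simp only: sum_distrib_right[symmetric] density_Win_divergence[OF True]) simp
    finally show ?thesis using True by (simp add: Lap_def sum_distrib_left mult.assoc)
  next
    case False
    then have "dz a (V a) z = dz a (\<lambda>_. 0) z" for a
      using K(2) by (intro dz_cong_open[OF oK] V0) auto
    then show ?thesis using False by simp
  qed
  ultimately show ?thesis by simp
qed

end

lemma max_power_has_derivative: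
  fixes x :: real
  shows "((\<lambda>x. max 0 x ^ Suc (Suc n)) has_derivative (\<lambda>v. (real (Suc (Suc n)) * max 0 x ^ Suc n) * v)) (at x)"
proof -
  consider "x < 0" | "x > 0" | "x = 0" by linarith
  then have "((\<lambda>x. max 0 x ^ Suc (Suc n)) has_field_derivative real (Suc (Suc n)) * max 0 x ^ Suc n) (at x)"
  proof cases
    case 1
    have "((\<lambda>x. 0 :: real) has_field_derivative 0) (at x)" by simp
    then have "((\<lambda>x. max 0 x ^ Suc (Suc n)) has_field_derivative 0) (at x)"
      by (rule has_field_derivative_transform_within_open[of _ _ _ "{..<0}"]) (use 1 in auto)
    then show ?thesis using 1 by simp
  next
    case 2
    have "((\<lambda>x. x ^ Suc (Suc n)) has_field_derivative real (Suc (Suc n)) * x ^ Suc n) (at x)"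
      by (rule derivative_eq_intros refl)+ simp
    then have "((\<lambda>x. max 0 x ^ Suc (Suc n)) has_field_derivative real (Suc (Suc n)) * x ^ Suc n) (at x)"
      by (rule has_field_derivative_transform_within_open[of _ _ _ "{0<..}"]) (use 2 in auto)
    then show ?thesis using 2 by simp
  next
    case 3
    have "((\<lambda>h :: real. \<bar>h\<bar> ^ Suc n) \<longlongrightarrow> \<bar>0\<bar> ^ Suc n) (at 0)" by (intro tendsto_intros)
    then have L: "((\<lambda>h :: real. \<bar>h\<bar> ^ Suc n) \<longlongrightarrow> 0) (at 0)" by simp
    have B: "norm ((max 0 (0 + h) ^ Suc (Suc n) - max 0 0 ^ Suc (Suc n)) / h) \<le> \<bar>h\<bar> ^ Suc n" for h :: real
    proof -
      have "\<bar>max 0 h\<bar> ^ Suc (Suc n) \<le> \<bar>h\<bar> ^ Suc (Suc n)" by (rule power_mono) auto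
      then have "\<bar>max 0 h\<bar> ^ Suc (Suc n) / \<bar>h\<bar> \<le> \<bar>h\<bar> ^ Suc (Suc n) / \<bar>h\<bar>" by (rule divide_right_mono) simp
      also have "\<dots> \<le> \<bar>h\<bar> ^ Suc n" by simp
      finally show ?thesis by (simp add: power_abs)
    qed
    have "((\<lambda>h :: real. (max 0 (0 + h) ^ Suc (Suc n) - max 0 0 ^ Suc (Suc n)) / h) \<longlongrightarrow> 0) (at 0)"
      by (rule Lim_null_comparison[OF always_eventually[OF allI[OF B]] L])
    then show ?thesis using 3 by (simp add: DERIV_def)
  qed
  then show ?thesis by (simp add: has_field_derivative_def)
qed

text \<open>The cube is the lowest power of the positive part that is C^2, and two derivatives are
  what the Laplacian asks of the partition of unity.\<close>

lemma Ck_max_cube: "Ck 2 UNIV (\<lambda>x :: real. max 0 x ^ 3)"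
proof -
  have "Ck 0 UNIV (\<lambda>x :: real. (real (Suc (Suc 0)) * max 0 x ^ Suc 0) * v)" for v by (auto intro!: continuous_intros)
  then have "Ck (Suc 0) UNIV (\<lambda>x :: real. max 0 x ^ Suc (Suc 0))"
    by (intro Ck_SucI[OF open_UNIV max_power_has_derivative])
  then have "Ck (Suc 0) UNIV (\<lambda>x :: real. (real (Suc (Suc (Suc 0))) * max 0 x ^ Suc (Suc 0)) * v)" for v
    by (intro Ck_mult Ck_const open_UNIV)
  then have "Ck (Suc (Suc 0)) UNIV (\<lambda>x :: real. max 0 x ^ Suc (Suc (Suc 0)))"
    by (intro Ck_SucI[OF open_UNIV max_power_has_derivative])
  then show ?thesis by (simp only: numeral_2_eq_2 numeral_3_eq_3)
qed

section \<open>Partition of unity and the integral of a Laplacian over the manifold\<close>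

context csc_kaehler_manifold
begin

lemma Lap_sum:
  fixes F :: "'i \<Rightarrow> complex ^ 'm \<Rightarrow> complex"
  assumes S: "open S" "z \<in> S" and F: "\<And>i. i \<in> I \<Longrightarrow> Ck 2 S (F i)"
  shows "Lap H (\<lambda>y. \<Sum>i\<in>I. F i y) z = (\<Sum>i\<in>I. Lap H (F i) z)"
proof -
  have d: "F i differentiable (at y)" if "i \<in> I" "y \<in> S" for i y
    using F[OF that(1)] that(2) by (simp add: numeral_2_eq_2)
  have d2: "dzb b (F i) differentiable (at z)" if "i \<in> I" for i b
    using Ck_dzb[OF S(1), of 1 "F i"] F[OF that] S(2) by (simp add: numeral_2_eq_2)
  have "dz a (dzb b (\<lambda>y. \<Sum>i\<in>I. F i y)) z = (\<Sum>i\<in>I. dz a (dzb b (F i)) z)" for a b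
  proof -
    have "dz a (dzb b (\<lambda>y. \<Sum>i\<in>I. F i y)) z = dz a (\<lambda>y. \<Sum>i\<in>I. dzb b (F i) y) z"
      by (rule dz_cong_open[OF S]) (rule dzb_sum[OF d])
    also have "\<dots> = (\<Sum>i\<in>I. dz a (dzb b (F i)) z)" by (rule dz_sum[OF d2])
    finally show ?thesis .
  qed
  then have "Lap H (\<lambda>y. \<Sum>i\<in>I. F i y) z = (\<Sum>*a b. \<Sum>i\<in>I. Win H z $ b $ a * dz a (dzb b (F i)) z)"
    by (simp add: Lap_def sum_distrib_left)
  also have "\<dots> = (\<Sum>*a. \<Sum>i\<in>I. \<Sum>*b. Win H z $ b $ a * dz a (dzb b (F i)) z)"
    by (rule sum.cong[OF refl], rule sum.swap)
  also have "\<dots> = (\<Sum>i\<in>I. \<Sum>*a b. Win H z $ b $ a * dz a (dzb b (F i)) z)" by (rule sum.swap)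
  finally show ?thesis by (simp add: Lap_def)
qed

lemma LapX_sum:
  assumes p: "p \<in> topspace X" and F: "\<And>i. i \<in> I \<Longrightarrow> CkX 2 (f i)"
  shows "LapX (\<lambda>q. \<Sum>i\<in>I. f i q) p = (\<Sum>i\<in>I. LapX (f i) p)"
proof -
  obtain c where c: "c \<in> A" "p \<in> fst c" using p cover by blast
  note o = open_chart_image[OF c(1)]
  have "Lap H (\<lambda>y. \<Sum>i\<in>I. complex_of_real (f i (chart_inv c y))) (snd c p) = (\<Sum>i\<in>I. Lap H (\<lambda>y. complex_of_real (f i (chart_inv c y))) (snd c p))" for H
    by (rule Lap_sum[OF o snd_in[OF c(2)] Ck_of_real[OF o CkXD[OF F c(1)]]])
  then show ?thesis
    by (simp add: LapX_eq[OF CkX_sum[OF F] c] LapX_eq[OF F c] chart_laplacian_def o_def sum_distrib_left)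
qed

lemma LapX_cong:
  assumes U: "openin X U" "p \<in> U" and eq: "\<And>q. q \<in> U \<Longrightarrow> f q = f' q" and f: "CkX 2 f" "CkX 2 f'"
  shows "LapX f p = LapX f' p"
proof -
  obtain c where c: "c \<in> A" "p \<in> fst c" using U openin_subset cover by blast
  have "Lap H (\<lambda>y. complex_of_real (f (chart_inv c y))) (snd c p) = Lap H (\<lambda>y. complex_of_real (f' (chart_inv c y))) (snd c p)" for H
    using c U by (intro Lap_cong[OF open_snd_image[OF c(1) U(1)]]) (auto simp: eq)
  then show ?thesis by (simp add: LapX_eq[OF f(1) c] LapX_eq[OF f(2) c] chart_laplacian_def o_def)
qed

lemma Lap_0: "Lap H (\<lambda>y :: complex ^ 'm. 0) z = 0"
proof -
  have "dzb b (\<lambda>y :: complex ^ 'm. 0) = (\<lambda>y. 0)" for b by (rule ext) simp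
  then show ?thesis by (simp add: Lap_def)
qed

lemma CkX_LapX: assumes f: "CkX 2 f" shows "CkX 0 (LapX f)"
  unfolding CkX_def
proof
  fix c assume c: "c \<in> A"
  interpret csc_kaehler_metric "chart_image c" "g c" s "real CARD('m)" by (rule metric_in_chart[OF c])
  have F: "Ck (Suc (Suc 0)) (chart_image c) (\<lambda>y. complex_of_real (f (chart_inv c y)))"
    using Ck_of_real[OF open_S CkXD[OF f c]] by (simp only: numeral_2_eq_2)
  have "Ck 0 (chart_image c) (\<lambda>z. 2 * Re (\<Sum>*a b. Win H z $ b $ a * dz a (dzb b (\<lambda>y. complex_of_real (f (chart_inv c y)))) z))"
    using smooth_Win[of 0, unfolded mCk_def]
    by (intro Ck_mult Ck_const Ck_Re Ck_sum Ck_dz Ck_dzb open_S F) blast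
  moreover have "LapX f (chart_inv c z) = 2 * Re (\<Sum>*a b. Win H z $ b $ a * dz a (dzb b (\<lambda>y. complex_of_real (f (chart_inv c y)))) z)"
    if "z \<in> chart_image c" for z
    using that c by (simp add: LapX_eq[OF f c] chart_laplacian_def Lap_def o_def)
  ultimately show "Ck 0 (chart_image c) (\<lambda>z. LapX f (chart_inv c z))"
    by (subst Ck_cong[OF open_S]) assumption
qed

text \<open>Positive exactly on the open coordinate ball of radius r (for r > 0 and the ball inside
  the chart). The squared distance is used because the distance is not differentiable at the
  centre.\<close>

definition bump :: "('a, 'm) chart \<Rightarrow> complex ^ 'm \<Rightarrow> real \<Rightarrow> 'a \<Rightarrow> real" where
  "bump c w r p = (if p \<in> fst c then max 0 (r\<^sup>2 - (snd c p - w) \<bullet> (snd c p - w)) ^ 3 else 0)"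

lemma bump_eq_0:
  assumes "r > 0" "p \<in> fst c \<Longrightarrow> snd c p \<notin> cball w r"
  shows "bump c w r p = 0"
proof (cases "p \<in> fst c")
  case True
  then have "r < norm (snd c p - w)" using assms(2) by (simp add: dist_norm norm_minus_commute)
  then have "r\<^sup>2 < (norm (snd c p - w))\<^sup>2" using assms(1) by (intro power_strict_mono) auto
  then show ?thesis by (simp add: bump_def power2_norm_eq_inner)
qed (simp add: bump_def)

text \<open>Hausdorff separation enters here: the compact coordinate ball is closed in X, so
  functions carried by it extend by zero across an open complement.\<close>

lemma closedin_chart_ball:
  assumes c: "c \<in> A" and r: "cball w r \<subseteq> chart_image c"
  shows "closedin X (chart_inv c ` cball w r)"
proof -
  have h: "homeomorphic_maps (subtopology X (fst c)) (top_of_set (chart_image c)) (snd c) (chart_inv c)"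
  proof -
    obtain k where k: "homeomorphic_maps (subtopology X (fst c)) (top_of_set (chart_image c)) (snd c) k"
      using chart_homeomorphic[OF c] by (auto simp: homeomorphic_map_maps)
    then have "k z = chart_inv c z" if "z \<in> chart_image c" for z
      using that chart_subset[OF c] by (force simp: homeomorphic_maps_def chart_image_def Int_absorb1 c)
    then show ?thesis using k homeomorphic_maps_eq[OF k] by auto
  qed
  then have "continuous_map (top_of_set (chart_image c)) (subtopology X (fst c)) (chart_inv c)"
    by (simp add: homeomorphic_maps_def)
  then have cm: "continuous_map (top_of_set (chart_image c)) X (chart_inv c)"
    by (rule continuous_map_into_fulltopology)
  have "compactin (top_of_set (chart_image c)) (cball w r)" using r by (simp add: compactin_subtopology)
  then have "compactin X (chart_inv c ` cball w r)" by (rule image_compactin[OF _ cm])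
  moreover have "Hausdorff_space X" using complex_manifold by (simp add: complex_manifold_def)
  ultimately show ?thesis by (rule compactin_imp_closedin[rotated])
qed

text \<open>In another chart d the image is covered by two open sets: the overlap with c, where the
  bump is a composition of C^2 maps, and the complement of the closed ball, where it
  vanishes.\<close>

lemma CkX_bump:
  assumes c: "c \<in> A" and r: "r > 0" "cball w r \<subseteq> chart_image c"
  shows "CkX 2 (bump c w r)"
  unfolding CkX_def
proof
  fix d assume d: "d \<in> A"
  interpret kaehler_transition "chart_image d" "chart_image c" "g d" "g c" s "real CARD('m)" "snd d ` (fst d \<inter> fst c)" "snd c \<circ> chart_inv d"
    by (rule transition[OF d c])
  let ?T = "snd d ` (fst d \<inter> fst c)" and ?\<tau> = "snd c \<circ> chart_inv d"
  let ?T' = "snd d ` ((topspace X - chart_inv c ` cball w r) \<inter> fst d)"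
  have "openin X (topspace X - chart_inv c ` cball w r)"
    using closedin_chart_ball[OF c r(2)] by (simp add: closedin_def)
  then have T': "open ?T'" by (rule open_snd_image[OF d])
  have \<tau>: "Ck 2 ?T (\<lambda>y. ?\<tau> y - w)"
    by (intro Ck_diff Ck_const open_T holomorphic_map_Ck tau_holomorphic)
  have "Ck 2 ?T (\<lambda>y. r\<^sup>2 - (?\<tau> y - w) \<bullet> (?\<tau> y - w))"
    by (rule Ck_diff[OF open_T Ck_const Ck_bilinear[OF bounded_bilinear_inner open_T \<tau> \<tau>]])
  then have "Ck 2 ?T (\<lambda>y. max 0 (r\<^sup>2 - (?\<tau> y - w) \<bullet> (?\<tau> y - w)) ^ 3)"
    by (rule Ck_compose[OF open_T open_UNIV subset_UNIV _ Ck_max_cube])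
  then have 1: "Ck 2 ?T (\<lambda>y. bump c w r (chart_inv d y))"
    by (subst Ck_cong[OF open_T, where g = "\<lambda>y. max 0 (r\<^sup>2 - (?\<tau> y - w) \<bullet> (?\<tau> y - w)) ^ 3"]) (auto simp: bump_def d)
  have "bump c w r p = 0" if "p \<in> topspace X - chart_inv c ` cball w r" for p
    using that c by (intro bump_eq_0[OF r(1)]) (metis DiffD2 chart_inv_snd image_eqI)
  then have 2: "Ck 2 ?T' (\<lambda>y. bump c w r (chart_inv d y))"
    by (subst Ck_cong[OF T', where g = "\<lambda>y. 0"]) (auto simp: d Ck_const simp del: Ck.simps)
  have "chart_inv c ` cball w r \<subseteq> fst c" using r(2) by auto
  then have "chart_image d \<subseteq> ?T \<union> ?T'"
    using chart_subset[OF d] unfolding chart_image_def by blast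
  then show "Ck 2 (chart_image d) (\<lambda>z. bump c w r (chart_inv d z))"
    by (rule Ck_subset[OF _ Ck_Un[OF open_T T' 1 2]])
qed

lemma integral_LapX_chart:
  assumes c: "c \<in> A" and r: "r > 0" "cball w r \<subseteq> chart_image c" and f: "CkX 2 f"
    and 0: "\<And>p. p \<in> topspace X \<Longrightarrow> p \<notin> chart_inv c ` cball w r \<Longrightarrow> f p = 0"
  shows "(LINT p|vol. LapX f p) = 0"
proof -
  interpret csc_kaehler_metric "chart_image c" "g c" s "real CARD('m)" by (rule metric_in_chart[OF c])
  let ?U = "topspace X - chart_inv c ` cball w r"
  have U: "openin X ?U" using closedin_chart_ball[OF c r(2)] by (simp add: closedin_def)
  have L0: "LapX f p = 0" if p: "p \<in> topspace X" "p \<notin> fst c" for p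
  proof -
    have "chart_inv c ` cball w r \<subseteq> fst c" using r(2) by auto
    then have pU: "p \<in> ?U" using p by auto
    have "LapX f p = LapX (\<lambda>_. 0) p" by (rule LapX_cong[OF U pU _ f CkX_const]) (auto simp: 0)
    also have "\<dots> = 0"
    proof -
      obtain d where d: "d \<in> A" "p \<in> fst d" using p cover by blast
      show ?thesis by (simp add: LapX_eq[OF CkX_const d] chart_laplacian_def o_def Lap_0)
    qed
    finally show ?thesis .
  qed
  have I: "has_bochner_integral lborel (\<lambda>z. if z \<in> chart_image c then of_real (volume_density (g c) z) * Lap H (\<lambda>y. of_real (f (chart_inv c y))) z else 0) 0"
  proof (rule integral_Lap_chart[OF Ck_of_real[OF open_S CkXD[OF f c]] compact_cball r(2)])
    fix z assume z: "z \<in> chart_image c" "z \<notin> cball w r"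
    have "chart_inv c z \<notin> chart_inv c ` cball w r"
    proof
      assume "chart_inv c z \<in> chart_inv c ` cball w r"
      then obtain y where "y \<in> cball w r" "chart_inv c z = chart_inv c y" by blast
      then show False using z r(2) snd_chart_inv by (metis subsetD)
    qed
    moreover have "chart_inv c z \<in> topspace X" using z chart_subset[OF c] by auto
    ultimately show "complex_of_real (f (chart_inv c z)) = 0" by (simp add: 0)
  qed
  have "(LINT p|vol. LapX f p) = (LINT z|lborel. (if z \<in> chart_image c then volume_density (g c) z * LapX f (chart_inv c z) else 0))"
    by (rule integral_chart[OF c measurable_CkX[OF CkX_LapX[OF f]] L0])
  also have "\<dots> = (LINT z|lborel. 2 * Re (if z \<in> chart_image c then of_real (volume_density (g c) z) * Lap H (\<lambda>y. of_real (f (chart_inv c y))) z else 0))"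
    using c by (intro Bochner_Integration.integral_cong refl) (auto simp: LapX_eq[OF f c] chart_laplacian_def o_def)
  also have "\<dots> = 0"
    using has_bochner_integral_mult_right[OF has_bochner_integral_Re[OF I], of 2] by (simp add: has_bochner_integral_iff)
  finally show ?thesis .
qed

theorem integral_LapX: assumes f: "CkX 2 f" shows "(LINT p|vol. LapX f p) = 0"
proof -
  \<comment> \<open>Chart and radius around p are chosen together, as a pair.\<close>
  have "\<forall>p\<in>topspace X. \<exists>x. fst x \<in> A \<and> p \<in> fst (fst x) \<and> snd x > 0 \<and> cball (snd (fst x) p) (snd x) \<subseteq> chart_image (fst x)"
  proof
    fix p assume "p \<in> topspace X"
    then obtain c where c: "c \<in> A" "p \<in> fst c" using cover by blast
    have "\<exists>r>0. cball (snd c p) r \<subseteq> chart_image c"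
      using open_contains_cball[THEN iffD1, OF open_chart_image[OF c(1)]] snd_in[OF c(2)] by (rule bspec)
    then obtain r where "r > 0" "cball (snd c p) r \<subseteq> chart_image c" by blast
    then show "\<exists>x. fst x \<in> A \<and> p \<in> fst (fst x) \<and> snd x > 0 \<and> cball (snd (fst x) p) (snd x) \<subseteq> chart_image (fst x)"
      using c by (intro exI[of _ "(c, r)"]) simp
  qed
  from bchoice[OF this] obtain k where k: "\<forall>p\<in>topspace X. fst (k p) \<in> A \<and> p \<in> fst (fst (k p)) \<and> snd (k p) > 0 \<and> cball (snd (fst (k p)) p) (snd (k p)) \<subseteq> chart_image (fst (k p))" ..
  define \<gamma> where "\<gamma> p = fst (k p)" for p
  define \<rho> where "\<rho> p = snd (k p)" for p
  have \<gamma>: "\<gamma> p \<in> A \<and> p \<in> fst (\<gamma> p) \<and> \<rho> p > 0 \<and> cball (snd (\<gamma> p) p) (\<rho> p) \<subseteq> chart_image (\<gamma> p)" if "p \<in> topspace X" for p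
    using bspec[OF k that] unfolding \<gamma>_def \<rho>_def .
  define b where "b p = bump (\<gamma> p) (snd (\<gamma> p) p) (\<rho> p)" for p
  have Cb: "CkX 2 (b p)" if "p \<in> topspace X" for p unfolding b_def using \<gamma>[OF that] by (intro CkX_bump) auto
  have b0: "b p q \<ge> 0" for p q by (simp add: b_def bump_def)
  have bp: "b p p > 0" if "p \<in> topspace X" for p using \<gamma>[OF that] by (simp add: b_def bump_def)
  define U where "U p = {q \<in> topspace X. b p q \<in> {0<..}}" for p
  have U: "openin X (U p)" "p \<in> U p" if "p \<in> topspace X" for p
    unfolding U_def using openin_preimage[OF CkX_le[OF zero_le Cb[OF that]] open_greaterThan] bp[OF that] that by simp_all
  obtain F where F: "finite F" "F \<subseteq> U ` topspace X" "topspace X \<subseteq> \<Union>F"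
  proof -
    have "\<forall>V\<in>U ` topspace X. openin X V" "topspace X \<subseteq> \<Union>(U ` topspace X)" using U by auto
    then show thesis using compact_space that unfolding compact_space_alt by meson
  qed
  obtain Q where Q: "Q \<subseteq> topspace X" "finite Q" "F = U ` Q" using F(1,2) finite_subset_image by metis
  define \<Theta> where "\<Theta> q = (\<Sum>p\<in>Q. b p q)" for q
  have \<Theta>: "\<Theta> q > 0" if q: "q \<in> topspace X" for q
  proof -
    obtain p where "p \<in> Q" "q \<in> U p" using F(3) Q(3) q by auto
    then show ?thesis unfolding \<Theta>_def using Q(2) b0 by (intro sum_pos2[of _ p]) (auto simp: U_def)
  qed
  have C\<Theta>: "CkX 2 \<Theta>" unfolding \<Theta>_def[abs_def] using Cb Q(1) by (intro CkX_sum) auto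
  \<comment> \<open>The piece of f cut out by a bump normalised with the positive sum \<Theta>; it
    is carried by a single coordinate ball.\<close>
  define f' where "f' p q = f q * b p q * inverse (\<Theta> q)" for p q
  have Cf': "CkX 2 (f' p)" if "p \<in> Q" for p
    unfolding f'_def[abs_def] using \<Theta> that Q(1) by (intro CkX_mult f Cb CkX_inverse C\<Theta>) (auto simp: less_imp_neq[THEN not_sym])
  have sum: "(\<Sum>p\<in>Q. f' p q) = f q" if "q \<in> topspace X" for q
  proof -
    have "(\<Sum>p\<in>Q. f' p q) = f q * \<Theta> q * inverse (\<Theta> q)" by (simp add: f'_def \<Theta>_def sum_distrib_left sum_distrib_right)
    then show ?thesis using \<Theta>[OF that] by simp
  qed
  have I0: "(LINT q|vol. LapX (f' p) q) = 0" if p: "p \<in> Q" for p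
  proof -
    have pX: "p \<in> topspace X" using p Q(1) by auto
    note \<gamma>p = \<gamma>[OF pX]
    show ?thesis
    proof (rule integral_LapX_chart[of "\<gamma> p" "\<rho> p" "snd (\<gamma> p) p"])
      fix q assume q: "q \<in> topspace X" "q \<notin> chart_inv (\<gamma> p) ` cball (snd (\<gamma> p) p) (\<rho> p)"
      have "b p q = 0" unfolding b_def using q(2) \<gamma>p by (intro bump_eq_0) (auto, metis chart_inv_snd image_eqI mem_cball)
      then show "f' p q = 0" by (simp add: f'_def)
    qed (use \<gamma>p Cf'[OF p] in auto)
  qed
  have "(LINT q|vol. LapX f q) = (LINT q|vol. (\<Sum>p\<in>Q. LapX (f' p) q))"
  proof (rule Bochner_Integration.integral_cong[OF refl])
    fix q assume "q \<in> space vol"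
    then have q: "q \<in> topspace X" by (simp add: space_vol)
    have "LapX f q = LapX (\<lambda>q. \<Sum>p\<in>Q. f' p q) q"
      by (rule LapX_cong[OF openin_topspace q]) (auto simp: sum f intro!: CkX_sum Cf')
    then show "LapX f q = (\<Sum>p\<in>Q. LapX (f' p) q)" by (simp add: LapX_sum[OF q Cf'])
  qed
  also have "\<dots> = (\<Sum>p\<in>Q. (LINT q|vol. LapX (f' p) q))"
    by (intro Bochner_Integration.integral_sum integrable_CkX CkX_LapX Cf')
  finally show ?thesis by (simp add: I0)
qed

end

section \<open>The integral estimate\<close>

lemma (in kaehler_metric) continuous_grad_norm_sq:
  assumes F: "Ck 1 S F"
  shows "continuous_on S (grad_norm_sq h F)"
proof -
  have F': "Ck (Suc 0) S (\<lambda>y. complex_of_real (F y))" using Ck_of_real[OF open_S F] by simp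
  have "Ck 0 S (\<lambda>z. 2 * Re (\<Sum>*a b. Win H z $ b $ a * dz a (\<lambda>y. complex_of_real (F y)) z * dzb b (\<lambda>y. complex_of_real (F y)) z))"
    using smooth_Win[of 0, unfolded mCk_def]
    by (intro Ck_mult Ck_const Ck_Re Ck_sum Ck_dz Ck_dzb open_S F') blast
  moreover have "grad_norm_sq h F z = 2 * Re (\<Sum>*a b. Win H z $ b $ a * dz a (\<lambda>y. complex_of_real (F y)) z * dzb b (\<lambda>y. complex_of_real (F y)) z)"
    if "z \<in> S" for z
    using grad_norm_sq_eq[OF that, of F] Ck_differentiable[of 0 S F z] F that by (simp add: grad2_def)
  ultimately show ?thesis by (subst continuous_on_cong[OF refl]) (assumption, simp only: Ck.simps)
qed

text \<open>P(m) is the minimum of (m+1)/m and 2(2m-1)/(m^2-1). The second claim serves the gradient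
  terms. In the third, the fraction is the Yamabe coefficient (n-2)/(4(n-1)) for n = 2m, and 1/(m+1)
  is the coefficient of s |E|^2 in the Weitzenboeck inequality. For m = 2 the second claim is an
  equality, for m >= 3 the third.\<close>

lemma P_bounds:
  assumes "2 \<le> k"
  shows "P k > 0" "P k \<le> (real k + 1) / real k" "P k * ((real k - 1) / (2 * (2 * real k - 1))) \<le> 1 / (real k + 1)"
proof -
  consider "k = 2" | "k \<ge> 3" using assms by linarith
  then have "P k > 0 \<and> P k \<le> (real k + 1) / real k \<and> P k * ((real k - 1) / (2 * (2 * real k - 1))) \<le> 1 / (real k + 1)"
  proof cases
    case 1
    then show ?thesis by (simp add: P_def)
  next
    case 2
    define x where "x = real k"
    have x: "x \<ge> 3" using 2 by (simp add: x_def)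
    have Px: "P k = 2 * (2 * x - 1) / ((x - 1) * (x + 1))"
      using 2 by (simp add: P_def x_def power2_eq_square algebra_simps)
    \<comment> \<open>The difference x^2 (x - 3) + (x - 1) is nonnegative from 3 on but negative at
      2, which is why m = 2 has its own value.\<close>
    have "2 * (2 * x - 1) * x \<le> (x + 1) * ((x - 1) * (x + 1))"
    proof -
      have "(x + 1) * ((x - 1) * (x + 1)) - 2 * (2 * x - 1) * x = x * (x * (x - 3)) + (x - 1)"
        by (simp add: algebra_simps)
      moreover have "x * (x * (x - 3)) + (x - 1) \<ge> 0" using x by (intro add_nonneg_nonneg mult_nonneg_nonneg) auto
      ultimately show ?thesis by linarith
    qed
    then have "2 * (2 * x - 1) \<le> (x + 1) / x * ((x - 1) * (x + 1))" using x by (simp add: pos_le_divide_eq)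
    moreover have "(x - 1) * (x + 1) > 0" using x by simp
    ultimately have "P k \<le> (x + 1) / x" unfolding Px by (simp only: pos_divide_le_eq)
    moreover have "P k * ((x - 1) / (2 * (2 * x - 1))) = 1 / (x + 1)" unfolding Px using x by simp
    moreover have "P k > 0" unfolding Px using x by simp
    ultimately show ?thesis by (simp add: x_def)
  qed
  then show "P k > 0" "P k \<le> (real k + 1) / real k" "P k * ((real k - 1) / (2 * (2 * real k - 1))) \<le> 1 / (real k + 1)" by blast+
qed

context csc_kaehler_manifold
begin

lemma CkX_powr:
  assumes f: "CkX 0 f" and nonneg: "\<And>p. p \<in> topspace X \<Longrightarrow> f p \<ge> 0" and r: "r > 0"
  shows "CkX 0 (\<lambda>p. f p powr r)"
  unfolding CkX_def
proof
  fix c assume c: "c \<in> A"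
  have "f (chart_inv c z) \<ge> 0" if "z \<in> chart_image c" for z
    using that chart_subset[OF c] by (intro nonneg) auto
  then show "Ck 0 (chart_image c) (\<lambda>z. f (chart_inv c z) powr r)"
    using CkXD[OF f c] r by (auto intro!: continuous_on_powr')
qed

text \<open>Young's inequality for the normalised functions. If one of the norms is zero, that
  factor vanishes everywhere by continuity and so does the product.\<close>

lemma Hoelder:
  assumes f: "CkX 0 f" "\<And>p. p \<in> topspace X \<Longrightarrow> f p \<ge> 0" and h: "CkX 0 h" "\<And>p. p \<in> topspace X \<Longrightarrow> h p \<ge> 0"
    and pq: "a > 1" "b > 1" "1 / a + 1 / b = 1"
  shows "(LINT p|vol. f p * h p) \<le> (LINT p|vol. f p powr a) powr (1 / a) * (LINT p|vol. h p powr b) powr (1 / b)"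
proof -
  let ?\<alpha> = "LINT p|vol. f p powr a" and ?\<beta> = "LINT p|vol. h p powr b"
  have Cf: "CkX 0 (\<lambda>p. f p powr a)" and Ch: "CkX 0 (\<lambda>p. h p powr b)" using pq by (auto intro!: CkX_powr f h)
  have \<alpha>0: "?\<alpha> \<ge> 0" and \<beta>0: "?\<beta> \<ge> 0" by (auto intro!: Bochner_Integration.integral_nonneg)
  have zero: "(LINT p|vol. f p * h p) = 0" if "\<And>p. p \<in> topspace X \<Longrightarrow> f p * h p = 0"
  proof -
    have "(LINT p|vol. f p * h p) = (LINT p|vol. 0)"
      by (rule Bochner_Integration.integral_cong[OF refl]) (use that in \<open>simp add: space_vol\<close>)
    then show ?thesis by simp
  qed
  consider "?\<alpha> = 0" | "?\<beta> = 0" | "?\<alpha> > 0" "?\<beta> > 0" using \<alpha>0 \<beta>0 by linarith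
  then show ?thesis
  proof cases
    case 1
    have "f p powr a = 0" if "p \<in> topspace X" for p
      using integral_zero_imp_zero[OF Cf _ 1 that] by simp
    then show ?thesis by (subst zero) auto
  next
    case 2
    have "h p powr b = 0" if "p \<in> topspace X" for p
      using integral_zero_imp_zero[OF Ch _ 2 that] by simp
    then show ?thesis by (subst zero) auto
  next
    case 3
    let ?k = "?\<alpha> powr (1 / a) * ?\<beta> powr (1 / b)"
    have k: "?k > 0" using 3 by simp
    have Y: "f p * h p / ?k \<le> f p powr a / (a * ?\<alpha>) + h p powr b / (b * ?\<beta>)" if "p \<in> topspace X" for p
    proof -
      have "(f p / ?\<alpha> powr (1 / a)) * (h p / ?\<beta> powr (1 / b)) \<le> (f p / ?\<alpha> powr (1 / a)) powr a / a + (h p / ?\<beta> powr (1 / b)) powr b / b"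
        using pq f(2)[OF that] h(2)[OF that] by (intro Youngs_inequality) auto
      also have "(f p / ?\<alpha> powr (1 / a)) powr a = f p powr a / ?\<alpha>"
        using f(2)[OF that] 3 pq by (simp add: powr_divide powr_powr)
      also have "(h p / ?\<beta> powr (1 / b)) powr b = h p powr b / ?\<beta>"
        using h(2)[OF that] 3 pq by (simp add: powr_divide powr_powr)
      finally show ?thesis by (simp add: mult.commute)
    qed
    have "(LINT p|vol. f p * h p) / ?k = (LINT p|vol. f p * h p / ?k)" by simp
    also have "\<dots> \<le> (LINT p|vol. f p powr a / (a * ?\<alpha>) + h p powr b / (b * ?\<beta>))"
      using integrable_CkX[OF CkX_mult[OF f(1) h(1)]] integrable_CkX[OF Cf] integrable_CkX[OF Ch] Y
      by (intro integral_mono) (auto simp: space_vol)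
    also have "\<dots> = ?\<alpha> / (a * ?\<alpha>) + ?\<beta> / (b * ?\<beta>)"
      using integrable_CkX[OF Cf] integrable_CkX[OF Ch] by simp
    also have "\<dots> = 1" using 3 pq by simp
    finally show ?thesis using k by (simp add: divide_le_eq)
  qed
qed

text \<open>On a compact space every support is compact.\<close>

lemma test_function_CkX: "test_function X A u \<longleftrightarrow> (\<forall>k. CkX k u)"
proof -
  have "compactin X (X closure_of {p \<in> topspace X. u p \<noteq> 0})"
    by (rule closedin_compact_space[OF compact_space closedin_closure_of])
  then show ?thesis by (auto simp: test_function_def smooth_fun_on_def CkX_def Ck_on_eq_Ck o_def)
qed

lemma CkX_grad: assumes u: "CkX 1 u" shows "CkX 0 (at_point A (\<lambda>c. grad_norm_sq (g c) (u \<circ> chart_inv c)))"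
  unfolding CkX_def
proof
  fix c assume c: "c \<in> A"
  interpret csc_kaehler_metric "chart_image c" "g c" s "real CARD('m)" by (rule metric_in_chart[OF c])
  have "continuous_on (chart_image c) (grad_norm_sq (g c) (u \<circ> chart_inv c))"
    using CkXD[OF u c] by (intro continuous_grad_norm_sq) (simp add: o_def)
  then show "Ck 0 (chart_image c) (\<lambda>z. at_point A (\<lambda>c. grad_norm_sq (g c) (u \<circ> chart_inv c)) (chart_inv c z))"
    by (subst Ck_cong[OF open_S, where g = "grad_norm_sq (g c) (u \<circ> chart_inv c)"]) (simp_all add: at_point_grad[OF u c])
qed

lemma grad_nonneg: assumes u: "CkX 1 u" and p: "p \<in> topspace X"
  shows "at_point A (\<lambda>c. grad_norm_sq (g c) (u \<circ> chart_inv c)) p \<ge> 0"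
proof -
  obtain c where c: "c \<in> A" "p \<in> fst c" using p cover by blast
  interpret csc_kaehler_metric "chart_image c" "g c" s "real CARD('m)" by (rule metric_in_chart[OF c(1)])
  have "(u \<circ> chart_inv c) differentiable (at (snd c p))"
    using Ck_differentiable[of 0] CkXD[OF u c(1)] c(2) by (simp add: o_def)
  then show ?thesis by (simp add: at_point_grad[OF u c] grad_norm_sq_nonneg[OF snd_in[OF c(2)]])
qed

definition eN :: "'a \<Rightarrow> real" where "eN = at_point A (\<lambda>c. E_norm (g c))"
definition bN :: "'a \<Rightarrow> real" where "bN = at_point A (\<lambda>c. bochner_norm (g c))"

lemma eN_nonneg: "eN p \<ge> 0" and bN_nonneg: "bN p \<ge> 0"
  by (auto simp: eN_def bN_def at_point_def E_norm_def bochner_norm_def Let_def intro!: sum_nonneg)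

lemma CkX_norms: "CkX 0 eN" "CkX 0 bN" "CkX k (\<lambda>p. (eN p)\<^sup>2)"
proof -
  have "Ck 0 (chart_image c) (\<lambda>z. eN (chart_inv c z)) \<and> Ck 0 (chart_image c) (\<lambda>z. bN (chart_inv c z)) \<and>
    Ck k (chart_image c) (\<lambda>z. (eN (chart_inv c z))\<^sup>2)" if c: "c \<in> A" for c
  proof -
    interpret csc_kaehler_metric "chart_image c" "g c" s "real CARD('m)" by (rule metric_in_chart[OF c])
    have e: "eN (chart_inv c z) = sqrt (f2 z)" if "z \<in> chart_image c" for z
      using that by (simp add: eN_def at_point_E_norm[OF c] E_norm_eq)
    have b: "bN (chart_inv c z) = bochner_norm (g c) z" if "z \<in> chart_image c" for z
      using that by (simp add: bN_def at_point_bochner_norm[OF c])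
    have "Ck 0 (chart_image c) (\<lambda>z. sqrt (f2 z))" using Ck_f2[of 0] by (auto intro!: continuous_intros)
    then have "Ck 0 (chart_image c) (\<lambda>z. eN (chart_inv c z))"
      by (subst Ck_cong[OF open_S, where g = "\<lambda>z. sqrt (f2 z)"]) (simp_all only: e)
    moreover have "Ck 0 (chart_image c) (\<lambda>z. bN (chart_inv c z))"
      by (subst Ck_cong[OF open_S, where g = "bochner_norm (g c)"]) (simp_all add: b continuous_bochner_norm)
    moreover have "Ck k (chart_image c) (\<lambda>z. (eN (chart_inv c z))\<^sup>2)"
      by (subst Ck_cong[OF open_S, where g = f2]) (simp_all add: e f2_nonneg Ck_f2)
    ultimately show ?thesis by blast
  qed
  then show "CkX 0 eN" "CkX 0 bN" "CkX k (\<lambda>p. (eN p)\<^sup>2)" unfolding CkX_def by blast+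
qed

text \<open>The numerator of the Yamabe quotient with n = 2m, the constant s already inserted for
  the scalar curvature.\<close>

definition yamabe_energy :: "('a \<Rightarrow> real) \<Rightarrow> real" where
  "yamabe_energy u = (LINT p|vol. at_point A (\<lambda>c. grad_norm_sq (g c) (u \<circ> chart_inv c)) p
     + (real CARD('m) - 1) / (2 * (2 * real CARD('m) - 1)) * s * (u p)\<^sup>2)"

section \<open>The Yamabe inequality and the absorption argument\<close>

context
  fixes m :: real
  assumes m_eq: "m = real CARD('m)"
begin

lemma m_ge_2: "m \<ge> 2" using card m_eq by simp

lemma yamabe_energy_nonneg: assumes "s \<ge> 0" "CkX 1 u" shows "yamabe_energy u \<ge> 0"
  unfolding yamabe_energy_def m_eq[symmetric]
proof (rule Bochner_Integration.integral_nonneg)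
  fix p assume "p \<in> space vol"
  then show "0 \<le> at_point A (\<lambda>c. grad_norm_sq (g c) (u \<circ> chart_inv c)) p + (m - 1) / (2 * (2 * m - 1)) * s * (u p)\<^sup>2"
    using grad_nonneg[OF assms(2)] m_ge_2 assms(1) by (simp add: space_vol)
qed

lemma yamabe_quotient_eq:
  "yamabe_quotient X A g u = yamabe_energy u / (LINT p|vol. \<bar>u p\<bar> powr (2 * m / (m - 1))) powr ((m - 1) / m)"
proof -
  have 1: "(2 * m - 2) / (4 * (2 * m - 1)) = (m - 1) / (2 * (2 * m - 1))" using m_ge_2 by (simp add: field_simps)
  have 2: "2 * (2 * m) / (2 * m - 2) = 2 * m / (m - 1)" using m_ge_2 by (simp add: field_simps)
  have 3: "(2 * m - 2) / (2 * m) = (m - 1) / m" using m_ge_2 by (simp add: field_simps)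
  have "(LINT p|vol. at_point A (\<lambda>c. grad_norm_sq (g c) (u \<circ> chart_inv c)) p
      + (2 * m - 2) / (4 * (2 * m - 1)) * at_point A (\<lambda>c. scalar_curvature (g c)) p * (u p)\<^sup>2) = yamabe_energy u"
    unfolding yamabe_energy_def m_eq[symmetric] 1
    by (rule Bochner_Integration.integral_cong[OF refl]) (simp add: space_vol at_point_scalar)
  then show ?thesis unfolding yamabe_quotient_def Let_def m_eq[symmetric] 2 3 by simp
qed

lemma yamabe_inequality:
  assumes s: "s \<ge> 0" and u: "\<And>k. CkX k u" and nz: "\<exists>p\<in>topspace X. u p \<noteq> 0"
  shows "yamabe_constant X A g * (LINT p|vol. \<bar>u p\<bar> powr (2 * m / (m - 1))) powr ((m - 1) / m) \<le> yamabe_energy u"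
proof -
  let ?D = "(LINT p|vol. \<bar>u p\<bar> powr (2 * m / (m - 1))) powr ((m - 1) / m)"
  have "yamabe_constant X A g \<le> yamabe_quotient X A g u"
    unfolding yamabe_constant_def
  proof (rule cINF_lower)
    \<comment> \<open>The infimum of a set of reals lies below its elements only if the set is
      bounded below; here all energies are nonnegative because s >= 0.\<close>
    show "bdd_below (yamabe_quotient X A g ` {u. test_function X A u \<and> (\<exists>p\<in>topspace X. u p \<noteq> 0)})"
      by (rule bdd_belowI2[of _ 0]) (auto simp: yamabe_quotient_eq test_function_CkX yamabe_energy_nonneg[OF s])
    show "u \<in> {u. test_function X A u \<and> (\<exists>p\<in>topspace X. u p \<noteq> 0)}" using u nz by (simp add: test_function_CkX)
  qed
  then have "yamabe_constant X A g \<le> yamabe_energy u / ?D" by (simp only: yamabe_quotient_eq)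
  moreover have "?D \<ge> 0" by simp
  ultimately show ?thesis
    \<comment> \<open>A vanishing denominator makes the left-hand side zero.\<close>
    using yamabe_energy_nonneg[OF s u] by (cases "?D = 0") (auto simp: pos_le_divide_eq)
qed

lemma pointwise_inequality:
  assumes p: "p \<in> topspace X" and \<epsilon>: "\<epsilon> > 0"
  defines "\<kappa> \<equiv> sqrt ((2 * m\<^sup>2 + 4 * m + 3) / (2 * (m + 1) * (m + 2)))"
  shows "(m + 1) / m * at_point A (\<lambda>c. grad_norm_sq (g c) ((\<lambda>p. sqrt ((eN p)\<^sup>2 + \<epsilon>)) \<circ> chart_inv c)) p
     + s / (m + 1) * (eN p)\<^sup>2 - \<kappa> * (sqrt 2 * eN p + bN p) * (eN p)\<^sup>2 \<le> LapX (\<lambda>p. (eN p)\<^sup>2) p / 2"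
proof -
  obtain c where c: "c \<in> A" "p \<in> fst c" using p cover by blast
  interpret csc_kaehler_metric "chart_image c" "g c" s m unfolding m_eq by (rule metric_in_chart[OF c(1)])
  let ?z = "snd c p"
  have z: "?z \<in> chart_image c" using c by simp
  have e: "eN (chart_inv c y) = sqrt (f2 y)" if "y \<in> chart_image c" for y
    using that by (simp add: eN_def at_point_E_norm[OF c(1)] E_norm_eq)
  have e2: "(eN (chart_inv c y))\<^sup>2 = f2 y" if "y \<in> chart_image c" for y
    using that by (simp add: e f2_nonneg)
  have Cu: "CkX 1 (\<lambda>p. sqrt ((eN p)\<^sup>2 + \<epsilon>))"
    using \<epsilon> by (intro CkX_sqrt CkX_add CkX_norms CkX_const) (simp add: add_nonneg_pos)
  have G: "at_point A (\<lambda>c. grad_norm_sq (g c) ((\<lambda>p. sqrt ((eN p)\<^sup>2 + \<epsilon>)) \<circ> chart_inv c)) p = grad_norm_sq (g c) (\<lambda>y. sqrt (f2 y + \<epsilon>)) ?z"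
    unfolding at_point_grad[OF Cu c] by (rule grad_norm_sq_cong_open[OF open_S z]) (simp add: e2)
  have "Lap H (\<lambda>y. complex_of_real ((eN (chart_inv c y))\<^sup>2)) ?z = Lap H (\<lambda>y. complex_of_real (f2 y)) ?z"
    by (rule Lap_cong[OF open_S z]) (simp only: e2)
  then have L: "LapX (\<lambda>p. (eN p)\<^sup>2) p = laplacian f2 ?z"
    by (simp add: LapX_eq[OF CkX_norms(3) c] chart_laplacian_def laplacian_def o_def)
  have en: "eN p = E_norm (g c) ?z" and bn: "bN p = bochner_norm (g c) ?z"
    by (simp_all add: eN_def bN_def at_point_E_norm[OF c] at_point_bochner_norm[OF c])
  have e2p: "(eN p)\<^sup>2 = f2 ?z" using e2[OF z] c by simp
  show ?thesis
    using laplacian_inequality[OF z \<epsilon>] unfolding G L e2p unfolding en bn \<kappa>_def .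
qed

theorem integral_eN_zero:
  assumes s: "s > 0"
    and small: "sqrt 2 * lp_norm X A g m (\<lambda>c. E_norm (g c)) + lp_norm X A g m (\<lambda>c. bochner_norm (g c))
         < yamabe_constant X A g * P CARD('m) * sqrt (2 * (m + 1) * (m + 2) / (2 * m\<^sup>2 + 4 * m + 3))"
  shows "(LINT p|vol. (eN p)\<^sup>2) = 0"
proof -
  let ?\<Lambda> = "yamabe_constant X A g" and ?P = "P CARD('m)"
  define \<kappa> where "\<kappa> = sqrt ((2 * m\<^sup>2 + 4 * m + 3) / (2 * (m + 1) * (m + 2)))"
  define a where "a = (m - 1) / (2 * (2 * m - 1))"
  define N where "N = sqrt 2 * (LINT p|vol. eN p powr m) powr (1 / m) + (LINT p|vol. bN p powr m) powr (1 / m)"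
  define F where "F = (LINT p|vol. (eN p)\<^sup>2)"
  define V where "V = measure vol (space vol)"
  interpret finite_measure vol by (rule finite_measure_vol)
  have m: "m \<ge> 2" by (rule m_ge_2)
  have q: "2 * m\<^sup>2 + 4 * m + 3 > 0" "2 * (m + 1) * (m + 2) > 0" using m by (auto intro!: add_nonneg_pos)
  have \<kappa>: "\<kappa> > 0" unfolding \<kappa>_def using q by simp
  have \<kappa>1: "\<kappa> * sqrt (2 * (m + 1) * (m + 2) / (2 * m\<^sup>2 + 4 * m + 3)) = 1"
    unfolding \<kappa>_def real_sqrt_mult[symmetric] using q m by simp
  have N: "N \<ge> 0" unfolding N_def by simp
  have "N < ?\<Lambda> * ?P * sqrt (2 * (m + 1) * (m + 2) / (2 * m\<^sup>2 + 4 * m + 3))"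
    using small by (simp add: N_def lp_norm_def eN_def[symmetric] bN_def[symmetric] abs_of_nonneg eN_nonneg bN_nonneg)
  then have "\<kappa> * N < \<kappa> * (?\<Lambda> * ?P * sqrt (2 * (m + 1) * (m + 2) / (2 * m\<^sup>2 + 4 * m + 3)))"
    using \<kappa> by simp
  also have "\<dots> = ?\<Lambda> * ?P" using \<kappa>1 by (simp add: ac_simps)
  finally have \<kappa>N: "\<kappa> * N < ?\<Lambda> * ?P" .
  have P: "?P > 0" "?P \<le> (m + 1) / m" "?P * a \<le> 1 / (m + 1)"
    using P_bounds[OF card] by (simp_all add: a_def m_eq)
  \<comment> \<open>The left-hand side of the smallness hypothesis is nonnegative, so the hypothesis
    forces a positive Yamabe constant.\<close>
  have "0 < ?\<Lambda> * ?P" using \<kappa>N \<kappa> N by (meson le_less_trans less_imp_le mult_nonneg_nonneg)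
  then have \<Lambda>: "?\<Lambda> > 0" using P(1) by (simp add: zero_less_mult_iff)
  \<comment> \<open>The cubic term will be at most \<theta> times the Yamabe energy; the smallness
    hypothesis says \<theta> < P(m).\<close>
  define \<theta> where "\<theta> = \<kappa> * N / ?\<Lambda>"
  have \<theta>: "\<theta> \<ge> 0" "\<theta> < ?P" using \<kappa>N \<kappa> N \<Lambda> by (auto simp: \<theta>_def divide_less_eq mult.commute)
  have a: "a > 0" using m by (simp add: a_def)
  have \<theta>a: "\<theta> * a < 1 / (m + 1)" using mult_strict_right_mono[OF \<theta>(2) a] P(3) by linarith
  have F0: "F \<ge> 0" unfolding F_def by simp
  \<comment> \<open>All of the energy is absorbed except the zeroth-order contribution of the
    \<epsilon> in u^2 = |E|^2 + \<epsilon>.\<close>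
  have key: "s * (1 / (m + 1) - \<theta> * a) * F \<le> \<theta> * a * s * V * \<epsilon>" if \<epsilon>: "\<epsilon> > 0" for \<epsilon>
  proof -
    define u where "u p = sqrt ((eN p)\<^sup>2 + \<epsilon>)" for p
    have u2: "(u p)\<^sup>2 = (eN p)\<^sup>2 + \<epsilon>" for p using \<epsilon> by (simp add: u_def add_nonneg_nonneg)
    have u0: "u p > 0" for p using \<epsilon> by (simp add: u_def add_nonneg_pos)
    have Cu: "CkX k u" for k
      unfolding u_def[abs_def] using \<epsilon> by (intro CkX_sqrt CkX_add CkX_norms CkX_const) (simp add: add_nonneg_pos)
    define G where "G p = at_point A (\<lambda>c. grad_norm_sq (g c) (u \<circ> chart_inv c)) p" for p
    have CG: "CkX 0 G" unfolding G_def[abs_def] by (rule CkX_grad[OF Cu])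
    have G0: "(LINT p|vol. G p) \<ge> 0"
      using grad_nonneg[OF Cu] by (intro Bochner_Integration.integral_nonneg) (simp add: G_def space_vol)
    note ints = integrable_CkX[OF CG] integrable_CkX[OF CkX_norms(3)]
      integrable_CkX[OF CkX_mult[OF CkX_norms(1) CkX_norms(3)]] integrable_CkX[OF CkX_mult[OF CkX_norms(2) CkX_norms(3)]]
    have Iu2: "(LINT p|vol. (u p)\<^sup>2) = F + \<epsilon> * V"
      using ints(2) by (simp add: u2 F_def V_def mult.commute)
    have Y: "yamabe_energy u = (LINT p|vol. G p) + a * s * (F + \<epsilon> * V)"
    proof -
      have "integrable vol (\<lambda>p. (u p)\<^sup>2)" using ints(2) by (simp add: u2)
      then show ?thesis
        unfolding yamabe_energy_def m_eq[symmetric] a_def[symmetric] G_def[symmetric] using ints(1) Iu2 by simp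
    qed
    let ?D = "(LINT p|vol. \<bar>u p\<bar> powr (2 * m / (m - 1))) powr ((m - 1) / m)"
    \<comment> \<open>The exponents m and m/(m-1) are conjugate, and u^2 to the power m/(m-1) gives
      the Yamabe exponent 2n/(n-2) = 2m/(m-1).\<close>
    have pw: "(u p)\<^sup>2 powr (m / (m - 1)) = \<bar>u p\<bar> powr (2 * m / (m - 1))" for p
    proof -
      have e: "(u p)\<^sup>2 = u p powr 2" using u0[of p] by simp
      show ?thesis unfolding e powr_powr using u0[of p] by simp
    qed
    \<comment> \<open>|E|^2 is replaced by the larger u^2, whose root u is smooth and therefore
      admissible in the Yamabe quotient.\<close>
    have H: "(LINT p|vol. f p * (eN p)\<^sup>2) \<le> (LINT p|vol. f p powr m) powr (1 / m) * ?D"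
      if f: "CkX 0 f" "\<And>p. f p \<ge> 0" for f
    proof -
      have If: "integrable vol (\<lambda>p. f p * (eN p)\<^sup>2)" "integrable vol (\<lambda>p. f p * (u p)\<^sup>2)"
        using integrable_CkX[OF CkX_mult[OF f(1) CkX_norms(3)]] integrable_CkX[OF CkX_mult[OF f(1) CkX_mult[OF Cu Cu]]]
        by (simp_all add: power2_eq_square)
      have "(LINT p|vol. f p * (eN p)\<^sup>2) \<le> (LINT p|vol. f p * (u p)\<^sup>2)"
        using If f(2) \<epsilon> by (intro integral_mono) (auto simp: u2 intro!: mult_left_mono)
      also have "\<dots> \<le> (LINT p|vol. f p powr m) powr (1 / m) * (LINT p|vol. (u p)\<^sup>2 powr (m / (m - 1))) powr (1 / (m / (m - 1)))"
      proof (rule Hoelder)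
        show "CkX 0 (\<lambda>p. (u p)\<^sup>2)" using CkX_mult[OF Cu Cu] by (simp add: power2_eq_square)
        show "1 / m + 1 / (m / (m - 1)) = 1" "m / (m - 1) > 1" "m > 1" using m by (auto simp: field_simps)
      qed (use f in auto)
      finally show ?thesis unfolding pw by simp
    qed
    have "\<kappa> * (LINT p|vol. (sqrt 2 * eN p + bN p) * (eN p)\<^sup>2) \<le> \<theta> * yamabe_energy u"
    proof -
      have "(LINT p|vol. (sqrt 2 * eN p + bN p) * (eN p)\<^sup>2) = sqrt 2 * (LINT p|vol. eN p * (eN p)\<^sup>2) + (LINT p|vol. bN p * (eN p)\<^sup>2)"
        using ints(3,4) by (simp add: distrib_right mult.assoc)
      also have "\<dots> \<le> N * ?D"
        unfolding N_def using H[OF CkX_norms(1) eN_nonneg] H[OF CkX_norms(2) bN_nonneg]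
        by (simp add: distrib_right mult.assoc add_mono mult_left_mono)
      also have "\<dots> = (N / ?\<Lambda>) * (?\<Lambda> * ?D)" using \<Lambda> by simp
      also have "\<dots> \<le> (N / ?\<Lambda>) * yamabe_energy u"
      proof (rule mult_left_mono[OF yamabe_inequality])
        show "\<exists>p\<in>topspace X. u p \<noteq> 0" using topspace_nonempty u0 by (metis ex_in_conv less_irrefl)
      qed (use s Cu N \<Lambda> in auto)
      finally have "\<kappa> * (LINT p|vol. (sqrt 2 * eN p + bN p) * (eN p)\<^sup>2) \<le> \<kappa> * ((N / ?\<Lambda>) * yamabe_energy u)"
        using \<kappa> by (intro mult_left_mono) auto
      then show ?thesis by (simp add: \<theta>_def)
    qed
    moreover have "(m + 1) / m * (LINT p|vol. G p) + s / (m + 1) * F - \<kappa> * (LINT p|vol. (sqrt 2 * eN p + bN p) * (eN p)\<^sup>2) \<le> 0"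
    proof -
      have ib: "integrable vol (\<lambda>p. (sqrt 2 * eN p + bN p) * (eN p)\<^sup>2)"
        using ints(3,4) by (simp add: distrib_right mult.assoc)
      have "(m + 1) / m * (LINT p|vol. G p) + s / (m + 1) * F - \<kappa> * (LINT p|vol. (sqrt 2 * eN p + bN p) * (eN p)\<^sup>2)
        = (LINT p|vol. (m + 1) / m * G p + s / (m + 1) * (eN p)\<^sup>2 - \<kappa> * ((sqrt 2 * eN p + bN p) * (eN p)\<^sup>2))"
        unfolding F_def using ints(1,2) ib by simp
      also have "\<dots> \<le> (LINT p|vol. LapX (\<lambda>p. (eN p)\<^sup>2) p / 2)"
      proof (rule integral_mono)
        show "integrable vol (\<lambda>p. (m + 1) / m * G p + s / (m + 1) * (eN p)\<^sup>2 - \<kappa> * ((sqrt 2 * eN p + bN p) * (eN p)\<^sup>2))"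
          using ints(1,2) ib by simp
        show "integrable vol (\<lambda>p. LapX (\<lambda>p. (eN p)\<^sup>2) p / 2)"
          using integrable_CkX[OF CkX_LapX[OF CkX_norms(3)]] by simp
        fix p assume "p \<in> space vol"
        then show "(m + 1) / m * G p + s / (m + 1) * (eN p)\<^sup>2 - \<kappa> * ((sqrt 2 * eN p + bN p) * (eN p)\<^sup>2) \<le> LapX (\<lambda>p. (eN p)\<^sup>2) p / 2"
          using pointwise_inequality[OF _ \<epsilon>, of p] unfolding \<kappa>_def G_def u_def[abs_def] by (simp add: space_vol mult.assoc)
      qed
      also have "\<dots> = 0" using integral_LapX[OF CkX_norms(3)] by simp
      finally show ?thesis .
    qed
    \<comment> \<open>The bound P(m) <= (m+1)/m: the gradient part of the energy is absorbed by the
      Kato term.\<close>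
    moreover have "\<theta> * (LINT p|vol. G p) \<le> (m + 1) / m * (LINT p|vol. G p)"
      using \<theta>(2) P(2) G0 by (intro mult_right_mono) auto
    ultimately have "s / (m + 1) * F \<le> \<theta> * (a * s * (F + \<epsilon> * V))"
      unfolding Y by (simp only: distrib_left)
    then show ?thesis by (simp add: algebra_simps)
  qed
  have "s * (1 / (m + 1) - \<theta> * a) * F \<le> 0"
  proof (rule ccontr)
    let ?L = "s * (1 / (m + 1) - \<theta> * a) * F" and ?K = "\<theta> * a * s * V"
    assume "\<not> ?L \<le> 0"
    then have L: "?L > 0" by simp
    have K: "?K \<ge> 0" using \<theta>(1) a s by (simp add: V_def)
    \<comment> \<open>The choice \<epsilon> = L / (2 (K + 1)) leads to L <= L / 2; the summand 1
      covers K = 0.\<close>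
    have "?L \<le> ?K * (?L / (2 * (?K + 1)))" by (rule key) (use L K in auto)
    also have "\<dots> = ?L * (?K / (2 * (?K + 1)))" by simp
    also have "\<dots> \<le> ?L * (1 / 2)" using L K by (intro mult_left_mono) (auto simp: divide_le_eq)
    finally have "?L \<le> ?L * (1 / 2)" .
    moreover have "?L * (1 / 2) < ?L * 1" by (rule mult_strict_left_mono) (use L in simp_all)
    ultimately show False by (metis mult_1_right not_le)
  qed
  moreover have "s * (1 / (m + 1) - \<theta> * a) > 0" using s \<theta>a by simp
  ultimately have "F \<le> 0" by (meson mult_pos_pos not_le)
  then show ?thesis using F0 unfolding F_def by linarith
qed

end

end

theorem theorem3p3:
  fixes X :: "'a topology"
    and A :: "('a, 'm::finite) chart set"
    and g :: "('a, 'm) mfd_metric"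
    and s :: real
  assumes "kaehler_manifold X A g"
    and "compact_space X"
    and "CARD('m) \<ge> 2"
    and "s > 0"
    and "\<forall>c\<in>A. \<forall>z\<in>chart_image c. scalar_curvature (g c) z = s"
    and "sqrt 2 * lp_norm X A g (real CARD('m)) (\<lambda>c. E_norm (g c))
         + lp_norm X A g (real CARD('m)) (\<lambda>c. bochner_norm (g c))
         < yamabe_constant X A g * P CARD('m)
           * sqrt (2 * (real CARD('m) + 1) * (real CARD('m) + 2)
                   / (2 * (real CARD('m))\<^sup>2 + 4 * real CARD('m) + 3))"
  shows "kaehler_einstein A g"
proof -
  interpret csc_kaehler_manifold X A g s using assms by unfold_locales auto
  \<comment> \<open>|E|^2 is continuous and nonnegative with integral zero, hence zero
    everywhere.\<close>
  have eN0: "(eN p)\<^sup>2 = 0" if "p \<in> topspace X" for p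
    by (rule integral_zero_imp_zero[OF CkX_norms(3) _ integral_eN_zero[OF refl assms(4,6)] that]) (rule zero_le_power2)
  have "E_comp (g c) z coord_frame a b = 0" if c: "c \<in> A" and z: "z \<in> chart_image c" for c z a b
  proof -
    interpret csc_kaehler_metric "chart_image c" "g c" s "real CARD('m)" by (rule metric_in_chart[OF c])
    have "chart_inv c z \<in> topspace X" using chart_subset[OF c] chart_inv_in[OF z] by blast
    then have "(eN (chart_inv c z))\<^sup>2 = 0" by (rule eN0)
    then have "E_norm (g c) z = 0" using at_point_E_norm[OF c chart_inv_in[OF z]] z by (simp add: eN_def)
    then have "f2 z = 0" using E_norm_eq[OF z] by simp
    then show ?thesis by (rule E_comp_zero[OF z])
  qed
  then show ?thesis by (simp add: kaehler_einstein_def)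
qed

end
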